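(* Let $A$ be an associative unital ring, $\mathcal{C}$ an $A$-coring, $P\in\mathbf{M}^{\mathcal{C}}$ with $P_A$ finitely generated and projective, $S=\mathrm{End}^{\mathcal{C}}(P)$, $P^*=\mathrm{Hom}_A(P,A)$, and $B\subseteq S$ a subring. Assume $P^*$ to be flat as a right $B$-module, or $P$ to be $B$-strongly $(\mathcal{C},A)$-injective. Then the following are equivalent: (a) the canonical map $\mu'_{\mathcal{C}}:\mathrm{Hom}^{\mathcal{C}}(P,\mathcal{C})\otimes_B P\to\mathcal{C}$, $f\otimes p\mapsto f(p)$, is a splitting epimorphism in $\mathbf{M}^{\mathcal{C}}$; (b) $P^*$ is a Galois (left $\mathcal{C}$-)comodule and is $(S,B)$-projective as a right $S$-module.
   Context: $\mathbf{M}^{\mathcal{C}}$ is the category of right $\mathcal{C}$-comodules $(M,\varrho^M:M\to M\otimes_A\mathcal{C})$; $\mathrm{Hom}^{\mathcal{C}}$, $\mathrm{End}^{\mathcal{C}}$ denote colinear maps. $P$ is a left $S$-module by evaluation; $P^*$ and $\mathrm{Hom}^{\mathcal{C}}(P,\mathcal{C})$ are right $S$-modules by composition. With a dual basis $p_i\in P$, $\pi_i\in P^*$, $P^*$ is a left $\mathcal{C}$-comodule via $\varrho^{P^*}(g)=\sum_i (g\otimes I_{\mathcal{C}})\varrho^P(p_i)\otimes\pi_i$; the ring of left $\mathcal{C}$-colinear endomorphisms of $P^*$, written as acting on the right, is canonically $S$. A left $\mathcal{C}$-comodule $Q$, with ring $S'$ of colinear endomorphisms acting on the right of $Q$, is a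 Galois left comodule if for every left $A$-module $K$ the map $Q\otimes_{S'}{}_A\mathrm{Hom}(Q,K)\to\mathcal{C}\otimes_A K$, $q\otimes h\mapsto(I_{\mathcal{C}}\otimes h)\varrho^{Q}(q)$, is an isomorphism. $P$ is $B$-strongly $(\mathcal{C},A)$-injective if $\varrho^P$ is split by a map $P\otimes_A\mathcal{C}\to P$ that is $\mathcal{C}$-colinear and left $B$-linear. A right $S$-module $X$ is $(S,B)$-projective if the multiplication map $X\otimes_B S\to X$ splits in the category of right $S$-modules. *)

theory Defs
  imports "HOL-Algebra.Free_Abelian_Groups" "HOL-Algebra.Module" "HOL-Algebra.Subrings"
begin

section \<open>Modules over noncommutative rings\<close>

text \<open>
  One record serves for left modules, right modules and bimodules over rings that need not be
  commutative (the locale \<open>module\<close> of HOL-Algebra requires a commutative ring).  The predicates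
  \<open>left_module\<close> and \<open>right_module\<close> each look at one of the two actions only; the other action of a
  one-sided module is ignored, and its scalar type is then usually \<open>unit\<close>.  As in HOL-Algebra's own
  modules, the inherited fields \<open>mult\<close> and \<open>one\<close> have no meaning.

  Linear maps are ordinary HOL functions of which only the values on the carrier matter; the
  elements of Hom sets are made unique by extensionality, i.e. they are \<open>undefined\<close> off the carrier.
\<close>

record ('l, 'm, 'r) bimod = "('l, 'm) module" +
  rsmult :: "'m \<Rightarrow> 'r \<Rightarrow> 'm" (infixl \<open>\<odot>\<^sub>r\<index>\<close> 70)

definition left_module :: "('l, 'x) ring_scheme \<Rightarrow> ('l, 'm, 'r, 'z) bimod_scheme \<Rightarrow> bool" where
  "left_module R M \<longleftrightarrow> ring R \<and> abelian_group M \<and>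
     (\<forall>a\<in>carrier R. \<forall>x\<in>carrier M. a \<odot>\<^bsub>M\<^esub> x \<in> carrier M) \<and>
     (\<forall>a\<in>carrier R. \<forall>b\<in>carrier R. \<forall>x\<in>carrier M. (a \<oplus>\<^bsub>R\<^esub> b) \<odot>\<^bsub>M\<^esub> x = a \<odot>\<^bsub>M\<^esub> x \<oplus>\<^bsub>M\<^esub> b \<odot>\<^bsub>M\<^esub> x) \<and>
     (\<forall>a\<in>carrier R. \<forall>x\<in>carrier M. \<forall>y\<in>carrier M. a \<odot>\<^bsub>M\<^esub> (x \<oplus>\<^bsub>M\<^esub> y) = a \<odot>\<^bsub>M\<^esub> x \<oplus>\<^bsub>M\<^esub> a \<odot>\<^bsub>M\<^esub> y) \<and>
     (\<forall>a\<in>carrier R. \<forall>b\<in>carrier R. \<forall>x\<in>carrier M. (a \<otimes>\<^bsub>R\<^esub> b) \<odot>\<^bsub>M\<^esub> x = a \<odot>\<^bsub>M\<^esub> (b \<odot>\<^bsub>M\<^esub> x)) \<and>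
     (\<forall>x\<in>carrier M. \<one>\<^bsub>R\<^esub> \<odot>\<^bsub>M\<^esub> x = x)"

definition right_module :: "('r, 'x) ring_scheme \<Rightarrow> ('l, 'm, 'r, 'z) bimod_scheme \<Rightarrow> bool" where
  "right_module R M \<longleftrightarrow> ring R \<and> abelian_group M \<and>
     (\<forall>a\<in>carrier R. \<forall>x\<in>carrier M. x \<odot>\<^sub>r\<^bsub>M\<^esub> a \<in> carrier M) \<and>
     (\<forall>a\<in>carrier R. \<forall>b\<in>carrier R. \<forall>x\<in>carrier M. x \<odot>\<^sub>r\<^bsub>M\<^esub> (a \<oplus>\<^bsub>R\<^esub> b) = x \<odot>\<^sub>r\<^bsub>M\<^esub> a \<oplus>\<^bsub>M\<^esub> x \<odot>\<^sub>r\<^bsub>M\<^esub> b) \<and>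
     (\<forall>a\<in>carrier R. \<forall>x\<in>carrier M. \<forall>y\<in>carrier M. (x \<oplus>\<^bsub>M\<^esub> y) \<odot>\<^sub>r\<^bsub>M\<^esub> a = x \<odot>\<^sub>r\<^bsub>M\<^esub> a \<oplus>\<^bsub>M\<^esub> y \<odot>\<^sub>r\<^bsub>M\<^esub> a) \<and>
     (\<forall>a\<in>carrier R. \<forall>b\<in>carrier R. \<forall>x\<in>carrier M. x \<odot>\<^sub>r\<^bsub>M\<^esub> (a \<otimes>\<^bsub>R\<^esub> b) = (x \<odot>\<^sub>r\<^bsub>M\<^esub> a) \<odot>\<^sub>r\<^bsub>M\<^esub> b) \<and>
     (\<forall>x\<in>carrier M. x \<odot>\<^sub>r\<^bsub>M\<^esub> \<one>\<^bsub>R\<^esub> = x)"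

definition bimodule :: "('l, 'x) ring_scheme \<Rightarrow> ('r, 'y) ring_scheme \<Rightarrow> ('l, 'm, 'r, 'z) bimod_scheme \<Rightarrow> bool" where
  "bimodule L R M \<longleftrightarrow> left_module L M \<and> right_module R M \<and>
     (\<forall>a\<in>carrier L. \<forall>x\<in>carrier M. \<forall>b\<in>carrier R. (a \<odot>\<^bsub>M\<^esub> x) \<odot>\<^sub>r\<^bsub>M\<^esub> b = a \<odot>\<^bsub>M\<^esub> (x \<odot>\<^sub>r\<^bsub>M\<^esub> b))"

definition additive_map :: "('m, 'x) ring_scheme \<Rightarrow> ('n, 'y) ring_scheme \<Rightarrow> ('m \<Rightarrow> 'n) \<Rightarrow> bool" where
  "additive_map M N f \<longleftrightarrow> f \<in> carrier M \<rightarrow> carrier N \<and>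
     (\<forall>x\<in>carrier M. \<forall>y\<in>carrier M. f (x \<oplus>\<^bsub>M\<^esub> y) = f x \<oplus>\<^bsub>N\<^esub> f y)"

definition left_linear :: "('l, 'x) ring_scheme \<Rightarrow> ('l, 'm, 'r, 'y) bimod_scheme \<Rightarrow>
    ('l, 'n, 's, 'z) bimod_scheme \<Rightarrow> ('m \<Rightarrow> 'n) \<Rightarrow> bool" where
  "left_linear R M N f \<longleftrightarrow> additive_map M N f \<and>
     (\<forall>a\<in>carrier R. \<forall>x\<in>carrier M. f (a \<odot>\<^bsub>M\<^esub> x) = a \<odot>\<^bsub>N\<^esub> f x)"

definition right_linear :: "('r, 'x) ring_scheme \<Rightarrow> ('l, 'm, 'r, 'y) bimod_scheme \<Rightarrow>
    ('k, 'n, 'r, 'z) bimod_scheme \<Rightarrow> ('m \<Rightarrow> 'n) \<Rightarrow> bool" where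
  "right_linear R M N f \<longleftrightarrow> additive_map M N f \<and>
     (\<forall>a\<in>carrier R. \<forall>x\<in>carrier M. f (x \<odot>\<^sub>r\<^bsub>M\<^esub> a) = f x \<odot>\<^sub>r\<^bsub>N\<^esub> a)"

definition regular :: "('a, 'x) ring_scheme \<Rightarrow> ('a, 'a, 'a) bimod" where
  "regular R = \<lparr>carrier = carrier R, mult = mult R, one = one R, zero = zero R, add = add R,
     smult = mult R, rsmult = mult R\<rparr>"


section \<open>Tensor products\<close>

type_synonym ('m, 'n) tens = "('m \<times> 'n \<Rightarrow>\<^sub>0 int) set"

definition tensor_relators :: "('r, 'x) ring_scheme \<Rightarrow> ('l, 'm, 'r, 'y) bimod_scheme \<Rightarrow>
    ('r, 'n, 's, 'z) bimod_scheme \<Rightarrow> ('m \<times> 'n \<Rightarrow>\<^sub>0 int) set" where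
  "tensor_relators R M N =
     {frag_of (x \<oplus>\<^bsub>M\<^esub> x', y) - frag_of (x, y) - frag_of (x', y) | x x' y.
        x \<in> carrier M \<and> x' \<in> carrier M \<and> y \<in> carrier N} \<union>
     {frag_of (x, y \<oplus>\<^bsub>N\<^esub> y') - frag_of (x, y) - frag_of (x, y') | x y y'.
        x \<in> carrier M \<and> y \<in> carrier N \<and> y' \<in> carrier N} \<union>
     {frag_of (x \<odot>\<^sub>r\<^bsub>M\<^esub> r, y) - frag_of (x, r \<odot>\<^bsub>N\<^esub> y) | x r y.
        x \<in> carrier M \<and> r \<in> carrier R \<and> y \<in> carrier N}"

definition tensor_kernel :: "('r, 'x) ring_scheme \<Rightarrow> ('l, 'm, 'r, 'y) bimod_scheme \<Rightarrow>
    ('r, 'n, 's, 'z) bimod_scheme \<Rightarrow> ('m \<times> 'n \<Rightarrow>\<^sub>0 int) set" where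
  "tensor_kernel R M N =
     generate (free_Abelian_group (carrier M \<times> carrier N)) (tensor_relators R M N)"

definition tensor_quot :: "('r, 'x) ring_scheme \<Rightarrow> ('l, 'm, 'r, 'y) bimod_scheme \<Rightarrow>
    ('r, 'n, 's, 'z) bimod_scheme \<Rightarrow> ('m, 'n) tens monoid" where
  "tensor_quot R M N = free_Abelian_group (carrier M \<times> carrier N) Mod tensor_kernel R M N"

text \<open>The element \<open>x \<otimes> y\<close> of \<open>M \<otimes>\<^sub>R N\<close>.\<close>

definition pure :: "('r, 'x) ring_scheme \<Rightarrow> ('l, 'm, 'r, 'y) bimod_scheme \<Rightarrow>
    ('r, 'n, 's, 'z) bimod_scheme \<Rightarrow> 'm \<Rightarrow> 'n \<Rightarrow> ('m, 'n) tens" where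
  "pure R M N x y =
     tensor_kernel R M N #>\<^bsub>free_Abelian_group (carrier M \<times> carrier N)\<^esub> frag_of (x, y)"

definition tensor_group :: "('r, 'x) ring_scheme \<Rightarrow> ('l, 'm, 'r, 'y) bimod_scheme \<Rightarrow>
    ('r, 'n, 's, 'z) bimod_scheme \<Rightarrow> ('m, 'n) tens ring" where
  "tensor_group R M N = \<lparr>carrier = carrier (tensor_quot R M N), mult = undefined, one = undefined,
     zero = one (tensor_quot R M N), add = mult (tensor_quot R M N)\<rparr>"

text \<open>
  \<open>tensor_lift G \<beta>\<close> is the map \<open>x \<otimes> y \<mapsto> \<beta> x y\<close> from a tensor product to the abelian group \<open>G\<close>.
  It evaluates \<open>\<beta>\<close> on an arbitrarily chosen representative, and hence is meaningful only
  for balanced biadditive \<open>\<beta>\<close>; all uses below are of this kind.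
\<close>

definition tensor_lift :: "('g, 'x) ring_scheme \<Rightarrow> ('m \<Rightarrow> 'n \<Rightarrow> 'g) \<Rightarrow> ('m, 'n) tens \<Rightarrow> 'g" where
  "tensor_lift G \<beta> t = (let c = (SOME c. c \<in> t) in
     \<Oplus>\<^bsub>G\<^esub>k\<in>Poly_Mapping.keys c. [Poly_Mapping.lookup c k] \<cdot>\<^bsub>G\<^esub> \<beta> (fst k) (snd k))"

text \<open>\<open>f \<otimes> g\<close> as a map into \<open>M \<otimes>\<^sub>R N\<close>.\<close>

definition tensor_map :: "('r, 'x) ring_scheme \<Rightarrow> ('l, 'm, 'r, 'y) bimod_scheme \<Rightarrow>
    ('r, 'n, 's, 'z) bimod_scheme \<Rightarrow> ('k \<Rightarrow> 'm) \<Rightarrow> ('h \<Rightarrow> 'n) \<Rightarrow> ('k, 'h) tens \<Rightarrow> ('m, 'n) tens" where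
  "tensor_map R M N f g = tensor_lift (tensor_group R M N) (\<lambda>x y. pure R M N (f x) (g y))"

text \<open>
  The tensor product with the left action coming from the left factor and the right action
  coming from the right factor, whenever these exist.
\<close>

definition tensor :: "('r, 'x) ring_scheme \<Rightarrow> ('l, 'm, 'r, 'y) bimod_scheme \<Rightarrow>
    ('r, 'n, 's, 'z) bimod_scheme \<Rightarrow> ('l, ('m, 'n) tens, 's) bimod" where
  "tensor R M N = \<lparr>carrier = carrier (tensor_group R M N), mult = undefined, one = undefined,
     zero = zero (tensor_group R M N), add = add (tensor_group R M N),
     smult = (\<lambda>a. tensor_map R M N (\<lambda>x. a \<odot>\<^bsub>M\<^esub> x) (\<lambda>y. y)),
     rsmult = (\<lambda>t b. tensor_map R M N (\<lambda>x. x) (\<lambda>y. y \<odot>\<^sub>r\<^bsub>N\<^esub> b) t)\<rparr>"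

text \<open>\<open>(L \<otimes>\<^sub>R M) \<otimes>\<^sub>S N \<rightarrow> L \<otimes>\<^sub>R (M \<otimes>\<^sub>S N)\<close> and its inverse.\<close>

definition tensor_assoc where
  "tensor_assoc R S L M N =
     tensor_lift (tensor R L (tensor S M N))
       (\<lambda>t z. tensor_lift (tensor R L (tensor S M N))
          (\<lambda>x y. pure R L (tensor S M N) x (pure S M N y z)) t)"

definition tensor_assoc_inv where
  "tensor_assoc_inv R S L M N =
     tensor_lift (tensor S (tensor R L M) N)
       (\<lambda>x. tensor_lift (tensor S (tensor R L M) N)
          (\<lambda>y z. pure S (tensor R L M) N (pure R L M x y) z))"


section \<open>Flat, projective and relatively projective modules\<close>

text \<open>
  HOL cannot quantify over types inside a formula, so a quantifier over all modules is rendered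
  as a quantifier over all modules with carrier in a type \<open>'u\<close> that is passed as a parameter.
  In a theorem \<open>'u\<close> should be an arbitrary type subject only to a lower bound on its size: as a
  hypothesis, the condition for a given \<open>'u\<close> is implied by the one over all modules, while a
  conclusion for every such \<open>'u\<close> gives the condition over all modules.
\<close>

definition flat_right_module :: "'u itself \<Rightarrow> ('r, 'x) ring_scheme \<Rightarrow> ('l, 'm, 'r, 'y) bimod_scheme \<Rightarrow> bool" where
  "flat_right_module U R X \<longleftrightarrow> right_module R X \<and>
     (\<forall>(M :: ('r, 'u, unit) bimod) (N :: ('r, 'u, unit) bimod) f.
        left_module R M \<and> left_module R N \<and> left_linear R M N f \<and> inj_on f (carrier M) \<longrightarrow>
        inj_on (tensor_map R X N (\<lambda>x. x) f) (carrier (tensor R X M)))"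

definition projective_right_module :: "'u itself \<Rightarrow> ('r, 'x) ring_scheme \<Rightarrow> ('l, 'm, 'r, 'y) bimod_scheme \<Rightarrow> bool" where
  "projective_right_module U R X \<longleftrightarrow> right_module R X \<and>
     (\<forall>(M :: (unit, 'u, 'r) bimod) (N :: (unit, 'u, 'r) bimod) g h.
        right_module R M \<and> right_module R N \<and>
        right_linear R M N g \<and> g ` carrier M = carrier N \<and> right_linear R X N h \<longrightarrow>
        (\<exists>k. right_linear R X M k \<and> (\<forall>x\<in>carrier X. g (k x) = h x)))"

definition fin_gen_right_module :: "('r, 'x) ring_scheme \<Rightarrow> ('l, 'm, 'r, 'y) bimod_scheme \<Rightarrow> bool" where
  "fin_gen_right_module R X \<longleftrightarrow> right_module R X \<and>
     (\<exists>G. finite G \<and> G \<subseteq> carrier X \<and>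
        (\<forall>x\<in>carrier X. \<exists>a. a \<in> G \<rightarrow> carrier R \<and> x = (\<Oplus>\<^bsub>X\<^esub>g\<in>G. g \<odot>\<^sub>r\<^bsub>X\<^esub> a g)))"

text \<open>For a subring \<open>B\<close> of \<open>S\<close>: the multiplication \<open>X \<otimes>\<^sub>B S \<rightarrow> X\<close> splits as a map of right \<open>S\<close>-modules.\<close>

definition relative_projective :: "('s, 'x) ring_scheme \<Rightarrow> 's set \<Rightarrow> ('l, 'm, 's, 'y) bimod_scheme \<Rightarrow> bool" where
  "relative_projective S B X \<longleftrightarrow> right_module S X \<and>
     (\<exists>\<sigma>. right_linear S X (tensor (S\<lparr>carrier := B\<rparr>) X (regular S)) \<sigma> \<and>
        (\<forall>x\<in>carrier X. tensor_lift X (\<lambda>y s. y \<odot>\<^sub>r\<^bsub>X\<^esub> s) (\<sigma> x) = x))"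


section \<open>Corings and comodules\<close>

record ('a, 'c) coring = "('a, 'c, 'a) bimod" +
  comult :: "'c \<Rightarrow> ('c, 'c) tens"
  counit :: "'c \<Rightarrow> 'a"

definition is_coring :: "('a, 'x) ring_scheme \<Rightarrow> ('a, 'c) coring \<Rightarrow> bool" where
  "is_coring A C \<longleftrightarrow> bimodule A A C \<and>
     left_linear A C (tensor A C C) (comult C) \<and> right_linear A C (tensor A C C) (comult C) \<and>
     left_linear A C (regular A) (counit C) \<and> right_linear A C (regular A) (counit C) \<and>
     (\<forall>c\<in>carrier C.
        tensor_assoc A A C C C (tensor_map A (tensor A C C) C (comult C) (\<lambda>d. d) (comult C c)) =
        tensor_map A C (tensor A C C) (\<lambda>d. d) (comult C) (comult C c)) \<and>
     (\<forall>c\<in>carrier C. tensor_lift C (\<lambda>d e. counit C d \<odot>\<^bsub>C\<^esub> e) (comult C c) = c) \<and>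
     (\<forall>c\<in>carrier C. tensor_lift C (\<lambda>d e. d \<odot>\<^sub>r\<^bsub>C\<^esub> counit C e) (comult C c) = c)"

definition right_comodule :: "('a, 'x) ring_scheme \<Rightarrow> ('a, 'c) coring \<Rightarrow> ('l, 'm, 'a, 'y) bimod_scheme \<Rightarrow>
    ('m \<Rightarrow> ('m, 'c) tens) \<Rightarrow> bool" where
  "right_comodule A C M \<rho> \<longleftrightarrow> right_module A M \<and> right_linear A M (tensor A M C) \<rho> \<and>
     (\<forall>x\<in>carrier M.
        tensor_assoc A A M C C (tensor_map A (tensor A M C) C \<rho> (\<lambda>c. c) (\<rho> x)) =
        tensor_map A M (tensor A C C) (\<lambda>y. y) (comult C) (\<rho> x)) \<and>
     (\<forall>x\<in>carrier M. tensor_lift M (\<lambda>y c. y \<odot>\<^sub>r\<^bsub>M\<^esub> counit C c) (\<rho> x) = x)"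

definition left_comodule :: "('a, 'x) ring_scheme \<Rightarrow> ('a, 'c) coring \<Rightarrow> ('a, 'm, 'r, 'y) bimod_scheme \<Rightarrow>
    ('m \<Rightarrow> ('c, 'm) tens) \<Rightarrow> bool" where
  "left_comodule A C M \<rho> \<longleftrightarrow> left_module A M \<and> left_linear A M (tensor A C M) \<rho> \<and>
     (\<forall>x\<in>carrier M.
        tensor_assoc A A C C M (tensor_map A (tensor A C C) M (comult C) (\<lambda>y. y) (\<rho> x)) =
        tensor_map A C (tensor A C M) (\<lambda>c. c) \<rho> (\<rho> x)) \<and>
     (\<forall>x\<in>carrier M. tensor_lift M (\<lambda>c y. counit C c \<odot>\<^bsub>M\<^esub> y) (\<rho> x) = x)"

definition right_colinear where
  "right_colinear A C M \<rho>\<^sub>M N \<rho>\<^sub>N f \<longleftrightarrow> right_linear A M N f \<and>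
     (\<forall>x\<in>carrier M. \<rho>\<^sub>N (f x) = tensor_map A N C f (\<lambda>c. c) (\<rho>\<^sub>M x))"

definition left_colinear where
  "left_colinear A C M \<rho>\<^sub>M N \<rho>\<^sub>N f \<longleftrightarrow> left_linear A M N f \<and>
     (\<forall>x\<in>carrier M. \<rho>\<^sub>N (f x) = tensor_map A C N (\<lambda>c. c) f (\<rho>\<^sub>M x))"

text \<open>The coaction \<open>I\<^sub>X \<otimes> \<rho>\<close> on \<open>X \<otimes>\<^sub>R N\<close>, for a right comodule \<open>(N, \<rho>)\<close> with left \<open>R\<close>-linear \<open>\<rho>\<close>.\<close>

definition tensor_coaction where
  "tensor_coaction R A C X N \<rho> t =
     tensor_assoc_inv R A X N C (tensor_map R X (tensor A N C) (\<lambda>x. x) \<rho> t)"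

definition splitting_epi where
  "splitting_epi A C M \<rho>\<^sub>M N \<rho>\<^sub>N f \<longleftrightarrow> right_colinear A C M \<rho>\<^sub>M N \<rho>\<^sub>N f \<and>
     (\<exists>\<sigma>. right_colinear A C N \<rho>\<^sub>N M \<rho>\<^sub>M \<sigma> \<and> (\<forall>y\<in>carrier N. f (\<sigma> y) = y))"


section \<open>Hom groups and endomorphism rings\<close>

text \<open>
  A set \<open>H\<close> of (extensional) maps \<open>M \<rightarrow> N\<close> as a bimodule, with \<open>(a f)(x) = a f(x)\<close> and with
  endomorphisms of \<open>M\<close> acting on the right by composition.
\<close>

definition hom_bimod :: "('m \<Rightarrow> 'n) set \<Rightarrow> ('l, 'm, 'r, 'x) bimod_scheme \<Rightarrow> ('a, 'n, 'b, 'y) bimod_scheme \<Rightarrow>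
    ('a, 'm \<Rightarrow> 'n, 'm \<Rightarrow> 'm) bimod" where
  "hom_bimod H M N = \<lparr>carrier = H, mult = undefined, one = undefined,
     zero = (\<lambda>x\<in>carrier M. \<zero>\<^bsub>N\<^esub>), add = (\<lambda>f g. \<lambda>x\<in>carrier M. f x \<oplus>\<^bsub>N\<^esub> g x),
     smult = (\<lambda>a f. \<lambda>x\<in>carrier M. a \<odot>\<^bsub>N\<^esub> f x),
     rsmult = (\<lambda>f s. compose (carrier M) f s)\<rparr>"

definition right_dual :: "('a, 'x) ring_scheme \<Rightarrow> ('l, 'p, 'a, 'y) bimod_scheme \<Rightarrow> ('a, 'p \<Rightarrow> 'a, 'p \<Rightarrow> 'p) bimod" where
  "right_dual A P =
     hom_bimod {f \<in> extensional (carrier P). right_linear A P (regular A) f} P (regular A)"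

definition colinear_hom where
  "colinear_hom A C P \<rho>\<^sub>P N \<rho>\<^sub>N =
     hom_bimod {f \<in> extensional (carrier P). right_colinear A C P \<rho>\<^sub>P N \<rho>\<^sub>N f} P N"

definition right_comodule_End :: "('a, 'x) ring_scheme \<Rightarrow> ('a, 'c) coring \<Rightarrow> ('l, 'p, 'a, 'y) bimod_scheme \<Rightarrow>
    ('p \<Rightarrow> ('p, 'c) tens) \<Rightarrow> ('p \<Rightarrow> 'p) ring" where
  "right_comodule_End A C P \<rho> = \<lparr>
     carrier = {f \<in> extensional (carrier P). right_colinear A C P \<rho> P \<rho> f},
     mult = (\<lambda>f g. compose (carrier P) f g), one = (\<lambda>x\<in>carrier P. x),
     zero = (\<lambda>x\<in>carrier P. \<zero>\<^bsub>P\<^esub>), add = (\<lambda>f g. \<lambda>x\<in>carrier P. f x \<oplus>\<^bsub>P\<^esub> g x)\<rparr>"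

text \<open>\<open>P\<close> with endomorphisms acting on the left by evaluation.\<close>

definition eval_bimod :: "('l, 'p, 'a, 'y) bimod_scheme \<Rightarrow> ('p \<Rightarrow> 'p, 'p, 'a) bimod" where
  "eval_bimod P = \<lparr>carrier = carrier P, mult = undefined, one = undefined, zero = zero P, add = add P,
     smult = (\<lambda>s x. s x), rsmult = rsmult P\<rparr>"

text \<open>Endomorphisms of a left comodule act on the right, so the product \<open>s t\<close> applies \<open>s\<close> first.\<close>

definition left_comodule_End :: "('a, 'x) ring_scheme \<Rightarrow> ('a, 'c) coring \<Rightarrow> ('a, 'q, 'r, 'y) bimod_scheme \<Rightarrow>
    ('q \<Rightarrow> ('c, 'q) tens) \<Rightarrow> ('q \<Rightarrow> 'q) ring" where
  "left_comodule_End A C Q \<rho> = \<lparr>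
     carrier = {f \<in> extensional (carrier Q). left_colinear A C Q \<rho> Q \<rho> f},
     mult = (\<lambda>s t. compose (carrier Q) t s), one = (\<lambda>x\<in>carrier Q. x),
     zero = (\<lambda>x\<in>carrier Q. \<zero>\<^bsub>Q\<^esub>), add = (\<lambda>f g. \<lambda>x\<in>carrier Q. f x \<oplus>\<^bsub>Q\<^esub> g x)\<rparr>"

definition right_eval_bimod :: "('a, 'q, 'r, 'y) bimod_scheme \<Rightarrow> ('a, 'q, 'q \<Rightarrow> 'q) bimod" where
  "right_eval_bimod Q = \<lparr>carrier = carrier Q, mult = undefined, one = undefined, zero = zero Q, add = add Q,
     smult = smult Q, rsmult = (\<lambda>x s. s x)\<rparr>"

text \<open>Left linear maps \<open>Q \<rightarrow> K\<close>, as a left module over endomorphisms of \<open>Q\<close>: \<open>(q)(s h) = (q s)h\<close>.\<close>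

definition left_hom_bimod :: "('a, 'x) ring_scheme \<Rightarrow> ('a, 'q, 'r, 'y) bimod_scheme \<Rightarrow>
    ('a, 'k, 'b, 'z) bimod_scheme \<Rightarrow> ('q \<Rightarrow> 'q, 'q \<Rightarrow> 'k, 'b) bimod" where
  "left_hom_bimod A Q K = \<lparr>
     carrier = {h \<in> extensional (carrier Q). left_linear A Q K h}, mult = undefined, one = undefined,
     zero = (\<lambda>x\<in>carrier Q. \<zero>\<^bsub>K\<^esub>), add = (\<lambda>f g. \<lambda>x\<in>carrier Q. f x \<oplus>\<^bsub>K\<^esub> g x),
     smult = (\<lambda>s h. compose (carrier Q) h s),
     rsmult = (\<lambda>h b. \<lambda>x\<in>carrier Q. h x \<odot>\<^sub>r\<^bsub>K\<^esub> b)\<rparr>"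


section \<open>The dual comodule, Galois comodules, strong injectivity\<close>

definition dual_basis :: "('a, 'x) ring_scheme \<Rightarrow> ('l, 'p, 'a, 'y) bimod_scheme \<Rightarrow>
    nat \<Rightarrow> (nat \<Rightarrow> 'p) \<Rightarrow> (nat \<Rightarrow> 'p \<Rightarrow> 'a) \<Rightarrow> bool" where
  "dual_basis A P n p \<pi> \<longleftrightarrow>
     (\<forall>i<n. p i \<in> carrier P \<and> \<pi> i \<in> carrier (right_dual A P)) \<and>
     (\<forall>x\<in>carrier P. x = (\<Oplus>\<^bsub>P\<^esub>i\<in>{..<n}. p i \<odot>\<^sub>r\<^bsub>P\<^esub> \<pi> i x))"

definition dual_coaction_wrt :: "('a, 'x) ring_scheme \<Rightarrow> ('a, 'c) coring \<Rightarrow> ('l, 'p, 'a, 'y) bimod_scheme \<Rightarrow>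
    ('p \<Rightarrow> ('p, 'c) tens) \<Rightarrow> nat \<Rightarrow> (nat \<Rightarrow> 'p) \<Rightarrow> (nat \<Rightarrow> 'p \<Rightarrow> 'a) \<Rightarrow>
    ('p \<Rightarrow> 'a) \<Rightarrow> ('c, 'p \<Rightarrow> 'a) tens" where
  "dual_coaction_wrt A C P \<rho> n p \<pi> g =
     (\<Oplus>\<^bsub>tensor A C (right_dual A P)\<^esub>i\<in>{..<n}.
        pure A C (right_dual A P) (tensor_lift C (\<lambda>x c. g x \<odot>\<^bsub>C\<^esub> c) (\<rho> (p i))) (\<pi> i))"

text \<open>The coaction on \<open>P\<^sup>*\<close> does not depend on the dual basis, so an arbitrary one is chosen.\<close>

definition dual_coaction where
  "dual_coaction A C P \<rho> =
     (let (n, p, \<pi>) = (SOME (n, p, \<pi>). dual_basis A P n p \<pi>) in dual_coaction_wrt A C P \<rho> n p \<pi>)"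

definition galois_map where
  "galois_map A C \<rho> K = tensor_lift (tensor A C K) (\<lambda>q h. tensor_map A C K (\<lambda>c. c) h (\<rho> q))"

text \<open>The isomorphism required below is one of left \<open>A\<close>-modules.\<close>

definition galois_left_comodule :: "'u itself \<Rightarrow> ('a, 'x) ring_scheme \<Rightarrow> ('a, 'c) coring \<Rightarrow>
    ('a, 'q, 'r, 'y) bimod_scheme \<Rightarrow> ('q \<Rightarrow> ('c, 'q) tens) \<Rightarrow> bool" where
  "galois_left_comodule U A C Q \<rho> \<longleftrightarrow> left_comodule A C Q \<rho> \<and>
     (\<forall>K :: ('a, 'u, unit) bimod. left_module A K \<longrightarrow>
        (let T = tensor (left_comodule_End A C Q \<rho>) (right_eval_bimod Q) (left_hom_bimod A Q K)
         in left_linear A T (tensor A C K) (galois_map A C \<rho> K) \<and>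
            bij_betw (galois_map A C \<rho> K) (carrier T) (carrier (tensor A C K))))"

text \<open>\<open>P\<close> is \<open>B\<close>-strongly \<open>(C, A)\<close>-injective; here \<open>S\<close> is the ring of colinear endomorphisms of \<open>P\<close>.\<close>

definition strongly_injective where
  "strongly_injective A C P \<rho> B \<longleftrightarrow>
     (let S = right_comodule_End A C P \<rho>; E = eval_bimod P in
      \<exists>\<kappa>. right_colinear A C (tensor A E C) (tensor_coaction A A C E C (comult C)) P \<rho> \<kappa> \<and>
           left_linear (S\<lparr>carrier := B\<rparr>) (tensor A E C) E \<kappa> \<and>
           (\<forall>x\<in>carrier P. \<kappa> (\<rho> x) = x))"

text \<open>The canonical map \<open>f \<otimes> p \<mapsto> f(p)\<close>, together with its domain as a right comodule.\<close>

definition canonical_domain where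
  "canonical_domain A C P \<rho> B =
     tensor ((right_comodule_End A C P \<rho>)\<lparr>carrier := B\<rparr>)
       (colinear_hom A C P \<rho> C (comult C)) (eval_bimod P)"

definition canonical_domain_coaction where
  "canonical_domain_coaction A C P \<rho> B =
     tensor_coaction ((right_comodule_End A C P \<rho>)\<lparr>carrier := B\<rparr>) A C
       (colinear_hom A C P \<rho> C (comult C)) (eval_bimod P) \<rho>"

definition canonical_map where
  "canonical_map C = tensor_lift C (\<lambda>f p. f p)"

end

theory Submission
  imports Defs
begin

text \<open>
  Write \<open>X = P\<^sup>*\<close>, and \<open>g^ = (g \<otimes> C) \<rho>\<close> for a form \<open>g\<close> on \<open>P\<close>.  By coassociativity \<open>g^\<close> is colinear, and \<open>g \<mapsto> g^\<close> is an
  isomorphism from \<open>X\<close> to \<open>Hom\<^sup>C(P, C)\<close> whose inverse is composition with the counit (lemmas \<open>comult_hat\<close>,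
  \<open>hat_unhat\<close>, \<open>counit_hat\<close>).  So the canonical map may be read as \<open>X \<otimes>\<^sub>B P \<rightarrow> C\<close>, \<open>g \<otimes> x \<mapsto> g^(x)\<close>.  A dual basis of
  \<open>P\<close> gives \<open>Hom\<^sub>A(X, K) = P \<otimes>\<^sub>A K\<close> for all left modules \<open>K\<close>, and identifies the left colinear endomorphisms of \<open>X\<close>
  with \<open>S\<close> (\<open>transpose_closed\<close>, \<open>transpose_surj\<close>).  Hence the Galois map at \<open>K\<close> is the canonical map over \<open>S\<close> tensored
  with \<open>K\<close>, and \<open>X\<close> is Galois iff \<open>X \<otimes>\<^sub>S P \<rightarrow> C\<close> is bijective.

  The heart of the matter is that \<open>Y \<otimes>\<^sub>B S \<rightarrow> Hom\<^sup>C(P, Y \<otimes>\<^sub>B P)\<close> is bijective for \<open>Y = X\<close> (\<open>hom_tensor_bij\<close>).  With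
  \<open>End\<^sub>A(P)\<close> and \<open>Hom\<^sub>A\<close> instead of \<open>S\<close> and \<open>Hom\<^sup>C\<close> this is so for every \<open>Y\<close>, as \<open>P\<close> is finitely generated projective
  (\<open>ev_unev\<close>, \<open>ev_inj\<close>).  Now \<open>S\<close> is the kernel of \<open>e \<mapsto> \<rho> e - (e \<otimes> C) \<rho>\<close> on \<open>End\<^sub>A(P)\<close>.  If \<open>Y\<close> is flat over \<open>B\<close>, tensoring
  preserves this kernel (\<open>flat_hom_tensor_bij\<close>).  If \<open>\<rho>\<close> is split by a colinear, left \<open>B\<close>-linear \<open>\<kappa>\<close>, then
  \<open>e \<mapsto> \<kappa> (e \<otimes> C) \<rho>\<close> is a left \<open>B\<close>-linear retraction of \<open>End\<^sub>A(P)\<close> onto \<open>S\<close>, and the kernel is preserved for that reason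
  (\<open>strongly_injective_hom_tensor_bij\<close>).

  Let \<open>\<sigma>\<close> be a colinear splitting of the canonical map.  For \<open>q\<close> in \<open>X\<close> the colinear map \<open>\<sigma> q^\<close> comes from a unique
  tensor \<open>\<Sum> g\<^sub>j \<otimes> s\<^sub>j\<close> in \<open>X \<otimes>\<^sub>B S\<close>, so that \<open>\<sigma>(q^(x)) = \<Sum> g\<^sub>j \<otimes> s\<^sub>j(x)\<close>; applying the canonical map shows
  \<open>\<Sum> g\<^sub>j s\<^sub>j = q\<close>.  Uniqueness makes \<open>q \<mapsto> \<Sum> g\<^sub>j \<otimes> s\<^sub>j\<close> right \<open>S\<close>-linear, so \<open>X\<close> is \<open>(S, B)\<close>-projective.  Over \<open>S\<close> we have
  \<open>\<Sum> g\<^sub>j \<otimes> s\<^sub>j(x) = q \<otimes> x\<close>, which says that \<open>\<sigma>\<close> becomes a two-sided inverse of \<open>X \<otimes>\<^sub>S P \<rightarrow> C\<close> (\<open>galois_bij\<close>).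

  Conversely, tensoring a section \<open>X \<rightarrow> X \<otimes>\<^sub>B S\<close> with \<open>P\<close> over \<open>S\<close> and composing with the inverse of \<open>X \<otimes>\<^sub>S P \<rightarrow> C\<close>
  gives a map \<open>C \<rightarrow> X \<otimes>\<^sub>B P\<close>.  As \<open>C\<close> is generated by the elements \<open>q^(x)\<close>, it is easily checked to be a colinear
  splitting (\<open>splitting_from_galois\<close>).

  Flatness, projectivity and the Galois property are tested on modules with carrier in \<open>'u\<close>.  The modules that occur
  are built from maps \<open>P \<rightarrow> P \<otimes> C\<close> and from tuples over \<open>A\<close>, and are copied to \<open>'u\<close> along the given injection.
\<close>

section \<open>Additive maps and one-sided modules\<close>

lemma additive_mapI:
  assumes "\<And>x. x \<in> carrier M \<Longrightarrow> f x \<in> carrier N"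
    and "\<And>x y. x \<in> carrier M \<Longrightarrow> y \<in> carrier M \<Longrightarrow> f (x \<oplus>\<^bsub>M\<^esub> y) = f x \<oplus>\<^bsub>N\<^esub> f y"
  shows "additive_map M N f"
  using assms by (auto simp: additive_map_def)

lemma additive_map_closed: "additive_map M N f \<Longrightarrow> x \<in> carrier M \<Longrightarrow> f x \<in> carrier N"
  by (auto simp: additive_map_def)

lemma additive_map_add:
  "additive_map M N f \<Longrightarrow> x \<in> carrier M \<Longrightarrow> y \<in> carrier M \<Longrightarrow> f (x \<oplus>\<^bsub>M\<^esub> y) = f x \<oplus>\<^bsub>N\<^esub> f y"
  by (auto simp: additive_map_def)

lemma additive_map_hom:
  assumes "additive_map M N f" "abelian_group M" "abelian_group N"
  shows "group_hom (add_monoid M) (add_monoid N) f"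
  using assms
  by (auto simp: group_hom_def group_hom_axioms_def hom_def additive_map_def abelian_group.a_group)

lemma additive_map_zero:
  assumes "additive_map M N f" "abelian_group M" "abelian_group N"
  shows "f \<zero>\<^bsub>M\<^esub> = \<zero>\<^bsub>N\<^esub>"
  using group_hom.hom_one[OF additive_map_hom[OF assms]] by simp

lemma additive_map_neg:
  assumes "additive_map M N f" "abelian_group M" "abelian_group N" "x \<in> carrier M"
  shows "f (\<ominus>\<^bsub>M\<^esub> x) = \<ominus>\<^bsub>N\<^esub> f x"
  using group_hom.hom_inv[OF additive_map_hom[OF assms(1-3)]] assms(4) by (simp add: a_inv_def)

lemma additive_map_minus:
  assumes "additive_map M N f" "abelian_group M" "abelian_group N" "x \<in> carrier M" "y \<in> carrier M"
  shows "f (x \<ominus>\<^bsub>M\<^esub> y) = f x \<ominus>\<^bsub>N\<^esub> f y"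
  using assms by (simp add: a_minus_def additive_map_add[of M N] additive_map_neg[of M N] abelian_group.a_inv_closed)

lemma additive_map_finsum:
  assumes "additive_map M N f" "abelian_group M" "abelian_group N" "h \<in> I \<rightarrow> carrier M"
  shows "f (\<Oplus>\<^bsub>M\<^esub>i\<in>I. h i) = (\<Oplus>\<^bsub>N\<^esub>i\<in>I. f (h i))"
proof (cases "finite I")
  interpret M: abelian_group M by fact
  interpret N: abelian_group N by fact
  case True
  then show ?thesis using assms(4)
  proof induction
    case empty
    show ?case by (simp add: additive_map_zero[OF assms(1-3)])
  next
    case (insert i J)
    then have c: "h i \<in> carrier M" "h \<in> J \<rightarrow> carrier M" by auto
    with insert show ?case
      by (subst N.finsum_insert)
        (auto simp: additive_map_add[OF assms(1)] Pi_iff intro!: additive_map_closed[OF assms(1)])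
  qed
next
  interpret M: abelian_group M by fact
  interpret N: abelian_group N by fact
  case False
  then show ?thesis by (simp add: additive_map_zero[OF assms(1-3)])
qed

lemma additive_map_comp:
  "additive_map M N f \<Longrightarrow> additive_map N K g \<Longrightarrow> additive_map M K (\<lambda>x. g (f x))"
  by (simp add: additive_map_def Pi_iff)

lemma additive_map_ident: "additive_map M M (\<lambda>x. x)"
  by (auto simp: additive_map_def)

lemma additive_map_plus:
  assumes "additive_map M N f" "additive_map M N g" "abelian_group N"
  shows "additive_map M N (\<lambda>x. f x \<oplus>\<^bsub>N\<^esub> g x)"
proof -
  interpret N: abelian_group N by fact
  show ?thesis
    using assms(1,2) by (intro additive_mapI)
      (auto simp: additive_map_add[of M N] additive_map_closed[of M N] N.a_ac)
qed

lemma left_linear_additive: "left_linear R M N f \<Longrightarrow> additive_map M N f"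
  by (simp add: left_linear_def)

lemma right_linear_additive: "right_linear R M N f \<Longrightarrow> additive_map M N f"
  by (simp add: right_linear_def)

lemma right_linear_closed: "right_linear R M N f \<Longrightarrow> x \<in> carrier M \<Longrightarrow> f x \<in> carrier N"
  and right_linear_add: "right_linear R M N f \<Longrightarrow> x \<in> carrier M \<Longrightarrow> y \<in> carrier M \<Longrightarrow> f (x \<oplus>\<^bsub>M\<^esub> y) = f x \<oplus>\<^bsub>N\<^esub> f y"
  by (auto simp: right_linear_def additive_map_def)

lemma left_linear_closed: "left_linear R M N f \<Longrightarrow> x \<in> carrier M \<Longrightarrow> f x \<in> carrier N"
  and left_linear_add: "left_linear R M N f \<Longrightarrow> x \<in> carrier M \<Longrightarrow> y \<in> carrier M \<Longrightarrow> f (x \<oplus>\<^bsub>M\<^esub> y) = f x \<oplus>\<^bsub>N\<^esub> f y"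
  by (auto simp: left_linear_def additive_map_def)

lemma left_linear_smult:
  "left_linear R M N f \<Longrightarrow> a \<in> carrier R \<Longrightarrow> x \<in> carrier M \<Longrightarrow> f (a \<odot>\<^bsub>M\<^esub> x) = a \<odot>\<^bsub>N\<^esub> f x"
  by (simp add: left_linear_def)

lemma right_linear_rsmult:
  "right_linear R M N f \<Longrightarrow> a \<in> carrier R \<Longrightarrow> x \<in> carrier M \<Longrightarrow> f (x \<odot>\<^sub>r\<^bsub>M\<^esub> a) = f x \<odot>\<^sub>r\<^bsub>N\<^esub> a"
  by (simp add: right_linear_def)

lemma left_linear_ident: "left_linear R M M (\<lambda>x. x)"
  by (simp add: left_linear_def additive_map_ident)

lemma right_linear_ident: "right_linear R M M (\<lambda>x. x)"
  by (simp add: right_linear_def additive_map_ident)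

lemma right_linear_comp:
  "right_linear R M N f \<Longrightarrow> right_linear R N K g \<Longrightarrow> right_linear R M K (\<lambda>x. g (f x))"
  by (simp add: right_linear_def additive_map_def Pi_iff)

lemma left_linear_comp:
  "left_linear R M N f \<Longrightarrow> left_linear R N K g \<Longrightarrow> left_linear R M K (\<lambda>x. g (f x))"
  by (simp add: left_linear_def additive_map_def Pi_iff)

lemma right_linear_cong:
  assumes "right_linear R M N f" "\<And>x. x \<in> carrier M \<Longrightarrow> g x = f x"
    and "right_module R M"
  shows "right_linear R M N g"
proof -
  interpret M: abelian_group M using assms(3) by (simp add: right_module_def)
  show ?thesis using assms by (auto simp: right_linear_def additive_map_def right_module_def)
qed

lemma left_linear_cong:
  assumes "left_linear R M N f" "\<And>x. x \<in> carrier M \<Longrightarrow> g x = f x"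
    and "left_module R M"
  shows "left_linear R M N g"
proof -
  interpret M: abelian_group M using assms(3) by (simp add: left_module_def)
  show ?thesis using assms by (auto simp: left_linear_def additive_map_def left_module_def)
qed

lemma lmod_ring: "left_module R M \<Longrightarrow> ring R"
  and lmod_group: "left_module R M \<Longrightarrow> abelian_group M"
  and lmod_closed: "left_module R M \<Longrightarrow> a \<in> carrier R \<Longrightarrow> x \<in> carrier M \<Longrightarrow> a \<odot>\<^bsub>M\<^esub> x \<in> carrier M"
  and lmod_scalar_add: "left_module R M \<Longrightarrow> a \<in> carrier R \<Longrightarrow> b \<in> carrier R \<Longrightarrow> x \<in> carrier M \<Longrightarrow>
    (a \<oplus>\<^bsub>R\<^esub> b) \<odot>\<^bsub>M\<^esub> x = a \<odot>\<^bsub>M\<^esub> x \<oplus>\<^bsub>M\<^esub> b \<odot>\<^bsub>M\<^esub> x"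
  and lmod_add: "left_module R M \<Longrightarrow> a \<in> carrier R \<Longrightarrow> x \<in> carrier M \<Longrightarrow> y \<in> carrier M \<Longrightarrow>
    a \<odot>\<^bsub>M\<^esub> (x \<oplus>\<^bsub>M\<^esub> y) = a \<odot>\<^bsub>M\<^esub> x \<oplus>\<^bsub>M\<^esub> a \<odot>\<^bsub>M\<^esub> y"
  and lmod_mult: "left_module R M \<Longrightarrow> a \<in> carrier R \<Longrightarrow> b \<in> carrier R \<Longrightarrow> x \<in> carrier M \<Longrightarrow>
    (a \<otimes>\<^bsub>R\<^esub> b) \<odot>\<^bsub>M\<^esub> x = a \<odot>\<^bsub>M\<^esub> (b \<odot>\<^bsub>M\<^esub> x)"
  and lmod_one: "left_module R M \<Longrightarrow> x \<in> carrier M \<Longrightarrow> \<one>\<^bsub>R\<^esub> \<odot>\<^bsub>M\<^esub> x = x"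
  by (auto simp: left_module_def)

lemma rmod_ring: "right_module R M \<Longrightarrow> ring R"
  and rmod_group: "right_module R M \<Longrightarrow> abelian_group M"
  and rmod_closed: "right_module R M \<Longrightarrow> a \<in> carrier R \<Longrightarrow> x \<in> carrier M \<Longrightarrow> x \<odot>\<^sub>r\<^bsub>M\<^esub> a \<in> carrier M"
  and rmod_scalar_add: "right_module R M \<Longrightarrow> a \<in> carrier R \<Longrightarrow> b \<in> carrier R \<Longrightarrow> x \<in> carrier M \<Longrightarrow>
    x \<odot>\<^sub>r\<^bsub>M\<^esub> (a \<oplus>\<^bsub>R\<^esub> b) = x \<odot>\<^sub>r\<^bsub>M\<^esub> a \<oplus>\<^bsub>M\<^esub> x \<odot>\<^sub>r\<^bsub>M\<^esub> b"
  and rmod_add: "right_module R M \<Longrightarrow> a \<in> carrier R \<Longrightarrow> x \<in> carrier M \<Longrightarrow> y \<in> carrier M \<Longrightarrow>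
    (x \<oplus>\<^bsub>M\<^esub> y) \<odot>\<^sub>r\<^bsub>M\<^esub> a = x \<odot>\<^sub>r\<^bsub>M\<^esub> a \<oplus>\<^bsub>M\<^esub> y \<odot>\<^sub>r\<^bsub>M\<^esub> a"
  and rmod_mult: "right_module R M \<Longrightarrow> a \<in> carrier R \<Longrightarrow> b \<in> carrier R \<Longrightarrow> x \<in> carrier M \<Longrightarrow>
    x \<odot>\<^sub>r\<^bsub>M\<^esub> (a \<otimes>\<^bsub>R\<^esub> b) = (x \<odot>\<^sub>r\<^bsub>M\<^esub> a) \<odot>\<^sub>r\<^bsub>M\<^esub> b"
  and rmod_one: "right_module R M \<Longrightarrow> x \<in> carrier M \<Longrightarrow> x \<odot>\<^sub>r\<^bsub>M\<^esub> \<one>\<^bsub>R\<^esub> = x"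
  by (auto simp: right_module_def)

lemma bimod_left: "bimodule L R M \<Longrightarrow> left_module L M"
  and bimod_right: "bimodule L R M \<Longrightarrow> right_module R M"
  and bimod_assoc: "bimodule L R M \<Longrightarrow> a \<in> carrier L \<Longrightarrow> x \<in> carrier M \<Longrightarrow> b \<in> carrier R \<Longrightarrow>
    (a \<odot>\<^bsub>M\<^esub> x) \<odot>\<^sub>r\<^bsub>M\<^esub> b = a \<odot>\<^bsub>M\<^esub> (x \<odot>\<^sub>r\<^bsub>M\<^esub> b)"
  by (auto simp: bimodule_def)

lemma lmod_additive: "left_module R M \<Longrightarrow> a \<in> carrier R \<Longrightarrow> additive_map M M (\<lambda>x. a \<odot>\<^bsub>M\<^esub> x)"
  by (auto intro!: additive_mapI simp: lmod_closed lmod_add)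

lemma rmod_additive: "right_module R M \<Longrightarrow> a \<in> carrier R \<Longrightarrow> additive_map M M (\<lambda>x. x \<odot>\<^sub>r\<^bsub>M\<^esub> a)"
  by (auto intro!: additive_mapI simp: rmod_closed rmod_add)

lemma rmod_scalar_additive:
  "right_module R M \<Longrightarrow> x \<in> carrier M \<Longrightarrow> additive_map R M (\<lambda>a. x \<odot>\<^sub>r\<^bsub>M\<^esub> a)"
  by (auto intro!: additive_mapI simp: rmod_closed rmod_scalar_add)

lemma bimod_left_smult_right_linear:
  "bimodule L R M \<Longrightarrow> a \<in> carrier L \<Longrightarrow> right_linear R M M (\<lambda>x. a \<odot>\<^bsub>M\<^esub> x)"
  by (auto simp: right_linear_def bimod_assoc intro!: lmod_additive dest: bimod_left)

lemma bimod_right_smult_left_linear: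
  "bimodule L R M \<Longrightarrow> b \<in> carrier R \<Longrightarrow> left_linear L M M (\<lambda>x. x \<odot>\<^sub>r\<^bsub>M\<^esub> b)"
  by (auto simp: left_linear_def bimod_assoc intro!: rmod_additive dest: bimod_right)

section \<open>The universal property of the tensor product\<close>

definition balanced where
  "balanced R M N G \<beta> \<longleftrightarrow>
     (\<forall>x\<in>carrier M. \<forall>y\<in>carrier N. \<beta> x y \<in> carrier G) \<and>
     (\<forall>x\<in>carrier M. \<forall>x'\<in>carrier M. \<forall>y\<in>carrier N. \<beta> (x \<oplus>\<^bsub>M\<^esub> x') y = \<beta> x y \<oplus>\<^bsub>G\<^esub> \<beta> x' y) \<and>
     (\<forall>x\<in>carrier M. \<forall>y\<in>carrier N. \<forall>y'\<in>carrier N. \<beta> x (y \<oplus>\<^bsub>N\<^esub> y') = \<beta> x y \<oplus>\<^bsub>G\<^esub> \<beta> x y') \<and>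
     (\<forall>x\<in>carrier M. \<forall>r\<in>carrier R. \<forall>y\<in>carrier N. \<beta> (x \<odot>\<^sub>r\<^bsub>M\<^esub> r) y = \<beta> x (r \<odot>\<^bsub>N\<^esub> y))"

lemma balancedI:
  assumes "\<And>x. x \<in> carrier M \<Longrightarrow> additive_map N G (\<lambda>y. \<beta> x y)"
    and "\<And>y. y \<in> carrier N \<Longrightarrow> additive_map M G (\<lambda>x. \<beta> x y)"
    and "\<And>x r y. x \<in> carrier M \<Longrightarrow> r \<in> carrier R \<Longrightarrow> y \<in> carrier N \<Longrightarrow> \<beta> (x \<odot>\<^sub>r\<^bsub>M\<^esub> r) y = \<beta> x (r \<odot>\<^bsub>N\<^esub> y)"
  shows "balanced R M N G \<beta>"
  using assms by (simp add: balanced_def additive_map_def Pi_def)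

lemma tensor_carrier_group: "carrier (tensor R M N) = carrier (tensor_quot R M N)"
  and tensor_zero_group: "\<zero>\<^bsub>tensor R M N\<^esub> = \<one>\<^bsub>tensor_quot R M N\<^esub>"
  and tensor_add_group: "add (tensor R M N) = mult (tensor_quot R M N)"
  by (simp_all add: tensor_def tensor_group_def)

text \<open>Only the additive structure of the target enters, so records that differ in other fields are interchangeable.\<close>

lemma tensor_lift_cong:
  assumes "carrier G = carrier G'" "zero G = zero G'" "add G = add G'"
  shows "tensor_lift G \<beta> = tensor_lift G' \<beta>"
  by (rule ext) (simp add: assms tensor_lift_def finsum_def add_pow_def finprod_def
    int_pow_def nat_pow_def m_inv_def cong: if_cong)

lemma tensor_lift_tensor_group: "tensor_lift (tensor_group R M N) \<beta> = tensor_lift (tensor R M N) \<beta>"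
  by (rule tensor_lift_cong) (simp_all add: tensor_def)

lemma keys_add_subset: "Poly_Mapping.keys a \<subseteq> Z \<Longrightarrow> Poly_Mapping.keys b \<subseteq> Z \<Longrightarrow> Poly_Mapping.keys (a + b) \<subseteq> Z"
  using keys_add by fastforce

lemma keys_diff_subset: "Poly_Mapping.keys a \<subseteq> Z \<Longrightarrow> Poly_Mapping.keys b \<subseteq> Z \<Longrightarrow> Poly_Mapping.keys (a - b) \<subseteq> Z"
  for a b :: "'k \<Rightarrow>\<^sub>0 int"
  using keys_diff by fastforce

context
  fixes R :: "('r, 'x) ring_scheme"
    and M :: "('l, 'm, 'r, 'y) bimod_scheme" and N :: "('r, 'n, 's, 'z) bimod_scheme"
  assumes M: "right_module R M" and N: "left_module R N"
begin

private abbreviation "F \<equiv> free_Abelian_group (carrier M \<times> carrier N)"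
private abbreviation "K \<equiv> tensor_kernel R M N"

private lemma relators: "tensor_relators R M N \<subseteq> carrier F"
proof -
  interpret M: abelian_group M by (rule rmod_group[OF M])
  interpret N: abelian_group N by (rule lmod_group[OF N])
  show ?thesis
    unfolding tensor_relators_def
    by (clarsimp, safe; simp add: keys_diff_subset rmod_closed[OF M] lmod_closed[OF N])
qed

private lemma kernel: "K \<lhd> F"
  unfolding tensor_kernel_def
  by (intro comm_group.subgroup_imp_normal abelian_free_Abelian_group
      group.generate_is_subgroup group_free_Abelian_group relators)

private lemma quot: "comm_group (tensor_quot R M N)"
proof -
  interpret n: normal K F by (rule kernel)
  interpret q: group "tensor_quot R M N"
    unfolding tensor_quot_def by (rule n.factorgroup_is_group)
  show ?thesis
  proof (rule q.group_comm_groupI)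
    fix x y assume "x \<in> carrier (tensor_quot R M N)" "y \<in> carrier (tensor_quot R M N)"
    then show "x \<otimes>\<^bsub>tensor_quot R M N\<^esub> y = y \<otimes>\<^bsub>tensor_quot R M N\<^esub> x"
      by (auto simp: tensor_quot_def carrier_FactGroup n.rcos_sum add.commute)
  qed
qed

lemma tensor_group: "abelian_group (tensor R M N)"
proof -
  interpret q: comm_group "tensor_quot R M N" by (rule quot)
  show ?thesis
    by (rule abelian_groupI)
      (auto simp: tensor_carrier_group tensor_zero_group tensor_add_group q.m_ac intro: q.l_inv_ex)
qed

private lemma coset_hom: "(\<lambda>a. K #>\<^bsub>F\<^esub> a) \<in> hom F (tensor_quot R M N)"
  unfolding tensor_quot_def by (rule normal.r_coset_hom_Mod[OF kernel])

private lemma coset_closed: "a \<in> carrier F \<Longrightarrow> K #>\<^bsub>F\<^esub> a \<in> carrier (tensor R M N)"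
  using coset_hom by (auto simp: hom_def tensor_carrier_group)

private lemma coset_add:
  "a \<in> carrier F \<Longrightarrow> b \<in> carrier F \<Longrightarrow> K #>\<^bsub>F\<^esub> (a + b) = (K #>\<^bsub>F\<^esub> a) \<oplus>\<^bsub>tensor R M N\<^esub> (K #>\<^bsub>F\<^esub> b)"
  using hom_mult[OF coset_hom] by (simp add: tensor_add_group)

private lemma coset_relator: "a \<in> tensor_relators R M N \<Longrightarrow> K #>\<^bsub>F\<^esub> (a + b) = K #>\<^bsub>F\<^esub> b" if "b \<in> carrier F"
proof -
  assume a: "a \<in> tensor_relators R M N"
  then have aK: "a \<in> K" unfolding tensor_kernel_def by (rule generate.incl)
  interpret n: normal K F by (rule kernel)
  have "a + b \<in> K #>\<^bsub>F\<^esub> b" using aK by (auto simp: r_coset_def)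
  then show ?thesis
    using that n.is_subgroup by (metis group.repr_independence group_free_Abelian_group)
qed

private lemma frag_closed: "x \<in> carrier M \<Longrightarrow> y \<in> carrier N \<Longrightarrow> frag_of (x, y) \<in> carrier F"
  by simp

lemma pure_closed: "x \<in> carrier M \<Longrightarrow> y \<in> carrier N \<Longrightarrow> pure R M N x y \<in> carrier (tensor R M N)"
  unfolding pure_def by (intro coset_closed frag_closed)

lemma pure_add_left:
  assumes "x \<in> carrier M" "x' \<in> carrier M" "y \<in> carrier N"
  shows "pure R M N (x \<oplus>\<^bsub>M\<^esub> x') y = pure R M N x y \<oplus>\<^bsub>tensor R M N\<^esub> pure R M N x' y"
proof -
  have "frag_of (x \<oplus>\<^bsub>M\<^esub> x', y) - frag_of (x, y) - frag_of (x', y) \<in> tensor_relators R M N"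
    using assms unfolding tensor_relators_def by blast
  from coset_relator[OF _ this, of "frag_of (x, y) + frag_of (x', y)"]
  show ?thesis
    using assms unfolding pure_def
    by (simp add: coset_add[symmetric] keys_add_subset algebra_simps)
qed

lemma pure_add_right:
  assumes "x \<in> carrier M" "y \<in> carrier N" "y' \<in> carrier N"
  shows "pure R M N x (y \<oplus>\<^bsub>N\<^esub> y') = pure R M N x y \<oplus>\<^bsub>tensor R M N\<^esub> pure R M N x y'"
proof -
  have "frag_of (x, y \<oplus>\<^bsub>N\<^esub> y') - frag_of (x, y) - frag_of (x, y') \<in> tensor_relators R M N"
    using assms unfolding tensor_relators_def by blast
  from coset_relator[OF _ this, of "frag_of (x, y) + frag_of (x, y')"]
  show ?thesis
    using assms unfolding pure_def
    by (simp add: coset_add[symmetric] keys_add_subset algebra_simps)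
qed

lemma pure_balanced:
  assumes "x \<in> carrier M" "r \<in> carrier R" "y \<in> carrier N"
  shows "pure R M N (x \<odot>\<^sub>r\<^bsub>M\<^esub> r) y = pure R M N x (r \<odot>\<^bsub>N\<^esub> y)"
proof -
  have "frag_of (x \<odot>\<^sub>r\<^bsub>M\<^esub> r, y) - frag_of (x, r \<odot>\<^bsub>N\<^esub> y) \<in> tensor_relators R M N"
    using assms unfolding tensor_relators_def by blast
  from coset_relator[OF _ this, of "frag_of (x, r \<odot>\<^bsub>N\<^esub> y)"]
  show ?thesis
    using assms lmod_closed[OF N] unfolding pure_def by simp
qed

lemma pure_additive_left: "y \<in> carrier N \<Longrightarrow> additive_map M (tensor R M N) (\<lambda>x. pure R M N x y)"
  by (auto intro!: additive_mapI simp: pure_closed pure_add_left)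

lemma pure_additive_right: "x \<in> carrier M \<Longrightarrow> additive_map N (tensor R M N) (\<lambda>y. pure R M N x y)"
  by (auto intro!: additive_mapI simp: pure_closed pure_add_right)

text \<open>Only sums occur, because \<open>- (x \<otimes> y) = (- x) \<otimes> y\<close> is again pure.\<close>

lemma tensor_induct [consumes 1, case_names pure sum]:
  assumes t: "t \<in> carrier (tensor R M N)"
    and p: "\<And>x y. x \<in> carrier M \<Longrightarrow> y \<in> carrier N \<Longrightarrow> Q (pure R M N x y)"
    and s: "\<And>t u. t \<in> carrier (tensor R M N) \<Longrightarrow> u \<in> carrier (tensor R M N) \<Longrightarrow> Q t \<Longrightarrow> Q u \<Longrightarrow>
      Q (t \<oplus>\<^bsub>tensor R M N\<^esub> u)"
  shows "Q t"
proof -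
  interpret M: abelian_group M by (rule rmod_group[OF M])
  interpret N: abelian_group N by (rule lmod_group[OF N])
  interpret T: abelian_group "tensor R M N" by (rule tensor_group)
  interpret h: group_hom F "tensor_quot R M N" "\<lambda>a. K #>\<^bsub>F\<^esub> a"
    using coset_hom quot by (simp add: group_hom_def group_hom_axioms_def comm_group_def)
  have neg: "K #>\<^bsub>F\<^esub> (- frag_of (x, y)) = pure R M N (\<ominus>\<^bsub>M\<^esub> x) y"
    if "x \<in> carrier M" "y \<in> carrier N" for x y
  proof -
    have "(K #>\<^bsub>F\<^esub> (- frag_of (x, y))) \<oplus>\<^bsub>tensor R M N\<^esub> pure R M N x y = \<zero>\<^bsub>tensor R M N\<^esub>"
      using that coset_add[of "- frag_of (x, y)" "frag_of (x, y)"] h.hom_one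
      by (simp add: pure_def tensor_zero_group)
    moreover have "pure R M N (\<ominus>\<^bsub>M\<^esub> x) y \<oplus>\<^bsub>tensor R M N\<^esub> pure R M N x y = \<zero>\<^bsub>tensor R M N\<^esub>"
      using that additive_map_zero[OF pure_additive_left[of y] M.abelian_group_axioms tensor_group]
      by (simp add: pure_add_left[symmetric] M.l_neg)
    ultimately show ?thesis
      using that by (metis T.add.right_cancel coset_closed frag_closed pure_closed
        M.a_inv_closed carrier_free_Abelian_group_iff keys_minus)
  qed
  obtain c where c: "Poly_Mapping.keys c \<subseteq> carrier M \<times> carrier N" "t = K #>\<^bsub>F\<^esub> c"
    using t by (auto simp: tensor_carrier_group tensor_quot_def carrier_FactGroup)
  have "Q (K #>\<^bsub>F\<^esub> c) \<and> Q (K #>\<^bsub>F\<^esub> (- c))"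
    using c(1)
  proof (induction rule: free_Abelian_group_induct[consumes 1, case_names zero diff gen])
    case zero
    have "pure R M N \<zero>\<^bsub>M\<^esub> \<zero>\<^bsub>N\<^esub> = \<zero>\<^bsub>tensor R M N\<^esub>"
      by (rule additive_map_zero[OF pure_additive_left M.abelian_group_axioms tensor_group]) simp
    also have "\<dots> = K #>\<^bsub>F\<^esub> 0" using h.hom_one by (simp add: tensor_zero_group)
    finally show ?case using p[of "\<zero>\<^bsub>M\<^esub>" "\<zero>\<^bsub>N\<^esub>"] by simp
  next
    case (diff a b)
    have "K #>\<^bsub>F\<^esub> (a - b) = (K #>\<^bsub>F\<^esub> a) \<oplus>\<^bsub>tensor R M N\<^esub> (K #>\<^bsub>F\<^esub> (- b))"
      "K #>\<^bsub>F\<^esub> (- (a - b)) = (K #>\<^bsub>F\<^esub> (- a)) \<oplus>\<^bsub>tensor R M N\<^esub> (K #>\<^bsub>F\<^esub> b)"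
      using diff coset_add[of a "- b"] coset_add[of "- a" b] by simp_all
    with diff show ?case by (simp add: s coset_closed)
  next
    case (gen a)
    then obtain x y where a: "a = (x, y)" "x \<in> carrier M" "y \<in> carrier N" by (cases a) auto
    show ?case
      using p[OF a(2,3)] p[OF M.a_inv_closed[OF a(2)] a(3)]
      unfolding a(1) neg[OF a(2,3)] pure_def[of R M N x y] by blast
  qed
  with c show ?thesis by simp
qed

text \<open>The choice of a representative is harmless: \<open>\<beta>\<close> extends to the free abelian group, and there it kills the
  relators, so it is constant on the cosets of the tensor kernel.\<close>

lemma tensor_lift:
  assumes G: "abelian_group G" and \<beta>: "balanced R M N G \<beta>"
  shows "additive_map (tensor R M N) G (tensor_lift G \<beta>)"
    and "\<And>x y. x \<in> carrier M \<Longrightarrow> y \<in> carrier N \<Longrightarrow> tensor_lift G \<beta> (pure R M N x y) = \<beta> x y"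
proof -
  interpret G: abelian_group G by fact
  interpret T: abelian_group "tensor R M N" by (rule tensor_group)
  interpret n: normal K F by (rule kernel)
  have "(\<lambda>k. \<beta> (fst k) (snd k)) ` (carrier M \<times> carrier N) \<subseteq> carrier (add_monoid G)"
    using \<beta> by (auto simp: balanced_def)
  then obtain h where h: "h \<in> hom F (add_monoid G)"
    and hf: "\<And>k. k \<in> carrier M \<times> carrier N \<Longrightarrow> h (frag_of k) = \<beta> (fst k) (snd k)"
    by (rule comm_group.free_Abelian_group_universal[OF G.a_comm_group]) blast
  interpret h: group_hom F "add_monoid G" h
    using h G.a_group by (simp add: group_hom_def group_hom_axioms_def)
  have hd: "h (a - b) = h a \<ominus>\<^bsub>G\<^esub> h b" if "a \<in> carrier F" "b \<in> carrier F" for a b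
    using that h.hom_mult[of a "- b"] h.hom_inv[of b] by (simp add: a_minus_def a_inv_def)
  have hc: "h a \<in> carrier G" if "a \<in> carrier F" for a
    using h.hom_closed[OF that] by simp
  have fin: "h (\<Sum>k\<in>I. frag_cmul (m k) (frag_of k)) = (\<Oplus>\<^bsub>G\<^esub>k\<in>I. [m k] \<cdot>\<^bsub>G\<^esub> \<beta> (fst k) (snd k))"
    if "finite I" "I \<subseteq> carrier M \<times> carrier N" for I m
    using that
  proof induction
    case empty
    show ?case using h.hom_one by simp
  next
    case (insert k I)
    have kF: "frag_of k \<in> carrier F" using insert by simp
    have kc: "frag_cmul (m k) (frag_of k) \<in> carrier F"
      using insert keys_cmul[of "m k" "frag_of k"] by auto
    have sc: "(\<Sum>k\<in>I. frag_cmul (m k) (frag_of k)) \<in> carrier F"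
      using insert by (intro sum_closed_free_Abelian_group) (auto dest!: subsetD[OF keys_cmul])
    have "h (frag_cmul (m k) (frag_of k)) = [m k] \<cdot>\<^bsub>G\<^esub> \<beta> (fst k) (snd k)"
      using h.hom_int_pow[OF kF, of "m k"] kF hf insert.prems
      by (simp add: add_pow_def)
    moreover have "(\<lambda>k. [m k] \<cdot>\<^bsub>G\<^esub> \<beta> (fst k) (snd k)) \<in> insert k I \<rightarrow> carrier G"
      using \<beta> insert.prems by (auto simp: balanced_def intro!: G.add.int_pow_closed)
    ultimately show ?case
      using insert h.hom_mult[OF kc sc] by (simp add: Pi_iff)
  qed
  have eval: "h c = (\<Oplus>\<^bsub>G\<^esub>k\<in>Poly_Mapping.keys c. [Poly_Mapping.lookup c k] \<cdot>\<^bsub>G\<^esub> \<beta> (fst k) (snd k))"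
    if "c \<in> carrier F" for c
    using fin[of "Poly_Mapping.keys c" "Poly_Mapping.lookup c"] that
      frag_expansion[of c] by (simp add: frag_extend_def)
  have "tensor_relators R M N \<subseteq> kernel F (add_monoid G) h"
  proof
    fix a assume a: "a \<in> tensor_relators R M N"
    then have aF: "a \<in> carrier F" using relators by blast
    have "h a = \<zero>\<^bsub>G\<^esub>"
    proof -
      interpret M: abelian_group M by (rule rmod_group[OF M])
      interpret N: abelian_group N by (rule lmod_group[OF N])
      consider x x' y where "a = frag_of (x \<oplus>\<^bsub>M\<^esub> x', y) - frag_of (x, y) - frag_of (x', y)"
          "x \<in> carrier M" "x' \<in> carrier M" "y \<in> carrier N"
        | x y y' where "a = frag_of (x, y \<oplus>\<^bsub>N\<^esub> y') - frag_of (x, y) - frag_of (x, y')"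
          "x \<in> carrier M" "y \<in> carrier N" "y' \<in> carrier N"
        | x r y where "a = frag_of (x \<odot>\<^sub>r\<^bsub>M\<^esub> r, y) - frag_of (x, r \<odot>\<^bsub>N\<^esub> y)"
          "x \<in> carrier M" "r \<in> carrier R" "y \<in> carrier N"
        using a unfolding tensor_relators_def by blast
      then show ?thesis
      proof cases
        case 1
        have c: "\<beta> x y \<in> carrier G" "\<beta> x' y \<in> carrier G"
          "\<beta> (x \<oplus>\<^bsub>M\<^esub> x') y = \<beta> x y \<oplus>\<^bsub>G\<^esub> \<beta> x' y"
          using 1 \<beta> by (auto simp: balanced_def)
        have "h a = (\<beta> x y \<oplus>\<^bsub>G\<^esub> \<beta> x' y) \<ominus>\<^bsub>G\<^esub> \<beta> x y \<ominus>\<^bsub>G\<^esub> \<beta> x' y"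
          unfolding 1(1) using 1 c by (simp add: hd hf keys_diff_subset)
        then show ?thesis using c by (simp add: G.minus_eq G.a_ac G.r_neg G.r_neg2 G.r_neg1)
      next
        case 2
        have c: "\<beta> x y \<in> carrier G" "\<beta> x y' \<in> carrier G"
          "\<beta> x (y \<oplus>\<^bsub>N\<^esub> y') = \<beta> x y \<oplus>\<^bsub>G\<^esub> \<beta> x y'"
          using 2 \<beta> by (auto simp: balanced_def)
        have "h a = (\<beta> x y \<oplus>\<^bsub>G\<^esub> \<beta> x y') \<ominus>\<^bsub>G\<^esub> \<beta> x y \<ominus>\<^bsub>G\<^esub> \<beta> x y'"
          unfolding 2(1) using 2 c by (simp add: hd hf keys_diff_subset)
        then show ?thesis using c by (simp add: G.minus_eq G.a_ac G.r_neg G.r_neg2 G.r_neg1)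
      next
        case 3
        have c: "x \<odot>\<^sub>r\<^bsub>M\<^esub> r \<in> carrier M" "r \<odot>\<^bsub>N\<^esub> y \<in> carrier N" "\<beta> x (r \<odot>\<^bsub>N\<^esub> y) \<in> carrier G"
          "\<beta> (x \<odot>\<^sub>r\<^bsub>M\<^esub> r) y = \<beta> x (r \<odot>\<^bsub>N\<^esub> y)"
          using 3 \<beta> rmod_closed[OF M] lmod_closed[OF N] by (auto simp: balanced_def)
        then show ?thesis unfolding 3(1) using 3 by (simp add: hd hf G.r_neg G.minus_eq)
      qed
    qed
    with aF show "a \<in> kernel F (add_monoid G) h" by (simp add: kernel_def)
  qed
  then have "K \<subseteq> kernel F (add_monoid G) h"
    unfolding tensor_kernel_def
    by (rule group.generate_subgroup_incl[OF group_free_Abelian_group _ h.subgroup_kernel])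
  then have K0: "h a = \<zero>\<^bsub>G\<^esub>" if "a \<in> K" for a
    using that by (auto simp: kernel_def)
  have rep: "tensor_lift G \<beta> (K #>\<^bsub>F\<^esub> a) = h a" if a: "a \<in> carrier F" for a
  proof -
    define c where "c = (SOME c. c \<in> K #>\<^bsub>F\<^esub> a)"
    have "a \<in> K #>\<^bsub>F\<^esub> a" using a n.is_subgroup by (simp add: group.rcos_self)
    then have "c \<in> K #>\<^bsub>F\<^esub> a" unfolding c_def by (rule someI)
    then obtain k where k: "k \<in> K" "c = k + a" by (auto simp: r_coset_def)
    have kF: "k \<in> carrier F" using k n.subset by blast
    have cF: "c \<in> carrier F" using k kF a by (simp add: keys_add_subset)
    have "tensor_lift G \<beta> (K #>\<^bsub>F\<^esub> a) = h c"
      unfolding tensor_lift_def c_def[symmetric] Let_def using eval[OF cF] by simp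
    also have "\<dots> = h a" using h.hom_mult[OF kF a] K0[OF k(1)] k(2) hc[OF a] by simp
    finally show ?thesis .
  qed
  show "additive_map (tensor R M N) G (tensor_lift G \<beta>)"
  proof (rule additive_mapI)
    fix x assume "x \<in> carrier (tensor R M N)"
    then obtain a where "a \<in> carrier F" "x = K #>\<^bsub>F\<^esub> a"
      by (auto simp: tensor_carrier_group tensor_quot_def carrier_FactGroup)
    then show "tensor_lift G \<beta> x \<in> carrier G" using rep hc by simp
  next
    fix x y assume "x \<in> carrier (tensor R M N)" "y \<in> carrier (tensor R M N)"
    then obtain a b where a: "a \<in> carrier F" "x = K #>\<^bsub>F\<^esub> a" and b: "b \<in> carrier F" "y = K #>\<^bsub>F\<^esub> b"
      by (auto simp: tensor_carrier_group tensor_quot_def carrier_FactGroup)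
    have "x \<oplus>\<^bsub>tensor R M N\<^esub> y = K #>\<^bsub>F\<^esub> (a + b)" using a b coset_add by simp
    then show "tensor_lift G \<beta> (x \<oplus>\<^bsub>tensor R M N\<^esub> y) = tensor_lift G \<beta> x \<oplus>\<^bsub>G\<^esub> tensor_lift G \<beta> y"
      using a b rep[of a] rep[of b] rep[of "a + b"] h.hom_mult[of a b] by (simp add: keys_add_subset)
  qed
  show "tensor_lift G \<beta> (pure R M N x y) = \<beta> x y" if "x \<in> carrier M" "y \<in> carrier N" for x y
    using that rep[OF frag_closed[OF that]] hf by (simp add: pure_def)
qed

lemma tensor_eqI:
  assumes "additive_map (tensor R M N) G f" "additive_map (tensor R M N) G g"
    and "\<And>x y. x \<in> carrier M \<Longrightarrow> y \<in> carrier N \<Longrightarrow> f (pure R M N x y) = g (pure R M N x y)"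
    and "t \<in> carrier (tensor R M N)"
  shows "f t = g t"
  using assms(4)
  by (induction rule: tensor_induct) (auto simp: assms(3) additive_map_add[OF assms(1)] additive_map_add[OF assms(2)])

end

section \<open>Functoriality and module structures of tensor products\<close>

lemma tensor_map_eq_lift: "tensor_map R M N f g = tensor_lift (tensor R M N) (\<lambda>x y. pure R M N (f x) (g y))"
  by (simp add: tensor_map_def tensor_lift_tensor_group)

lemma tensor_map_balanced:
  assumes M: "right_module R M" and N: "left_module R N"
    and f: "additive_map M' M f" and g: "additive_map N' N g"
    and b: "\<And>x r y. x \<in> carrier M' \<Longrightarrow> r \<in> carrier R' \<Longrightarrow> y \<in> carrier N' \<Longrightarrow>
      pure R M N (f (x \<odot>\<^sub>r\<^bsub>M'\<^esub> r)) (g y) = pure R M N (f x) (g (r \<odot>\<^bsub>N'\<^esub> y))"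
  shows "balanced R' M' N' (tensor R M N) (\<lambda>x y. pure R M N (f x) (g y))"
proof (rule balancedI)
  show "additive_map N' (tensor R M N) (\<lambda>y. pure R M N (f x) (g y))" if "x \<in> carrier M'" for x
    by (rule additive_map_comp[OF g pure_additive_right[OF M N]]) (rule additive_map_closed[OF f that])
  show "additive_map M' (tensor R M N) (\<lambda>x. pure R M N (f x) (g y))" if "y \<in> carrier N'" for y
    by (rule additive_map_comp[OF f pure_additive_left[OF M N]]) (rule additive_map_closed[OF g that])
qed (rule b)

context
  fixes R :: "('r, 'x) ring_scheme"
    and M' :: "('l', 'm', 'r, 'y') bimod_scheme" and N' :: "('r, 'n', 's', 'z') bimod_scheme"
    and M :: "('l, 'm, 'r, 'y) bimod_scheme" and N :: "('r, 'n, 's, 'z) bimod_scheme"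
  assumes M': "right_module R M'" and N': "left_module R N'"
    and M: "right_module R M" and N: "left_module R N"
begin

private lemma tensor_map_linear_balanced:
  assumes f: "right_linear R M' M f" and g: "left_linear R N' N g"
  shows "balanced R M' N' (tensor R M N) (\<lambda>x y. pure R M N (f x) (g y))"
  by (rule tensor_map_balanced[OF M N right_linear_additive[OF f] left_linear_additive[OF g]])
    (simp add: right_linear_rsmult[OF f] left_linear_smult[OF g] pure_balanced[OF M N]
      right_linear_closed[OF f] left_linear_closed[OF g])

lemma tensor_map_additive:
  assumes f: "right_linear R M' M f" and g: "left_linear R N' N g"
  shows "additive_map (tensor R M' N') (tensor R M N) (tensor_map R M N f g)"
  unfolding tensor_map_eq_lift by (rule tensor_lift(1)[OF M' N' tensor_group[OF M N] tensor_map_linear_balanced[OF f g]])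

lemma tensor_map_pure:
  assumes f: "right_linear R M' M f" and g: "left_linear R N' N g"
    and "x \<in> carrier M'" "y \<in> carrier N'"
  shows "tensor_map R M N f g (pure R M' N' x y) = pure R M N (f x) (g y)"
  unfolding tensor_map_eq_lift
  by (rule tensor_lift(2)[OF M' N' tensor_group[OF M N] tensor_map_linear_balanced[OF f g] assms(3,4)])

lemma tensor_map_cong:
  assumes f: "right_linear R M' M f" and g: "left_linear R N' N g"
    and f': "\<And>x. x \<in> carrier M' \<Longrightarrow> f' x = f x" and g': "\<And>y. y \<in> carrier N' \<Longrightarrow> g' y = g y"
    and t: "t \<in> carrier (tensor R M' N')"
  shows "tensor_map R M N f' g' t = tensor_map R M N f g t"
proof -
  have lf: "right_linear R M' M f'" by (rule right_linear_cong[OF f f' M'])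
  have lg: "left_linear R N' N g'" by (rule left_linear_cong[OF g g' N'])
  show ?thesis
    by (rule tensor_eqI[OF M' N' tensor_map_additive[OF lf lg] tensor_map_additive[OF f g] _ t])
      (simp add: tensor_map_pure[OF lf lg] tensor_map_pure[OF f g] f' g')
qed

lemma tensor_map_add_left:
  assumes f: "right_linear R M' M f" "right_linear R M' M f'" and g: "left_linear R N' N g"
    and t: "t \<in> carrier (tensor R M' N')"
  shows "tensor_map R M N (\<lambda>x. f x \<oplus>\<^bsub>M\<^esub> f' x) g t =
    tensor_map R M N f g t \<oplus>\<^bsub>tensor R M N\<^esub> tensor_map R M N f' g t"
proof -
  have fl: "right_linear R M' M (\<lambda>x. f x \<oplus>\<^bsub>M\<^esub> f' x)"
    using f additive_map_plus[OF f[THEN right_linear_additive] rmod_group[OF M]]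
    by (auto simp: right_linear_def rmod_add[OF M] additive_map_closed)
  show ?thesis
    by (rule tensor_eqI[OF M' N' tensor_map_additive[OF fl g]
          additive_map_plus[OF tensor_map_additive[OF f(1) g] tensor_map_additive[OF f(2) g] tensor_group[OF M N]] _ t])
      (simp add: tensor_map_pure[OF fl g] tensor_map_pure[OF f(1) g] tensor_map_pure[OF f(2) g]
        pure_add_left[OF M N] additive_map_closed[OF f(1)[THEN right_linear_additive]]
        additive_map_closed[OF f(2)[THEN right_linear_additive]] additive_map_closed[OF g[THEN left_linear_additive]])
qed

lemma tensor_map_add_right:
  assumes f: "right_linear R M' M f" and g: "left_linear R N' N g" "left_linear R N' N g'"
    and t: "t \<in> carrier (tensor R M' N')"
  shows "tensor_map R M N f (\<lambda>x. g x \<oplus>\<^bsub>N\<^esub> g' x) t =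
    tensor_map R M N f g t \<oplus>\<^bsub>tensor R M N\<^esub> tensor_map R M N f g' t"
proof -
  have gl: "left_linear R N' N (\<lambda>x. g x \<oplus>\<^bsub>N\<^esub> g' x)"
    using g additive_map_plus[OF g[THEN left_linear_additive] lmod_group[OF N]]
    by (auto simp: left_linear_def lmod_add[OF N] additive_map_closed)
  show ?thesis
    by (rule tensor_eqI[OF M' N' tensor_map_additive[OF f gl]
          additive_map_plus[OF tensor_map_additive[OF f g(1)] tensor_map_additive[OF f g(2)] tensor_group[OF M N]] _ t])
      (simp add: tensor_map_pure[OF f gl] tensor_map_pure[OF f g(1)] tensor_map_pure[OF f g(2)]
        pure_add_right[OF M N] additive_map_closed[OF g(1)[THEN left_linear_additive]]
        additive_map_closed[OF g(2)[THEN left_linear_additive]] additive_map_closed[OF f[THEN right_linear_additive]])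
qed

end

lemma tensor_map_comp:
  assumes "right_module R M0" "left_module R N0" "right_module R M1" "left_module R N1"
    "right_module R M2" "left_module R N2"
    and f1: "right_linear R M0 M1 f1" and g1: "left_linear R N0 N1 g1"
    and f2: "right_linear R M1 M2 f2" and g2: "left_linear R N1 N2 g2"
    and t: "t \<in> carrier (tensor R M0 N0)"
  shows "tensor_map R M2 N2 f2 g2 (tensor_map R M1 N1 f1 g1 t) =
    tensor_map R M2 N2 (\<lambda>x. f2 (f1 x)) (\<lambda>y. g2 (g1 y)) t"
proof -
  note c = right_linear_comp[OF f1 f2] left_linear_comp[OF g1 g2]
  show ?thesis
    by (rule tensor_eqI[OF assms(1,2) additive_map_comp[OF tensor_map_additive[OF assms(1-4) f1 g1]
            tensor_map_additive[OF assms(3-6) f2 g2]] tensor_map_additive[OF assms(1,2,5,6) c] _ t])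
      (simp add: tensor_map_pure[OF assms(1-4) f1 g1] tensor_map_pure[OF assms(3-6) f2 g2]
        tensor_map_pure[OF assms(1,2,5,6) c] additive_map_closed[OF f1[THEN right_linear_additive]]
        additive_map_closed[OF g1[THEN left_linear_additive]])
qed

lemma tensor_map_ident:
  assumes M: "right_module R M" and N: "left_module R N" and t: "t \<in> carrier (tensor R M N)"
  shows "tensor_map R M N (\<lambda>x. x) (\<lambda>y. y) t = t"
  by (rule tensor_eqI[OF M N tensor_map_additive[OF M N M N right_linear_ident left_linear_ident]
        additive_map_ident _ t])
    (simp add: tensor_map_pure[OF M N M N right_linear_ident left_linear_ident])

lemma smult_tensor: "a \<odot>\<^bsub>tensor R M N\<^esub> t = tensor_map R M N (\<lambda>x. a \<odot>\<^bsub>M\<^esub> x) (\<lambda>y. y) t"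
  and rsmult_tensor: "t \<odot>\<^sub>r\<^bsub>tensor R M N\<^esub> b = tensor_map R M N (\<lambda>x. x) (\<lambda>y. y \<odot>\<^sub>r\<^bsub>N\<^esub> b) t"
  by (simp_all add: tensor_def)

lemma smult_pure:
  assumes M: "bimodule L R M" and N: "left_module R N"
    and "a \<in> carrier L" "x \<in> carrier M" "y \<in> carrier N"
  shows "a \<odot>\<^bsub>tensor R M N\<^esub> pure R M N x y = pure R M N (a \<odot>\<^bsub>M\<^esub> x) y"
  unfolding smult_tensor
  by (rule tensor_map_pure[OF bimod_right[OF M] N bimod_right[OF M] N
        bimod_left_smult_right_linear[OF M assms(3)] left_linear_ident assms(4,5)])

lemma rsmult_pure:
  assumes M: "right_module R M" and N: "bimodule R S N"
    and "b \<in> carrier S" "x \<in> carrier M" "y \<in> carrier N"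
  shows "pure R M N x y \<odot>\<^sub>r\<^bsub>tensor R M N\<^esub> b = pure R M N x (y \<odot>\<^sub>r\<^bsub>N\<^esub> b)"
  unfolding rsmult_tensor
  by (rule tensor_map_pure[OF M bimod_left[OF N] M bimod_left[OF N] right_linear_ident
        bimod_right_smult_left_linear[OF N assms(3)] assms(4,5)])

lemma smult_tensor_additive:
  assumes M: "bimodule L R M" and N: "left_module R N" and "a \<in> carrier L"
  shows "additive_map (tensor R M N) (tensor R M N) (\<lambda>t. a \<odot>\<^bsub>tensor R M N\<^esub> t)"
  unfolding smult_tensor
  by (rule tensor_map_additive[OF bimod_right[OF M] N bimod_right[OF M] N
        bimod_left_smult_right_linear[OF M assms(3)] left_linear_ident])

lemma rsmult_tensor_additive:
  assumes M: "right_module R M" and N: "bimodule R S N" and "b \<in> carrier S"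
  shows "additive_map (tensor R M N) (tensor R M N) (\<lambda>t. t \<odot>\<^sub>r\<^bsub>tensor R M N\<^esub> b)"
  unfolding rsmult_tensor
  by (rule tensor_map_additive[OF M bimod_left[OF N] M bimod_left[OF N] right_linear_ident
        bimod_right_smult_left_linear[OF N assms(3)]])

lemma tensor_left_module:
  assumes M: "bimodule L R M" and N: "left_module R N"
  shows "left_module L (tensor R M N)"
proof -
  note Mr = bimod_right[OF M] and Ml = bimod_left[OF M]
  interpret T: abelian_group "tensor R M N" by (rule tensor_group[OF Mr N])
  interpret L: ring L by (rule lmod_ring[OF Ml])
  note ad = smult_tensor_additive[OF M N]
  note simps = smult_pure[OF M N] lmod_closed[OF Ml] pure_closed[OF Mr N] additive_map_add[OF ad]
    additive_map_closed[OF ad]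
  show ?thesis
    unfolding left_module_def
  proof (intro conjI ballI)
    fix a b t assume ab: "a \<in> carrier L" "b \<in> carrier L" and t: "t \<in> carrier (tensor R M N)"
    show "(a \<oplus>\<^bsub>L\<^esub> b) \<odot>\<^bsub>tensor R M N\<^esub> t = a \<odot>\<^bsub>tensor R M N\<^esub> t \<oplus>\<^bsub>tensor R M N\<^esub> b \<odot>\<^bsub>tensor R M N\<^esub> t"
      using t ab by (induction t rule: tensor_induct[OF Mr N, consumes 1])
        (simp_all add: simps lmod_scalar_add[OF Ml] pure_add_left[OF Mr N] T.a_ac)
    show "(a \<otimes>\<^bsub>L\<^esub> b) \<odot>\<^bsub>tensor R M N\<^esub> t = a \<odot>\<^bsub>tensor R M N\<^esub> (b \<odot>\<^bsub>tensor R M N\<^esub> t)"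
      using t ab by (induction t rule: tensor_induct[OF Mr N, consumes 1])
        (simp_all add: simps lmod_mult[OF Ml])
  next
    fix t assume t: "t \<in> carrier (tensor R M N)"
    show "\<one>\<^bsub>L\<^esub> \<odot>\<^bsub>tensor R M N\<^esub> t = t"
      using t by (induction t rule: tensor_induct[OF Mr N, consumes 1])
        (simp_all add: simps lmod_one[OF Ml])
  qed (simp_all add: T.abelian_group_axioms L.ring_axioms simps)
qed

lemma tensor_right_module:
  assumes M: "right_module R M" and N: "bimodule R S N"
  shows "right_module S (tensor R M N)"
proof -
  note Nr = bimod_right[OF N] and Nl = bimod_left[OF N]
  interpret T: abelian_group "tensor R M N" by (rule tensor_group[OF M Nl])
  interpret S: ring S by (rule rmod_ring[OF Nr])
  note ad = rsmult_tensor_additive[OF M N]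
  note simps = rsmult_pure[OF M N] rmod_closed[OF Nr] pure_closed[OF M Nl] additive_map_add[OF ad]
    additive_map_closed[OF ad]
  show ?thesis
    unfolding right_module_def
  proof (intro conjI ballI)
    fix a b t assume ab: "a \<in> carrier S" "b \<in> carrier S" and t: "t \<in> carrier (tensor R M N)"
    show "t \<odot>\<^sub>r\<^bsub>tensor R M N\<^esub> (a \<oplus>\<^bsub>S\<^esub> b) = t \<odot>\<^sub>r\<^bsub>tensor R M N\<^esub> a \<oplus>\<^bsub>tensor R M N\<^esub> t \<odot>\<^sub>r\<^bsub>tensor R M N\<^esub> b"
      using t ab by (induction t rule: tensor_induct[OF M Nl, consumes 1])
        (simp_all add: simps rmod_scalar_add[OF Nr] pure_add_right[OF M Nl] T.a_ac)
    show "t \<odot>\<^sub>r\<^bsub>tensor R M N\<^esub> (a \<otimes>\<^bsub>S\<^esub> b) = (t \<odot>\<^sub>r\<^bsub>tensor R M N\<^esub> a) \<odot>\<^sub>r\<^bsub>tensor R M N\<^esub> b"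
      using t ab by (induction t rule: tensor_induct[OF M Nl, consumes 1])
        (simp_all add: simps rmod_mult[OF Nr])
  next
    fix t assume t: "t \<in> carrier (tensor R M N)"
    show "t \<odot>\<^sub>r\<^bsub>tensor R M N\<^esub> \<one>\<^bsub>S\<^esub> = t"
      using t by (induction t rule: tensor_induct[OF M Nl, consumes 1])
        (simp_all add: simps rmod_one[OF Nr])
  qed (simp_all add: T.abelian_group_axioms S.ring_axioms simps)
qed

lemma tensor_bimodule:
  assumes M: "bimodule L R M" and N: "bimodule R S N"
  shows "bimodule L S (tensor R M N)"
  unfolding bimodule_def
proof (intro conjI ballI)
  note Mr = bimod_right[OF M] and Nl = bimod_left[OF N]
  fix a t b assume ab: "a \<in> carrier L" "b \<in> carrier S" and t: "t \<in> carrier (tensor R M N)"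
  note ad = smult_tensor_additive[OF M Nl] rsmult_tensor_additive[OF Mr N]
  show "(a \<odot>\<^bsub>tensor R M N\<^esub> t) \<odot>\<^sub>r\<^bsub>tensor R M N\<^esub> b = a \<odot>\<^bsub>tensor R M N\<^esub> (t \<odot>\<^sub>r\<^bsub>tensor R M N\<^esub> b)"
    using t ab by (induction t rule: tensor_induct[OF Mr Nl, consumes 1])
      (simp_all add: smult_pure[OF M Nl] rsmult_pure[OF Mr N] lmod_closed[OF bimod_left[OF M]]
        rmod_closed[OF bimod_right[OF N]] additive_map_add[OF ad(1)] additive_map_add[OF ad(2)]
        additive_map_closed[OF ad(1)] additive_map_closed[OF ad(2)])
qed (simp_all add: tensor_left_module[OF M bimod_left[OF N]] tensor_right_module[OF bimod_right[OF M] N])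

lemma tensor_map_right_linear:
  assumes M': "right_module R M'" and N': "bimodule R S N'" and M: "right_module R M" and N: "bimodule R S N"
    and f: "right_linear R M' M f" and g: "left_linear R N' N g" and g': "right_linear S N' N g"
  shows "right_linear S (tensor R M' N') (tensor R M N) (tensor_map R M N f g)"
  unfolding right_linear_def
proof (intro conjI ballI)
  note Nl = bimod_left[OF N] bimod_left[OF N'] and Nr = bimod_right[OF N] bimod_right[OF N']
  show ad: "additive_map (tensor R M' N') (tensor R M N) (tensor_map R M N f g)"
    by (rule tensor_map_additive[OF M' Nl(2) M Nl(1) f g])
  fix b t assume b: "b \<in> carrier S" and t: "t \<in> carrier (tensor R M' N')"
  show "tensor_map R M N f g (t \<odot>\<^sub>r\<^bsub>tensor R M' N'\<^esub> b) = tensor_map R M N f g t \<odot>\<^sub>r\<^bsub>tensor R M N\<^esub> b"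
    by (rule tensor_eqI[OF M' Nl(2) additive_map_comp[OF rsmult_tensor_additive[OF M' N' b] ad]
        additive_map_comp[OF ad rsmult_tensor_additive[OF M N b]] _ t])
      (simp add: b rsmult_pure[OF M' N'] rsmult_pure[OF M N] tensor_map_pure[OF M' Nl(2) M Nl(1) f g]
        rmod_closed[OF Nr(2)] right_linear_rsmult[OF g'] additive_map_closed[OF f[THEN right_linear_additive]]
        additive_map_closed[OF g[THEN left_linear_additive]])
qed

lemma tensor_map_left_linear:
  assumes M': "bimodule L R M'" and N': "left_module R N'" and M: "bimodule L R M" and N: "left_module R N"
    and f: "right_linear R M' M f" and f': "left_linear L M' M f" and g: "left_linear R N' N g"
  shows "left_linear L (tensor R M' N') (tensor R M N) (tensor_map R M N f g)"
  unfolding left_linear_def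
proof (intro conjI ballI)
  note Ml = bimod_left[OF M] bimod_left[OF M'] and Mr = bimod_right[OF M] bimod_right[OF M']
  show ad: "additive_map (tensor R M' N') (tensor R M N) (tensor_map R M N f g)"
    by (rule tensor_map_additive[OF Mr(2) N' Mr(1) N f g])
  fix b t assume b: "b \<in> carrier L" and t: "t \<in> carrier (tensor R M' N')"
  show "tensor_map R M N f g (b \<odot>\<^bsub>tensor R M' N'\<^esub> t) = b \<odot>\<^bsub>tensor R M N\<^esub> tensor_map R M N f g t"
    by (rule tensor_eqI[OF Mr(2) N' additive_map_comp[OF smult_tensor_additive[OF M' N' b] ad]
        additive_map_comp[OF ad smult_tensor_additive[OF M N b]] _ t])
      (simp add: b smult_pure[OF M' N'] smult_pure[OF M N] tensor_map_pure[OF Mr(2) N' Mr(1) N f g]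
        lmod_closed[OF Ml(2)] left_linear_smult[OF f'] additive_map_closed[OF f[THEN right_linear_additive]]
        additive_map_closed[OF g[THEN left_linear_additive]])
qed

context
  fixes R :: "('r, 'x) ring_scheme" and S :: "('s, 'w) ring_scheme"
    and L :: "('k, 'l, 'r, 'u) bimod_scheme" and M :: "('r, 'm, 's, 'y) bimod_scheme"
    and N :: "('s, 'n, 'q, 'z) bimod_scheme"
  assumes L: "right_module R L" and M: "bimodule R S M" and N: "left_module S N"
begin

private lemmas Ml = bimod_left[OF M] and Mr = bimod_right[OF M]
private lemmas LM = tensor_right_module[OF L M] and MN = tensor_left_module[OF M N]
private lemmas LM_N = tensor_group[OF LM N] and L_MN = tensor_group[OF L MN]

private lemma bal1:
  assumes z: "z \<in> carrier N"
  shows "balanced R L M (tensor R L (tensor S M N)) (\<lambda>x y. pure R L (tensor S M N) x (pure S M N y z))"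
proof (rule balancedI)
  show "additive_map M (tensor R L (tensor S M N)) (\<lambda>y. pure R L (tensor S M N) x (pure S M N y z))"
    if "x \<in> carrier L" for x
    by (rule additive_map_comp[OF pure_additive_left[OF Mr N z] pure_additive_right[OF L MN that]])
qed (simp_all add: pure_additive_left[OF L MN] pure_closed[OF Mr N] z pure_balanced[OF L MN] smult_pure[OF M N])

private lemmas inner = tensor_lift[OF L Ml L_MN bal1]

text \<open>The two nested lifts are legitimate because, for every fixed \<open>z\<close>, the inner one is an additive map of \<open>t\<close>;
  that the pair \<open>(t, z)\<close> is treated in a balanced way can then be tested on pure \<open>t\<close>.\<close>

private lemma bal2:
  "balanced S (tensor R L M) N (tensor R L (tensor S M N)) (\<lambda>t z. tensor_lift (tensor R L (tensor S M N))
          (\<lambda>x y. pure R L (tensor S M N) x (pure S M N y z)) t)"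
proof (rule balancedI)
  interpret G: abelian_group "tensor R L (tensor S M N)" by (rule L_MN)
  interpret N: abelian_group N by (rule lmod_group[OF N])
  fix t assume t: "t \<in> carrier (tensor R L M)"
  show "additive_map N (tensor R L (tensor S M N)) (\<lambda>z. tensor_lift (tensor R L (tensor S M N))
          (\<lambda>x y. pure R L (tensor S M N) x (pure S M N y z)) t)"
  proof (rule additive_mapI)
    fix z z' assume z: "z \<in> carrier N" "z' \<in> carrier N"
    show "tensor_lift (tensor R L (tensor S M N))
          (\<lambda>x y. pure R L (tensor S M N) x (pure S M N y (z \<oplus>\<^bsub>N\<^esub> z'))) t =
         tensor_lift (tensor R L (tensor S M N)) (\<lambda>x y. pure R L (tensor S M N) x (pure S M N y z)) t
         \<oplus>\<^bsub>tensor R L (tensor S M N)\<^esub>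
         tensor_lift (tensor R L (tensor S M N)) (\<lambda>x y. pure R L (tensor S M N) x (pure S M N y z')) t"
      using z by (intro tensor_eqI[OF L Ml inner(1) additive_map_plus[OF inner(1) inner(1) L_MN] _ t])
        (simp_all add: inner(2) pure_add_right[OF Mr N] pure_add_right[OF L MN] pure_closed[OF Mr N])
  qed (rule additive_map_closed[OF inner(1) t])
  fix s z assume s: "s \<in> carrier S" and z: "z \<in> carrier N"
  show "tensor_lift (tensor R L (tensor S M N)) (\<lambda>x y. pure R L (tensor S M N) x (pure S M N y z))
          (t \<odot>\<^sub>r\<^bsub>tensor R L M\<^esub> s) =
        tensor_lift (tensor R L (tensor S M N)) (\<lambda>x y. pure R L (tensor S M N) x (pure S M N y (s \<odot>\<^bsub>N\<^esub> z))) t"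
    using s z by (intro tensor_eqI[OF L Ml additive_map_comp[OF rsmult_tensor_additive[OF L M s] inner(1)] inner(1) _ t])
      (simp_all add: lmod_closed[OF N] rsmult_pure[OF L M] inner(2) rmod_closed[OF Mr] pure_balanced[OF Mr N])
qed (rule inner(1))

lemma tensor_assoc_additive:
  "additive_map (tensor S (tensor R L M) N) (tensor R L (tensor S M N)) (tensor_assoc R S L M N)"
  unfolding tensor_assoc_def by (rule tensor_lift(1)[OF LM N L_MN bal2])

lemma tensor_assoc_pure:
  assumes "x \<in> carrier L" "y \<in> carrier M" "z \<in> carrier N"
  shows "tensor_assoc R S L M N (pure S (tensor R L M) N (pure R L M x y) z) =
    pure R L (tensor S M N) x (pure S M N y z)"
  unfolding tensor_assoc_def
  using assms by (simp add: tensor_lift(2)[OF LM N L_MN bal2] inner(2) pure_closed[OF L Ml])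

private lemma bal1':
  assumes x: "x \<in> carrier L"
  shows "balanced S M N (tensor S (tensor R L M) N) (\<lambda>y z. pure S (tensor R L M) N (pure R L M x y) z)"
proof (rule balancedI)
  show "additive_map M (tensor S (tensor R L M) N) (\<lambda>y. pure S (tensor R L M) N (pure R L M x y) z)"
    if "z \<in> carrier N" for z
    by (rule additive_map_comp[OF pure_additive_right[OF L Ml x] pure_additive_left[OF LM N that]])
qed (simp_all add: pure_additive_right[OF LM N] pure_closed[OF L Ml] x pure_balanced[OF LM N, symmetric] rsmult_pure[OF L M])

private lemmas inner' = tensor_lift[OF Mr N LM_N bal1']

private lemma bal2':
  "balanced R L (tensor S M N) (tensor S (tensor R L M) N) (\<lambda>x. tensor_lift (tensor S (tensor R L M) N)
          (\<lambda>y z. pure S (tensor R L M) N (pure R L M x y) z))"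
proof (rule balancedI)
  interpret G: abelian_group "tensor S (tensor R L M) N" by (rule LM_N)
  interpret L: abelian_group L by (rule rmod_group[OF L])
  fix t assume t: "t \<in> carrier (tensor S M N)"
  show "additive_map L (tensor S (tensor R L M) N) (\<lambda>x. tensor_lift (tensor S (tensor R L M) N)
          (\<lambda>y z. pure S (tensor R L M) N (pure R L M x y) z) t)"
  proof (rule additive_mapI)
    fix x x' assume z: "x \<in> carrier L" "x' \<in> carrier L"
    show "tensor_lift (tensor S (tensor R L M) N)
          (\<lambda>y z. pure S (tensor R L M) N (pure R L M (x \<oplus>\<^bsub>L\<^esub> x') y) z) t =
         tensor_lift (tensor S (tensor R L M) N) (\<lambda>y z. pure S (tensor R L M) N (pure R L M x y) z) t
         \<oplus>\<^bsub>tensor S (tensor R L M) N\<^esub>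
         tensor_lift (tensor S (tensor R L M) N) (\<lambda>y z. pure S (tensor R L M) N (pure R L M x' y) z) t"
      using z by (intro tensor_eqI[OF Mr N inner'(1) additive_map_plus[OF inner'(1) inner'(1) LM_N] _ t])
        (simp_all add: inner'(2) pure_add_left[OF LM N] pure_add_left[OF L Ml] pure_closed[OF L Ml])
  qed (rule additive_map_closed[OF inner'(1) t])
next
  fix x r t assume x: "x \<in> carrier L" and r: "r \<in> carrier R" and t: "t \<in> carrier (tensor S M N)"
  show "tensor_lift (tensor S (tensor R L M) N)
          (\<lambda>y z. pure S (tensor R L M) N (pure R L M (x \<odot>\<^sub>r\<^bsub>L\<^esub> r) y) z) t =
        tensor_lift (tensor S (tensor R L M) N) (\<lambda>y z. pure S (tensor R L M) N (pure R L M x y) z) (r \<odot>\<^bsub>tensor S M N\<^esub> t)"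
    using x r by (intro tensor_eqI[OF Mr N inner'(1) additive_map_comp[OF smult_tensor_additive[OF M N r] inner'(1)] _ t])
      (simp_all add: rmod_closed[OF L] smult_pure[OF M N] inner'(2) lmod_closed[OF Ml] pure_balanced[OF L Ml])
qed (rule inner'(1))

lemma tensor_assoc_inv_additive:
  "additive_map (tensor R L (tensor S M N)) (tensor S (tensor R L M) N) (tensor_assoc_inv R S L M N)"
  unfolding tensor_assoc_inv_def by (rule tensor_lift(1)[OF L MN LM_N bal2'])

lemma tensor_assoc_inv_pure:
  assumes "x \<in> carrier L" "y \<in> carrier M" "z \<in> carrier N"
  shows "tensor_assoc_inv R S L M N (pure R L (tensor S M N) x (pure S M N y z)) =
    pure S (tensor R L M) N (pure R L M x y) z"
  unfolding tensor_assoc_inv_def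
  using assms by (simp add: tensor_lift(2)[OF L MN LM_N bal2'] inner'(2) pure_closed[OF Mr N])

lemma tensor3_eqI:
  assumes f: "additive_map (tensor S (tensor R L M) N) G f" and g: "additive_map (tensor S (tensor R L M) N) G g"
    and eq: "\<And>x y z. x \<in> carrier L \<Longrightarrow> y \<in> carrier M \<Longrightarrow> z \<in> carrier N \<Longrightarrow>
      f (pure S (tensor R L M) N (pure R L M x y) z) = g (pure S (tensor R L M) N (pure R L M x y) z)"
    and t: "t \<in> carrier (tensor S (tensor R L M) N)"
  shows "f t = g t"
proof (rule tensor_eqI[OF LM N f g _ t])
  fix u z assume u: "u \<in> carrier (tensor R L M)" and z: "z \<in> carrier N"
  note p = pure_additive_left[OF LM N z]
  show "f (pure S (tensor R L M) N u z) = g (pure S (tensor R L M) N u z)"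
    by (rule tensor_eqI[OF L Ml additive_map_comp[OF p f] additive_map_comp[OF p g] _ u]) (rule eq[OF _ _ z])
qed

lemma tensor3_eqI':
  assumes f: "additive_map (tensor R L (tensor S M N)) G f" and g: "additive_map (tensor R L (tensor S M N)) G g"
    and eq: "\<And>x y z. x \<in> carrier L \<Longrightarrow> y \<in> carrier M \<Longrightarrow> z \<in> carrier N \<Longrightarrow>
      f (pure R L (tensor S M N) x (pure S M N y z)) = g (pure R L (tensor S M N) x (pure S M N y z))"
    and t: "t \<in> carrier (tensor R L (tensor S M N))"
  shows "f t = g t"
proof (rule tensor_eqI[OF L MN f g _ t])
  fix x u assume u: "u \<in> carrier (tensor S M N)" and x: "x \<in> carrier L"
  note p = pure_additive_right[OF L MN x]
  show "f (pure R L (tensor S M N) x u) = g (pure R L (tensor S M N) x u)"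
    by (rule tensor_eqI[OF Mr N additive_map_comp[OF p f] additive_map_comp[OF p g] _ u]) (rule eq[OF x])
qed

lemma tensor_assoc_inv_assoc:
  assumes "t \<in> carrier (tensor S (tensor R L M) N)"
  shows "tensor_assoc_inv R S L M N (tensor_assoc R S L M N t) = t"
  by (rule tensor3_eqI[OF additive_map_comp[OF tensor_assoc_additive tensor_assoc_inv_additive] additive_map_ident _ assms])
    (simp add: tensor_assoc_pure tensor_assoc_inv_pure)

lemma tensor_assoc_assoc_inv:
  assumes "t \<in> carrier (tensor R L (tensor S M N))"
  shows "tensor_assoc R S L M N (tensor_assoc_inv R S L M N t) = t"
  by (rule tensor3_eqI'[OF additive_map_comp[OF tensor_assoc_inv_additive tensor_assoc_additive] additive_map_ident _ assms])
    (simp add: tensor_assoc_pure tensor_assoc_inv_pure)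

end

lemma tensor_assoc_natural:
  assumes L: "right_module R L" and L': "right_module R L'" and M: "bimodule R S M" and N: "left_module S N"
    and j: "right_linear R L L' j" and t: "t \<in> carrier (tensor S (tensor R L M) N)"
  shows "tensor_assoc R S L' M N (tensor_map S (tensor R L' M) N (tensor_map R L' M j (\<lambda>y. y)) (\<lambda>z. z) t) =
    tensor_map R L' (tensor S M N) j (\<lambda>y. y) (tensor_assoc R S L M N t)"
proof -
  note Ml = bimod_left[OF M] and LM = tensor_right_module[OF L M] and LM' = tensor_right_module[OF L' M]
    and MN = tensor_left_module[OF M N]
  note jM = tensor_map_right_linear[OF L M L' M j left_linear_ident right_linear_ident]
    tensor_map_pure[OF L Ml L' Ml j left_linear_ident]
  note idN = left_linear_ident[of S N] and idMN = left_linear_ident[of R "tensor S M N"]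
  note a = tensor_map_additive[OF LM N LM' N jM(1) idN] tensor_map_pure[OF LM N LM' N jM(1) idN]
  note b = tensor_map_additive[OF L MN L' MN j idMN] tensor_map_pure[OF L MN L' MN j idMN]
  note as = tensor_assoc_additive[OF L M N] tensor_assoc_pure[OF L M N]
  note as' = tensor_assoc_additive[OF L' M N] tensor_assoc_pure[OF L' M N]
  show ?thesis
    by (rule tensor3_eqI[OF L M N additive_map_comp[OF a(1) as'(1)] additive_map_comp[OF as(1) b(1)] _ t])
      (simp add: a(2) b(2) as(2) as'(2) jM(2) pure_closed[OF L Ml] pure_closed[OF bimod_right[OF M] N]
        right_linear_closed[OF j])
qed

section \<open>Groups of linear and colinear maps\<close>

text \<open>This one criterion serves for all Hom groups and endomorphism rings below; the records differ, but their
  additive structure is pointwise everywhere.\<close>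

lemma pointwise_abelian_group:
  fixes G :: "('m \<Rightarrow> 'n, 'z) ring_scheme"
  assumes N: "abelian_group N"
    and add: "add G = (\<lambda>f g. \<lambda>x\<in>X. f x \<oplus>\<^bsub>N\<^esub> g x)" and zero: "zero G = (\<lambda>x\<in>X. \<zero>\<^bsub>N\<^esub>)"
    and ext: "\<And>f. f \<in> carrier G \<Longrightarrow> f \<in> extensional X" and fn: "\<And>f x. f \<in> carrier G \<Longrightarrow> x \<in> X \<Longrightarrow> f x \<in> carrier N"
    and add_closed: "\<And>f g. f \<in> carrier G \<Longrightarrow> g \<in> carrier G \<Longrightarrow> (\<lambda>x\<in>X. f x \<oplus>\<^bsub>N\<^esub> g x) \<in> carrier G"
    and zero_closed: "(\<lambda>x\<in>X. \<zero>\<^bsub>N\<^esub>) \<in> carrier G"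
    and neg_closed: "\<And>f. f \<in> carrier G \<Longrightarrow> (\<lambda>x\<in>X. \<ominus>\<^bsub>N\<^esub> f x) \<in> carrier G"
  shows "abelian_group G"
proof -
  interpret N: abelian_group N by fact
  show ?thesis
  proof (rule abelian_groupI)
    fix f assume f: "f \<in> carrier G"
    show "\<zero>\<^bsub>G\<^esub> \<oplus>\<^bsub>G\<^esub> f = f"
      unfolding add zero by (rule extensionalityI[of _ X]) (auto simp: ext[OF f] fn[OF f])
    show "\<exists>g\<in>carrier G. g \<oplus>\<^bsub>G\<^esub> f = \<zero>\<^bsub>G\<^esub>"
      unfolding add zero by (rule bexI[OF _ neg_closed[OF f]]) (auto simp: fn[OF f] N.l_neg restrict_def)
  next
    fix f g assume "f \<in> carrier G" "g \<in> carrier G"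
    then show "f \<oplus>\<^bsub>G\<^esub> g \<in> carrier G" unfolding add by (rule add_closed)
  next
    show "\<zero>\<^bsub>G\<^esub> \<in> carrier G" unfolding zero by (rule zero_closed)
  qed (auto simp: add fn N.a_ac restrict_def fun_eq_iff)
qed

lemma smult_zero: "left_module R M \<Longrightarrow> a \<in> carrier R \<Longrightarrow> a \<odot>\<^bsub>M\<^esub> \<zero>\<^bsub>M\<^esub> = \<zero>\<^bsub>M\<^esub>"
  by (metis additive_map_zero lmod_additive lmod_group)

lemma rsmult_zero: "right_module R M \<Longrightarrow> a \<in> carrier R \<Longrightarrow> \<zero>\<^bsub>M\<^esub> \<odot>\<^sub>r\<^bsub>M\<^esub> a = \<zero>\<^bsub>M\<^esub>"
  by (metis additive_map_zero rmod_additive rmod_group)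

lemma smult_neg: "left_module R M \<Longrightarrow> a \<in> carrier R \<Longrightarrow> x \<in> carrier M \<Longrightarrow> a \<odot>\<^bsub>M\<^esub> (\<ominus>\<^bsub>M\<^esub> x) = \<ominus>\<^bsub>M\<^esub> (a \<odot>\<^bsub>M\<^esub> x)"
  using additive_map_neg[OF lmod_additive] lmod_group by metis

lemma rsmult_neg: "right_module R M \<Longrightarrow> a \<in> carrier R \<Longrightarrow> x \<in> carrier M \<Longrightarrow> (\<ominus>\<^bsub>M\<^esub> x) \<odot>\<^sub>r\<^bsub>M\<^esub> a = \<ominus>\<^bsub>M\<^esub> (x \<odot>\<^sub>r\<^bsub>M\<^esub> a)"
  using additive_map_neg[OF rmod_additive] rmod_group by metis

lemma right_linear_restrict:
  assumes "right_module R M" and "right_linear R M N f"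
  shows "right_linear R M N (restrict f (carrier M))"
  by (rule right_linear_cong[OF assms(2) _ assms(1)]) simp

lemma left_linear_restrict:
  assumes "left_module R M" and "left_linear R M N f"
  shows "left_linear R M N (restrict f (carrier M))"
  by (rule left_linear_cong[OF assms(2) _ assms(1)]) simp

lemma right_linear_zero:
  assumes N: "right_module R N"
  shows "right_linear R M N (\<lambda>x. \<zero>\<^bsub>N\<^esub>)"
proof -
  interpret N: abelian_group N by (rule rmod_group[OF N])
  show ?thesis by (auto simp: right_linear_def additive_map_def rsmult_zero[OF N])
qed

lemma right_linear_plus:
  assumes N: "right_module R N" and f: "right_linear R M N f" "right_linear R M N g"
  shows "right_linear R M N (\<lambda>x. f x \<oplus>\<^bsub>N\<^esub> g x)"
  using f additive_map_plus[OF f[THEN right_linear_additive] rmod_group[OF N]]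
  by (auto simp: right_linear_def rmod_add[OF N] additive_map_closed)

lemma right_linear_neg:
  assumes N: "right_module R N" and f: "right_linear R M N f"
  shows "right_linear R M N (\<lambda>x. \<ominus>\<^bsub>N\<^esub> f x)"
proof -
  interpret N: abelian_group N by (rule rmod_group[OF N])
  show ?thesis
    using f by (auto simp: right_linear_def additive_map_def rsmult_neg[OF N] N.minus_add Pi_iff)
qed

lemma left_linear_zero:
  assumes N: "left_module R N"
  shows "left_linear R M N (\<lambda>x. \<zero>\<^bsub>N\<^esub>)"
proof -
  interpret N: abelian_group N by (rule lmod_group[OF N])
  show ?thesis by (auto simp: left_linear_def additive_map_def smult_zero[OF N])
qed

lemma left_linear_plus:
  assumes N: "left_module R N" and f: "left_linear R M N f" "left_linear R M N g"
  shows "left_linear R M N (\<lambda>x. f x \<oplus>\<^bsub>N\<^esub> g x)"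
  using f additive_map_plus[OF f[THEN left_linear_additive] lmod_group[OF N]]
  by (auto simp: left_linear_def lmod_add[OF N] additive_map_closed)

lemma left_linear_neg:
  assumes N: "left_module R N" and f: "left_linear R M N f"
  shows "left_linear R M N (\<lambda>x. \<ominus>\<^bsub>N\<^esub> f x)"
proof -
  interpret N: abelian_group N by (rule lmod_group[OF N])
  show ?thesis
    using f by (auto simp: left_linear_def additive_map_def smult_neg[OF N] N.minus_add Pi_iff)
qed

lemma bimod_smult_right_linear:
  assumes "bimodule R A N" and "right_linear A P N f" and "r \<in> carrier R"
  shows "right_linear A P N (\<lambda>x. r \<odot>\<^bsub>N\<^esub> f x)"
  by (rule right_linear_comp[OF assms(2) bimod_left_smult_right_linear[OF assms(1,3)]])

abbreviation lin_hom where
  "lin_hom A P N \<equiv> hom_bimod {f \<in> extensional (carrier P). right_linear A P N f} P N"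

lemma hom_bimod_simps [simp]:
  "carrier (hom_bimod H M N) = H"
  "zero (hom_bimod H M N) = (\<lambda>x\<in>carrier M. \<zero>\<^bsub>N\<^esub>)"
  "add (hom_bimod H M N) = (\<lambda>f g. \<lambda>x\<in>carrier M. f x \<oplus>\<^bsub>N\<^esub> g x)"
  "smult (hom_bimod H M N) = (\<lambda>a f. \<lambda>x\<in>carrier M. a \<odot>\<^bsub>N\<^esub> f x)"
  "rsmult (hom_bimod H M N) = (\<lambda>f s. compose (carrier M) f s)"
  by (simp_all add: hom_bimod_def)

lemma lin_hom_left_module:
  assumes P: "right_module A P" and N: "bimodule R A N"
  shows "left_module R (lin_hom A P N)"
proof -
  note Nl = bimod_left[OF N] and Nr = bimod_right[OF N]
  interpret N: abelian_group N by (rule rmod_group[OF Nr])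
  interpret R: ring R by (rule lmod_ring[OF Nl])
  have G: "abelian_group (lin_hom A P N)"
    by (rule pointwise_abelian_group[OF N.abelian_group_axioms])
      (auto intro!: right_linear_restrict[OF P] right_linear_plus[OF Nr] right_linear_zero[OF Nr]
        right_linear_neg[OF Nr] intro: right_linear_closed)
  show ?thesis
    unfolding left_module_def
  proof (intro conjI ballI)
    fix f assume f: "f \<in> carrier (lin_hom A P N)"
    then have fc: "f x \<in> carrier N" if "x \<in> carrier P" for x
      using that by (auto intro: right_linear_closed)
    have fe: "f \<in> extensional (carrier P)" using f by simp
    show "\<one>\<^bsub>R\<^esub> \<odot>\<^bsub>lin_hom A P N\<^esub> f = f"
      by (rule extensionalityI[of _ "carrier P"]) (simp_all add: fe fc lmod_one[OF Nl])
    fix a assume a: "a \<in> carrier R"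
    show "a \<odot>\<^bsub>lin_hom A P N\<^esub> f \<in> carrier (lin_hom A P N)"
      using f a by (auto intro!: right_linear_restrict[OF P] bimod_smult_right_linear[OF N])
    fix b assume b: "b \<in> carrier R"
    show "(a \<oplus>\<^bsub>R\<^esub> b) \<odot>\<^bsub>lin_hom A P N\<^esub> f = a \<odot>\<^bsub>lin_hom A P N\<^esub> f \<oplus>\<^bsub>lin_hom A P N\<^esub> b \<odot>\<^bsub>lin_hom A P N\<^esub> f"
      by (simp add: restrict_def fun_eq_iff lmod_scalar_add[OF Nl] a b fc)
    show "(a \<otimes>\<^bsub>R\<^esub> b) \<odot>\<^bsub>lin_hom A P N\<^esub> f = a \<odot>\<^bsub>lin_hom A P N\<^esub> (b \<odot>\<^bsub>lin_hom A P N\<^esub> f)"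
      by (simp add: restrict_def fun_eq_iff lmod_mult[OF Nl] a b fc)
  next
    fix a f g assume "a \<in> carrier R" "f \<in> carrier (lin_hom A P N)" "g \<in> carrier (lin_hom A P N)"
    then show "a \<odot>\<^bsub>lin_hom A P N\<^esub> (f \<oplus>\<^bsub>lin_hom A P N\<^esub> g) = a \<odot>\<^bsub>lin_hom A P N\<^esub> f \<oplus>\<^bsub>lin_hom A P N\<^esub> a \<odot>\<^bsub>lin_hom A P N\<^esub> g"
      by (auto simp: restrict_def fun_eq_iff lmod_add[OF Nl] right_linear_closed)
  qed (simp_all add: G R.ring_axioms)
qed

lemma regular_simps [simp]:
  "carrier (regular R) = carrier R" "zero (regular R) = zero R" "add (regular R) = add R"
  "smult (regular R) = mult R" "rsmult (regular R) = mult R"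
  by (simp_all add: regular_def)

lemma abelian_group_cong:
  assumes "abelian_group G" "carrier G' = carrier G" "zero G' = zero G" "add G' = add G"
  shows "abelian_group G'"
proof -
  interpret abelian_group G by fact
  show ?thesis
    using assms(2-) by (intro abelian_groupI) (auto simp: a_ac intro: bexI[of _ "\<ominus>\<^bsub>G\<^esub> _"] l_neg)
qed

lemma regular_bimodule: "ring R \<Longrightarrow> bimodule R R (regular R)"
proof -
  assume R: "ring R"
  interpret ring R by fact
  have "abelian_group (regular R)"
    by (rule abelian_group_cong[OF abelian_group_axioms]) simp_all
  then show ?thesis
    by (simp add: bimodule_def left_module_def right_module_def R l_distr r_distr m_assoc)
qed

lemma right_module_subring:
  assumes B: "subring B S" and "right_module S M"
  shows "right_module (S\<lparr>carrier := B\<rparr>) M"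
  using assms ring.subring_is_ring[OF rmod_ring[OF assms(2)] B] subringE(1)[OF B]
  by (auto simp: right_module_def subset_iff)

lemma left_module_subring:
  assumes B: "subring B S" and "left_module S M"
  shows "left_module (S\<lparr>carrier := B\<rparr>) M"
  using assms ring.subring_is_ring[OF lmod_ring[OF assms(2)] B] subringE(1)[OF B]
  by (auto simp: left_module_def subset_iff)

lemma bimodule_left_subring:
  assumes B: "subring B S" and "bimodule S A M"
  shows "bimodule (S\<lparr>carrier := B\<rparr>) A M"
  using assms left_module_subring[OF B] subringE(1)[OF B] by (auto simp: bimodule_def)

lemma right_linear_subring:
  assumes "subring B S" and "right_linear S M N f"
  shows "right_linear (S\<lparr>carrier := B\<rparr>) M N f"
  using assms subringE(1) by (fastforce simp: right_linear_def)

section \<open>Comodules and their endomorphisms\<close>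

lemma rcomod_module: "right_comodule A C M \<rho> \<Longrightarrow> right_module A M"
  and rcomod_linear: "right_comodule A C M \<rho> \<Longrightarrow> right_linear A M (tensor A M C) \<rho>"
  by (simp_all add: right_comodule_def)

lemma rcolin_linear: "right_colinear A C M \<rho>\<^sub>M N \<rho>\<^sub>N f \<Longrightarrow> right_linear A M N f"
  by (simp add: right_colinear_def)

lemma rcolin_coaction:
  "right_colinear A C M \<rho>\<^sub>M N \<rho>\<^sub>N f \<Longrightarrow> x \<in> carrier M \<Longrightarrow> \<rho>\<^sub>N (f x) = tensor_map A N C f (\<lambda>c. c) (\<rho>\<^sub>M x)"
  by (simp add: right_colinear_def)

locale coring =
  fixes A :: "('a, 'x) ring_scheme" and C :: "('a, 'c) coring"
  assumes is_coring: "is_coring A C"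
begin

lemma C_bimodule: "bimodule A A C"
  using is_coring by (simp add: is_coring_def)

lemmas C_left = bimod_left[OF C_bimodule] and C_right = bimod_right[OF C_bimodule]

lemma A_ring: "ring A" by (rule lmod_ring[OF C_left])

lemma C_comodule: "right_comodule A C C (comult C)"
  using is_coring by (simp add: is_coring_def right_comodule_def bimodule_def)

lemmas comult_linear = rcomod_linear[OF C_comodule]

lemma comult_left_linear: "left_linear A C (tensor A C C) (comult C)"
  using is_coring by (simp add: is_coring_def)

lemma counit_left: "left_linear A C (regular A) (counit C)"
  and counit_right: "right_linear A C (regular A) (counit C)"
  using is_coring by (simp_all add: is_coring_def)

lemma counit_closed: "c \<in> carrier C \<Longrightarrow> counit C c \<in> carrier A"
  using left_linear_closed[OF counit_left] by simp

lemma counit_comult: "c \<in> carrier C \<Longrightarrow> tensor_lift C (\<lambda>d e. counit C d \<odot>\<^bsub>C\<^esub> e) (comult C c) = c"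
  using is_coring by (simp add: is_coring_def)

lemma tensor_C_group: "right_module A M \<Longrightarrow> abelian_group (tensor A M C)"
  by (rule tensor_group[OF _ C_left])

lemma tensor_C_module: "right_module A M \<Longrightarrow> right_module A (tensor A M C)"
  by (rule tensor_right_module[OF _ C_bimodule])

lemmas C_ident = left_linear_ident[of A C]

lemma coaction_closed: "right_comodule A C M \<rho> \<Longrightarrow> x \<in> carrier M \<Longrightarrow> \<rho> x \<in> carrier (tensor A M C)"
  by (rule right_linear_closed[OF rcomod_linear])

lemma tensor_C_additive:
  "right_module A M \<Longrightarrow> right_module A N \<Longrightarrow> right_linear A M N f \<Longrightarrow>
    additive_map (tensor A M C) (tensor A N C) (tensor_map A N C f (\<lambda>c. c))"
  by (rule tensor_map_additive[OF _ C_left _ C_left _ C_ident])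

lemma tensor_C_pure:
  "right_module A M \<Longrightarrow> right_module A N \<Longrightarrow> right_linear A M N f \<Longrightarrow> x \<in> carrier M \<Longrightarrow> c \<in> carrier C \<Longrightarrow>
    tensor_map A N C f (\<lambda>c. c) (pure A M C x c) = pure A N C (f x) c"
  by (rule tensor_map_pure[OF _ C_left _ C_left _ C_ident])

lemma tensor_C_cong:
  assumes "right_module A M" "right_module A N" "right_linear A M N f"
    and "\<And>x. x \<in> carrier M \<Longrightarrow> f' x = f x" and "t \<in> carrier (tensor A M C)"
  shows "tensor_map A N C f' (\<lambda>c. c) t = tensor_map A N C f (\<lambda>c. c) t"
  by (rule tensor_map_cong[OF assms(1) C_left assms(2) C_left assms(3) C_ident assms(4) _ assms(5)]) simp_all

lemma tensor_C_comp:
  assumes "right_module A M0" "right_module A M1" "right_module A M2"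
    and "right_linear A M0 M1 f" "right_linear A M1 M2 g" "t \<in> carrier (tensor A M0 C)"
  shows "tensor_map A M2 C g (\<lambda>c. c) (tensor_map A M1 C f (\<lambda>c. c) t) = tensor_map A M2 C (\<lambda>x. g (f x)) (\<lambda>c. c) t"
  by (rule tensor_map_comp[OF assms(1) C_left assms(2) C_left assms(3) C_left assms(4) C_ident assms(5) C_ident assms(6)])

lemma tensor_C_plus:
  assumes "right_module A M" "right_module A N" "right_linear A M N f" "right_linear A M N g"
    and "t \<in> carrier (tensor A M C)"
  shows "tensor_map A N C (\<lambda>x. f x \<oplus>\<^bsub>N\<^esub> g x) (\<lambda>c. c) t =
    tensor_map A N C f (\<lambda>c. c) t \<oplus>\<^bsub>tensor A N C\<^esub> tensor_map A N C g (\<lambda>c. c) t"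
  by (rule tensor_map_add_left[OF assms(1) C_left assms(2) C_left assms(3,4) C_ident assms(5)])

lemma tensor_C_zero:
  assumes M: "right_module A M" and N: "right_module A N" and t: "t \<in> carrier (tensor A M C)"
  shows "tensor_map A N C (\<lambda>x. \<zero>\<^bsub>N\<^esub>) (\<lambda>c. c) t = \<zero>\<^bsub>tensor A N C\<^esub>"
proof -
  interpret T: abelian_group "tensor A N C" by (rule tensor_C_group[OF N])
  let ?z = "tensor_map A N C (\<lambda>x. \<zero>\<^bsub>N\<^esub>) (\<lambda>c. c) t"
  have "?z \<in> carrier (tensor A N C)"
    by (rule additive_map_closed[OF tensor_C_additive[OF M N right_linear_zero[OF N]] t])
  moreover have "?z = ?z \<oplus>\<^bsub>tensor A N C\<^esub> ?z"
    using tensor_C_plus[OF M N right_linear_zero[OF N] right_linear_zero[OF N] t]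
      abelian_monoid.l_zero[OF abelian_group.axioms(1)[OF rmod_group[OF N]]]
    by (simp add: abelian_monoid.zero_closed[OF abelian_group.axioms(1)[OF rmod_group[OF N]]])
  ultimately show ?thesis by (metis T.add.l_cancel_one')
qed

lemma tensor_C_neg:
  assumes M: "right_module A M" and N: "right_module A N" and f: "right_linear A M N f" and t: "t \<in> carrier (tensor A M C)"
  shows "tensor_map A N C (\<lambda>x. \<ominus>\<^bsub>N\<^esub> f x) (\<lambda>c. c) t = \<ominus>\<^bsub>tensor A N C\<^esub> tensor_map A N C f (\<lambda>c. c) t"
proof -
  interpret N: abelian_group N by (rule rmod_group[OF N])
  interpret T: abelian_group "tensor A N C" by (rule tensor_C_group[OF N])
  note n = right_linear_neg[OF N f]
  have "tensor_map A N C (\<lambda>x. \<ominus>\<^bsub>N\<^esub> f x) (\<lambda>c. c) t \<oplus>\<^bsub>tensor A N C\<^esub> tensor_map A N C f (\<lambda>c. c) t =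
      tensor_map A N C (\<lambda>x. \<ominus>\<^bsub>N\<^esub> f x \<oplus>\<^bsub>N\<^esub> f x) (\<lambda>c. c) t"
    by (rule tensor_C_plus[OF M N n f t, symmetric])
  also have "\<dots> = tensor_map A N C (\<lambda>x. \<zero>\<^bsub>N\<^esub>) (\<lambda>c. c) t"
    by (rule tensor_C_cong[OF M N right_linear_zero[OF N] _ t])
      (simp add: N.l_neg right_linear_closed[OF f])
  also have "\<dots> = \<zero>\<^bsub>tensor A N C\<^esub>" by (rule tensor_C_zero[OF M N t])
  finally show ?thesis
    using additive_map_closed[OF tensor_C_additive[OF M N n] t] additive_map_closed[OF tensor_C_additive[OF M N f] t]
    by (simp add: T.minus_equality)
qed

lemma right_colinear_cong:
  assumes M: "right_comodule A C M \<rho>\<^sub>M" and N: "right_comodule A C N \<rho>\<^sub>N"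
    and f: "right_colinear A C M \<rho>\<^sub>M N \<rho>\<^sub>N f" and eq: "\<And>x. x \<in> carrier M \<Longrightarrow> g x = f x"
  shows "right_colinear A C M \<rho>\<^sub>M N \<rho>\<^sub>N g"
  unfolding right_colinear_def
  using right_linear_cong[OF rcolin_linear[OF f] eq rcomod_module[OF M]] f
    tensor_C_cong[OF rcomod_module[OF M] rcomod_module[OF N] rcolin_linear[OF f] eq coaction_closed[OF M]]
  by (auto simp: right_colinear_def eq)

lemma right_colinear_plus:
  assumes M: "right_comodule A C M \<rho>\<^sub>M" and N: "right_comodule A C N \<rho>\<^sub>N"
    and f: "right_colinear A C M \<rho>\<^sub>M N \<rho>\<^sub>N f" and g: "right_colinear A C M \<rho>\<^sub>M N \<rho>\<^sub>N g"
  shows "right_colinear A C M \<rho>\<^sub>M N \<rho>\<^sub>N (\<lambda>x. f x \<oplus>\<^bsub>N\<^esub> g x)"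
  unfolding right_colinear_def
  using f g right_linear_plus[OF rcomod_module[OF N] rcolin_linear[OF f] rcolin_linear[OF g]]
    tensor_C_plus[OF rcomod_module[OF M] rcomod_module[OF N] rcolin_linear[OF f] rcolin_linear[OF g] coaction_closed[OF M]]
    right_linear_add[OF rcomod_linear[OF N]]
    right_linear_closed[OF rcolin_linear[OF f]]
    right_linear_closed[OF rcolin_linear[OF g]]
  by (auto simp: right_colinear_def)

lemma right_colinear_zero:
  assumes M: "right_comodule A C M \<rho>\<^sub>M" and N: "right_comodule A C N \<rho>\<^sub>N"
  shows "right_colinear A C M \<rho>\<^sub>M N \<rho>\<^sub>N (\<lambda>x. \<zero>\<^bsub>N\<^esub>)"
  unfolding right_colinear_def
  using right_linear_zero[OF rcomod_module[OF N]]
    tensor_C_zero[OF rcomod_module[OF M] rcomod_module[OF N] coaction_closed[OF M]]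
    additive_map_zero[OF right_linear_additive[OF rcomod_linear[OF N]] rmod_group[OF rcomod_module[OF N]] tensor_C_group[OF rcomod_module[OF N]]]
  by auto

lemma right_colinear_neg:
  assumes M: "right_comodule A C M \<rho>\<^sub>M" and N: "right_comodule A C N \<rho>\<^sub>N"
    and f: "right_colinear A C M \<rho>\<^sub>M N \<rho>\<^sub>N f"
  shows "right_colinear A C M \<rho>\<^sub>M N \<rho>\<^sub>N (\<lambda>x. \<ominus>\<^bsub>N\<^esub> f x)"
  unfolding right_colinear_def
  using f right_linear_neg[OF rcomod_module[OF N] rcolin_linear[OF f]]
    tensor_C_neg[OF rcomod_module[OF M] rcomod_module[OF N] rcolin_linear[OF f] coaction_closed[OF M]]
    additive_map_neg[OF right_linear_additive[OF rcomod_linear[OF N]] rmod_group[OF rcomod_module[OF N]] tensor_C_group[OF rcomod_module[OF N]]]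
    right_linear_closed[OF rcolin_linear[OF f]]
  by (auto simp: right_colinear_def)

lemma right_colinear_comp:
  assumes L: "right_comodule A C L \<rho>\<^sub>L" and M: "right_comodule A C M \<rho>\<^sub>M" and N: "right_comodule A C N \<rho>\<^sub>N"
    and f: "right_colinear A C L \<rho>\<^sub>L M \<rho>\<^sub>M f" and g: "right_colinear A C M \<rho>\<^sub>M N \<rho>\<^sub>N g"
  shows "right_colinear A C L \<rho>\<^sub>L N \<rho>\<^sub>N (\<lambda>x. g (f x))"
  unfolding right_colinear_def
  using right_linear_comp[OF rcolin_linear[OF f] rcolin_linear[OF g]]
    rcolin_coaction[OF g] rcolin_coaction[OF f]
    right_linear_closed[OF rcolin_linear[OF f]]
    tensor_C_comp[OF rcomod_module[OF L] rcomod_module[OF M] rcomod_module[OF N] rcolin_linear[OF f]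
      rcolin_linear[OF g] coaction_closed[OF L]]
  by auto

lemma right_colinear_ident:
  assumes M: "right_comodule A C M \<rho>\<^sub>M"
  shows "right_colinear A C M \<rho>\<^sub>M M \<rho>\<^sub>M (\<lambda>x. x)"
  unfolding right_colinear_def
  using right_linear_ident tensor_map_ident[OF rcomod_module[OF M] C_left coaction_closed[OF M]] by auto

lemma colinear_hom_group:
  assumes M: "right_comodule A C M \<rho>\<^sub>M" and N: "right_comodule A C N \<rho>\<^sub>N"
    and "add G = (\<lambda>f g. \<lambda>x\<in>carrier M. f x \<oplus>\<^bsub>N\<^esub> g x)" "zero G = (\<lambda>x\<in>carrier M. \<zero>\<^bsub>N\<^esub>)"
    and "carrier G = {f \<in> extensional (carrier M). right_colinear A C M \<rho>\<^sub>M N \<rho>\<^sub>N f}"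
  shows "abelian_group G"
  by (rule pointwise_abelian_group[OF rmod_group[OF rcomod_module[OF N]] assms(3,4)])
    (auto simp: assms(5) intro: right_linear_closed[OF rcolin_linear]
      right_colinear_cong[OF M N right_colinear_plus[OF M N]]
      right_colinear_cong[OF M N right_colinear_zero[OF M N]]
      right_colinear_cong[OF M N right_colinear_neg[OF M N]])

end

locale comodule = coring A C for A :: "('a, 'x) ring_scheme" and C :: "('a, 'c) coring" +
  fixes P :: "('l, 'p, 'a) bimod" and \<rho> :: "'p \<Rightarrow> ('p, 'c) tens"
  assumes comodule: "right_comodule A C P \<rho>"
begin

abbreviation "S \<equiv> right_comodule_End A C P \<rho>"
abbreviation "X \<equiv> right_dual A P"
abbreviation "E0 \<equiv> eval_bimod P"
abbreviation "H \<equiv> colinear_hom A C P \<rho> C (comult C)"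

lemmas P_module = rcomod_module[OF comodule]
lemmas coact_linear = rcomod_linear[OF comodule]
lemmas coact_closed = coaction_closed[OF comodule]

lemma S_simps [simp]:
  "carrier S = {f \<in> extensional (carrier P). right_colinear A C P \<rho> P \<rho> f}"
  "mult S = (\<lambda>f g. compose (carrier P) f g)" "one S = (\<lambda>x\<in>carrier P. x)"
  "zero S = (\<lambda>x\<in>carrier P. \<zero>\<^bsub>P\<^esub>)" "add S = (\<lambda>f g. \<lambda>x\<in>carrier P. f x \<oplus>\<^bsub>P\<^esub> g x)"
  by (simp_all add: right_comodule_End_def)

lemma E0_simps [simp]:
  "carrier E0 = carrier P" "zero E0 = zero P" "add E0 = add P" "smult E0 = (\<lambda>s x. s x)" "rsmult E0 = rsmult P"
  by (simp_all add: eval_bimod_def)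

lemma S_linear: "s \<in> carrier S \<Longrightarrow> right_linear A P P s"
  by (auto dest: rcolin_linear)

lemma S_closed: "s \<in> carrier S \<Longrightarrow> x \<in> carrier P \<Longrightarrow> s x \<in> carrier P"
  by (rule right_linear_closed[OF S_linear])

lemma S_ring: "ring S"
proof (rule ringI)
  interpret P: abelian_group P by (rule rmod_group[OF P_module])
  show "abelian_group S"
    by (rule colinear_hom_group[OF comodule comodule]) simp_all
  have comp: "compose (carrier P) s t \<in> carrier S" if "s \<in> carrier S" "t \<in> carrier S" for s t
    using that by (auto simp: compose_def intro: right_colinear_cong[OF comodule comodule
      right_colinear_comp[OF comodule comodule comodule]])
  show "monoid S"
  proof (rule monoidI)
    fix s t u assume s: "s \<in> carrier S" and t: "t \<in> carrier S" and u: "u \<in> carrier S"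
    show "s \<otimes>\<^bsub>S\<^esub> t \<otimes>\<^bsub>S\<^esub> u = s \<otimes>\<^bsub>S\<^esub> (t \<otimes>\<^bsub>S\<^esub> u)"
      using S_closed[OF u] by (simp add: compose_def restrict_def fun_eq_iff)
  next
    show "\<one>\<^bsub>S\<^esub> \<in> carrier S"
      by (auto intro: right_colinear_cong[OF comodule comodule right_colinear_ident[OF comodule]])
  next
    fix s assume s: "s \<in> carrier S"
    then have e: "s \<in> extensional (carrier P)" by simp
    show "\<one>\<^bsub>S\<^esub> \<otimes>\<^bsub>S\<^esub> s = s" "s \<otimes>\<^bsub>S\<^esub> \<one>\<^bsub>S\<^esub> = s"
      by (rule extensionalityI[of _ "carrier P"]; simp add: compose_def e S_closed[OF s])+
  qed (use comp in simp)
  fix s t u assume s: "s \<in> carrier S" and t: "t \<in> carrier S" and u: "u \<in> carrier S"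
  show "(s \<oplus>\<^bsub>S\<^esub> t) \<otimes>\<^bsub>S\<^esub> u = s \<otimes>\<^bsub>S\<^esub> u \<oplus>\<^bsub>S\<^esub> t \<otimes>\<^bsub>S\<^esub> u"
    using S_closed[OF u] by (simp add: compose_def restrict_def fun_eq_iff)
  show "u \<otimes>\<^bsub>S\<^esub> (s \<oplus>\<^bsub>S\<^esub> t) = u \<otimes>\<^bsub>S\<^esub> s \<oplus>\<^bsub>S\<^esub> u \<otimes>\<^bsub>S\<^esub> t"
    using S_closed[OF s] S_closed[OF t] right_linear_add[OF S_linear[OF u]]
    by (simp add: compose_def restrict_def fun_eq_iff)
qed

lemma E0_bimodule: "bimodule S A E0"
proof -
  interpret P: abelian_group P by (rule rmod_group[OF P_module])
  interpret S: ring S by (rule S_ring)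
  have "abelian_group E0" by (rule abelian_group_cong[OF P.abelian_group_axioms]) simp_all
  then show ?thesis
    using P_module S_ring S_closed
    by (auto simp: bimodule_def left_module_def right_module_def compose_def
      right_linear_add[OF S_linear] right_linear_rsmult[OF S_linear])
qed

lemma X_eq: "X = lin_hom A P (regular A)"
  by (simp add: right_dual_def)

lemma X_simps [simp]:
  "carrier X = {f \<in> extensional (carrier P). right_linear A P (regular A) f}"
  "zero X = (\<lambda>x\<in>carrier P. \<zero>\<^bsub>A\<^esub>)" "add X = (\<lambda>f g. \<lambda>x\<in>carrier P. f x \<oplus>\<^bsub>A\<^esub> g x)"
  "smult X = (\<lambda>a f. \<lambda>x\<in>carrier P. a \<otimes>\<^bsub>A\<^esub> f x)" "rsmult X = (\<lambda>f s. compose (carrier P) f s)"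
  by (simp_all add: X_eq)

lemma X_linear: "g \<in> carrier X \<Longrightarrow> right_linear A P (regular A) g"
  by simp

lemma X_closed: "g \<in> carrier X \<Longrightarrow> x \<in> carrier P \<Longrightarrow> g x \<in> carrier A"
  using right_linear_closed[OF X_linear] by simp

lemma X_bimodule: "bimodule A S X"
proof -
  interpret A: ring A by (rule A_ring)
  have L: "left_module A X"
    unfolding X_eq by (rule lin_hom_left_module[OF P_module regular_bimodule[OF A_ring]])
  have "right_module S X"
    unfolding right_module_def
  proof (intro conjI ballI)
    fix s g assume s: "s \<in> carrier S" and g: "g \<in> carrier X"
    show "g \<odot>\<^sub>r\<^bsub>X\<^esub> s \<in> carrier X"
      using right_linear_cong[OF right_linear_comp[OF S_linear[OF s] X_linear[OF g]] _ P_module] s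
      by (auto simp: compose_def)
    fix t assume t: "t \<in> carrier S"
    show "g \<odot>\<^sub>r\<^bsub>X\<^esub> (s \<oplus>\<^bsub>S\<^esub> t) = g \<odot>\<^sub>r\<^bsub>X\<^esub> s \<oplus>\<^bsub>X\<^esub> g \<odot>\<^sub>r\<^bsub>X\<^esub> t"
      using S_closed[OF s] S_closed[OF t] right_linear_add[OF X_linear[OF g]]
      by (simp add: compose_def restrict_def fun_eq_iff)
    show "g \<odot>\<^sub>r\<^bsub>X\<^esub> (s \<otimes>\<^bsub>S\<^esub> t) = g \<odot>\<^sub>r\<^bsub>X\<^esub> s \<odot>\<^sub>r\<^bsub>X\<^esub> t"
      using S_closed[OF t] by (simp add: compose_def restrict_def fun_eq_iff)
  next
    fix g assume g: "g \<in> carrier X"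
    then have e: "g \<in> extensional (carrier P)" by simp
    show "g \<odot>\<^sub>r\<^bsub>X\<^esub> \<one>\<^bsub>S\<^esub> = g"
      by (rule extensionalityI[of _ "carrier P"]) (simp_all add: compose_def e)
  next
    fix s g h assume s: "s \<in> carrier S"
    show "(g \<oplus>\<^bsub>X\<^esub> h) \<odot>\<^sub>r\<^bsub>X\<^esub> s = g \<odot>\<^sub>r\<^bsub>X\<^esub> s \<oplus>\<^bsub>X\<^esub> h \<odot>\<^sub>r\<^bsub>X\<^esub> s"
      using S_closed[OF s] by (simp add: compose_def restrict_def fun_eq_iff)
  qed (simp_all add: S_ring lmod_group[OF L])
  moreover have "(a \<odot>\<^bsub>X\<^esub> g) \<odot>\<^sub>r\<^bsub>X\<^esub> s = a \<odot>\<^bsub>X\<^esub> (g \<odot>\<^sub>r\<^bsub>X\<^esub> s)" if s: "s \<in> carrier S" for a g s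
    using S_closed[OF s] by (simp add: compose_def restrict_def fun_eq_iff)
  ultimately show ?thesis using L by (simp add: bimodule_def)
qed

lemma H_simps [simp]:
  "carrier H = {f \<in> extensional (carrier P). right_colinear A C P \<rho> C (comult C) f}"
  "zero H = (\<lambda>x\<in>carrier P. \<zero>\<^bsub>C\<^esub>)" "add H = (\<lambda>f g. \<lambda>x\<in>carrier P. f x \<oplus>\<^bsub>C\<^esub> g x)"
  "rsmult H = (\<lambda>f s. compose (carrier P) f s)"
  by (simp_all add: colinear_hom_def)

lemma H_linear: "f \<in> carrier H \<Longrightarrow> right_linear A P C f"
  by (auto dest: rcolin_linear)

lemma H_closed: "f \<in> carrier H \<Longrightarrow> x \<in> carrier P \<Longrightarrow> f x \<in> carrier C"
  by (rule right_linear_closed[OF H_linear])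

lemma H_module: "right_module S H"
  unfolding right_module_def
proof (intro conjI ballI)
  show "abelian_group H"
    by (rule colinear_hom_group[OF comodule C_comodule]) simp_all
  fix s g assume s: "s \<in> carrier S" and g: "g \<in> carrier H"
  show "g \<odot>\<^sub>r\<^bsub>H\<^esub> s \<in> carrier H"
    using s g by (auto simp: compose_def intro: right_colinear_cong[OF comodule C_comodule
      right_colinear_comp[OF comodule comodule C_comodule]])
  fix t assume t: "t \<in> carrier S"
  show "g \<odot>\<^sub>r\<^bsub>H\<^esub> (s \<oplus>\<^bsub>S\<^esub> t) = g \<odot>\<^sub>r\<^bsub>H\<^esub> s \<oplus>\<^bsub>H\<^esub> g \<odot>\<^sub>r\<^bsub>H\<^esub> t"
    using S_closed[OF s] S_closed[OF t] right_linear_add[OF H_linear[OF g]]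
    by (simp add: compose_def restrict_def fun_eq_iff)
  show "g \<odot>\<^sub>r\<^bsub>H\<^esub> (s \<otimes>\<^bsub>S\<^esub> t) = g \<odot>\<^sub>r\<^bsub>H\<^esub> s \<odot>\<^sub>r\<^bsub>H\<^esub> t"
    using S_closed[OF t] by (simp add: compose_def restrict_def fun_eq_iff)
next
  fix g assume g: "g \<in> carrier H"
  then have e: "g \<in> extensional (carrier P)" by simp
  show "g \<odot>\<^sub>r\<^bsub>H\<^esub> \<one>\<^bsub>S\<^esub> = g"
    by (rule extensionalityI[of _ "carrier P"]) (simp_all add: compose_def e)
next
  fix s g h assume s: "s \<in> carrier S"
  show "(g \<oplus>\<^bsub>H\<^esub> h) \<odot>\<^sub>r\<^bsub>H\<^esub> s = g \<odot>\<^sub>r\<^bsub>H\<^esub> s \<oplus>\<^bsub>H\<^esub> h \<odot>\<^sub>r\<^bsub>H\<^esub> s"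
    using S_closed[OF s] by (simp add: compose_def restrict_def fun_eq_iff)
qed (rule S_ring)

end

section \<open>Finite sums and additive maps\<close>

lemma finsum_swap:
  assumes G: "abelian_group G" and I: "finite I" and J: "finite J"
    and c: "\<And>i j. i \<in> I \<Longrightarrow> j \<in> J \<Longrightarrow> f i j \<in> carrier G"
  shows "(\<Oplus>\<^bsub>G\<^esub>i\<in>I. \<Oplus>\<^bsub>G\<^esub>j\<in>J. f i j) = (\<Oplus>\<^bsub>G\<^esub>j\<in>J. \<Oplus>\<^bsub>G\<^esub>i\<in>I. f i j)"
proof -
  interpret G: abelian_group G by fact
  show ?thesis
    using I c
  proof induction
    case empty
    then show ?case by simp
  next
    case (insert i I)
    have "(\<Oplus>\<^bsub>G\<^esub>i\<in>insert i I. \<Oplus>\<^bsub>G\<^esub>j\<in>J. f i j) =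
        (\<Oplus>\<^bsub>G\<^esub>j\<in>J. f i j) \<oplus>\<^bsub>G\<^esub> (\<Oplus>\<^bsub>G\<^esub>j\<in>J. \<Oplus>\<^bsub>G\<^esub>i\<in>I. f i j)"
      using insert by (subst G.finsum_insert) (auto intro!: G.finsum_closed)
    also have "\<dots> = (\<Oplus>\<^bsub>G\<^esub>j\<in>J. f i j \<oplus>\<^bsub>G\<^esub> (\<Oplus>\<^bsub>G\<^esub>i\<in>I. f i j))"
      using insert by (intro G.finsum_addf[symmetric]) (auto intro!: G.finsum_closed)
    also have "\<dots> = (\<Oplus>\<^bsub>G\<^esub>j\<in>J. \<Oplus>\<^bsub>G\<^esub>i\<in>insert i I. f i j)"
      using insert by (intro G.finsum_cong') (auto simp: Pi_iff intro!: G.finsum_closed)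
    finally show ?case .
  qed
qed

lemma additive_map_sum:
  assumes "additive_map M N f" "abelian_group M" "abelian_group N" "\<And>i. i \<in> I \<Longrightarrow> h i \<in> carrier M"
  shows "f (\<Oplus>\<^bsub>M\<^esub>i\<in>I. h i) = (\<Oplus>\<^bsub>N\<^esub>i\<in>I. f (h i))"
  using assms by (intro additive_map_finsum) auto

lemma finsum_eqI:
  assumes "abelian_group G" "\<And>i. i \<in> I \<Longrightarrow> f i = g i" "\<And>i. i \<in> I \<Longrightarrow> g i \<in> carrier G"
  shows "(\<Oplus>\<^bsub>G\<^esub>i\<in>I. f i) = (\<Oplus>\<^bsub>G\<^esub>i\<in>I. g i)"
  using abelian_monoid.finsum_cong'[OF abelian_group.axioms(1)[OF assms(1)], of I I g f] assms by auto

lemma finsum_in: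
  assumes "abelian_group G" "\<And>i. i \<in> I \<Longrightarrow> f i \<in> carrier G"
  shows "(\<Oplus>\<^bsub>G\<^esub>i\<in>I. f i) \<in> carrier G"
  using assms by (intro abelian_monoid.finsum_closed[OF abelian_group.axioms(1)]) auto

lemma additive_map_sum_maps:
  assumes N: "abelian_group N" and I: "finite I" and f: "\<And>i. i \<in> I \<Longrightarrow> additive_map M N (f i)"
  shows "additive_map M N (\<lambda>x. \<Oplus>\<^bsub>N\<^esub>i\<in>I. f i x)"
proof (rule additive_mapI)
  interpret N: abelian_group N by fact
  show "(\<Oplus>\<^bsub>N\<^esub>i\<in>I. f i x) \<in> carrier N" if "x \<in> carrier M" for x
    using additive_map_closed[OF f that] by (rule finsum_in[OF N])
  fix x y assume xy: "x \<in> carrier M" "y \<in> carrier M"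
  have "(\<Oplus>\<^bsub>N\<^esub>i\<in>I. f i (x \<oplus>\<^bsub>M\<^esub> y)) = (\<Oplus>\<^bsub>N\<^esub>i\<in>I. f i x \<oplus>\<^bsub>N\<^esub> f i y)"
    using xy by (intro finsum_eqI[OF N]) (auto simp: additive_map_add[OF f] additive_map_closed[OF f])
  also have "\<dots> = (\<Oplus>\<^bsub>N\<^esub>i\<in>I. f i x) \<oplus>\<^bsub>N\<^esub> (\<Oplus>\<^bsub>N\<^esub>i\<in>I. f i y)"
    using xy by (intro N.finsum_addf) (auto simp: additive_map_closed[OF f])
  finally show "(\<Oplus>\<^bsub>N\<^esub>i\<in>I. f i (x \<oplus>\<^bsub>M\<^esub> y)) = (\<Oplus>\<^bsub>N\<^esub>i\<in>I. f i x) \<oplus>\<^bsub>N\<^esub> (\<Oplus>\<^bsub>N\<^esub>i\<in>I. f i y)" .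
qed

section \<open>Contraction with a linear form\<close>

text \<open>\<open>contract N g\<close> is \<open>g \<otimes> N\<close> followed by the identification of \<open>A \<otimes> N\<close> with \<open>N\<close>.\<close>

abbreviation contract where "contract N g \<equiv> tensor_lift N (\<lambda>y t. g y \<odot>\<^bsub>N\<^esub> t)"

context
  fixes A :: "('a, 'x) ring_scheme" and M :: "('l, 'm, 'a, 'y) bimod_scheme" and N :: "('a, 'n, 's, 'z) bimod_scheme"
    and g :: "'m \<Rightarrow> 'a"
  assumes M: "right_module A M" and N: "left_module A N" and g: "right_linear A M (regular A) g"
begin

private lemma g_closed: "y \<in> carrier M \<Longrightarrow> g y \<in> carrier A"
  using right_linear_closed[OF g] by simp

private lemma contract_balanced: "balanced A M N N (\<lambda>y t. g y \<odot>\<^bsub>N\<^esub> t)"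
proof (rule balancedI)
  interpret A: ring A by (rule lmod_ring[OF N])
  show "additive_map M N (\<lambda>y. g y \<odot>\<^bsub>N\<^esub> t)" if "t \<in> carrier N" for t
    using that right_linear_add[OF g]
    by (intro additive_mapI) (simp_all add: g_closed lmod_closed[OF N] lmod_scalar_add[OF N])
qed (simp_all add: g_closed lmod_additive[OF N] right_linear_rsmult[OF g] lmod_mult[OF N])

lemma contract_additive: "additive_map (tensor A M N) N (contract N g)"
  by (rule tensor_lift(1)[OF M N lmod_group[OF N] contract_balanced])

lemma contract_pure: "y \<in> carrier M \<Longrightarrow> t \<in> carrier N \<Longrightarrow> contract N g (pure A M N y t) = g y \<odot>\<^bsub>N\<^esub> t"
  by (rule tensor_lift(2)[OF M N lmod_group[OF N] contract_balanced])

end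

section \<open>Colinear maps into the coring\<close>

context comodule
begin

abbreviation "CC \<equiv> tensor A C C"

lemma CC_bimodule: "bimodule A A CC" by (rule tensor_bimodule[OF C_bimodule C_bimodule])

lemmas C_group = rmod_group[OF C_right] and P_group = rmod_group[OF P_module]
lemmas PC_group = tensor_C_group[OF P_module] and PC_module = tensor_C_module[OF P_module]
lemmas PC_additive = tensor_C_additive[OF P_module] and PC_pure = tensor_C_pure[OF P_module]
lemmas PC_closed = pure_closed[OF P_module C_left]

lemma coassoc:
  "x \<in> carrier P \<Longrightarrow> tensor_assoc A A P C C (tensor_map A (tensor A P C) C \<rho> (\<lambda>c. c) (\<rho> x)) =
     tensor_map A P CC (\<lambda>y. y) (comult C) (\<rho> x)"
  using comodule by (simp add: right_comodule_def)

lemma coact_counit: "x \<in> carrier P \<Longrightarrow> tensor_lift P (\<lambda>y c. y \<odot>\<^sub>r\<^bsub>P\<^esub> counit C c) (\<rho> x) = x"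
  using comodule by (simp add: right_comodule_def)

text \<open>The colinear map \<open>P \<rightarrow> C\<close> that corresponds to a linear form on \<open>P\<close>.\<close>

definition hat where "hat g = (\<lambda>x\<in>carrier P. contract C g (\<rho> x))"

lemmas contractX = contract_additive[OF P_module C_left X_linear] contract_pure[OF P_module C_left X_linear]
lemmas contractXC = contract_additive[OF P_module bimod_left[OF CC_bimodule] X_linear]
  contract_pure[OF P_module bimod_left[OF CC_bimodule] X_linear]

lemma contract_right_linear:
  assumes g: "g \<in> carrier X"
  shows "right_linear A (tensor A P C) C (contract C g)"
  unfolding right_linear_def
proof (intro conjI ballI)
  show ad: "additive_map (tensor A P C) C (contract C g)" by (rule contractX(1)[OF g])
  fix a t assume a: "a \<in> carrier A" and t: "t \<in> carrier (tensor A P C)"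
  show "contract C g (t \<odot>\<^sub>r\<^bsub>tensor A P C\<^esub> a) = contract C g t \<odot>\<^sub>r\<^bsub>C\<^esub> a"
    by (rule tensor_eqI[OF P_module C_left additive_map_comp[OF rmod_additive[OF PC_module a] ad]
        additive_map_comp[OF ad rmod_additive[OF C_right a]] _ t])
      (simp add: rsmult_pure[OF P_module C_bimodule a] contractX(2)[OF g] rmod_closed[OF C_right a]
        bimod_assoc[OF C_bimodule] X_closed[OF g] a)
qed

lemma hat_linear: "g \<in> carrier X \<Longrightarrow> right_linear A P C (hat g)"
  unfolding hat_def
  by (rule right_linear_restrict[OF P_module right_linear_comp[OF coact_linear contract_right_linear]])

lemma hat_apply: "x \<in> carrier P \<Longrightarrow> hat g x = contract C g (\<rho> x)"
  by (simp add: hat_def)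

lemma hat_C: "g \<in> carrier X \<Longrightarrow> x \<in> carrier P \<Longrightarrow> hat g x \<in> carrier C"
  by (rule right_linear_closed[OF hat_linear])

lemma comult_contract:
  assumes g: "g \<in> carrier X" and w: "w \<in> carrier (tensor A P C)"
  shows "comult C (contract C g w) = contract CC g (tensor_map A P CC (\<lambda>y. y) (comult C) w)"
proof -
  note CCl = bimod_left[OF CC_bimodule]
  note cl = right_linear_ident[of A P] comult_left_linear
  note m = tensor_map_additive[OF P_module C_left P_module CCl cl] tensor_map_pure[OF P_module C_left P_module CCl cl]
  show ?thesis
    by (rule tensor_eqI[OF P_module C_left additive_map_comp[OF contractX(1)[OF g] right_linear_additive[OF comult_linear]]
        additive_map_comp[OF m(1) contractXC(1)[OF g]] _ w])
      (simp add: m(2) contractX(2)[OF g] contractXC(2)[OF g] left_linear_smult[OF comult_left_linear] X_closed[OF g]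
        left_linear_closed[OF comult_left_linear])
qed

lemma contract_assoc:
  assumes g: "g \<in> carrier X" and u: "u \<in> carrier (tensor A (tensor A P C) C)"
  shows "contract CC g (tensor_assoc A A P C C u) = tensor_map A C C (contract C g) (\<lambda>c. c) u"
proof -
  note as = tensor_assoc_additive[OF P_module C_bimodule C_left] tensor_assoc_pure[OF P_module C_bimodule C_left]
  note l = contract_right_linear[OF g]
  show ?thesis
    by (rule tensor3_eqI[OF P_module C_bimodule C_left additive_map_comp[OF as(1) contractXC(1)[OF g]]
        tensor_C_additive[OF PC_module C_right l] _ u])
      (simp add: as(2) contractXC(2)[OF g] pure_closed[OF C_right C_left] smult_pure[OF C_bimodule C_left]
        tensor_C_pure[OF PC_module C_right l] PC_closed contractX(2)[OF g] X_closed[OF g])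
qed

text \<open>Coassociativity of \<open>\<rho>\<close>, contracted with \<open>g\<close> in the first of its three factors.\<close>

lemma comult_hat:
  assumes g: "g \<in> carrier X" and x: "x \<in> carrier P"
  shows "comult C (hat g x) = tensor_map A C C (hat g) (\<lambda>c. c) (\<rho> x)"
proof -
  note l = contract_right_linear[OF g]
  have w: "tensor_map A (tensor A P C) C \<rho> (\<lambda>c. c) (\<rho> x) \<in> carrier (tensor A (tensor A P C) C)"
    by (rule additive_map_closed[OF PC_additive[OF PC_module coact_linear] coact_closed[OF x]])
  have "comult C (hat g x) = contract CC g (tensor_assoc A A P C C (tensor_map A (tensor A P C) C \<rho> (\<lambda>c. c) (\<rho> x)))"
    by (simp add: hat_apply x comult_contract[OF g coact_closed[OF x]] coassoc)
  also have "\<dots> = tensor_map A C C (contract C g) (\<lambda>c. c) (tensor_map A (tensor A P C) C \<rho> (\<lambda>c. c) (\<rho> x))"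
    by (rule contract_assoc[OF g w])
  also have "\<dots> = tensor_map A C C (\<lambda>x. contract C g (\<rho> x)) (\<lambda>c. c) (\<rho> x)"
    by (rule tensor_C_comp[OF P_module PC_module C_right coact_linear l coact_closed[OF x]])
  also have "\<dots> = tensor_map A C C (hat g) (\<lambda>c. c) (\<rho> x)"
    by (rule tensor_C_cong[OF P_module C_right hat_linear[OF g] _ coact_closed[OF x]]) (simp add: hat_apply)
  finally show ?thesis .
qed

lemma hat_H: "g \<in> carrier X \<Longrightarrow> hat g \<in> carrier H"
  using hat_linear comult_hat by (auto simp: right_colinear_def hat_def)

definition unhat where "unhat f = (\<lambda>x\<in>carrier P. counit C (f x))"

lemma unhat_X: "f \<in> carrier H \<Longrightarrow> unhat f \<in> carrier X"
  using right_linear_restrict[OF P_module right_linear_comp[OF H_linear counit_right]]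
  by (simp add: unhat_def)

text \<open>Colinearity of \<open>f\<close>, followed by \<open>\<epsilon> \<otimes> C\<close>.\<close>

lemma hat_unhat:
  assumes f: "f \<in> carrier H"
  shows "hat (unhat f) = f"
proof (rule extensionalityI[of _ "carrier P"])
  show "hat (unhat f) \<in> extensional (carrier P)" "f \<in> extensional (carrier P)"
    using f by (simp_all add: hat_def)
  fix x assume x: "x \<in> carrier P"
  note cc = contract_additive[OF C_right C_left counit_right] contract_pure[OF C_right C_left counit_right]
  have "contract C (unhat f) w = contract C (counit C) (tensor_map A C C f (\<lambda>c. c) w)"
    if w: "w \<in> carrier (tensor A P C)" for w
    by (rule tensor_eqI[OF P_module C_left contractX(1)[OF unhat_X[OF f]]
        additive_map_comp[OF PC_additive[OF C_right H_linear[OF f]] cc(1)] _ w])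
      (simp only: contractX(2)[OF unhat_X[OF f]] PC_pure[OF C_right H_linear[OF f]],
       simp add: cc(2) H_closed[OF f] unhat_def)
  then show "hat (unhat f) x = f x"
    using f x counit_comult[OF H_closed[OF f x]] coact_closed[OF x]
    by (simp add: hat_apply right_colinear_def)
qed

text \<open>The counit axiom of \<open>P\<close>, contracted with \<open>g\<close>.\<close>

lemma counit_hat:
  assumes g: "g \<in> carrier X" and x: "x \<in> carrier P"
  shows "counit C (hat g x) = g x"
proof -
  have contract_balanced: "balanced A P C P (\<lambda>y c. y \<odot>\<^sub>r\<^bsub>P\<^esub> counit C c)"
  proof (rule balancedI)
    show "additive_map C P (\<lambda>c. y \<odot>\<^sub>r\<^bsub>P\<^esub> counit C c)" if "y \<in> carrier P" for y
      using left_linear_add[OF counit_left] that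
      by (intro additive_mapI) (simp_all add: counit_closed rmod_closed[OF P_module] rmod_scalar_add[OF P_module])
  qed (simp_all add: rmod_additive[OF P_module] counit_closed left_linear_smult[OF counit_left] rmod_mult[OF P_module])
  note l = tensor_lift[OF P_module C_left P_group contract_balanced]
  have "counit C (contract C g w) = g (tensor_lift P (\<lambda>y c. y \<odot>\<^sub>r\<^bsub>P\<^esub> counit C c) w)"
    if w: "w \<in> carrier (tensor A P C)" for w
    by (rule tensor_eqI[OF P_module C_left additive_map_comp[OF contractX(1)[OF g] left_linear_additive[OF counit_left]]
        additive_map_comp[OF l(1) right_linear_additive[OF X_linear[OF g]]] _ w])
      (simp add: contractX(2)[OF g] l(2) left_linear_smult[OF counit_left] X_closed[OF g]
        right_linear_rsmult[OF X_linear[OF g]] counit_closed)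
  then show ?thesis using x coact_counit coact_closed by (simp add: hat_apply)
qed

lemma unhat_hat: "g \<in> carrier X \<Longrightarrow> unhat (hat g) = g"
  by (rule extensionalityI[of _ "carrier P"]) (simp_all add: unhat_def counit_hat)

lemma hat_add:
  assumes g: "g \<in> carrier X" and h: "h \<in> carrier X" and x: "x \<in> carrier P"
  shows "hat (g \<oplus>\<^bsub>X\<^esub> h) x = hat g x \<oplus>\<^bsub>C\<^esub> hat h x"
proof -
  interpret X: abelian_group X by (rule lmod_group[OF bimod_left[OF X_bimodule]])
  note gh = X.a_closed[OF g h]
  have "contract C (g \<oplus>\<^bsub>X\<^esub> h) w = contract C g w \<oplus>\<^bsub>C\<^esub> contract C h w" if w: "w \<in> carrier (tensor A P C)" for w
    by (rule tensor_eqI[OF P_module C_left contractX(1)[OF gh] additive_map_plus[OF contractX(1)[OF g] contractX(1)[OF h] C_group] _ w])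
      (simp only: contractX(2)[OF gh] contractX(2)[OF g] contractX(2)[OF h],
       simp add: lmod_scalar_add[OF C_left] X_closed[OF g] X_closed[OF h])
  then show ?thesis using x coact_closed unfolding hat_apply[OF x] by blast
qed

lemma hat_smult:
  assumes g: "g \<in> carrier X" and a: "a \<in> carrier A" and x: "x \<in> carrier P"
  shows "hat (a \<odot>\<^bsub>X\<^esub> g) x = a \<odot>\<^bsub>C\<^esub> hat g x"
proof -
  note gh = lmod_closed[OF bimod_left[OF X_bimodule] a g]
  have "contract C (a \<odot>\<^bsub>X\<^esub> g) w = a \<odot>\<^bsub>C\<^esub> contract C g w" if w: "w \<in> carrier (tensor A P C)" for w
    by (rule tensor_eqI[OF P_module C_left contractX(1)[OF gh] additive_map_comp[OF contractX(1)[OF g] lmod_additive[OF C_left a]] _ w])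
      (simp only: contractX(2)[OF gh] contractX(2)[OF g], simp add: lmod_mult[OF C_left] X_closed[OF g] a)
  then show ?thesis using x coact_closed unfolding hat_apply[OF x] by blast
qed

lemma contract_comp:
  assumes g: "g \<in> carrier X" and s: "right_linear A P P s" and w: "w \<in> carrier (tensor A P C)"
  shows "contract C (compose (carrier P) g s) w = contract C g (tensor_map A P C s (\<lambda>c. c) w)"
proof -
  have sc: "s y \<in> carrier P" if "y \<in> carrier P" for y
    by (rule right_linear_closed[OF s that])
  have gs: "compose (carrier P) g s \<in> carrier X"
    using right_linear_cong[OF right_linear_comp[OF s X_linear[OF g]] _ P_module] by (auto simp: compose_def)
  show ?thesis
    by (rule tensor_eqI[OF P_module C_left contractX(1)[OF gs] additive_map_comp[OF PC_additive[OF P_module s] contractX(1)[OF g]] _ w])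
      (simp only: contractX(2)[OF gs] contractX(2)[OF g] PC_pure[OF P_module s] sc, simp add: compose_def)
qed

lemma hat_rsmult:
  assumes g: "g \<in> carrier X" and s: "s \<in> carrier S" and x: "x \<in> carrier P"
  shows "hat (g \<odot>\<^sub>r\<^bsub>X\<^esub> s) x = hat g (s x)"
  using contract_comp[OF g S_linear[OF s] coact_closed[OF x]] s x S_closed[OF s x]
  by (simp add: hat_apply right_colinear_def)

text \<open>Together with its inverse \<open>unhat\<close>, this is the isomorphism \<open>P\<^sup>* = Hom\<^sup>C(P, C)\<close> of right \<open>S\<close>-modules.\<close>

lemma hat_right_linear: "right_linear S X H hat"
  unfolding right_linear_def
proof (intro conjI ballI additive_mapI)
  interpret X: abelian_group X by (rule lmod_group[OF bimod_left[OF X_bimodule]])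
  interpret H: abelian_group H by (rule rmod_group[OF H_module])
  fix g assume g: "g \<in> carrier X"
  then show "hat g \<in> carrier H" by (rule hat_H)
  show "hat (g \<oplus>\<^bsub>X\<^esub> h) = hat g \<oplus>\<^bsub>H\<^esub> hat h" if h: "h \<in> carrier X" for h
    using hat_add[OF g h] by (intro extensionalityI[of _ "carrier P"]) (auto simp: hat_def)
  show "hat (g \<odot>\<^sub>r\<^bsub>X\<^esub> s) = hat g \<odot>\<^sub>r\<^bsub>H\<^esub> s" if s: "s \<in> carrier S" for s
    using hat_rsmult[OF g s] by (intro extensionalityI[of _ "carrier P"]) (auto simp: hat_def compose_def)
qed

lemma unhat_right_linear: "right_linear S H X unhat"
  unfolding right_linear_def
proof (intro conjI ballI additive_mapI)
  fix f assume f: "f \<in> carrier H"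
  then show "unhat f \<in> carrier X" by (rule unhat_X)
  show "unhat (f \<oplus>\<^bsub>H\<^esub> h) = unhat f \<oplus>\<^bsub>X\<^esub> unhat h" if h: "h \<in> carrier H" for h
    by (rule extensionalityI[of _ "carrier P"])
      (simp_all add: unhat_def H_closed[OF f] H_closed[OF h] left_linear_add[OF counit_left])
  show "unhat (f \<odot>\<^sub>r\<^bsub>H\<^esub> s) = unhat f \<odot>\<^sub>r\<^bsub>X\<^esub> s" if s: "s \<in> carrier S" for s
    by (rule extensionalityI[of _ "carrier P"]) (simp_all add: unhat_def compose_def S_closed[OF s])
qed

end

section \<open>The dual comodule and its endomorphisms\<close>

locale fg_comodule = comodule A C P \<rho>
  for A :: "('a, 'x) ring_scheme" and C :: "('a, 'c) coring" and P :: "('l, 'p, 'a) bimod" and \<rho> +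
  fixes n :: nat and p :: "nat \<Rightarrow> 'p" and \<pi> :: "nat \<Rightarrow> 'p \<Rightarrow> 'a"
  assumes basis: "dual_basis A P n p \<pi>"
begin

abbreviation "\<rho>X \<equiv> dual_coaction_wrt A C P \<rho> n p \<pi>"

lemma p_closed: "i < n \<Longrightarrow> p i \<in> carrier P"
  and \<pi>_closed: "i < n \<Longrightarrow> \<pi> i \<in> carrier X"
  and expand: "x \<in> carrier P \<Longrightarrow> (\<Oplus>\<^bsub>P\<^esub>i\<in>{..<n}. p i \<odot>\<^sub>r\<^bsub>P\<^esub> \<pi> i x) = x"
  using basis unfolding dual_basis_def by (blast, blast, metis)

lemmas X_left = bimod_left[OF X_bimodule] and X_right = bimod_right[OF X_bimodule]
lemmas X_group = lmod_group[OF X_left]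

lemma X_ext: "g \<in> carrier X \<Longrightarrow> g \<in> extensional (carrier P)"
  by simp

text \<open>The expansions below are all instances of \<open>f = f \<circ> (\<Sum> p\<^sub>i \<pi>\<^sub>i)\<close>.\<close>

lemma linear_expand:
  assumes M: "right_module A M" and f: "right_linear A P M f" and x: "x \<in> carrier P"
  shows "(\<Oplus>\<^bsub>M\<^esub>i\<in>{..<n}. f (p i) \<odot>\<^sub>r\<^bsub>M\<^esub> \<pi> i x) = f x"
proof -
  have "f (\<Oplus>\<^bsub>P\<^esub>i\<in>{..<n}. p i \<odot>\<^sub>r\<^bsub>P\<^esub> \<pi> i x) = (\<Oplus>\<^bsub>M\<^esub>i\<in>{..<n}. f (p i \<odot>\<^sub>r\<^bsub>P\<^esub> \<pi> i x))"
    using x by (intro additive_map_sum[OF right_linear_additive[OF f] P_group rmod_group[OF M]])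
      (simp add: rmod_closed[OF P_module] p_closed X_closed[OF \<pi>_closed])
  also have "\<dots> = (\<Oplus>\<^bsub>M\<^esub>i\<in>{..<n}. f (p i) \<odot>\<^sub>r\<^bsub>M\<^esub> \<pi> i x)"
    using x by (intro finsum_eqI[OF rmod_group[OF M]])
      (simp_all add: right_linear_rsmult[OF f] p_closed X_closed[OF \<pi>_closed] rmod_closed[OF M]
        right_linear_closed[OF f])
  finally show ?thesis using expand[OF x] by simp
qed

lemma X_eval_additive: "x \<in> carrier P \<Longrightarrow> additive_map X (regular A) (\<lambda>g. g x)"
  by (rule additive_mapI) (simp_all add: X_closed[simplified])

lemma X_eval_left_linear: "x \<in> carrier P \<Longrightarrow> left_linear A X (regular A) (\<lambda>g. g x)"
  unfolding left_linear_def by (simp add: X_eval_additive)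

lemma X_sum_apply:
  assumes "\<And>i. i \<in> I \<Longrightarrow> h i \<in> carrier X" "x \<in> carrier P"
  shows "(\<Oplus>\<^bsub>X\<^esub>i\<in>I. h i) x = (\<Oplus>\<^bsub>regular A\<^esub>i\<in>I. h i x)"
  by (rule additive_map_sum[OF X_eval_additive[OF assms(2)] X_group lmod_group[OF bimod_left[OF regular_bimodule[OF A_ring]]] assms(1)])

lemma form_expand:
  assumes g: "g \<in> carrier X"
  shows "(\<Oplus>\<^bsub>X\<^esub>i\<in>{..<n}. g (p i) \<odot>\<^bsub>X\<^esub> \<pi> i) = g"
proof (rule extensionalityI[of _ "carrier P"])
  have c: "g (p i) \<odot>\<^bsub>X\<^esub> \<pi> i \<in> carrier X" if "i \<in> {..<n}" for i
    using that by (intro lmod_closed[OF X_left] \<pi>_closed) (auto simp: X_closed[OF g] p_closed)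
  show "(\<Oplus>\<^bsub>X\<^esub>i\<in>{..<n}. g (p i) \<odot>\<^bsub>X\<^esub> \<pi> i) \<in> extensional (carrier P)" "g \<in> extensional (carrier P)"
    by (rule X_ext[OF finsum_in[OF X_group c]]) (assumption, rule X_ext[OF g])
  fix x assume x: "x \<in> carrier P"
  note rg = regular_bimodule[OF A_ring]
  show "(\<Oplus>\<^bsub>X\<^esub>i\<in>{..<n}. g (p i) \<odot>\<^bsub>X\<^esub> \<pi> i) x = g x"
    using X_sum_apply[of "{..<n}" "\<lambda>i. g (p i) \<odot>\<^bsub>X\<^esub> \<pi> i" x] c x
      linear_expand[OF bimod_right[OF rg] X_linear[OF g] x] x by simp
qed

lemma linear_form_expand:
  assumes K: "left_module A K" and h: "left_linear A X K h" and g: "g \<in> carrier X"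
  shows "(\<Oplus>\<^bsub>K\<^esub>i\<in>{..<n}. g (p i) \<odot>\<^bsub>K\<^esub> h (\<pi> i)) = h g"
proof -
  have "h (\<Oplus>\<^bsub>X\<^esub>i\<in>{..<n}. g (p i) \<odot>\<^bsub>X\<^esub> \<pi> i) = (\<Oplus>\<^bsub>K\<^esub>i\<in>{..<n}. h (g (p i) \<odot>\<^bsub>X\<^esub> \<pi> i))"
    by (intro additive_map_sum[OF left_linear_additive[OF h] X_group lmod_group[OF K]] lmod_closed[OF X_left] \<pi>_closed)
      (auto simp: X_closed[OF g] p_closed)
  also have "\<dots> = (\<Oplus>\<^bsub>K\<^esub>i\<in>{..<n}. g (p i) \<odot>\<^bsub>K\<^esub> h (\<pi> i))"
    by (intro finsum_eqI[OF lmod_group[OF K]] left_linear_smult[OF h] lmod_closed[OF K] \<pi>_closed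
        left_linear_closed[OF h])
      (auto simp: X_closed[OF g] p_closed)
  finally show ?thesis using form_expand[OF g] by simp
qed

text \<open>The isomorphism \<open>M \<otimes> P\<^sup>* = Hom(P, M)\<close>: a tensor is recovered from the map \<open>x \<mapsto> \<Sum> m\<^sub>i h\<^sub>i(x)\<close>.\<close>

lemma dual_tensor_expand:
  assumes M: "right_module A M" and I: "finite I"
    and m: "\<And>i. i \<in> I \<Longrightarrow> m i \<in> carrier M" and h: "\<And>i. i \<in> I \<Longrightarrow> h i \<in> carrier X"
    and f: "\<And>x. x \<in> carrier P \<Longrightarrow> f x = (\<Oplus>\<^bsub>M\<^esub>i\<in>I. m i \<odot>\<^sub>r\<^bsub>M\<^esub> h i x)"
  shows "(\<Oplus>\<^bsub>tensor A M X\<^esub>j\<in>{..<n}. pure A M X (f (p j)) (\<pi> j)) = (\<Oplus>\<^bsub>tensor A M X\<^esub>i\<in>I. pure A M X (m i) (h i))"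
proof -
  let ?T = "tensor A M X"
  note G = tensor_group[OF M X_left] and pc = pure_closed[OF M X_left]
  have mh: "m i \<odot>\<^sub>r\<^bsub>M\<^esub> h i x \<in> carrier M" if "i \<in> I" "x \<in> carrier P" for i x
    using that by (intro rmod_closed[OF M] m X_closed[OF h])
  have hp: "h i (p j) \<odot>\<^bsub>X\<^esub> \<pi> j \<in> carrier X" if "i \<in> I" "j < n" for i j
    using that by (intro lmod_closed[OF X_left] \<pi>_closed X_closed[OF h] p_closed)
  have "(\<Oplus>\<^bsub>?T\<^esub>j\<in>{..<n}. pure A M X (f (p j)) (\<pi> j)) =
     (\<Oplus>\<^bsub>?T\<^esub>j\<in>{..<n}. \<Oplus>\<^bsub>?T\<^esub>i\<in>I. pure A M X (m i) (h i (p j) \<odot>\<^bsub>X\<^esub> \<pi> j))"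
  proof (rule finsum_eqI[OF G])
    fix j assume "j \<in> {..<n}"
    then have j: "j < n" by simp
    show "(\<Oplus>\<^bsub>?T\<^esub>i\<in>I. pure A M X (m i) (h i (p j) \<odot>\<^bsub>X\<^esub> \<pi> j)) \<in> carrier ?T"
      using m hp[OF _ j] by (intro finsum_in[OF G] pc)
    have "pure A M X (f (p j)) (\<pi> j) = (\<Oplus>\<^bsub>?T\<^esub>i\<in>I. pure A M X (m i \<odot>\<^sub>r\<^bsub>M\<^esub> h i (p j)) (\<pi> j))"
      unfolding f[OF p_closed[OF j]]
      by (rule additive_map_sum[OF pure_additive_left[OF M X_left \<pi>_closed[OF j]] rmod_group[OF M] G mh[OF _ p_closed[OF j]]])
    also have "\<dots> = (\<Oplus>\<^bsub>?T\<^esub>i\<in>I. pure A M X (m i) (h i (p j) \<odot>\<^bsub>X\<^esub> \<pi> j))"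
      using m hp[OF _ j] by (intro finsum_eqI[OF G] pure_balanced[OF M X_left] pc X_closed[OF h] p_closed[OF j] \<pi>_closed[OF j])
    finally show "pure A M X (f (p j)) (\<pi> j) = (\<Oplus>\<^bsub>?T\<^esub>i\<in>I. pure A M X (m i) (h i (p j) \<odot>\<^bsub>X\<^esub> \<pi> j))" .
  qed
  also have "\<dots> = (\<Oplus>\<^bsub>?T\<^esub>i\<in>I. \<Oplus>\<^bsub>?T\<^esub>j\<in>{..<n}. pure A M X (m i) (h i (p j) \<odot>\<^bsub>X\<^esub> \<pi> j))"
    using m hp by (intro finsum_swap[OF G] I pc) auto
  also have "\<dots> = (\<Oplus>\<^bsub>?T\<^esub>i\<in>I. pure A M X (m i) (h i))"
  proof (rule finsum_eqI[OF G])
    fix i assume i: "i \<in> I"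
    show "pure A M X (m i) (h i) \<in> carrier ?T" by (rule pc[OF m[OF i] h[OF i]])
    have "pure A M X (m i) (\<Oplus>\<^bsub>X\<^esub>j\<in>{..<n}. h i (p j) \<odot>\<^bsub>X\<^esub> \<pi> j) =
        (\<Oplus>\<^bsub>?T\<^esub>j\<in>{..<n}. pure A M X (m i) (h i (p j) \<odot>\<^bsub>X\<^esub> \<pi> j))"
      using hp[OF i] by (intro additive_map_sum[OF pure_additive_right[OF M X_left m[OF i]] X_group G]) auto
    then show "(\<Oplus>\<^bsub>?T\<^esub>j\<in>{..<n}. pure A M X (m i) (h i (p j) \<odot>\<^bsub>X\<^esub> \<pi> j)) = pure A M X (m i) (h i)"
      using form_expand[OF h[OF i]] by simp
  qed
  finally show ?thesis .
qed

text \<open>For \<open>f = id\<close> this shows that an element of \<open>P \<otimes> C\<close> is determined by its contractions with the forms \<open>\<pi>\<^sub>i\<close>.\<close>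

lemma tensor_expand:
  assumes M: "right_module A M" and f: "right_linear A P M f" and w: "w \<in> carrier (tensor A P C)"
  shows "(\<Oplus>\<^bsub>tensor A M C\<^esub>i\<in>{..<n}. pure A M C (f (p i)) (contract C (\<pi> i) w)) = tensor_map A M C f (\<lambda>c. c) w"
proof -
  let ?T = "tensor A M C"
  note G = tensor_C_group[OF M] and fc = right_linear_closed[OF f]
  have ad: "additive_map (tensor A P C) ?T (\<lambda>w. pure A M C (f (p i)) (contract C (\<pi> i) w))"
    if "i \<in> {..<n}" for i
    using that by (intro additive_map_comp[OF contractX(1) pure_additive_right[OF M C_left]] fc p_closed \<pi>_closed) auto
  show ?thesis
  proof (rule tensor_eqI[OF P_module C_left additive_map_sum_maps[OF G finite_lessThan ad] PC_additive[OF M f] _ w])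
    fix x c assume x: "x \<in> carrier P" and c: "c \<in> carrier C"
    have t: "f (p i) \<odot>\<^sub>r\<^bsub>M\<^esub> \<pi> i x \<in> carrier M" if "i \<in> {..<n}" for i
      using that x by (intro rmod_closed[OF M] fc p_closed X_closed \<pi>_closed) auto
    have "(\<Oplus>\<^bsub>?T\<^esub>i\<in>{..<n}. pure A M C (f (p i)) (contract C (\<pi> i) (pure A P C x c))) =
        (\<Oplus>\<^bsub>?T\<^esub>i\<in>{..<n}. pure A M C (f (p i) \<odot>\<^sub>r\<^bsub>M\<^esub> \<pi> i x) c)"
    proof (rule finsum_eqI[OF G])
      fix i assume "i \<in> {..<n}"
      then have i: "i < n" by simp
      show "pure A M C (f (p i) \<odot>\<^sub>r\<^bsub>M\<^esub> \<pi> i x) c \<in> carrier ?T"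
        using t i by (intro pure_closed[OF M C_left] c) auto
      show "pure A M C (f (p i)) (contract C (\<pi> i) (pure A P C x c)) = pure A M C (f (p i) \<odot>\<^sub>r\<^bsub>M\<^esub> \<pi> i x) c"
        unfolding contractX(2)[OF \<pi>_closed[OF i] x c]
        by (rule pure_balanced[OF M C_left fc[OF p_closed[OF i]] X_closed[OF \<pi>_closed[OF i] x] c, symmetric])
    qed
    also have "\<dots> = pure A M C (\<Oplus>\<^bsub>M\<^esub>i\<in>{..<n}. f (p i) \<odot>\<^sub>r\<^bsub>M\<^esub> \<pi> i x) c"
      by (rule additive_map_sum[OF pure_additive_left[OF M C_left c] rmod_group[OF M] G t, symmetric])
    also have "\<dots> = tensor_map A M C f (\<lambda>c. c) (pure A P C x c)"
      unfolding linear_expand[OF M f x] by (rule PC_pure[OF M f x c, symmetric])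
    finally show "(\<Oplus>\<^bsub>?T\<^esub>i\<in>{..<n}. pure A M C (f (p i)) (contract C (\<pi> i) (pure A P C x c))) =
      tensor_map A M C f (\<lambda>c. c) (pure A P C x c)" .
  qed
qed

abbreviation "CX \<equiv> tensor A C X"

lemmas CX_group = tensor_group[OF C_right X_left] and CX_closed = pure_closed[OF C_right X_left]

lemma \<rho>X_eq: "g \<in> carrier X \<Longrightarrow> \<rho>X g = (\<Oplus>\<^bsub>CX\<^esub>i\<in>{..<n}. pure A C X (hat g (p i)) (\<pi> i))"
  unfolding dual_coaction_wrt_def
  by (rule finsum_eqI[OF CX_group]) (simp_all add: hat_apply[symmetric] p_closed CX_closed hat_C \<pi>_closed[simplified])

lemma \<rho>X_summand: "g \<in> carrier X \<Longrightarrow> i \<in> {..<n} \<Longrightarrow> pure A C X (hat g (p i)) (\<pi> i) \<in> carrier CX"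
  by (intro CX_closed hat_C p_closed \<pi>_closed) auto

lemma additive_\<rho>X:
  assumes f: "additive_map CX G f" and G: "abelian_group G" and g: "g \<in> carrier X"
  shows "f (\<rho>X g) = (\<Oplus>\<^bsub>G\<^esub>i\<in>{..<n}. f (pure A C X (hat g (p i)) (\<pi> i)))"
  unfolding \<rho>X_eq[OF g] by (rule additive_map_sum[OF f CX_group G \<rho>X_summand[OF g]])

lemma \<rho>X_left_linear: "left_linear A X CX \<rho>X"
  unfolding left_linear_def
proof (intro conjI ballI additive_mapI)
  interpret CX: abelian_group CX by (rule CX_group)
  fix g assume g: "g \<in> carrier X"
  show "\<rho>X g \<in> carrier CX" unfolding \<rho>X_eq[OF g] by (rule finsum_in[OF CX_group \<rho>X_summand[OF g]])
  {
    fix h assume h: "h \<in> carrier X"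
    have gh: "g \<oplus>\<^bsub>X\<^esub> h \<in> carrier X" by (rule abelian_monoid.a_closed[OF abelian_group.axioms(1)[OF X_group] g h])
    have "\<rho>X (g \<oplus>\<^bsub>X\<^esub> h) = (\<Oplus>\<^bsub>CX\<^esub>i\<in>{..<n}. pure A C X (hat g (p i)) (\<pi> i) \<oplus>\<^bsub>CX\<^esub> pure A C X (hat h (p i)) (\<pi> i))"
      unfolding \<rho>X_eq[OF gh]
    proof (rule finsum_eqI[OF CX_group])
      fix i assume "i \<in> {..<n}"
      then have i: "i < n" by simp
      show "pure A C X (hat (g \<oplus>\<^bsub>X\<^esub> h) (p i)) (\<pi> i) = pure A C X (hat g (p i)) (\<pi> i) \<oplus>\<^bsub>CX\<^esub> pure A C X (hat h (p i)) (\<pi> i)"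
        unfolding hat_add[OF g h p_closed[OF i]]
        by (rule pure_add_left[OF C_right X_left hat_C[OF g p_closed[OF i]] hat_C[OF h p_closed[OF i]] \<pi>_closed[OF i]])
    qed (auto intro!: CX.a_closed \<rho>X_summand[OF g] \<rho>X_summand[OF h])
    also have "\<dots> = \<rho>X g \<oplus>\<^bsub>CX\<^esub> \<rho>X h"
      unfolding \<rho>X_eq[OF g] \<rho>X_eq[OF h] using \<rho>X_summand[OF g] \<rho>X_summand[OF h] by (intro CX.finsum_addf) auto
    finally show "\<rho>X (g \<oplus>\<^bsub>X\<^esub> h) = \<rho>X g \<oplus>\<^bsub>CX\<^esub> \<rho>X h" .
  next
    fix a assume a: "a \<in> carrier A"
    have ag: "a \<odot>\<^bsub>X\<^esub> g \<in> carrier X" by (rule lmod_closed[OF X_left a g])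
    show "\<rho>X (a \<odot>\<^bsub>X\<^esub> g) = a \<odot>\<^bsub>CX\<^esub> \<rho>X g"
      unfolding \<rho>X_eq[OF ag] additive_\<rho>X[OF smult_tensor_additive[OF C_bimodule X_left a] CX_group g]
    proof (rule finsum_eqI[OF CX_group])
      fix i assume "i \<in> {..<n}"
      then have i: "i < n" by simp
      show "pure A C X (hat (a \<odot>\<^bsub>X\<^esub> g) (p i)) (\<pi> i) = a \<odot>\<^bsub>CX\<^esub> pure A C X (hat g (p i)) (\<pi> i)"
        unfolding hat_smult[OF g a p_closed[OF i]]
        by (rule smult_pure[OF C_bimodule X_left a hat_C[OF g p_closed[OF i]] \<pi>_closed[OF i], symmetric])
      show "a \<odot>\<^bsub>CX\<^esub> pure A C X (hat g (p i)) (\<pi> i) \<in> carrier CX"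
        using i by (intro additive_map_closed[OF smult_tensor_additive[OF C_bimodule X_left a]] \<rho>X_summand[OF g]) auto
    qed
  }
qed

text \<open>Write \<open>g^\<close> for \<open>hat g\<close>.  Both sides are \<open>\<Sum> g^(p\<^sub>i) \<otimes> \<pi>\<^sub>i^(p\<^sub>j) \<otimes> \<pi>\<^sub>j\<close>: the right one by definition, the left one because
  colinearity of \<open>g^\<close> and the dual basis give \<open>\<Delta>(g^(p\<^sub>j)) = \<Sum> g^(p\<^sub>i) \<otimes> \<pi>\<^sub>i^(p\<^sub>j)\<close>.\<close>

lemma \<rho>X_coassoc:
  assumes g: "g \<in> carrier X"
  shows "tensor_assoc A A C C X (tensor_map A CC X (comult C) (\<lambda>y. y) (\<rho>X g)) = tensor_map A C CX (\<lambda>c. c) \<rho>X (\<rho>X g)"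
proof -
  let ?G = "tensor A C CX"
  note CXl = tensor_left_module[OF C_bimodule X_left]
  note CCr = bimod_right[OF CC_bimodule]
  note G = tensor_group[OF C_right CXl]
  note cm = comult_linear left_linear_ident[of A X]
  note m1 = tensor_map_additive[OF C_right X_left CCr X_left cm] tensor_map_pure[OF C_right X_left CCr X_left cm]
  note cm' = right_linear_ident[of A C] \<rho>X_left_linear
  note m2 = tensor_map_additive[OF C_right X_left C_right CXl cm'] tensor_map_pure[OF C_right X_left C_right CXl cm']
  note as = tensor_assoc_additive[OF C_right C_bimodule X_left] tensor_assoc_pure[OF C_right C_bimodule X_left]
  let ?t = "\<lambda>i j. pure A C CX (hat g (p i)) (pure A C X (hat (\<pi> i) (p j)) (\<pi> j))"
  have tc: "?t i j \<in> carrier ?G" if "i \<in> {..<n}" "j \<in> {..<n}" for i j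
    using that by (intro pure_closed[OF C_right CXl] hat_C g p_closed CX_closed \<pi>_closed) auto
  have "tensor_assoc A A C C X (tensor_map A CC X (comult C) (\<lambda>y. y) (\<rho>X g)) =
      (\<Oplus>\<^bsub>?G\<^esub>j\<in>{..<n}. tensor_assoc A A C C X (tensor_map A CC X (comult C) (\<lambda>y. y) (pure A C X (hat g (p j)) (\<pi> j))))"
    by (rule additive_\<rho>X[OF additive_map_comp[OF m1(1) as(1)] G g])
  also have "\<dots> = (\<Oplus>\<^bsub>?G\<^esub>j\<in>{..<n}. \<Oplus>\<^bsub>?G\<^esub>i\<in>{..<n}. ?t i j)"
  proof (rule finsum_eqI[OF G])
    fix j assume jn: "j \<in> {..<n}"
    then have j: "j < n" by simp
    show "(\<Oplus>\<^bsub>?G\<^esub>i\<in>{..<n}. ?t i j) \<in> carrier ?G" by (rule finsum_in[OF G tc[OF _ jn]])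
    let ?s = "\<lambda>i. pure A C C (hat g (p i)) (hat (\<pi> i) (p j))"
    have sc: "?s i \<in> carrier CC" if "i \<in> {..<n}" for i
      using that j by (intro pure_closed[OF C_right C_left] hat_C g p_closed \<pi>_closed) auto
    have e: "comult C (hat g (p j)) = (\<Oplus>\<^bsub>CC\<^esub>i\<in>{..<n}. ?s i)"
      unfolding comult_hat[OF g p_closed[OF j]] unfolding hat_apply[OF p_closed[OF j], of "\<pi> _"]
      by (rule tensor_expand[OF C_right hat_linear[OF g] coact_closed[OF p_closed[OF j]], symmetric])
    have "tensor_map A CC X (comult C) (\<lambda>y. y) (pure A C X (hat g (p j)) (\<pi> j)) = pure A CC X (\<Oplus>\<^bsub>CC\<^esub>i\<in>{..<n}. ?s i) (\<pi> j)"
      using m1(2)[OF hat_C[OF g p_closed[OF j]] \<pi>_closed[OF j]] e by simp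
    then have "tensor_assoc A A C C X (tensor_map A CC X (comult C) (\<lambda>y. y) (pure A C X (hat g (p j)) (\<pi> j))) =
        tensor_assoc A A C C X (pure A CC X (\<Oplus>\<^bsub>CC\<^esub>i\<in>{..<n}. ?s i) (\<pi> j))" by simp
    also have "\<dots> = (\<Oplus>\<^bsub>?G\<^esub>i\<in>{..<n}. tensor_assoc A A C C X (pure A CC X (?s i) (\<pi> j)))"
      by (rule additive_map_sum[OF additive_map_comp[OF pure_additive_left[OF CCr X_left \<pi>_closed[OF j]] as(1)]
          lmod_group[OF bimod_left[OF CC_bimodule]] G sc])
    also have "\<dots> = (\<Oplus>\<^bsub>?G\<^esub>i\<in>{..<n}. ?t i j)"
      using j jn by (intro finsum_eqI[OF G] as(2) tc hat_C g p_closed \<pi>_closed) auto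
    finally show "tensor_assoc A A C C X (tensor_map A CC X (comult C) (\<lambda>y. y) (pure A C X (hat g (p j)) (\<pi> j))) =
        (\<Oplus>\<^bsub>?G\<^esub>i\<in>{..<n}. ?t i j)" .
  qed
  also have "\<dots> = (\<Oplus>\<^bsub>?G\<^esub>i\<in>{..<n}. \<Oplus>\<^bsub>?G\<^esub>j\<in>{..<n}. ?t i j)"
    using tc by (intro finsum_swap[OF G]) auto
  also have "\<dots> = (\<Oplus>\<^bsub>?G\<^esub>i\<in>{..<n}. tensor_map A C CX (\<lambda>c. c) \<rho>X (pure A C X (hat g (p i)) (\<pi> i)))"
  proof (rule finsum_eqI[OF G])
    fix i assume "i \<in> {..<n}"
    then have i: "i < n" by simp
    have e: "tensor_map A C CX (\<lambda>c. c) \<rho>X (pure A C X (hat g (p i)) (\<pi> i)) = pure A C CX (hat g (p i)) (\<rho>X (\<pi> i))"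
      by (rule m2(2)[OF hat_C[OF g p_closed[OF i]] \<pi>_closed[OF i]])
    show "(\<Oplus>\<^bsub>?G\<^esub>j\<in>{..<n}. ?t i j) = tensor_map A C CX (\<lambda>c. c) \<rho>X (pure A C X (hat g (p i)) (\<pi> i))"
      unfolding e by (rule additive_\<rho>X[OF pure_additive_right[OF C_right CXl hat_C[OF g p_closed[OF i]]] G \<pi>_closed[OF i], symmetric])
    show "tensor_map A C CX (\<lambda>c. c) \<rho>X (pure A C X (hat g (p i)) (\<pi> i)) \<in> carrier ?G"
      using i by (intro additive_map_closed[OF m2(1)] \<rho>X_summand[OF g]) auto
  qed
  also have "\<dots> = tensor_map A C CX (\<lambda>c. c) \<rho>X (\<rho>X g)"
    by (rule additive_\<rho>X[OF m2(1) G g, symmetric])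
  finally show ?thesis .
qed

lemma dual_left_comodule: "left_comodule A C X \<rho>X"
  unfolding left_comodule_def
proof (intro conjI ballI X_left \<rho>X_left_linear \<rho>X_coassoc)
  fix g assume g: "g \<in> carrier X"
  note cc = contract_additive[OF C_right X_left counit_right] contract_pure[OF C_right X_left counit_right]
  have "contract X (counit C) (\<rho>X g) = (\<Oplus>\<^bsub>X\<^esub>i\<in>{..<n}. contract X (counit C) (pure A C X (hat g (p i)) (\<pi> i)))"
    by (rule additive_\<rho>X[OF cc(1) X_group g])
  also have "\<dots> = (\<Oplus>\<^bsub>X\<^esub>i\<in>{..<n}. g (p i) \<odot>\<^bsub>X\<^esub> \<pi> i)"
  proof (rule finsum_eqI[OF X_group])
    fix i assume "i \<in> {..<n}"
    then have i: "i < n" by simp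
    show "contract X (counit C) (pure A C X (hat g (p i)) (\<pi> i)) = g (p i) \<odot>\<^bsub>X\<^esub> \<pi> i"
      using cc(2)[OF hat_C[OF g p_closed[OF i]] \<pi>_closed[OF i]] counit_hat[OF g p_closed[OF i]] by simp
    show "g (p i) \<odot>\<^bsub>X\<^esub> \<pi> i \<in> carrier X"
      by (rule lmod_closed[OF X_left X_closed[OF g p_closed[OF i]] \<pi>_closed[OF i]])
  qed
  also have "\<dots> = g" by (rule form_expand[OF g])
  finally show "tensor_lift X (\<lambda>c y. counit C c \<odot>\<^bsub>X\<^esub> y) (\<rho>X g) = g" .
qed

abbreviation "S' \<equiv> left_comodule_End A C X \<rho>X"

lemma S'_simps [simp]:
  "carrier S' = {f \<in> extensional (carrier X). left_colinear A C X \<rho>X X \<rho>X f}"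
  by (simp add: left_comodule_End_def)

definition transpose where "transpose s = (\<lambda>g\<in>carrier X. g \<odot>\<^sub>r\<^bsub>X\<^esub> s)"

text \<open>Colinearity of the transpose of \<open>s\<close> means \<open>\<Sum> g^(s p\<^sub>j) \<otimes> \<pi>\<^sub>j = \<Sum> g^(p\<^sub>i) \<otimes> \<pi>\<^sub>i s\<close>; under
  \<open>C \<otimes> P\<^sup>* = Hom(P, C)\<close> both sides represent \<open>g^ \<circ> s\<close>.\<close>

lemma transpose_closed:
  assumes s: "s \<in> carrier S"
  shows "transpose s \<in> carrier S'"
proof -
  have l: "left_linear A X X (transpose s)"
    unfolding transpose_def
    by (rule left_linear_restrict[OF X_left bimod_right_smult_left_linear[OF X_bimodule s]])
  have "\<rho>X (transpose s g) = tensor_map A C X (\<lambda>c. c) (transpose s) (\<rho>X g)" if g: "g \<in> carrier X" for g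
  proof -
    note li = right_linear_ident[of A C] l
    note m = tensor_map_additive[OF C_right X_left C_right X_left li] tensor_map_pure[OF C_right X_left C_right X_left li]
    have gs: "g \<odot>\<^sub>r\<^bsub>X\<^esub> s \<in> carrier X" and ps: "\<And>i. i \<in> {..<n} \<Longrightarrow> \<pi> i \<odot>\<^sub>r\<^bsub>X\<^esub> s \<in> carrier X"
      by (intro rmod_closed[OF X_right] g s \<pi>_closed; simp)+
    have "\<rho>X (transpose s g) = (\<Oplus>\<^bsub>CX\<^esub>j\<in>{..<n}. pure A C X (hat (g \<odot>\<^sub>r\<^bsub>X\<^esub> s) (p j)) (\<pi> j))"
      using \<rho>X_eq[OF gs] g unfolding transpose_def by simp
    also have "\<dots> = (\<Oplus>\<^bsub>CX\<^esub>i\<in>{..<n}. pure A C X (hat g (p i)) (\<pi> i \<odot>\<^sub>r\<^bsub>X\<^esub> s))"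
    proof (rule dual_tensor_expand[OF C_right finite_lessThan _ ps])
      show "hat (g \<odot>\<^sub>r\<^bsub>X\<^esub> s) x = (\<Oplus>\<^bsub>C\<^esub>i\<in>{..<n}. hat g (p i) \<odot>\<^sub>r\<^bsub>C\<^esub> (\<pi> i \<odot>\<^sub>r\<^bsub>X\<^esub> s) x)" if x: "x \<in> carrier P" for x
        unfolding hat_rsmult[OF g s x]
        using linear_expand[OF C_right hat_linear[OF g] S_closed[OF s x]] x
        by (simp add: compose_def)
    qed (auto intro: hat_C g p_closed)
    also have "\<dots> = (\<Oplus>\<^bsub>CX\<^esub>i\<in>{..<n}. tensor_map A C X (\<lambda>c. c) (transpose s) (pure A C X (hat g (p i)) (\<pi> i)))"
    proof (rule finsum_eqI[OF CX_group])
      fix i assume i: "i \<in> {..<n}"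
      have h: "hat g (p i) \<in> carrier C" "\<pi> i \<in> carrier X" using i by (auto intro!: hat_C g p_closed simp: \<pi>_closed[simplified])
      show "pure A C X (hat g (p i)) (\<pi> i \<odot>\<^sub>r\<^bsub>X\<^esub> s) = tensor_map A C X (\<lambda>c. c) (transpose s) (pure A C X (hat g (p i)) (\<pi> i))"
        unfolding m(2)[OF h] using h(2) unfolding transpose_def by simp
      show "tensor_map A C X (\<lambda>c. c) (transpose s) (pure A C X (hat g (p i)) (\<pi> i)) \<in> carrier CX"
        by (rule additive_map_closed[OF m(1) \<rho>X_summand[OF g i]])
    qed
    also have "\<dots> = tensor_map A C X (\<lambda>c. c) (transpose s) (\<rho>X g)"
      by (rule additive_\<rho>X[OF m(1) CX_group g, symmetric])
    finally show ?thesis .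
  qed
  moreover have "transpose s \<in> extensional (carrier X)" by (simp add: transpose_def)
  ultimately show ?thesis using l by (simp add: left_colinear_def)
qed

text \<open>Since \<open>P\<close> is reflexive, \<open>\<phi>\<close> is the transpose of \<open>s(x) = \<Sum> p\<^sub>i \<phi>(\<pi>\<^sub>i)(x)\<close>.  Colinearity of \<open>\<phi>\<close>, evaluated at \<open>x\<close>,
  says that \<open>\<rho>(s x)\<close> and \<open>(s \<otimes> C) \<rho>(x)\<close> have the same contractions with all forms, so \<open>s\<close> is colinear.\<close>

lemma transpose_surj:
  assumes \<phi>: "\<phi> \<in> carrier S'"
  obtains s where "s \<in> carrier S" and "\<And>g. g \<in> carrier X \<Longrightarrow> \<phi> g = g \<odot>\<^sub>r\<^bsub>X\<^esub> s"
proof -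
  have l: "left_linear A X X \<phi>" using \<phi> by (simp add: left_colinear_def)
  have \<phi>c: "\<phi> g \<in> carrier X" if "g \<in> carrier X" for g
    by (rule left_linear_closed[OF l that])
  define s where "s = (\<lambda>x\<in>carrier P. \<Oplus>\<^bsub>P\<^esub>i\<in>{..<n}. p i \<odot>\<^sub>r\<^bsub>P\<^esub> \<phi> (\<pi> i) x)"
  have t: "p i \<odot>\<^sub>r\<^bsub>P\<^esub> \<phi> (\<pi> i) x \<in> carrier P" if "i \<in> {..<n}" "x \<in> carrier P" for i x
    using that by (intro rmod_closed[OF P_module] p_closed X_closed[OF \<phi>c] \<pi>_closed) auto
  have ap: "\<phi> g x = g (s x)" if g: "g \<in> carrier X" and x: "x \<in> carrier P" for g x
  proof -
    have "g (s x) = (\<Oplus>\<^bsub>regular A\<^esub>i\<in>{..<n}. g (p i \<odot>\<^sub>r\<^bsub>P\<^esub> \<phi> (\<pi> i) x))"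
      unfolding s_def using x additive_map_sum[OF right_linear_additive[OF X_linear[OF g]] P_group
          lmod_group[OF bimod_left[OF regular_bimodule[OF A_ring]]],
          of "{..<n}" "\<lambda>i. p i \<odot>\<^sub>r\<^bsub>P\<^esub> \<phi> (\<pi> i) x", OF t[OF _ x]] by simp
    also have "\<dots> = (\<Oplus>\<^bsub>regular A\<^esub>i\<in>{..<n}. (g (p i) \<odot>\<^bsub>X\<^esub> \<phi> (\<pi> i)) x)"
    proof (rule finsum_eqI[OF lmod_group[OF bimod_left[OF regular_bimodule[OF A_ring]]]])
      fix i assume "i \<in> {..<n}"
      then have i: "i < n" by simp
      show "g (p i \<odot>\<^sub>r\<^bsub>P\<^esub> \<phi> (\<pi> i) x) = (g (p i) \<odot>\<^bsub>X\<^esub> \<phi> (\<pi> i)) x"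
        using right_linear_rsmult[OF X_linear[OF g] X_closed[OF \<phi>c[OF \<pi>_closed[OF i]] x] p_closed[OF i]] x by simp
      show "(g (p i) \<odot>\<^bsub>X\<^esub> \<phi> (\<pi> i)) x \<in> carrier (regular A)"
        using X_closed[OF lmod_closed[OF X_left X_closed[OF g p_closed[OF i]] \<phi>c[OF \<pi>_closed[OF i]]] x] by simp
    qed
    also have "\<dots> = (\<Oplus>\<^bsub>X\<^esub>i\<in>{..<n}. g (p i) \<odot>\<^bsub>X\<^esub> \<phi> (\<pi> i)) x"
      by (intro X_sum_apply[symmetric] lmod_closed[OF X_left] X_closed[OF g] p_closed \<phi>c \<pi>_closed x) auto
    also have "\<dots> = \<phi> g x" using linear_form_expand[OF X_left l g] by simp
    finally show ?thesis by simp
  qed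
  have sc: "s x \<in> carrier P" if "x \<in> carrier P" for x
    unfolding s_def restrict_apply'[OF that] by (rule finsum_in[OF P_group t[OF _ that]])
  have sl: "right_linear A P P s"
  proof -
    have "right_linear A P P (\<lambda>x. \<Oplus>\<^bsub>P\<^esub>i\<in>{..<n}. p i \<odot>\<^sub>r\<^bsub>P\<^esub> \<phi> (\<pi> i) x)"
      unfolding right_linear_def
    proof (intro conjI ballI)
      have ph: "right_linear A P (regular A) (\<phi> (\<pi> i))" if "i < n" for i by (rule X_linear[OF \<phi>c[OF \<pi>_closed[OF that]]])
      show "additive_map P P (\<lambda>x. \<Oplus>\<^bsub>P\<^esub>i\<in>{..<n}. p i \<odot>\<^sub>r\<^bsub>P\<^esub> \<phi> (\<pi> i) x)"
      proof (rule additive_map_sum_maps[OF P_group finite_lessThan])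
        fix i assume i: "i \<in> {..<n}"
        have "additive_map (regular A) P (\<lambda>a. p i \<odot>\<^sub>r\<^bsub>P\<^esub> a)"
          using rmod_scalar_additive[OF P_module p_closed] i by (simp add: additive_map_def)
        then show "additive_map P P (\<lambda>x. p i \<odot>\<^sub>r\<^bsub>P\<^esub> \<phi> (\<pi> i) x)"
          using additive_map_comp[OF right_linear_additive[OF ph]] i by blast
      qed
      fix a x assume a: "a \<in> carrier A" and x: "x \<in> carrier P"
      have "(\<Oplus>\<^bsub>P\<^esub>i\<in>{..<n}. p i \<odot>\<^sub>r\<^bsub>P\<^esub> \<phi> (\<pi> i) x) \<odot>\<^sub>r\<^bsub>P\<^esub> a = (\<Oplus>\<^bsub>P\<^esub>i\<in>{..<n}. p i \<odot>\<^sub>r\<^bsub>P\<^esub> \<phi> (\<pi> i) x \<odot>\<^sub>r\<^bsub>P\<^esub> a)"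
        by (rule additive_map_sum[OF rmod_additive[OF P_module a] P_group P_group t[OF _ x]])
      also have "\<dots> = (\<Oplus>\<^bsub>P\<^esub>i\<in>{..<n}. p i \<odot>\<^sub>r\<^bsub>P\<^esub> \<phi> (\<pi> i) (x \<odot>\<^sub>r\<^bsub>P\<^esub> a))"
      proof (rule finsum_eqI[OF P_group])
        fix i assume i: "i \<in> {..<n}"
        then have i': "i < n" by simp
        show "p i \<odot>\<^sub>r\<^bsub>P\<^esub> \<phi> (\<pi> i) x \<odot>\<^sub>r\<^bsub>P\<^esub> a = p i \<odot>\<^sub>r\<^bsub>P\<^esub> \<phi> (\<pi> i) (x \<odot>\<^sub>r\<^bsub>P\<^esub> a)"
          using right_linear_rsmult[OF ph[OF i'] a x] rmod_mult[OF P_module X_closed[OF \<phi>c[OF \<pi>_closed[OF i']] x] a p_closed[OF i']]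
          by simp
        show "p i \<odot>\<^sub>r\<^bsub>P\<^esub> \<phi> (\<pi> i) (x \<odot>\<^sub>r\<^bsub>P\<^esub> a) \<in> carrier P" by (rule t[OF i rmod_closed[OF P_module a x]])
      qed
      finally show "(\<Oplus>\<^bsub>P\<^esub>i\<in>{..<n}. p i \<odot>\<^sub>r\<^bsub>P\<^esub> \<phi> (\<pi> i) (x \<odot>\<^sub>r\<^bsub>P\<^esub> a)) = (\<Oplus>\<^bsub>P\<^esub>i\<in>{..<n}. p i \<odot>\<^sub>r\<^bsub>P\<^esub> \<phi> (\<pi> i) x) \<odot>\<^sub>r\<^bsub>P\<^esub> a"
        by simp
    qed
    then show ?thesis unfolding s_def by (rule right_linear_restrict[OF P_module])
  qed
  have \<phi>_eq: "\<phi> g = g \<odot>\<^sub>r\<^bsub>X\<^esub> s" if g: "g \<in> carrier X" for g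
  proof (rule extensionalityI[of _ "carrier P"])
    show "\<phi> g \<in> extensional (carrier P)" using \<phi>c[OF g] by simp
  qed (simp_all add: compose_def ap[OF g])
  have \<phi>_hat: "hat (\<phi> g) x = hat g (s x)" if g: "g \<in> carrier X" and x: "x \<in> carrier P" for g x
  proof -
    have ev: "left_linear A X (regular A) (\<lambda>h. h x)" by (rule X_eval_left_linear[OF x])
    note rg = regular_bimodule[OF A_ring]
    have bal: "balanced A C X C (\<lambda>c h. c \<odot>\<^sub>r\<^bsub>C\<^esub> h x)"
    proof (rule balancedI)
      show "additive_map X C (\<lambda>h. c \<odot>\<^sub>r\<^bsub>C\<^esub> h x)" if "c \<in> carrier C" for c
        using x that by (intro additive_mapI) (auto simp: rmod_closed[OF C_right] rmod_scalar_add[OF C_right] X_closed[simplified])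
    qed (use x in \<open>auto simp: rmod_mult[OF C_right] rmod_additive[OF C_right] X_closed[simplified]\<close>)
    note ev = tensor_lift[OF C_right X_left C_group bal]
    note li = right_linear_ident[of A C] l
    note m = tensor_map_additive[OF C_right X_left C_right X_left li] tensor_map_pure[OF C_right X_left C_right X_left li]
    let ?e = "tensor_lift C (\<lambda>c h. c \<odot>\<^sub>r\<^bsub>C\<^esub> h x)"
    have sum1: "?e (\<rho>X h) = hat h x" if h: "h \<in> carrier X" for h
    proof -
      have "?e (\<rho>X h) = (\<Oplus>\<^bsub>C\<^esub>i\<in>{..<n}. ?e (pure A C X (hat h (p i)) (\<pi> i)))"
        by (rule additive_\<rho>X[OF ev(1) C_group h])
      also have "\<dots> = (\<Oplus>\<^bsub>C\<^esub>i\<in>{..<n}. hat h (p i) \<odot>\<^sub>r\<^bsub>C\<^esub> \<pi> i x)"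
        using x by (intro finsum_eqI[OF C_group] ev(2) hat_C[OF h] p_closed \<pi>_closed rmod_closed[OF C_right] X_closed) auto
      also have "\<dots> = hat h x" by (rule linear_expand[OF C_right hat_linear[OF h] x])
      finally show ?thesis .
    qed
    have "hat (\<phi> g) x = ?e (\<rho>X (\<phi> g))" by (rule sum1[OF \<phi>c[OF g], symmetric])
    also have "\<dots> = ?e (tensor_map A C X (\<lambda>c. c) \<phi> (\<rho>X g))" using \<phi> g by (simp add: left_colinear_def)
    also have "\<dots> = (\<Oplus>\<^bsub>C\<^esub>i\<in>{..<n}. ?e (tensor_map A C X (\<lambda>c. c) \<phi> (pure A C X (hat g (p i)) (\<pi> i))))"
      by (rule additive_\<rho>X[OF additive_map_comp[OF m(1) ev(1)] C_group g])
    also have "\<dots> = (\<Oplus>\<^bsub>C\<^esub>i\<in>{..<n}. hat g (p i \<odot>\<^sub>r\<^bsub>P\<^esub> \<phi> (\<pi> i) x))"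
    proof (rule finsum_eqI[OF C_group])
      fix i assume i: "i \<in> {..<n}"
      then have i': "i < n" by simp
      show "hat g (p i \<odot>\<^sub>r\<^bsub>P\<^esub> \<phi> (\<pi> i) x) \<in> carrier C" by (rule hat_C[OF g t[OF i x]])
      show "?e (tensor_map A C X (\<lambda>c. c) \<phi> (pure A C X (hat g (p i)) (\<pi> i))) = hat g (p i \<odot>\<^sub>r\<^bsub>P\<^esub> \<phi> (\<pi> i) x)"
        using m(2)[OF hat_C[OF g p_closed[OF i']] \<pi>_closed[OF i']] ev(2)[OF hat_C[OF g p_closed[OF i']] \<phi>c[OF \<pi>_closed[OF i']]]
          right_linear_rsmult[OF hat_linear[OF g] X_closed[OF \<phi>c[OF \<pi>_closed[OF i']] x] p_closed[OF i']]
        by simp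
    qed
    also have "\<dots> = hat g (s x)"
      using additive_map_sum[OF right_linear_additive[OF hat_linear[OF g]] P_group C_group,
        of "{..<n}" "\<lambda>i. p i \<odot>\<^sub>r\<^bsub>P\<^esub> \<phi> (\<pi> i) x", OF t[OF _ x]] x
      by (simp add: s_def)
    finally show ?thesis .
  qed
  have "\<rho> (s x) = tensor_map A P C s (\<lambda>c. c) (\<rho> x)" if x: "x \<in> carrier P" for x
  proof -
    have w: "tensor_map A P C s (\<lambda>c. c) (\<rho> x) \<in> carrier (tensor A P C)"
      by (rule additive_map_closed[OF PC_additive[OF P_module sl] coact_closed[OF x]])
    have eq: "contract C (\<pi> i) (tensor_map A P C s (\<lambda>c. c) (\<rho> x)) = contract C (\<pi> i) (\<rho> (s x))" if i: "i < n" for i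
      using contract_comp[OF \<pi>_closed[OF i] sl coact_closed[OF x]] \<phi>_eq[OF \<pi>_closed[OF i]] \<phi>_hat[OF \<pi>_closed[OF i] x]
      by (simp add: hat_apply x sc)
    note id = right_linear_ident[of A P]
    have "tensor_map A P C s (\<lambda>c. c) (\<rho> x) = (\<Oplus>\<^bsub>tensor A P C\<^esub>i\<in>{..<n}. pure A P C (p i) (contract C (\<pi> i) (\<rho> (s x))))"
      using tensor_expand[OF P_module id w] tensor_map_ident[OF P_module C_left w]
        finsum_eqI[OF PC_group, of "{..<n}" "\<lambda>i. pure A P C (p i) (contract C (\<pi> i) (tensor_map A P C s (\<lambda>c. c) (\<rho> x)))"
          "\<lambda>i. pure A P C (p i) (contract C (\<pi> i) (\<rho> (s x)))"]
      by (simp add: eq PC_closed p_closed additive_map_closed[OF contractX(1)[OF \<pi>_closed]] coact_closed sc x)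
    also have "\<dots> = \<rho> (s x)"
      using tensor_expand[OF P_module id coact_closed[OF sc[OF x]]] tensor_map_ident[OF P_module C_left coact_closed[OF sc[OF x]]]
      by simp
    finally show ?thesis by simp
  qed
  then have "s \<in> carrier S" using sl by (simp add: right_colinear_def) (simp add: s_def)
  then show ?thesis using that \<phi>_eq by blast
qed

end

section \<open>Right exactness and flatness\<close>

text \<open>Sending \<open>y \<otimes> x\<close> to the class of \<open>y \<otimes> m\<close>, for any \<open>m\<close> with \<open>d m = x\<close>, defines a left inverse of the map from
  \<open>Y \<otimes> M\<close> modulo the image of \<open>Y \<otimes> M'\<close> to \<open>Y \<otimes> I\<close>.\<close>

lemma tensor_right_exact:
  assumes Y: "right_module R Y" and M': "left_module R M'" and M: "left_module R M" and I: "left_module R I"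
    and i: "left_linear R M' M i" and d: "left_linear R M I d" and surj: "d ` carrier M = carrier I"
    and ker: "\<And>m. m \<in> carrier M \<Longrightarrow> d m = \<zero>\<^bsub>I\<^esub> \<Longrightarrow> \<exists>m'\<in>carrier M'. i m' = m"
    and u: "u \<in> carrier (tensor R Y M)" and u0: "tensor_map R Y I (\<lambda>y. y) d u = \<zero>\<^bsub>tensor R Y I\<^esub>"
  shows "\<exists>t\<in>carrier (tensor R Y M'). tensor_map R Y M (\<lambda>y. y) i t = u"
proof -
  let ?T = "tensor R Y M"
  note T = tensor_group[OF Y M] and T' = tensor_group[OF Y M'] and TI = tensor_group[OF Y I]
  note idY = right_linear_ident[of R Y]
  note mi = tensor_map_additive[OF Y M' Y M idY i] tensor_map_pure[OF Y M' Y M idY i]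
  note md = tensor_map_additive[OF Y M Y I idY d] tensor_map_pure[OF Y M Y I idY d]
  interpret T: abelian_group ?T by (rule T)
  interpret M: abelian_group M by (rule lmod_group[OF M])
  interpret I: abelian_group I by (rule lmod_group[OF I])
  define W where "W = tensor_map R Y M (\<lambda>y. y) i ` carrier (tensor R Y M')"
  interpret W: abelian_subgroup W ?T
    using group_hom.img_is_subgroup[OF additive_map_hom[OF mi(1) T' T]] T
    by (intro abelian_subgroupI3 additive_subgroup.intro) (simp_all add: W_def)
  define Q where "Q = \<lparr>carrier = a_rcosets\<^bsub>?T\<^esub> W, mult = set_add ?T, one = W, zero = W, add = set_add ?T\<rparr>"
  have Q: "abelian_group Q"
  proof -
    interpret q: comm_group "?T A_Mod W" by (rule W.a_factorgroup_is_comm_group)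
    have s: "carrier (?T A_Mod W) = carrier Q" "\<one>\<^bsub>?T A_Mod W\<^esub> = zero Q" "mult (?T A_Mod W) = add Q"
      by (simp_all add: Q_def A_FactGroup_def')
    show ?thesis
      using q.m_assoc q.m_comm q.l_one q.l_inv_ex q.m_closed q.one_closed
      unfolding s by (intro abelian_groupI) auto
  qed
  have coset: "additive_map ?T Q (\<lambda>v. W +>\<^bsub>?T\<^esub> v)"
    by (rule additive_mapI) (auto simp: Q_def A_RCOSETS_def' W.a_rcos_sum)
  have eq: "W +>\<^bsub>?T\<^esub> pure R Y M y m = W +>\<^bsub>?T\<^esub> pure R Y M y m'"
    if y: "y \<in> carrier Y" and m: "m \<in> carrier M" "m' \<in> carrier M" and e: "d m = d m'" for y m m'
  proof -
    have "d (m \<ominus>\<^bsub>M\<^esub> m') = \<zero>\<^bsub>I\<^esub>"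
      using additive_map_minus[OF left_linear_additive[OF d] M.abelian_group_axioms I.abelian_group_axioms m] e
        left_linear_closed[OF d] m by (simp add: I.r_neg I.minus_eq)
    then obtain m0 where m0: "m0 \<in> carrier M'" "i m0 = m \<ominus>\<^bsub>M\<^esub> m'"
      using ker m by (meson M.minus_closed)
    have "pure R Y M y (m \<ominus>\<^bsub>M\<^esub> m') \<in> W"
      using mi(2)[OF y m0(1)] pure_closed[OF Y M' y m0(1)] m0(2) unfolding W_def by force
    moreover have "pure R Y M y (m \<ominus>\<^bsub>M\<^esub> m') = pure R Y M y m \<ominus>\<^bsub>?T\<^esub> pure R Y M y m'"
      by (rule additive_map_minus[OF pure_additive_right[OF Y M y] M.abelian_group_axioms T m])
    ultimately have "pure R Y M y m \<in> W +>\<^bsub>?T\<^esub> pure R Y M y m'"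
      using pure_closed[OF Y M y] m W.a_rcos_module by (simp add: T.minus_eq)
    then show ?thesis using W.a_repr_independence' pure_closed[OF Y M y m(2)] by metis
  qed
  define \<beta> where "\<beta> y x = W +>\<^bsub>?T\<^esub> pure R Y M y (SOME m. m \<in> carrier M \<and> d m = x)" for y x
  have \<beta>: "\<beta> y (d m) = W +>\<^bsub>?T\<^esub> pure R Y M y m" if y: "y \<in> carrier Y" and m: "m \<in> carrier M" for y m
    unfolding \<beta>_def using someI[of "\<lambda>m'. m' \<in> carrier M \<and> d m' = d m" m] m by (intro eq[OF y]) auto
  have bal: "balanced R Y I Q \<beta>"
  proof (rule balancedI)
    fix y assume y: "y \<in> carrier Y"
    note p = additive_map_comp[OF pure_additive_right[OF Y M y] coset]
    show "additive_map I Q (\<beta> y)"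
    proof (rule additive_mapI)
      fix x x' assume x: "x \<in> carrier I" "x' \<in> carrier I"
      then obtain m m' where m: "m \<in> carrier M" "x = d m" "m' \<in> carrier M" "x' = d m'" using surj by blast
      show "\<beta> y x \<in> carrier Q" using \<beta>[OF y m(1)] additive_map_closed[OF p m(1)] m(2) by simp
      have "x \<oplus>\<^bsub>I\<^esub> x' = d (m \<oplus>\<^bsub>M\<^esub> m')"
        using m left_linear_add[OF d] by simp
      then show "\<beta> y (x \<oplus>\<^bsub>I\<^esub> x') = \<beta> y x \<oplus>\<^bsub>Q\<^esub> \<beta> y x'"
        using \<beta>[OF y] m additive_map_add[OF p m(1,3)] by simp
    qed
  next
    fix x assume "x \<in> carrier I"
    then obtain m where m: "m \<in> carrier M" "x = d m" using surj by blast
    note p = additive_map_comp[OF pure_additive_left[OF Y M m(1)] coset]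
    show "additive_map Y Q (\<lambda>y. \<beta> y x)"
    proof (rule additive_mapI)
      interpret Y: abelian_group Y by (rule rmod_group[OF Y])
      fix y y' assume y: "y \<in> carrier Y" "y' \<in> carrier Y"
      show "\<beta> y x \<in> carrier Q" using \<beta>[OF y(1) m(1)] additive_map_closed[OF p y(1)] m(2) by simp
      show "\<beta> (y \<oplus>\<^bsub>Y\<^esub> y') x = \<beta> y x \<oplus>\<^bsub>Q\<^esub> \<beta> y' x"
        using \<beta>[OF _ m(1)] m(2) y additive_map_add[OF p y] by simp
    qed
  next
    fix y r x assume y: "y \<in> carrier Y" and r: "r \<in> carrier R" and "x \<in> carrier I"
    then obtain m where m: "m \<in> carrier M" "x = d m" using surj by blast
    show "\<beta> (y \<odot>\<^sub>r\<^bsub>Y\<^esub> r) x = \<beta> y (r \<odot>\<^bsub>I\<^esub> x)"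
      using \<beta>[OF rmod_closed[OF Y r y] m(1)] \<beta>[OF y lmod_closed[OF M r m(1)]] left_linear_smult[OF d r m(1)]
        pure_balanced[OF Y M y r m(1)] m(2) by simp
  qed
  note L = tensor_lift[OF Y I Q bal]
  have "tensor_lift Q \<beta> (tensor_map R Y I (\<lambda>y. y) d u) = W +>\<^bsub>?T\<^esub> u"
    by (rule tensor_eqI[OF Y M additive_map_comp[OF md(1) L(1)] coset _ u])
      (simp add: md(2) L(2) left_linear_closed[OF d] \<beta>)
  then have "W +>\<^bsub>?T\<^esub> u = W"
    unfolding u0 additive_map_zero[OF L(1) TI Q] by (simp add: Q_def)
  then have "u \<in> W" using T.a_coset_join1 u W.a_subgroup by blast
  then show ?thesis unfolding W_def by blast
qed

text \<open>Transport of structure along an injection into \<open>'u\<close>, the type on which flatness, projectivity and the Galois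
  property are tested.\<close>

definition left_copy :: "('m \<Rightarrow> 'u) \<Rightarrow> ('l, 'm, 'r, 'z) bimod_scheme \<Rightarrow> ('l, 'u, unit) bimod" where
  "left_copy j M = \<lparr>carrier = j ` carrier M, mult = undefined, one = undefined, zero = j \<zero>\<^bsub>M\<^esub>,
     add = (\<lambda>x y. j (inv_into UNIV j x \<oplus>\<^bsub>M\<^esub> inv_into UNIV j y)), smult = (\<lambda>a x. j (a \<odot>\<^bsub>M\<^esub> inv_into UNIV j x)), rsmult = undefined\<rparr>"

definition right_copy :: "('m \<Rightarrow> 'u) \<Rightarrow> ('l, 'm, 'r, 'z) bimod_scheme \<Rightarrow> (unit, 'u, 'r) bimod" where
  "right_copy j M = \<lparr>carrier = j ` carrier M, mult = undefined, one = undefined, zero = j \<zero>\<^bsub>M\<^esub>,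
     add = (\<lambda>x y. j (inv_into UNIV j x \<oplus>\<^bsub>M\<^esub> inv_into UNIV j y)), smult = undefined, rsmult = (\<lambda>x a. j (inv_into UNIV j x \<odot>\<^sub>r\<^bsub>M\<^esub> a))\<rparr>"

lemma copy_group:
  assumes "abelian_group M" and j: "inj j"
    and G: "carrier G = j ` carrier M" "zero G = j \<zero>\<^bsub>M\<^esub>" "add G = (\<lambda>x y. j (inv_into UNIV j x \<oplus>\<^bsub>M\<^esub> inv_into UNIV j y))"
  shows "abelian_group G"
proof -
  interpret abelian_group M by fact
  show ?thesis
  proof (rule abelian_groupI)
    fix x assume "x \<in> carrier G"
    then obtain m where "m \<in> carrier M" "x = j m" using G by auto
    then show "\<exists>y\<in>carrier G. y \<oplus>\<^bsub>G\<^esub> x = \<zero>\<^bsub>G\<^esub>"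
      using G j by (intro bexI[of _ "j (\<ominus>\<^bsub>M\<^esub> m)"]) (auto simp: l_neg)
  qed (use G j in \<open>auto simp: a_ac\<close>)
qed

lemma left_copy:
  assumes M: "left_module R M" and j: "inj j"
  shows "left_module R (left_copy j M)" and "left_linear R M (left_copy j M) j"
    and "left_linear R (left_copy j M) M (inv_into UNIV j)"
proof -
  interpret M: abelian_group M by (rule lmod_group[OF M])
  interpret R: ring R by (rule lmod_ring[OF M])
  have G: "abelian_group (left_copy j M)"
    by (rule copy_group[OF M.abelian_group_axioms j]) (simp_all add: left_copy_def)
  show "left_module R (left_copy j M)"
    using j M G
    by (simp add: left_module_def left_copy_def)
  show "left_linear R M (left_copy j M) j" "left_linear R (left_copy j M) M (inv_into UNIV j)"
    using j M by (auto simp: left_linear_def additive_map_def left_copy_def lmod_closed[OF M])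
qed

lemma right_copy:
  assumes M: "right_module R M" and j: "inj j"
  shows "right_module R (right_copy j M)" and "right_linear R M (right_copy j M) j"
    and "right_linear R (right_copy j M) M (inv_into UNIV j)"
proof -
  interpret M: abelian_group M by (rule rmod_group[OF M])
  interpret R: ring R by (rule rmod_ring[OF M])
  have G: "abelian_group (right_copy j M)"
    by (rule copy_group[OF M.abelian_group_axioms j]) (simp_all add: right_copy_def)
  show "right_module R (right_copy j M)"
    using j M G
    by (simp add: right_module_def right_copy_def)
  show "right_linear R M (right_copy j M) j" "right_linear R (right_copy j M) M (inv_into UNIV j)"
    using j M by (auto simp: right_linear_def additive_map_def right_copy_def rmod_closed[OF M])
qed

text \<open>Copies in \<open>'u\<close> have isomorphic tensor products, so injectivity carries over from the copies.\<close>

lemma flat_right_module_embed: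
  fixes j :: "'m \<Rightarrow> 'u" and j' :: "'n \<Rightarrow> 'u"
    and M :: "('r, 'm, 's, 'z) bimod_scheme" and N :: "('r, 'n, 's', 'z') bimod_scheme"
  assumes flat: "flat_right_module TYPE('u) R Y" and j: "inj j" and j': "inj j'"
    and M: "left_module R M" and N: "left_module R N" and f: "left_linear R M N f" and inj: "inj_on f (carrier M)"
  shows "inj_on (tensor_map R Y N (\<lambda>y. y) f) (carrier (tensor R Y M))"
proof (rule inj_onI)
  have Y: "right_module R Y" using flat by (simp add: flat_right_module_def)
  note idY = right_linear_ident[of R Y]
  let ?M = "left_copy j M" and ?N = "left_copy j' N" and ?f = "\<lambda>x. j' (f (inv_into UNIV j x))"
  note cM = left_copy[OF M j] and cN = left_copy[OF N j']
  have f': "left_linear R ?M ?N ?f" by (rule left_linear_comp[OF left_linear_comp[OF cM(3) f] cN(2)])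
  have "inj_on ?f (carrier ?M)"
  proof (rule inj_onI)
    fix x y assume "x \<in> carrier ?M" "y \<in> carrier ?M" and e: "?f x = ?f y"
    then obtain a b where ab: "a \<in> carrier M" "x = j a" "b \<in> carrier M" "y = j b" by (auto simp: left_copy_def)
    then have "f a = f b" using e j j' by (simp add: inj_eq)
    then show "x = y" using inj_onD[OF inj] ab by metis
  qed
  then have inj': "inj_on (tensor_map R Y ?N (\<lambda>y. y) ?f) (carrier (tensor R Y ?M))"
    using flat f' cM(1) cN(1) by (simp add: flat_right_module_def)
  fix t u assume t: "t \<in> carrier (tensor R Y M)" and u: "u \<in> carrier (tensor R Y M)"
    and e: "tensor_map R Y N (\<lambda>y. y) f t = tensor_map R Y N (\<lambda>y. y) f u"
  let ?J = "tensor_map R Y ?M (\<lambda>y. y) j"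
  have Jc: "?J v \<in> carrier (tensor R Y ?M)" if "v \<in> carrier (tensor R Y M)" for v
    by (rule additive_map_closed[OF tensor_map_additive[OF Y M Y cM(1) idY cM(2)] that])
  have sq: "tensor_map R Y ?N (\<lambda>y. y) ?f (?J v) = tensor_map R Y ?N (\<lambda>y. y) j' (tensor_map R Y N (\<lambda>y. y) f v)"
    if v: "v \<in> carrier (tensor R Y M)" for v
    using tensor_map_comp[OF Y M Y cM(1) Y cN(1) idY cM(2) idY f' v]
      tensor_map_comp[OF Y M Y N Y cN(1) idY f idY cN(2) v] j by simp
  have "?J t = ?J u" using inj' sq[OF t] sq[OF u] e Jc[OF t] Jc[OF u] by (auto dest: inj_onD)
  moreover have "tensor_map R Y M (\<lambda>y. y) (inv_into UNIV j) (?J v) = v" if v: "v \<in> carrier (tensor R Y M)" for v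
    using tensor_map_comp[OF Y M Y cM(1) Y M idY cM(2) idY cM(3) v] tensor_map_ident[OF Y M v] j by simp
  ultimately show "t = u" using t u by metis
qed

section \<open>Dual bases\<close>

text \<open>A section of the surjection \<open>A\<^sup>n \<rightarrow> P\<close> has the forms \<open>\<pi>\<^sub>i\<close> as components.  Elements of \<open>A\<^sup>n\<close> are functions on
  the natural numbers, which is why \<open>'u\<close> has to contain these.\<close>

lemma dual_basis_exists:
  fixes P :: "('l, 'p, 'a) bimod" and e1 :: "(nat \<Rightarrow> 'a) \<Rightarrow> 'u" and e2 :: "'p \<Rightarrow> 'u"
  assumes fg: "fin_gen_right_module A P" and proj: "projective_right_module TYPE('u) A P"
    and e1: "inj e1" and e2: "inj e2"
  shows "\<exists>n p \<pi>. dual_basis A P n p \<pi>"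
proof -
  have P: "right_module A P" using fg by (simp add: fin_gen_right_module_def)
  interpret A: ring A by (rule rmod_ring[OF P])
  interpret P: abelian_group P by (rule rmod_group[OF P])
  obtain G where G: "finite G" "G \<subseteq> carrier P"
    and gen: "\<And>x. x \<in> carrier P \<Longrightarrow> \<exists>a. a \<in> G \<rightarrow> carrier A \<and> x = (\<Oplus>\<^bsub>P\<^esub>g\<in>G. g \<odot>\<^sub>r\<^bsub>P\<^esub> a g)"
    using fg unfolding fin_gen_right_module_def by blast
  define n where "n = card G"
  obtain p where p: "bij_betw p {..<n} G"
    using ex_bij_betw_nat_finite[OF G(1)] unfolding n_def by (auto simp: lessThan_atLeast0)
  have pc: "p i \<in> carrier P" if "i \<in> {..<n}" for i using p that G by (auto simp: bij_betw_def)
  define F :: "(unit, nat \<Rightarrow> 'a, 'a) bimod" where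
    "F = \<lparr>carrier = {a \<in> extensional {..<n}. \<forall>i\<in>{..<n}. a i \<in> carrier A}, mult = undefined, one = undefined,
      zero = (\<lambda>i\<in>{..<n}. \<zero>\<^bsub>A\<^esub>), add = (\<lambda>a b. \<lambda>i\<in>{..<n}. a i \<oplus>\<^bsub>A\<^esub> b i), smult = undefined,
      rsmult = (\<lambda>a r. \<lambda>i\<in>{..<n}. a i \<otimes>\<^bsub>A\<^esub> r)\<rparr>"
  have FG: "abelian_group F"
    by (rule pointwise_abelian_group[OF A.abelian_group_axioms, of F "{..<n}"]) (auto simp: F_def)
  have F: "right_module A F"
    unfolding right_module_def
  proof (intro conjI ballI FG A.ring_axioms)
    fix a assume "a \<in> carrier F"
    then show "a \<odot>\<^sub>r\<^bsub>F\<^esub> \<one>\<^bsub>A\<^esub> = a" by (intro extensionalityI[of _ "{..<n}"]) (auto simp: F_def)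
  next
    fix r a assume "r \<in> carrier A" "a \<in> carrier F"
    then show "a \<odot>\<^sub>r\<^bsub>F\<^esub> r \<in> carrier F" by (auto simp: F_def)
  qed (auto simp: F_def A.r_distr A.l_distr A.m_assoc restrict_def fun_eq_iff)
  define \<epsilon> where "\<epsilon> a = (\<Oplus>\<^bsub>P\<^esub>i\<in>{..<n}. p i \<odot>\<^sub>r\<^bsub>P\<^esub> a i)" for a
  have ac: "a i \<in> carrier A" if "a \<in> carrier F" "i \<in> {..<n}" for a i using that by (simp add: F_def)
  have tc: "p i \<odot>\<^sub>r\<^bsub>P\<^esub> a i \<in> carrier P" if "a \<in> carrier F" "i \<in> {..<n}" for a i
    by (rule rmod_closed[OF P ac[OF that] pc[OF that(2)]])
  have \<epsilon>: "right_linear A F P \<epsilon>"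
    unfolding right_linear_def
  proof (intro conjI ballI)
    show "additive_map F P \<epsilon>"
      unfolding \<epsilon>_def
    proof (rule additive_map_sum_maps[OF P.abelian_group_axioms finite_lessThan])
      fix i assume i: "i \<in> {..<n}"
      show "additive_map F P (\<lambda>a. p i \<odot>\<^sub>r\<^bsub>P\<^esub> a i)"
        by (rule additive_mapI)
          (use i in \<open>auto simp: tc F_def rmod_scalar_add[OF P] pc rmod_closed[OF P]\<close>)
    qed
    fix r a assume r: "r \<in> carrier A" and a: "a \<in> carrier F"
    have "\<epsilon> a \<odot>\<^sub>r\<^bsub>P\<^esub> r = (\<Oplus>\<^bsub>P\<^esub>i\<in>{..<n}. p i \<odot>\<^sub>r\<^bsub>P\<^esub> a i \<odot>\<^sub>r\<^bsub>P\<^esub> r)"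
      unfolding \<epsilon>_def by (rule additive_map_sum[OF rmod_additive[OF P r] P.abelian_group_axioms P.abelian_group_axioms tc[OF a]])
    also have "\<dots> = \<epsilon> (a \<odot>\<^sub>r\<^bsub>F\<^esub> r)"
      unfolding \<epsilon>_def
      by (rule finsum_eqI[OF P.abelian_group_axioms]) (use r a in \<open>auto simp: F_def rmod_mult[OF P] pc rmod_closed[OF P]\<close>)
    finally show "\<epsilon> (a \<odot>\<^sub>r\<^bsub>F\<^esub> r) = \<epsilon> a \<odot>\<^sub>r\<^bsub>P\<^esub> r" by simp
  qed
  have surj: "\<epsilon> ` carrier F = carrier P"
  proof
    show "\<epsilon> ` carrier F \<subseteq> carrier P" using right_linear_closed[OF \<epsilon>] by blast
    show "carrier P \<subseteq> \<epsilon> ` carrier F"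
    proof
      fix x assume "x \<in> carrier P"
      then obtain a where a: "a \<in> G \<rightarrow> carrier A" "x = (\<Oplus>\<^bsub>P\<^esub>g\<in>G. g \<odot>\<^sub>r\<^bsub>P\<^esub> a g)" using gen by blast
      have Gp: "G = p ` {..<n}" and ip: "inj_on p {..<n}" using p by (auto simp: bij_betw_def)
      have "x = (\<Oplus>\<^bsub>P\<^esub>i\<in>{..<n}. p i \<odot>\<^sub>r\<^bsub>P\<^esub> a (p i))"
        unfolding a(2) Gp using a(1) G(2) by (intro P.add.finprod_reindex ip) (auto simp: Gp intro!: rmod_closed[OF P])
      also have "\<dots> = \<epsilon> (\<lambda>i\<in>{..<n}. a (p i))"
        unfolding \<epsilon>_def using a(1) by (intro finsum_eqI[OF P.abelian_group_axioms]) (auto simp: Gp intro!: rmod_closed[OF P] pc)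
      finally have "x = \<epsilon> (\<lambda>i\<in>{..<n}. a (p i))" .
      moreover have "(\<lambda>i\<in>{..<n}. a (p i)) \<in> carrier F" using a(1) by (auto simp: F_def Gp)
      ultimately show "x \<in> \<epsilon> ` carrier F" by (rule image_eqI)
    qed
  qed
  note cF = right_copy[OF F e1] and cP = right_copy[OF P e2]
  have g: "right_linear A (right_copy e1 F) (right_copy e2 P) (\<lambda>a. e2 (\<epsilon> (inv_into UNIV e1 a)))"
    by (rule right_linear_comp[OF right_linear_comp[OF cF(3) \<epsilon>] cP(2)])
  have gs: "(\<lambda>a. e2 (\<epsilon> (inv_into UNIV e1 a))) ` carrier (right_copy e1 F) = carrier (right_copy e2 P)"
  proof -
    have "(\<lambda>a. e2 (\<epsilon> (inv_into UNIV e1 a))) ` carrier (right_copy e1 F) = e2 ` \<epsilon> ` carrier F"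
      using e1 by (simp add: right_copy_def image_image)
    then show ?thesis by (simp add: surj right_copy_def)
  qed
  obtain k where k: "right_linear A P (right_copy e1 F) k" "\<And>x. x \<in> carrier P \<Longrightarrow> e2 (\<epsilon> (inv_into UNIV e1 (k x))) = e2 x"
    using proj[unfolded projective_right_module_def, THEN conjunct2, THEN spec, THEN spec, THEN spec, THEN spec,
        THEN mp, OF conjI[OF cF(1) conjI[OF cP(1) conjI[OF g conjI[OF gs cP(2)]]]]] by auto
  define k' where "k' x = inv_into UNIV e1 (k x)" for x
  have k': "right_linear A P F k'" unfolding k'_def by (rule right_linear_comp[OF k(1) cF(3)])
  have k'c: "k' x \<in> carrier F" if "x \<in> carrier P" for x
    by (rule right_linear_closed[OF k' that])
  have k'e: "\<epsilon> (k' x) = x" if "x \<in> carrier P" for x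
    using k(2)[OF that] e2 unfolding k'_def by (simp add: inj_eq)
  define \<pi> where "\<pi> i = (\<lambda>x\<in>carrier P. k' x i)" for i
  have "\<pi> i \<in> carrier (right_dual A P)" if i: "i < n" for i
  proof -
    have "right_linear A F (regular A) (\<lambda>a. a i)"
      using i by (auto simp: right_linear_def F_def intro!: additive_mapI)
    then have "right_linear A P (regular A) (\<pi> i)"
      unfolding \<pi>_def by (rule right_linear_restrict[OF P right_linear_comp[OF k']])
    then show ?thesis by (simp add: right_dual_def \<pi>_def)
  qed
  moreover have "x = (\<Oplus>\<^bsub>P\<^esub>i\<in>{..<n}. p i \<odot>\<^sub>r\<^bsub>P\<^esub> \<pi> i x)" if x: "x \<in> carrier P" for x
  proof -
    have "\<epsilon> (k' x) = (\<Oplus>\<^bsub>P\<^esub>i\<in>{..<n}. p i \<odot>\<^sub>r\<^bsub>P\<^esub> \<pi> i x)"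
      unfolding \<epsilon>_def \<pi>_def restrict_apply'[OF x] by (rule refl)
    then show ?thesis using k'e[OF x] by metis
  qed
  ultimately have "dual_basis A P n p \<pi>" unfolding dual_basis_def using pc by blast
  then show ?thesis by blast
qed

section \<open>Colinear maps into a tensor product\<close>

text \<open>The assumption \<open>eval_bimod P = P\<close> says that the left action on \<open>P\<close> is evaluation of maps, so that \<open>P\<close> itself is
  an \<open>S\<close>-\<open>A\<close>-bimodule.\<close>

locale galois_setup = fg_comodule A C P \<rho> n p \<pi>
  for A :: "('a, 'x) ring_scheme" and C :: "('a, 'c) coring" and P :: "('p \<Rightarrow> 'p, 'p, 'a) bimod" and \<rho> n p \<pi> +
  fixes B :: "('p \<Rightarrow> 'p) set"
  assumes eval_P: "eval_bimod P = P" and B: "subring B (right_comodule_End A C P \<rho>)"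
begin

abbreviation "Bs \<equiv> S\<lparr>carrier := B\<rparr>"
abbreviation "PC \<equiv> tensor A P C"
abbreviation "SB \<equiv> regular S"
abbreviation "E \<equiv> lin_hom A P P"

lemma smult_P [simp]: "smult P = (\<lambda>s x. s x)"
  by (metis E0_simps(4) eval_P)

lemma B_subset: "b \<in> B \<Longrightarrow> b \<in> carrier S"
  using subringE(1)[OF B] by blast

lemma P_bimodule: "bimodule Bs A P"
  using bimodule_left_subring[OF B E0_bimodule] eval_P by simp

lemmas P_left = bimod_left[OF P_bimodule]

lemma PC_bimodule: "bimodule Bs A PC"
  by (rule tensor_bimodule[OF P_bimodule C_bimodule])

lemmas PC_left = bimod_left[OF PC_bimodule]

lemma smult_PC: "b \<odot>\<^bsub>PC\<^esub> w = tensor_map A P C b (\<lambda>c. c) w"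
  by (simp add: smult_tensor)

lemma coact_left_linear: "left_linear Bs P PC \<rho>"
  using right_linear_additive[OF coact_linear] B_subset
  by (auto simp: left_linear_def smult_PC right_colinear_def)

text \<open>What \<open>S\<close> and \<open>Hom(P, N)\<close> have in common, so that evaluation at a point can be treated once for both.\<close>

definition map_module where
  "map_module N E' \<longleftrightarrow> left_module Bs E' \<and> (\<forall>e\<in>carrier E'. right_linear A P N e) \<and>
     (\<forall>e\<in>carrier E'. \<forall>e'\<in>carrier E'. \<forall>x\<in>carrier P. (e \<oplus>\<^bsub>E'\<^esub> e') x = e x \<oplus>\<^bsub>N\<^esub> e' x) \<and>
     (\<forall>b\<in>B. \<forall>e\<in>carrier E'. \<forall>x\<in>carrier P. (b \<odot>\<^bsub>E'\<^esub> e) x = b \<odot>\<^bsub>N\<^esub> e x)"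

lemma map_moduleD:
  assumes "map_module N E'"
  shows "left_module Bs E'"
    and "\<And>e. e \<in> carrier E' \<Longrightarrow> right_linear A P N e"
    and "\<And>e x. e \<in> carrier E' \<Longrightarrow> x \<in> carrier P \<Longrightarrow> e x \<in> carrier N"
    and "\<And>e e' x. e \<in> carrier E' \<Longrightarrow> e' \<in> carrier E' \<Longrightarrow> x \<in> carrier P \<Longrightarrow> (e \<oplus>\<^bsub>E'\<^esub> e') x = e x \<oplus>\<^bsub>N\<^esub> e' x"
    and "\<And>b e x. b \<in> B \<Longrightarrow> e \<in> carrier E' \<Longrightarrow> x \<in> carrier P \<Longrightarrow> (b \<odot>\<^bsub>E'\<^esub> e) x = b \<odot>\<^bsub>N\<^esub> e x"
proof -
  show l: "\<And>e. e \<in> carrier E' \<Longrightarrow> right_linear A P N e" using assms by (simp add: map_module_def)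
  show "\<And>e x. e \<in> carrier E' \<Longrightarrow> x \<in> carrier P \<Longrightarrow> e x \<in> carrier N"
    by (rule right_linear_closed[OF l])
qed (use assms in \<open>simp_all add: map_module_def\<close>)

lemma lin_hom_map_module: "bimodule Bs A N \<Longrightarrow> map_module N (lin_hom A P N)"
  unfolding map_module_def using lin_hom_left_module[OF P_module] by auto

lemma SB_left: "left_module Bs SB"
  by (rule left_module_subring[OF B bimod_left[OF regular_bimodule[OF S_ring]]])

lemma SB_map_module: "map_module P SB"
  unfolding map_module_def using SB_left S_linear B_subset by (auto simp: compose_def)

lemma eval_left_linear: "map_module N E' \<Longrightarrow> x \<in> carrier P \<Longrightarrow> left_linear Bs E' N (\<lambda>e. e x)"
  by (auto simp: left_linear_def map_moduleD intro!: additive_mapI)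

text \<open>Colinearity of \<open>F : P \<rightarrow> Y \<otimes> P\<close>, with the coaction \<open>Y \<otimes> \<rho>\<close> on the target.  The associativity map is kept on the
  side of \<open>F \<otimes> C\<close> because \<open>Y \<otimes> \<rho>\<close> is functorial in \<open>Y\<close> without it.\<close>

definition colin where
  "colin Y F \<longleftrightarrow> right_linear A P (tensor Bs Y P) F \<and>
     (\<forall>x\<in>carrier P. tensor_map Bs Y PC (\<lambda>y. y) \<rho> (F x) =
        tensor_assoc Bs A Y P C (tensor_map A (tensor Bs Y P) C F (\<lambda>c. c) (\<rho> x)))"

text \<open>Bijectivity of \<open>Y \<otimes> S \<rightarrow> Hom\<^sup>C(P, Y \<otimes> P)\<close>.\<close>

definition hom_tensor_bij where
  "hom_tensor_bij Y \<longleftrightarrow>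
     (\<forall>t\<in>carrier (tensor Bs Y SB). \<forall>t'\<in>carrier (tensor Bs Y SB).
        (\<forall>x\<in>carrier P. tensor_map Bs Y P (\<lambda>y. y) (\<lambda>e. e x) t = tensor_map Bs Y P (\<lambda>y. y) (\<lambda>e. e x) t') \<longrightarrow> t = t') \<and>
     (\<forall>F. colin Y F \<longrightarrow> (\<exists>t\<in>carrier (tensor Bs Y SB). \<forall>x\<in>carrier P. tensor_map Bs Y P (\<lambda>y. y) (\<lambda>e. e x) t = F x))"

context
  fixes Y :: "('y1, 'y, 'p \<Rightarrow> 'p, 'y2) bimod_scheme"
  assumes Y: "right_module Bs Y"
begin

text \<open>\<open>onY N h\<close> is \<open>Y \<otimes> h\<close>, with values in \<open>Y \<otimes> N\<close>.\<close>

abbreviation "onY N \<equiv> tensor_map Bs Y N (\<lambda>y. y)"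

abbreviation "ev N x \<equiv> onY N (\<lambda>e. e x)"

private lemmas idY = right_linear_ident[of Bs Y]

lemma ev_additive:
  assumes "map_module N E'" "left_module Bs N" "x \<in> carrier P"
  shows "additive_map (tensor Bs Y E') (tensor Bs Y N) (ev N x)"
  by (rule tensor_map_additive[OF Y map_moduleD(1)[OF assms(1)] Y assms(2) idY eval_left_linear[OF assms(1,3)]])

lemma ev_pure:
  assumes "map_module N E'" "left_module Bs N" "x \<in> carrier P" "y \<in> carrier Y" "e \<in> carrier E'"
  shows "ev N x (pure Bs Y E' y e) = pure Bs Y N y (e x)"
  by (rule tensor_map_pure[OF Y map_moduleD(1)[OF assms(1)] Y assms(2) idY eval_left_linear[OF assms(1,3)] assms(4,5)])

lemma ev_right_linear:
  assumes E': "map_module N E'" and N: "bimodule Bs A N" and u: "u \<in> carrier (tensor Bs Y E')"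
  shows "right_linear A P (tensor Bs Y N) (\<lambda>x. ev N x u)"
  unfolding right_linear_def
proof (intro conjI ballI additive_mapI)
  note El = map_moduleD(1)[OF E'] and Nl = bimod_left[OF N]
  interpret P: abelian_group P by (rule P_group)
  fix x assume x: "x \<in> carrier P"
  note l = eval_left_linear[OF E' x]
  show "ev N x u \<in> carrier (tensor Bs Y N)" by (rule additive_map_closed[OF ev_additive[OF E' Nl x] u])
  show "ev N (x \<oplus>\<^bsub>P\<^esub> x') u = ev N x u \<oplus>\<^bsub>tensor Bs Y N\<^esub> ev N x' u" if x': "x' \<in> carrier P" for x'
  proof -
    have "ev N (x \<oplus>\<^bsub>P\<^esub> x') u = onY N (\<lambda>e. e x \<oplus>\<^bsub>N\<^esub> e x') u"
      by (rule tensor_map_cong[OF Y El Y Nl idY left_linear_plus[OF Nl l eval_left_linear[OF E' x']] _ _ u])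
        (simp_all add: right_linear_add[OF map_moduleD(2)[OF E']] x x')
    then show ?thesis using tensor_map_add_right[OF Y El Y Nl idY l eval_left_linear[OF E' x'] u] by simp
  qed
  fix a assume a: "a \<in> carrier A"
  note ra = bimod_right_smult_left_linear[OF N a]
  have "ev N x u \<odot>\<^sub>r\<^bsub>tensor Bs Y N\<^esub> a = onY N (\<lambda>e. e x \<odot>\<^sub>r\<^bsub>N\<^esub> a) u"
    unfolding rsmult_tensor by (rule tensor_map_comp[OF Y El Y Nl Y Nl idY l idY ra u])
  also have "\<dots> = ev N (x \<odot>\<^sub>r\<^bsub>P\<^esub> a) u"
    by (rule tensor_map_cong[OF Y El Y Nl idY eval_left_linear[OF E' rmod_closed[OF P_module a x]] _ _ u])
      (simp_all add: right_linear_rsmult[OF map_moduleD(2)[OF E']] x a)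
  finally show "ev N (x \<odot>\<^sub>r\<^bsub>P\<^esub> a) u = ev N x u \<odot>\<^sub>r\<^bsub>tensor Bs Y N\<^esub> a" by simp
qed

text \<open>Since \<open>P\<close> is finitely generated projective, \<open>Y \<otimes> Hom(P, N) = Hom(P, Y \<otimes> N)\<close>.  The inverse of
  evaluation uses the maps \<open>N \<rightarrow> Hom(P, N)\<close> that multiply with a member of the dual basis.\<close>

definition rank1 where "rank1 N i y = (\<lambda>x\<in>carrier P. y \<odot>\<^sub>r\<^bsub>N\<^esub> \<pi> i x)"

definition unev where
  "unev N F = (\<Oplus>\<^bsub>tensor Bs Y (lin_hom A P N)\<^esub>i\<in>{..<n}. onY (lin_hom A P N) (rank1 N i) (F (p i)))"

private lemma rank1:
  assumes N: "bimodule Bs A N" and i: "i < n"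
  shows "left_linear Bs N (lin_hom A P N) (rank1 N i)"
  unfolding left_linear_def
proof (intro conjI ballI additive_mapI)
  note Nr = bimod_right[OF N]
  note lf = X_linear[OF \<pi>_closed[OF i]] and cl = X_closed[OF \<pi>_closed[OF i]]
  fix y assume y: "y \<in> carrier N"
  have "right_linear A (regular A) N (\<lambda>a. y \<odot>\<^sub>r\<^bsub>N\<^esub> a)"
    using rmod_scalar_additive[OF Nr y] rmod_mult[OF Nr] y by (simp add: right_linear_def additive_map_def)
  from right_linear_restrict[OF P_module right_linear_comp[OF lf this]]
  show "rank1 N i y \<in> carrier (lin_hom A P N)" by (simp add: rank1_def)
  show "rank1 N i (y \<oplus>\<^bsub>N\<^esub> y') = rank1 N i y \<oplus>\<^bsub>lin_hom A P N\<^esub> rank1 N i y'" if "y' \<in> carrier N" for y'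
    using y that by (simp add: rank1_def rmod_add[OF Nr] cl restrict_def fun_eq_iff)
  show "rank1 N i (b \<odot>\<^bsub>N\<^esub> y) = b \<odot>\<^bsub>lin_hom A P N\<^esub> rank1 N i y" if "b \<in> carrier Bs" for b
    using y that bimod_assoc[OF N] by (simp add: rank1_def cl restrict_def fun_eq_iff)
qed

lemma ev_unev:
  assumes N: "bimodule Bs A N" and F: "right_linear A P (tensor Bs Y N) F" and x: "x \<in> carrier P"
  shows "ev N x (unev N F) = F x" and "unev N F \<in> carrier (tensor Bs Y (lin_hom A P N))"
proof -
  let ?H = "lin_hom A P N"
  note Nl = bimod_left[OF N] and HN = lin_hom_map_module[OF N]
  note Hl = map_moduleD(1)[OF HN]
  note YN = tensor_group[OF Y Nl] and YH = tensor_group[OF Y Hl] and YNr = tensor_right_module[OF Y N]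
  have Fc: "F (p i) \<in> carrier (tensor Bs Y N)" if "i \<in> {..<n}" for i
    using that by (intro right_linear_closed[OF F] p_closed) simp
  have tc: "onY ?H (rank1 N i) (F (p i)) \<in> carrier (tensor Bs Y ?H)"
    if i: "i \<in> {..<n}" for i
    using i by (intro additive_map_closed[OF tensor_map_additive[OF Y Nl Y Hl idY rank1[OF N]]] Fc) auto
  show "unev N F \<in> carrier (tensor Bs Y ?H)"
    unfolding unev_def by (rule finsum_in[OF YH tc])
  have "ev N x (unev N F) = (\<Oplus>\<^bsub>tensor Bs Y N\<^esub>i\<in>{..<n}. ev N x (onY ?H (rank1 N i) (F (p i))))"
    unfolding unev_def by (rule additive_map_sum[OF ev_additive[OF HN Nl x] YH YN tc])
  also have "\<dots> = (\<Oplus>\<^bsub>tensor Bs Y N\<^esub>i\<in>{..<n}. F (p i) \<odot>\<^sub>r\<^bsub>tensor Bs Y N\<^esub> \<pi> i x)"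
  proof (rule finsum_eqI[OF YN])
    fix i assume i: "i \<in> {..<n}"
    then have i': "i < n" by simp
    have pa: "\<pi> i x \<in> carrier A" by (rule X_closed[OF \<pi>_closed[OF i'] x])
    show "F (p i) \<odot>\<^sub>r\<^bsub>tensor Bs Y N\<^esub> \<pi> i x \<in> carrier (tensor Bs Y N)" by (rule rmod_closed[OF YNr pa Fc[OF i]])
    show "ev N x (onY ?H (rank1 N i) (F (p i))) = F (p i) \<odot>\<^sub>r\<^bsub>tensor Bs Y N\<^esub> \<pi> i x"
      unfolding rsmult_tensor
      using tensor_map_comp[OF Y Nl Y Hl Y Nl idY rank1[OF N i'] idY eval_left_linear[OF HN x] Fc[OF i]] x
      by (simp add: rank1_def)
  qed
  also have "\<dots> = F x" by (rule linear_expand[OF YNr F x])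
  finally show "ev N x (unev N F) = F x" .
qed

text \<open>\<open>unev\<close> is also a left inverse of evaluation, by \<open>e = \<Sum> e(p\<^sub>i) \<pi>\<^sub>i\<close>.\<close>

lemma ev_inj:
  assumes N: "bimodule Bs A N"
    and u: "u \<in> carrier (tensor Bs Y (lin_hom A P N))" and v: "v \<in> carrier (tensor Bs Y (lin_hom A P N))"
    and eq: "\<And>x. x \<in> carrier P \<Longrightarrow> ev N x u = ev N x v"
  shows "u = v"
proof -
  let ?H = "lin_hom A P N"
  note Nl = bimod_left[OF N] and HN = lin_hom_map_module[OF N]
  note Hl = map_moduleD(1)[OF HN]
  note YN = tensor_group[OF Y Nl] and YH = tensor_group[OF Y Hl]
  have ad: "additive_map (tensor Bs Y ?H) (tensor Bs Y ?H)
      (\<lambda>u. onY ?H (rank1 N i) (ev N (p i) u))" if "i \<in> {..<n}" for i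
    using that by (intro additive_map_comp[OF ev_additive[OF HN Nl] tensor_map_additive[OF Y Nl Y Hl idY rank1[OF N]]] p_closed) auto
  have "unev N (\<lambda>x. ev N x u) = u" if u: "u \<in> carrier (tensor Bs Y ?H)" for u
    unfolding unev_def
  proof (rule tensor_eqI[OF Y Hl additive_map_sum_maps[OF YH finite_lessThan ad] additive_map_ident _ u])
    fix y e assume y: "y \<in> carrier Y" and e: "e \<in> carrier ?H"
    have rc: "rank1 N i (e (p i)) \<in> carrier ?H" if "i \<in> {..<n}" for i
      using that e by (intro left_linear_closed[OF rank1[OF N]] map_moduleD(3)[OF HN] p_closed) auto
    have "(\<Oplus>\<^bsub>tensor Bs Y ?H\<^esub>i\<in>{..<n}. onY ?H (rank1 N i) (ev N (p i) (pure Bs Y ?H y e))) =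
        (\<Oplus>\<^bsub>tensor Bs Y ?H\<^esub>i\<in>{..<n}. pure Bs Y ?H y (rank1 N i (e (p i))))"
    proof (rule finsum_eqI[OF YH])
      fix i assume i: "i \<in> {..<n}"
      then have i': "i < n" by simp
      show "pure Bs Y ?H y (rank1 N i (e (p i))) \<in> carrier (tensor Bs Y ?H)"
        by (rule pure_closed[OF Y Hl y rc[OF i]])
      show "onY ?H (rank1 N i) (ev N (p i) (pure Bs Y ?H y e)) =
          pure Bs Y ?H y (rank1 N i (e (p i)))"
        unfolding ev_pure[OF HN Nl p_closed[OF i'] y e]
        by (rule tensor_map_pure[OF Y Nl Y Hl idY rank1[OF N i'] y map_moduleD(3)[OF HN e p_closed[OF i']]])
    qed
    also have "\<dots> = pure Bs Y ?H y (\<Oplus>\<^bsub>?H\<^esub>i\<in>{..<n}. rank1 N i (e (p i)))"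
      by (rule additive_map_sum[OF pure_additive_right[OF Y Hl y] lmod_group[OF Hl] YH rc, symmetric])
    also have "(\<Oplus>\<^bsub>?H\<^esub>i\<in>{..<n}. rank1 N i (e (p i))) = e"
    proof (rule extensionalityI[of _ "carrier P"])
      show "(\<Oplus>\<^bsub>?H\<^esub>i\<in>{..<n}. rank1 N i (e (p i))) \<in> extensional (carrier P)" "e \<in> extensional (carrier P)"
        using finsum_in[OF lmod_group[OF Hl], of "{..<n}" "\<lambda>i. rank1 N i (e (p i))"] rc e by auto
      fix x assume x: "x \<in> carrier P"
      have "(\<Oplus>\<^bsub>?H\<^esub>i\<in>{..<n}. rank1 N i (e (p i))) x = (\<Oplus>\<^bsub>N\<^esub>i\<in>{..<n}. rank1 N i (e (p i)) x)"
        by (rule additive_map_sum[OF left_linear_additive[OF eval_left_linear[OF HN x]] lmod_group[OF Hl] lmod_group[OF Nl] rc])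
      also have "\<dots> = e x"
        using linear_expand[OF bimod_right[OF N] map_moduleD(2)[OF HN e] x] x by (simp add: rank1_def)
      finally show "(\<Oplus>\<^bsub>?H\<^esub>i\<in>{..<n}. rank1 N i (e (p i))) x = e x" .
    qed
    finally show "(\<Oplus>\<^bsub>tensor Bs Y ?H\<^esub>i\<in>{..<n}. onY ?H (rank1 N i) (ev N (p i) (pure Bs Y ?H y e))) =
      pure Bs Y ?H y e" .
  qed
  note r = this
  have "unev N (\<lambda>x. ev N x u) = unev N (\<lambda>x. ev N x v)"
    unfolding unev_def
    by (rule finsum_eqI[OF YH]) (auto simp: eq p_closed intro!: additive_map_closed[OF ad] v)
  then show ?thesis using r[OF u] r[OF v] by simp
qed

abbreviation "YP \<equiv> tensor Bs Y P"
abbreviation "YPC \<equiv> tensor Bs Y PC"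
abbreviation "assocY \<equiv> tensor_assoc Bs A Y P C"
abbreviation "coextend w \<equiv> (\<lambda>e. tensor_map A P C e (\<lambda>c. c) w)"

lemma YP_module: "right_module A YP"
  by (rule tensor_right_module[OF Y P_bimodule])

lemma coextend_left_linear:
  assumes E': "map_module P E'" and w: "w \<in> carrier PC"
  shows "left_linear Bs E' PC (coextend w)"
  unfolding left_linear_def
proof (intro conjI ballI additive_mapI)
  interpret E': abelian_group E' by (rule lmod_group[OF map_moduleD(1)[OF E']])
  fix e assume e: "e \<in> carrier E'"
  note el = map_moduleD(2)[OF E' e]
  show "coextend w e \<in> carrier PC" by (rule additive_map_closed[OF PC_additive[OF P_module el] w])
  show "coextend w (e \<oplus>\<^bsub>E'\<^esub> e') = coextend w e \<oplus>\<^bsub>PC\<^esub> coextend w e'" if e': "e' \<in> carrier E'" for e'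
  proof -
    note el' = map_moduleD(2)[OF E' e']
    have "coextend w (e \<oplus>\<^bsub>E'\<^esub> e') = tensor_map A P C (\<lambda>x. e x \<oplus>\<^bsub>P\<^esub> e' x) (\<lambda>c. c) w"
      by (rule tensor_C_cong[OF P_module P_module right_linear_plus[OF P_module el el'] _ w])
        (rule map_moduleD(4)[OF E' e e'])
    also have "\<dots> = coextend w e \<oplus>\<^bsub>PC\<^esub> coextend w e'" by (rule tensor_C_plus[OF P_module P_module el el' w])
    finally show ?thesis .
  qed
  fix b assume b: "b \<in> carrier Bs"
  have bl: "right_linear A P P b" using b B_subset S_linear by simp
  have "b \<odot>\<^bsub>PC\<^esub> coextend w e = tensor_map A P C (\<lambda>x. b (e x)) (\<lambda>c. c) w"
    unfolding smult_PC by (rule tensor_C_comp[OF P_module P_module P_module el bl w])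
  also have "\<dots> = coextend w (b \<odot>\<^bsub>E'\<^esub> e)"
    using map_moduleD(5)[OF E' _ e, of b] b
    by (intro tensor_C_cong[OF P_module P_module map_moduleD(2)[OF E' lmod_closed[OF map_moduleD(1)[OF E'] b e]] _ w]) simp
  finally show "coextend w (b \<odot>\<^bsub>E'\<^esub> e) = b \<odot>\<^bsub>PC\<^esub> coextend w e" by simp
qed

text \<open>For \<open>u = \<Sum> y\<^sub>j \<otimes> e\<^sub>j\<close>, tensoring \<open>x \<mapsto> \<Sum> y\<^sub>j \<otimes> e\<^sub>j(x)\<close> with \<open>C\<close> amounts to tensoring every \<open>e\<^sub>j\<close> with \<open>C\<close>.\<close>

lemma coextend_ev:
  assumes E': "map_module P E'" and u: "u \<in> carrier (tensor Bs Y E')" and w: "w \<in> carrier PC"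
  shows "onY PC (coextend w) u = assocY (tensor_map A YP C (\<lambda>x. ev P x u) (\<lambda>c. c) w)"
proof -
  note El = map_moduleD(1)[OF E']
  note as = tensor_assoc_additive[OF Y P_bimodule C_left] tensor_assoc_pure[OF Y P_bimodule C_left]
  note evl = ev_right_linear[OF E' P_bimodule u]
  note tm = tensor_C_additive[OF P_module YP_module evl] tensor_C_pure[OF P_module YP_module evl]
  have ad: "additive_map PC YPC (\<lambda>w. onY PC (coextend w) u)"
  proof (rule additive_mapI)
    interpret PC: abelian_group PC by (rule PC_group)
    fix w w' assume w: "w \<in> carrier PC" and w': "w' \<in> carrier PC"
    note lw = coextend_left_linear[OF E' w] and lw' = coextend_left_linear[OF E' w']
    show "onY PC (coextend w) u \<in> carrier YPC"
      by (rule additive_map_closed[OF tensor_map_additive[OF Y El Y PC_left idY lw] u])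
    have "onY PC (coextend (w \<oplus>\<^bsub>PC\<^esub> w')) u =
        onY PC (\<lambda>e. coextend w e \<oplus>\<^bsub>PC\<^esub> coextend w' e) u"
      by (rule tensor_map_cong[OF Y El Y PC_left idY left_linear_plus[OF PC_left lw lw'] _ _ u])
        (simp_all add: additive_map_add[OF PC_additive[OF P_module map_moduleD(2)[OF E']] w w'])
    then show "onY PC (coextend (w \<oplus>\<^bsub>PC\<^esub> w')) u =
        onY PC (coextend w) u \<oplus>\<^bsub>YPC\<^esub> onY PC (coextend w') u"
      using tensor_map_add_right[OF Y El Y PC_left idY lw lw' u] by simp
  qed
  show ?thesis
  proof (rule tensor_eqI[OF P_module C_left ad additive_map_comp[OF tm(1) as(1)] _ w])
    fix x c assume x: "x \<in> carrier P" and c: "c \<in> carrier C"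
    note lw = coextend_left_linear[OF E' PC_closed[OF x c]]
    note p1 = tensor_map_additive[OF Y El Y PC_left idY lw] tensor_map_pure[OF Y El Y PC_left idY lw]
    have "onY PC (coextend (pure A P C x c)) u = assocY (pure A YP C (ev P x u) c)"
    proof (rule tensor_eqI[OF Y El p1(1) additive_map_comp[OF additive_map_comp[OF ev_additive[OF E' P_left x]
            pure_additive_left[OF YP_module C_left c]] as(1)] _ u])
      fix y e assume y: "y \<in> carrier Y" and e: "e \<in> carrier E'"
      have "onY PC (coextend (pure A P C x c)) (pure Bs Y E' y e) = pure Bs Y PC y (pure A P C (e x) c)"
        unfolding p1(2)[OF y e] PC_pure[OF P_module map_moduleD(2)[OF E' e] x c] ..
      also have "\<dots> = assocY (pure A YP C (ev P x (pure Bs Y E' y e)) c)"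
        unfolding ev_pure[OF E' P_left x y e] as(2)[OF y map_moduleD(3)[OF E' e x] c] ..
      finally show "onY PC (coextend (pure A P C x c)) (pure Bs Y E' y e) =
        assocY (pure A YP C (ev P x (pure Bs Y E' y e)) c)" .
    qed
    also have "\<dots> = assocY (tensor_map A YP C (\<lambda>x. ev P x u) (\<lambda>c. c) (pure A P C x c))"
      unfolding tm(2)[OF x c] ..
    finally show "onY PC (coextend (pure A P C x c)) u =
      assocY (tensor_map A YP C (\<lambda>x. ev P x u) (\<lambda>c. c) (pure A P C x c))" .
  qed
qed

text \<open>The members of \<open>S\<close> are colinear, so replacing \<open>\<rho> \<circ> s\<close> by \<open>(s \<otimes> C) \<circ> \<rho>\<close> in \<open>t = \<Sum> y\<^sub>j \<otimes> s\<^sub>j\<close> changes nothing.\<close>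

lemma ev_colin:
  assumes t: "t \<in> carrier (tensor Bs Y SB)"
  shows "colin Y (\<lambda>x. ev P x t)"
  unfolding colin_def
proof (intro conjI ballI)
  note E' = SB_map_module
  show "right_linear A P YP (\<lambda>x. ev P x t)" by (rule ev_right_linear[OF E' P_bimodule t])
  fix x assume x: "x \<in> carrier P"
  have "onY PC \<rho> (ev P x t) = onY PC (\<lambda>s. \<rho> (s x)) t"
    by (rule tensor_map_comp[OF Y SB_left Y P_left Y PC_left idY eval_left_linear[OF E' x] idY coact_left_linear t])
  also have "\<dots> = onY PC (coextend (\<rho> x)) t"
    by (rule tensor_map_cong[OF Y SB_left Y PC_left idY coextend_left_linear[OF E' coact_closed[OF x]] _ _ t])
      (use x in \<open>auto simp: right_colinear_def\<close>)
  also have "\<dots> = assocY (tensor_map A YP C (\<lambda>x. ev P x t) (\<lambda>c. c) (\<rho> x))"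
    by (rule coextend_ev[OF E' t coact_closed[OF x]])
  finally show "onY PC \<rho> (ev P x t) = assocY (tensor_map A YP C (\<lambda>x. ev P x t) (\<lambda>c. c) (\<rho> x))" .
qed

text \<open>A colinear \<open>F\<close> corresponds to a tensor in \<open>Y \<otimes> End(P)\<close>; the question is whether the tensor lies in
  \<open>Y \<otimes> S\<close>.\<close>

lemma colin_tensor:
  assumes F: "colin Y F"
  obtains u where "u \<in> carrier (tensor Bs Y E)" and "\<And>x. x \<in> carrier P \<Longrightarrow> ev P x u = F x"
    and "\<And>x. x \<in> carrier P \<Longrightarrow> onY PC (coextend (\<rho> x)) u = onY PC \<rho> (F x)"
proof
  have Fl: "right_linear A P YP F" using F by (simp add: colin_def)
  note E = lin_hom_map_module[OF P_bimodule]
  interpret P: abelian_group P by (rule P_group)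
  show u: "unev P F \<in> carrier (tensor Bs Y E)" by (rule ev_unev(2)[OF P_bimodule Fl P.zero_closed])
  show ev: "ev P x (unev P F) = F x" if "x \<in> carrier P" for x by (rule ev_unev(1)[OF P_bimodule Fl that])
  fix x assume x: "x \<in> carrier P"
  have "onY PC (coextend (\<rho> x)) (unev P F) = assocY (tensor_map A YP C (\<lambda>x. ev P x (unev P F)) (\<lambda>c. c) (\<rho> x))"
    by (rule coextend_ev[OF E u coact_closed[OF x]])
  also have "\<dots> = assocY (tensor_map A YP C F (\<lambda>c. c) (\<rho> x))"
    using tensor_C_cong[OF P_module YP_module Fl ev coact_closed[OF x]] by simp
  also have "\<dots> = onY PC \<rho> (F x)" using F x by (simp add: colin_def)
  finally show "onY PC (coextend (\<rho> x)) (unev P F) = onY PC \<rho> (F x)" .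
qed

lemma S_into_E: "left_linear Bs SB E (\<lambda>s. s)"
  by (auto simp: left_linear_def compose_def dest: rcolin_linear intro!: additive_mapI)

lemma E_left: "left_module Bs E"
  by (rule lin_hom_left_module[OF P_module P_bimodule])

private lemma ev_S_into_E:
  assumes t: "t \<in> carrier (tensor Bs Y SB)" and x: "x \<in> carrier P"
  shows "ev P x (onY E (\<lambda>s. s) t) = ev P x t"
    and "onY E (\<lambda>s. s) t \<in> carrier (tensor Bs Y E)"
  using tensor_map_comp[OF Y SB_left Y E_left Y P_left idY S_into_E idY
      eval_left_linear[OF lin_hom_map_module[OF P_bimodule] x] t]
    additive_map_closed[OF tensor_map_additive[OF Y SB_left Y E_left idY S_into_E] t]
  by simp_all

text \<open>A splitting \<open>\<kappa>\<close> of the coaction retracts \<open>End(P)\<close> onto \<open>S\<close> by \<open>e \<mapsto> \<kappa> (e \<otimes> C) \<rho>\<close>.\<close>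

lemma strongly_injective_hom_tensor_bij:
  assumes inj: "strongly_injective A C P \<rho> B"
  shows "hom_tensor_bij Y"
proof -
  from inj obtain \<kappa> where
    \<kappa>1: "right_colinear A C PC (tensor_coaction A A C P C (comult C)) P \<rho> \<kappa>"
    and \<kappa>2: "left_linear Bs PC P \<kappa>" and \<kappa>3: "\<And>x. x \<in> carrier P \<Longrightarrow> \<kappa> (\<rho> x) = x"
    unfolding strongly_injective_def Let_def eval_P by blast
  have \<kappa>l: "right_linear A PC P \<kappa>" by (rule rcolin_linear[OF \<kappa>1])
  have \<kappa>c: "\<kappa> w \<in> carrier P" if "w \<in> carrier PC" for w
    by (rule right_linear_closed[OF \<kappa>l that])
  define r where "r e = (\<lambda>x\<in>carrier P. \<kappa> (coextend (\<rho> x) e))" for e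
  note E = lin_hom_map_module[OF P_bimodule]
  have eC: "right_linear A PC PC (tensor_map A P C e (\<lambda>c. c))" if "e \<in> carrier E" for e
    by (rule tensor_map_right_linear[OF P_module C_bimodule P_module C_bimodule map_moduleD(2)[OF E that] left_linear_ident right_linear_ident])
  have rS: "r e \<in> carrier S" if e: "e \<in> carrier E" for e
  proof -
    note el = map_moduleD(2)[OF E e] and eC = eC[OF e]
    have eCr: "right_linear A P PC (\<lambda>x. coextend (\<rho> x) e)" by (rule right_linear_comp[OF coact_linear eC])
    have l: "right_linear A P P (\<lambda>x. \<kappa> (coextend (\<rho> x) e))"
      by (rule right_linear_comp[OF eCr \<kappa>l])
    have "\<rho> (\<kappa> (coextend (\<rho> x) e)) = tensor_map A P C (r e) (\<lambda>c. c) (\<rho> x)" if x: "x \<in> carrier P" for x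
    proof -
      note CCl = bimod_left[OF CC_bimodule]
      let ?z = "tensor_map A PC C \<rho> (\<lambda>c. c) (\<rho> x)"
      have z: "?z \<in> carrier (tensor A PC C)"
        by (rule additive_map_closed[OF PC_additive[OF PC_module coact_linear] coact_closed[OF x]])
      have ez: "tensor_map A PC C (tensor_map A P C e (\<lambda>c. c)) (\<lambda>c. c) ?z \<in> carrier (tensor A PC C)"
        by (rule additive_map_closed[OF tensor_C_additive[OF PC_module PC_module eC] z])
      note idP = right_linear_ident[of A P] and idC = left_linear_ident[of A C] and idCC = left_linear_ident[of A CC]
      have "tensor_map A P CC (\<lambda>y. y) (comult C) (coextend (\<rho> x) e) = tensor_map A P CC e (comult C) (\<rho> x)"
        by (rule tensor_map_comp[OF P_module C_left P_module C_left P_module CCl el idC idP comult_left_linear coact_closed[OF x]])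
      also have "\<dots> = tensor_map A P CC e (\<lambda>y. y) (tensor_map A P CC (\<lambda>y. y) (comult C) (\<rho> x))"
        by (rule tensor_map_comp[OF P_module C_left P_module CCl P_module CCl idP comult_left_linear el idCC coact_closed[OF x], symmetric])
      also have "\<dots> = tensor_map A P CC e (\<lambda>y. y) (tensor_assoc A A P C C ?z)" by (simp add: coassoc[OF x])
      also have "\<dots> = tensor_assoc A A P C C (tensor_map A PC C (tensor_map A P C e (\<lambda>c. c)) (\<lambda>c. c) ?z)"
        by (rule tensor_assoc_natural[OF P_module P_module C_bimodule C_left el z, symmetric])
      finally have "tensor_coaction A A C P C (comult C) (coextend (\<rho> x) e) =
          tensor_map A PC C (tensor_map A P C e (\<lambda>c. c)) (\<lambda>c. c) ?z"
        using tensor_assoc_inv_assoc[OF P_module C_bimodule C_left ez] by (simp add: tensor_coaction_def)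
      then have "\<rho> (\<kappa> (coextend (\<rho> x) e)) =
          tensor_map A P C \<kappa> (\<lambda>c. c) (tensor_map A PC C (tensor_map A P C e (\<lambda>c. c)) (\<lambda>c. c) ?z)"
        using rcolin_coaction[OF \<kappa>1 right_linear_closed[OF eCr x]] by simp
      also have "\<dots> = tensor_map A P C (\<lambda>w. \<kappa> (tensor_map A P C e (\<lambda>c. c) w)) (\<lambda>c. c) ?z"
        by (rule tensor_C_comp[OF PC_module PC_module P_module eC \<kappa>l z])
      also have "\<dots> = tensor_map A P C (\<lambda>x. \<kappa> (coextend (\<rho> x) e)) (\<lambda>c. c) (\<rho> x)"
        by (rule tensor_C_comp[OF P_module PC_module P_module coact_linear right_linear_comp[OF eC \<kappa>l] coact_closed[OF x]])
      also have "\<dots> = tensor_map A P C (r e) (\<lambda>c. c) (\<rho> x)"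
        by (rule tensor_C_cong[OF P_module P_module right_linear_restrict[OF P_module l, folded r_def] _ coact_closed[OF x]])
          (simp add: r_def)
      finally show ?thesis .
    qed
    then show ?thesis
      using right_linear_restrict[OF P_module l] by (simp add: right_colinear_def) (simp add: r_def)
  qed
  have rl: "left_linear Bs E SB r"
    unfolding left_linear_def
  proof (intro conjI ballI additive_mapI)
    fix e assume e: "e \<in> carrier E"
    show "r e \<in> carrier SB" using rS[OF e] by simp
    show "r (e \<oplus>\<^bsub>E\<^esub> e') = r e \<oplus>\<^bsub>SB\<^esub> r e'" if e': "e' \<in> carrier E" for e'
    proof (rule extensionalityI[of _ "carrier P"])
      fix x assume x: "x \<in> carrier P"
      note xl = left_linear_comp[OF coextend_left_linear[OF E coact_closed[OF x]] \<kappa>2]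
      show "r (e \<oplus>\<^bsub>E\<^esub> e') x = (r e \<oplus>\<^bsub>SB\<^esub> r e') x"
        using left_linear_add[OF xl e e'] x by (simp add: r_def)
    qed (simp_all add: r_def)
    fix b assume b: "b \<in> carrier Bs"
    show "r (b \<odot>\<^bsub>E\<^esub> e) = b \<odot>\<^bsub>SB\<^esub> r e"
    proof (rule extensionalityI[of _ "carrier P"])
      fix x assume x: "x \<in> carrier P"
      note xl = left_linear_comp[OF coextend_left_linear[OF E coact_closed[OF x]] \<kappa>2]
      show "r (b \<odot>\<^bsub>E\<^esub> e) x = (b \<odot>\<^bsub>SB\<^esub> r e) x"
        using left_linear_smult[OF xl b e] x by (simp add: r_def compose_def)
    qed (simp_all add: r_def compose_def)
  qed
  have rs: "r s = s" if s: "s \<in> carrier S" for s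
  proof (rule extensionalityI[of _ "carrier P"])
    show "r s \<in> extensional (carrier P)" "s \<in> extensional (carrier P)" using s by (simp_all add: r_def)
    fix x assume x: "x \<in> carrier P"
    have "coextend (\<rho> x) s = \<rho> (s x)" using s x by (simp add: right_colinear_def)
    then show "r s x = s x" using \<kappa>3[OF S_closed[OF s x]] x by (simp add: r_def)
  qed
  let ?R = "onY SB r"
  show ?thesis
    unfolding hom_tensor_bij_def
  proof (intro conjI ballI allI impI)
    fix t t' assume t: "t \<in> carrier (tensor Bs Y SB)" and t': "t' \<in> carrier (tensor Bs Y SB)"
      and eq: "\<forall>x\<in>carrier P. ev P x t = ev P x t'"
    interpret P: abelian_group P by (rule P_group)
    have ret: "?R (onY E (\<lambda>s. s) t) = t" if t: "t \<in> carrier (tensor Bs Y SB)" for t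
      using tensor_map_comp[OF Y SB_left Y E_left Y SB_left idY S_into_E idY rl t]
        tensor_map_cong[OF Y SB_left Y SB_left idY left_linear_ident _ _ t, of "\<lambda>y. y" r] rs
        tensor_map_ident[OF Y SB_left t] by simp
    have "onY E (\<lambda>s. s) t = onY E (\<lambda>s. s) t'"
      by (rule ev_inj[OF P_bimodule ev_S_into_E(2)[OF t P.zero_closed] ev_S_into_E(2)[OF t' P.zero_closed]])
        (simp add: ev_S_into_E(1) t t' eq)
    then show "t = t'" using ret[OF t] ret[OF t'] by metis
  next
    fix F assume F: "colin Y F"
    obtain u where u: "u \<in> carrier (tensor Bs Y E)" and evu: "\<And>x. x \<in> carrier P \<Longrightarrow> ev P x u = F x" and
      ext: "\<And>x. x \<in> carrier P \<Longrightarrow> onY PC (coextend (\<rho> x)) u = onY PC \<rho> (F x)"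
      by (rule colin_tensor[OF F]) (rule that; blast)
    have "ev P x (?R u) = F x" if x: "x \<in> carrier P" for x
    proof -
      have Fx: "F x \<in> carrier YP"
        using F x by (auto simp: colin_def intro: right_linear_closed)
      note xl = coextend_left_linear[OF E coact_closed[OF x]]
      have "ev P x (?R u) = onY P (\<lambda>e. r e x) u"
        by (rule tensor_map_comp[OF Y E_left Y SB_left Y P_left idY rl idY eval_left_linear[OF SB_map_module x] u])
      also have "\<dots> = onY P (\<lambda>e. \<kappa> (coextend (\<rho> x) e)) u" using x by (simp add: r_def)
      also have "\<dots> = onY P \<kappa> (onY PC (coextend (\<rho> x)) u)"
        by (rule tensor_map_comp[OF Y E_left Y PC_left Y P_left idY xl idY \<kappa>2 u, symmetric])
      also have "\<dots> = onY P \<kappa> (onY PC \<rho> (F x))" by (simp add: ext x)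
      also have "\<dots> = onY P (\<lambda>x. \<kappa> (\<rho> x)) (F x)"
        by (rule tensor_map_comp[OF Y P_left Y PC_left Y P_left idY coact_left_linear idY \<kappa>2 Fx])
      also have "\<dots> = onY P (\<lambda>x. x) (F x)"
        by (rule tensor_map_cong[OF Y P_left Y P_left idY left_linear_ident _ _ Fx]) (simp_all add: \<kappa>3)
      also have "\<dots> = F x" by (rule tensor_map_ident[OF Y P_left Fx])
      finally show ?thesis .
    qed
    then show "\<exists>t\<in>carrier (tensor Bs Y SB). \<forall>x\<in>carrier P. ev P x t = F x"
      using additive_map_closed[OF tensor_map_additive[OF Y E_left Y SB_left idY rl] u] by blast
  qed
qed

text \<open>\<open>S\<close> is the kernel of \<open>e \<mapsto> \<rho> e - (e \<otimes> C) \<rho>\<close>, a map from \<open>End(P)\<close> to \<open>Hom(P, P \<otimes> C)\<close>, and a flat module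
  preserves kernels.\<close>

lemma flat_hom_tensor_bij:
  fixes emb :: "('p \<Rightarrow> ('p, 'c) tens) \<Rightarrow> 'u"
  assumes flat: "flat_right_module TYPE('u) Bs Y" and emb: "inj emb"
  shows "hom_tensor_bij Y"
proof -
  let ?D = "lin_hom A P PC"
  note E = lin_hom_map_module[OF P_bimodule] and D = lin_hom_map_module[OF PC_bimodule]
  note Dl = map_moduleD(1)[OF D]
  interpret PC: abelian_group PC by (rule PC_group)
  interpret P: abelian_group P by (rule P_group)
  interpret D: abelian_group ?D by (rule lmod_group[OF Dl])
  define d where "d e = (\<lambda>x\<in>carrier P. \<rho> (e x) \<ominus>\<^bsub>PC\<^esub> coextend (\<rho> x) e)" for e
  have l1: "left_linear Bs E PC (\<lambda>e. \<rho> (e x))" if "x \<in> carrier P" for x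
    by (rule left_linear_comp[OF eval_left_linear[OF E that] coact_left_linear])
  have l2: "left_linear Bs E PC (coextend (\<rho> x))" if "x \<in> carrier P" for x
    by (rule coextend_left_linear[OF E coact_closed[OF that]])
  have l3: "left_linear Bs E PC (\<lambda>e. \<ominus>\<^bsub>PC\<^esub> coextend (\<rho> x) e)" if "x \<in> carrier P" for x
    by (rule left_linear_neg[OF PC_left l2[OF that]])
  have l4: "left_linear Bs E PC (\<lambda>e. \<rho> (e x) \<ominus>\<^bsub>PC\<^esub> coextend (\<rho> x) e)" if "x \<in> carrier P" for x
    unfolding PC.minus_eq by (rule left_linear_plus[OF PC_left l1[OF that] l3[OF that]])
  have dD: "d e \<in> carrier ?D" if e: "e \<in> carrier E" for e
  proof -
    note el = map_moduleD(2)[OF E e]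
    have eC: "right_linear A PC PC (tensor_map A P C e (\<lambda>c. c))"
      by (rule tensor_map_right_linear[OF P_module C_bimodule P_module C_bimodule el left_linear_ident right_linear_ident])
    have "right_linear A P PC (\<lambda>x. \<rho> (e x) \<ominus>\<^bsub>PC\<^esub> coextend (\<rho> x) e)"
      unfolding PC.minus_eq
      by (rule right_linear_plus[OF PC_module right_linear_comp[OF el coact_linear]
          right_linear_neg[OF PC_module right_linear_comp[OF coact_linear eC]]])
    then show ?thesis using right_linear_restrict[OF P_module] by (simp add: d_def)
  qed
  have dl: "left_linear Bs E ?D d"
    unfolding left_linear_def
  proof (intro conjI ballI additive_mapI dD)
    fix e assume e: "e \<in> carrier E"
    show "d (e \<oplus>\<^bsub>E\<^esub> e') = d e \<oplus>\<^bsub>?D\<^esub> d e'" if e': "e' \<in> carrier E" for e'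
    proof (rule extensionalityI[of _ "carrier P"])
      fix x assume x: "x \<in> carrier P"
      show "d (e \<oplus>\<^bsub>E\<^esub> e') x = (d e \<oplus>\<^bsub>?D\<^esub> d e') x"
        using left_linear_add[OF l4[OF x] e e'] x by (simp add: d_def)
    qed (simp_all add: d_def)
    fix b assume b: "b \<in> carrier Bs"
    show "d (b \<odot>\<^bsub>E\<^esub> e) = b \<odot>\<^bsub>?D\<^esub> d e"
    proof (rule extensionalityI[of _ "carrier P"])
      fix x assume x: "x \<in> carrier P"
      show "d (b \<odot>\<^bsub>E\<^esub> e) x = (b \<odot>\<^bsub>?D\<^esub> d e) x"
        using left_linear_smult[OF l4[OF x] b e] x by (simp add: d_def)
    qed (simp_all add: d_def)
  qed
  have ker: "e \<in> carrier S" if e: "e \<in> carrier E" and z: "d e = \<zero>\<^bsub>?D\<^esub>" for e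
  proof -
    have "\<rho> (e x) = coextend (\<rho> x) e" if x: "x \<in> carrier P" for x
    proof -
      have "\<rho> (e x) \<ominus>\<^bsub>PC\<^esub> coextend (\<rho> x) e = \<zero>\<^bsub>PC\<^esub>"
        using fun_cong[OF z, of x] x by (simp add: d_def)
      moreover note left_linear_closed[OF l1[OF x] e] left_linear_closed[OF l2[OF x] e]
      ultimately show ?thesis
        using PC.minus_equality[of "\<rho> (e x)" "\<ominus>\<^bsub>PC\<^esub> coextend (\<rho> x) e"] by (simp add: PC.minus_eq)
    qed
    then show ?thesis using e by (simp add: right_colinear_def)
  qed
  define I where "I = ?D\<lparr>carrier := d ` carrier E\<rparr>"
  have Is: "carrier I = d ` carrier E" "zero I = zero ?D" "add I = add ?D" "smult I = smult ?D"
    by (simp_all add: I_def)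
  interpret E: abelian_group E by (rule lmod_group[OF E_left])
  have dz: "d \<zero>\<^bsub>E\<^esub> = \<zero>\<^bsub>?D\<^esub>"
    by (rule additive_map_zero[OF left_linear_additive[OF dl] E.abelian_group_axioms D.abelian_group_axioms])
  have dadd: "d (e \<oplus>\<^bsub>E\<^esub> e') = d e \<oplus>\<^bsub>?D\<^esub> d e'" if "e \<in> carrier E" "e' \<in> carrier E" for e e'
    by (rule left_linear_add[OF dl that])
  have IG: "abelian_group I"
  proof (rule abelian_groupI)
    fix x assume "x \<in> carrier I"
    then obtain e where e: "e \<in> carrier E" and xe: "x = d e" unfolding Is by (rule imageE)
    have neg: "d (\<ominus>\<^bsub>E\<^esub> e) \<oplus>\<^bsub>?D\<^esub> d e = \<zero>\<^bsub>?D\<^esub>"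
      unfolding dadd[OF E.a_inv_closed[OF e] e, symmetric] E.l_neg[OF e] by (rule dz)
    show "\<exists>y\<in>carrier I. y \<oplus>\<^bsub>I\<^esub> x = \<zero>\<^bsub>I\<^esub>"
      unfolding Is xe by (intro bexI[of _ "d (\<ominus>\<^bsub>E\<^esub> e)"] neg imageI E.a_inv_closed[OF e])
    show "\<zero>\<^bsub>I\<^esub> \<oplus>\<^bsub>I\<^esub> x = x" unfolding Is xe by (rule D.l_zero[OF dD[OF e]])
    fix y assume "y \<in> carrier I"
    then obtain e' where e': "e' \<in> carrier E" and ye: "y = d e'" unfolding Is by (rule imageE)
    show "x \<oplus>\<^bsub>I\<^esub> y \<in> carrier I"
      unfolding Is xe ye dadd[OF e e', symmetric] by (rule imageI[OF E.a_closed[OF e e']])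
    show "x \<oplus>\<^bsub>I\<^esub> y = y \<oplus>\<^bsub>I\<^esub> x" unfolding Is xe ye by (rule D.a_comm[OF dD[OF e] dD[OF e']])
    fix z assume "z \<in> carrier I"
    then obtain e'' where e'': "e'' \<in> carrier E" and ze: "z = d e''" unfolding Is by (rule imageE)
    show "x \<oplus>\<^bsub>I\<^esub> y \<oplus>\<^bsub>I\<^esub> z = x \<oplus>\<^bsub>I\<^esub> (y \<oplus>\<^bsub>I\<^esub> z)"
      unfolding Is xe ye ze by (rule D.a_assoc[OF dD[OF e] dD[OF e'] dD[OF e'']])
  next
    show "\<zero>\<^bsub>I\<^esub> \<in> carrier I" unfolding Is dz[symmetric] by (rule imageI[OF E.zero_closed])
  qed
  have ImD: "x \<in> carrier ?D" if "x \<in> carrier I" for x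
    using that unfolding Is by (rule imageE) (simp only: dD)
  have Il: "left_module Bs I"
    unfolding left_module_def
  proof (intro conjI ballI IG lmod_ring[OF Dl])
    fix a x assume a: "a \<in> carrier Bs" and "x \<in> carrier I"
    then obtain e where e: "e \<in> carrier E" and xe: "x = d e" unfolding Is by (elim imageE)
    show "a \<odot>\<^bsub>I\<^esub> x \<in> carrier I"
      unfolding Is xe left_linear_smult[OF dl a e, symmetric] by (rule imageI[OF lmod_closed[OF E_left a e]])
  next
    fix a b x assume a: "a \<in> carrier Bs" and b: "b \<in> carrier Bs" and x: "x \<in> carrier I"
    note x = ImD[OF x]
    show "(a \<oplus>\<^bsub>Bs\<^esub> b) \<odot>\<^bsub>I\<^esub> x = a \<odot>\<^bsub>I\<^esub> x \<oplus>\<^bsub>I\<^esub> b \<odot>\<^bsub>I\<^esub> x"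
      unfolding Is by (rule lmod_scalar_add[OF Dl a b x])
    show "(a \<otimes>\<^bsub>Bs\<^esub> b) \<odot>\<^bsub>I\<^esub> x = a \<odot>\<^bsub>I\<^esub> (b \<odot>\<^bsub>I\<^esub> x)"
      unfolding Is by (rule lmod_mult[OF Dl a b x])
  next
    fix a x y assume a: "a \<in> carrier Bs" and x: "x \<in> carrier I" and y: "y \<in> carrier I"
    show "a \<odot>\<^bsub>I\<^esub> (x \<oplus>\<^bsub>I\<^esub> y) = a \<odot>\<^bsub>I\<^esub> x \<oplus>\<^bsub>I\<^esub> a \<odot>\<^bsub>I\<^esub> y"
      unfolding Is by (rule lmod_add[OF Dl a ImD[OF x] ImD[OF y]])
  next
    fix x assume x: "x \<in> carrier I"
    show "\<one>\<^bsub>Bs\<^esub> \<odot>\<^bsub>I\<^esub> x = x" unfolding Is by (rule lmod_one[OF Dl ImD[OF x]])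
  qed
  have dI: "left_linear Bs E I d"
    using dl by (auto simp only: left_linear_def additive_map_def Is)
  have ID: "left_linear Bs I ?D (\<lambda>x. x)"
    using dD by (auto simp only: left_linear_def additive_map_def Is)
  \<comment> \<open>\<open>'p \<Rightarrow> 'p\<close> embeds into \<open>'p \<Rightarrow> ('p, 'c) tens\<close>: elements of \<open>'p\<close> become singletons of generators.\<close>
  obtain emb' :: "('p \<Rightarrow> 'p) \<Rightarrow> 'u" where emb': "inj emb'"
  proof
    have "inj (\<lambda>f. (\<lambda>x::'p. {frag_of (f x :: 'p, undefined :: 'c)}))"
      by (auto simp: inj_def fun_eq_iff frag_of_eq)
    then show "inj (emb \<circ> (\<lambda>f x. {frag_of (f x :: 'p, undefined :: 'c)}))" using emb by (rule inj_compose[rotated])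
  qed
  have injSE: "inj_on (onY E (\<lambda>s. s)) (carrier (tensor Bs Y SB))"
    by (rule flat_right_module_embed[OF flat emb' emb' SB_left E_left S_into_E]) (simp add: inj_on_def)
  have injID: "inj_on (onY ?D (\<lambda>s. s)) (carrier (tensor Bs Y I))"
    by (rule flat_right_module_embed[OF flat emb emb Il Dl ID]) (simp add: inj_on_def)
  show ?thesis
    unfolding hom_tensor_bij_def
  proof (intro conjI ballI allI impI)
    fix t t' assume t: "t \<in> carrier (tensor Bs Y SB)" and t': "t' \<in> carrier (tensor Bs Y SB)"
      and eq: "\<forall>x\<in>carrier P. ev P x t = ev P x t'"
    have "onY E (\<lambda>s. s) t = onY E (\<lambda>s. s) t'"
      by (rule ev_inj[OF P_bimodule ev_S_into_E(2)[OF t P.zero_closed] ev_S_into_E(2)[OF t' P.zero_closed]])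
        (simp add: ev_S_into_E(1) t t' eq)
    then show "t = t'" using inj_onD[OF injSE _ t t'] by blast
  next
    fix F assume F: "colin Y F"
    obtain u where u: "u \<in> carrier (tensor Bs Y E)" and evu: "\<And>x. x \<in> carrier P \<Longrightarrow> ev P x u = F x" and
      ext: "\<And>x. x \<in> carrier P \<Longrightarrow> onY PC (coextend (\<rho> x)) u = onY PC \<rho> (F x)"
      by (rule colin_tensor[OF F]) (rule that; blast)
    interpret YPC: abelian_group YPC by (rule tensor_group[OF Y PC_left])
    interpret YD: abelian_group "tensor Bs Y ?D" by (rule tensor_group[OF Y Dl])
    interpret YI: abelian_group "tensor Bs Y I" by (rule tensor_group[OF Y Il])
    have du: "onY ?D d u \<in> carrier (tensor Bs Y ?D)"
      by (rule additive_map_closed[OF tensor_map_additive[OF Y E_left Y Dl idY dl] u])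
    have dIu: "onY I d u \<in> carrier (tensor Bs Y I)"
      by (rule additive_map_closed[OF tensor_map_additive[OF Y E_left Y Il idY dI] u])
    have "onY ?D d u = \<zero>\<^bsub>tensor Bs Y ?D\<^esub>"
    proof (rule ev_inj[OF PC_bimodule du YD.zero_closed])
      fix x assume x: "x \<in> carrier P"
      have c2: "onY PC (coextend (\<rho> x)) u \<in> carrier YPC"
        by (rule additive_map_closed[OF tensor_map_additive[OF Y E_left Y PC_left idY l2[OF x]] u])
      have c3: "onY PC (\<lambda>e. \<ominus>\<^bsub>PC\<^esub> coextend (\<rho> x) e) u \<in> carrier YPC"
        by (rule additive_map_closed[OF tensor_map_additive[OF Y E_left Y PC_left idY l3[OF x]] u])
      have "onY PC (\<lambda>e. \<rho> (e x)) u = onY PC \<rho> (ev P x u)"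
        by (rule tensor_map_comp[OF Y E_left Y P_left Y PC_left idY eval_left_linear[OF E x] idY coact_left_linear u, symmetric])
      then have e1: "onY PC (\<lambda>e. \<rho> (e x)) u = onY PC (coextend (\<rho> x)) u"
        by (simp add: evu ext x)
      have "ev PC x (onY ?D d u) = onY PC (\<lambda>e. d e x) u"
        by (rule tensor_map_comp[OF Y E_left Y Dl Y PC_left idY dl idY eval_left_linear[OF D x] u])
      also have "\<dots> = onY PC (\<lambda>e. \<rho> (e x) \<oplus>\<^bsub>PC\<^esub> (\<ominus>\<^bsub>PC\<^esub> coextend (\<rho> x) e)) u"
        using x by (simp add: d_def PC.minus_eq)
      also have "\<dots> = onY PC (coextend (\<rho> x)) u \<oplus>\<^bsub>YPC\<^esub> onY PC (\<lambda>e. \<ominus>\<^bsub>PC\<^esub> coextend (\<rho> x) e) u"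
        using tensor_map_add_right[OF Y E_left Y PC_left idY l1[OF x] l3[OF x] u] e1 by simp
      also have "\<dots> = onY PC (\<lambda>e. coextend (\<rho> x) e \<oplus>\<^bsub>PC\<^esub> (\<ominus>\<^bsub>PC\<^esub> coextend (\<rho> x) e)) u"
        by (rule tensor_map_add_right[OF Y E_left Y PC_left idY l2[OF x] l3[OF x] u, symmetric])
      also have "\<dots> = onY PC (\<lambda>e. \<zero>\<^bsub>PC\<^esub>) u"
        by (rule tensor_map_cong[OF Y E_left Y PC_left idY left_linear_zero[OF PC_left] _ _ u])
          (simp_all add: PC.r_neg left_linear_closed[OF l2[OF x]])
      also have "\<dots> = \<zero>\<^bsub>YPC\<^esub>"
      proof -
        note z = left_linear_zero[OF PC_left]
        let ?z = "onY PC (\<lambda>e. \<zero>\<^bsub>PC\<^esub>) u"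
        have "?z \<in> carrier YPC" by (rule additive_map_closed[OF tensor_map_additive[OF Y E_left Y PC_left idY z] u])
        moreover have "?z = ?z \<oplus>\<^bsub>YPC\<^esub> ?z" using tensor_map_add_right[OF Y E_left Y PC_left idY z z u] by simp
        ultimately show ?thesis by (metis YPC.add.l_cancel_one')
      qed
      also have "\<dots> = ev PC x \<zero>\<^bsub>tensor Bs Y ?D\<^esub>"
        by (rule additive_map_zero[OF ev_additive[OF D PC_left x] YD.abelian_group_axioms YPC.abelian_group_axioms, symmetric])
      finally show "ev PC x (onY ?D d u) = ev PC x \<zero>\<^bsub>tensor Bs Y ?D\<^esub>" .
    qed
    moreover have "onY ?D (\<lambda>s. s) (onY I d u) = onY ?D d u"
      by (rule tensor_map_comp[OF Y E_left Y Il Y Dl idY dI idY ID u])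
    moreover have "onY ?D (\<lambda>s. s) \<zero>\<^bsub>tensor Bs Y I\<^esub> = \<zero>\<^bsub>tensor Bs Y ?D\<^esub>"
      by (rule additive_map_zero[OF tensor_map_additive[OF Y Il Y Dl idY ID] YI.abelian_group_axioms YD.abelian_group_axioms])
    ultimately have z: "onY I d u = \<zero>\<^bsub>tensor Bs Y I\<^esub>"
      using inj_onD[OF injID _ dIu YI.zero_closed] by metis
    have "\<exists>t\<in>carrier (tensor Bs Y SB). onY E (\<lambda>s. s) t = u"
      by (rule tensor_right_exact[OF Y SB_left E_left Il S_into_E dI Is(1)[symmetric] _ u z])
        (use ker Is in auto)
    then obtain t where t: "t \<in> carrier (tensor Bs Y SB)" "onY E (\<lambda>s. s) t = u" by blast
    have "ev P x t = F x" if x: "x \<in> carrier P" for x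
      using ev_S_into_E(1)[OF t(1) x] unfolding t(2) evu[OF x] by (rule sym)
    then show "\<exists>t\<in>carrier (tensor Bs Y SB). \<forall>x\<in>carrier P. ev P x t = F x"
      using t(1) by blast
  qed
qed

end

end

section \<open>The Galois map\<close>

context fg_comodule
begin

abbreviation "Xe \<equiv> right_eval_bimod X"
abbreviation "HK K \<equiv> left_hom_bimod A X K"
abbreviation "CK K \<equiv> tensor A C K"
abbreviation "T K \<equiv> tensor S' Xe (HK K)"
abbreviation "\<gamma> K \<equiv> galois_map A C \<rho>X K"

lemma S'_linear: "\<phi> \<in> carrier S' \<Longrightarrow> left_linear A X X \<phi>"
  by (simp add: left_colinear_def)

lemma S'_coaction: "\<phi> \<in> carrier S' \<Longrightarrow> g \<in> carrier X \<Longrightarrow> \<rho>X (\<phi> g) = tensor_map A C X (\<lambda>c. c) \<phi> (\<rho>X g)"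
  by (simp add: left_colinear_def)

lemma S'_closed: "\<phi> \<in> carrier S' \<Longrightarrow> g \<in> carrier X \<Longrightarrow> \<phi> g \<in> carrier X"
  by (rule left_linear_closed[OF S'_linear])

text \<open>Transposition is a bijection from \<open>S\<close>, so the ring axioms are inherited.  Its order is preserved because endomorphisms
  of \<open>P\<^sup>*\<close> act on the right.\<close>

lemma S'_ring: "ring S'"
proof -
  interpret S: ring S by (rule S_ring)
  note cl = rmod_closed[OF X_right]
  have im: "transpose ` carrier S = carrier S'"
  proof
    show "transpose ` carrier S \<subseteq> carrier S'" using transpose_closed by blast
    show "carrier S' \<subseteq> transpose ` carrier S"
    proof
      fix \<phi> assume \<phi>: "\<phi> \<in> carrier S'"
      then obtain s where s: "s \<in> carrier S" "\<And>g. g \<in> carrier X \<Longrightarrow> \<phi> g = g \<odot>\<^sub>r\<^bsub>X\<^esub> s" by (rule transpose_surj) blast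
      have "\<phi> = transpose s"
        by (rule extensionalityI[of _ "carrier X"]) (use \<phi> s(2) in \<open>simp_all add: transpose_def\<close>)
      then show "\<phi> \<in> transpose ` carrier S" using s(1) by blast
    qed
  qed
  have "transpose \<in> ring_hom S S'"
  proof (rule ring_hom_memI)
    fix s t assume s: "s \<in> carrier S" and t: "t \<in> carrier S"
    show "transpose s \<in> carrier S'" by (rule transpose_closed[OF s])
    show "transpose (s \<otimes>\<^bsub>S\<^esub> t) = transpose s \<otimes>\<^bsub>S'\<^esub> transpose t"
      using rmod_mult[OF X_right s t] cl[OF s]
      by (simp only: left_comodule_End_def transpose_def compose_def) (simp only: restrict_def fun_eq_iff monoid.simps ring.simps, simp)
    show "transpose (s \<oplus>\<^bsub>S\<^esub> t) = transpose s \<oplus>\<^bsub>S'\<^esub> transpose t"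
      using rmod_scalar_add[OF X_right s t]
      by (simp only: left_comodule_End_def transpose_def) (simp only: restrict_def fun_eq_iff monoid.simps ring.simps, simp)
  next
    show "transpose \<one>\<^bsub>S\<^esub> = \<one>\<^bsub>S'\<^esub>"
      using rmod_one[OF X_right]
      by (simp only: left_comodule_End_def transpose_def) (simp only: restrict_def fun_eq_iff monoid.simps ring.simps, simp)
  qed
  then have r: "ring (S'\<lparr>carrier := transpose ` carrier S, zero := transpose \<zero>\<^bsub>S\<^esub>\<rparr>)"
    by (rule S.ring_hom_imp_img_ring)
  have "transpose \<zero>\<^bsub>S\<^esub> = \<zero>\<^bsub>S'\<^esub>"
  proof (rule extensionalityI[of _ "carrier X"])
    fix g assume g: "g \<in> carrier X"
    have "g \<odot>\<^sub>r\<^bsub>X\<^esub> \<zero>\<^bsub>S\<^esub> = \<zero>\<^bsub>X\<^esub>"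
      by (rule additive_map_zero[OF rmod_scalar_additive[OF X_right g] S.abelian_group_axioms X_group])
    then show "transpose \<zero>\<^bsub>S\<^esub> g = \<zero>\<^bsub>S'\<^esub> g"
      using g unfolding left_comodule_End_def transpose_def by simp
  qed (simp_all add: transpose_def left_comodule_End_def)
  then have "S'\<lparr>carrier := transpose ` carrier S, zero := transpose \<zero>\<^bsub>S\<^esub>\<rparr> = S'"
    unfolding im by simp
  with r show ?thesis by simp
qed

lemma Xe_simps [simp]: "carrier Xe = carrier X" "zero Xe = zero X" "add Xe = add X" "smult Xe = smult X"
  "rsmult Xe = (\<lambda>x s. s x)"
  by (simp_all add: right_eval_bimod_def)

lemma Xe_bimodule: "bimodule A S' Xe"
proof -
  have G: "abelian_group Xe" by (rule abelian_group_cong[OF X_group]) (simp_all del: X_simps)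
  have l: "left_module A Xe" using X_left G by (simp add: left_module_def del: X_simps)
  have "right_module S' Xe"
    unfolding right_module_def
  proof (intro conjI ballI S'_ring G)
    fix \<phi> g assume \<phi>: "\<phi> \<in> carrier S'" and "g \<in> carrier Xe"
    then have g: "g \<in> carrier X" by simp
    show "g \<odot>\<^sub>r\<^bsub>Xe\<^esub> \<phi> \<in> carrier Xe" using S'_closed[OF \<phi> g] by simp
    show "(g \<oplus>\<^bsub>Xe\<^esub> h) \<odot>\<^sub>r\<^bsub>Xe\<^esub> \<phi> = g \<odot>\<^sub>r\<^bsub>Xe\<^esub> \<phi> \<oplus>\<^bsub>Xe\<^esub> h \<odot>\<^sub>r\<^bsub>Xe\<^esub> \<phi>" if h: "h \<in> carrier Xe" for h
      using left_linear_add[OF S'_linear[OF \<phi>] g] h by (simp del: X_simps)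
    fix \<psi> assume \<psi>: "\<psi> \<in> carrier S'"
    show "g \<odot>\<^sub>r\<^bsub>Xe\<^esub> (\<phi> \<oplus>\<^bsub>S'\<^esub> \<psi>) = g \<odot>\<^sub>r\<^bsub>Xe\<^esub> \<phi> \<oplus>\<^bsub>Xe\<^esub> g \<odot>\<^sub>r\<^bsub>Xe\<^esub> \<psi>"
      "g \<odot>\<^sub>r\<^bsub>Xe\<^esub> (\<phi> \<otimes>\<^bsub>S'\<^esub> \<psi>) = g \<odot>\<^sub>r\<^bsub>Xe\<^esub> \<phi> \<odot>\<^sub>r\<^bsub>Xe\<^esub> \<psi>"
      using g by (simp_all add: left_comodule_End_def compose_def del: X_simps)
  next
    fix g assume "g \<in> carrier Xe"
    then show "g \<odot>\<^sub>r\<^bsub>Xe\<^esub> \<one>\<^bsub>S'\<^esub> = g" by (simp add: left_comodule_End_def del: X_simps)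
  qed
  then show ?thesis
    using l left_linear_smult[OF S'_linear] by (simp add: bimodule_def del: X_simps S'_simps)
qed

lemmas Xe_right = bimod_right[OF Xe_bimodule]

lemma HK_simps [simp]:
  "carrier (HK K) = {h \<in> extensional (carrier X). left_linear A X K h}" "zero (HK K) = (\<lambda>x\<in>carrier X. \<zero>\<^bsub>K\<^esub>)"
  "add (HK K) = (\<lambda>f g. \<lambda>x\<in>carrier X. f x \<oplus>\<^bsub>K\<^esub> g x)" "smult (HK K) = (\<lambda>s h. compose (carrier X) h s)"
  by (simp_all add: left_hom_bimod_def)

text \<open>The image of \<open>x \<otimes> k\<close> under \<open>P \<otimes> K = Hom(P\<^sup>*, K)\<close>.\<close>

definition evk where "evk K x k = (\<lambda>g\<in>carrier X. g x \<odot>\<^bsub>K\<^esub> k)"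

context
  fixes K :: "('a, 'k, 'k1, 'k2) bimod_scheme"
  assumes K: "left_module A K"
begin

lemma HK_linear: "h \<in> carrier (HK K) \<Longrightarrow> left_linear A X K h"
  by simp

lemma HK_closed: "h \<in> carrier (HK K) \<Longrightarrow> g \<in> carrier X \<Longrightarrow> h g \<in> carrier K"
  by (rule left_linear_closed[OF HK_linear])

lemma HK_module: "left_module S' (HK K)"
proof -
  interpret K: abelian_group K by (rule lmod_group[OF K])
  have G: "abelian_group (HK K)"
    by (rule pointwise_abelian_group[OF K.abelian_group_axioms, of _ "carrier X"]; (rule HK_closed; assumption)?)
      (auto simp del: X_simps intro!: left_linear_restrict[OF X_left] left_linear_plus[OF K] left_linear_zero[OF K]
        left_linear_neg[OF K] intro: left_linear_closed)
  show ?thesis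
    unfolding left_module_def
  proof (intro conjI ballI S'_ring G)
    fix \<phi> h assume \<phi>: "\<phi> \<in> carrier S'" and h: "h \<in> carrier (HK K)"
    show "\<phi> \<odot>\<^bsub>HK K\<^esub> h \<in> carrier (HK K)"
      using left_linear_restrict[OF X_left left_linear_comp[OF S'_linear[OF \<phi>] HK_linear[OF h]]]
      by (simp add: compose_def del: X_simps)
    show "\<phi> \<odot>\<^bsub>HK K\<^esub> (h \<oplus>\<^bsub>HK K\<^esub> h') = \<phi> \<odot>\<^bsub>HK K\<^esub> h \<oplus>\<^bsub>HK K\<^esub> \<phi> \<odot>\<^bsub>HK K\<^esub> h'" for h'
      using S'_closed[OF \<phi>] by (simp add: compose_def restrict_def fun_eq_iff del: X_simps)
    fix \<psi> assume \<psi>: "\<psi> \<in> carrier S'"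
    show "(\<phi> \<oplus>\<^bsub>S'\<^esub> \<psi>) \<odot>\<^bsub>HK K\<^esub> h = \<phi> \<odot>\<^bsub>HK K\<^esub> h \<oplus>\<^bsub>HK K\<^esub> \<psi> \<odot>\<^bsub>HK K\<^esub> h"
      using S'_closed[OF \<phi>] S'_closed[OF \<psi>] left_linear_add[OF HK_linear[OF h]]
      by (simp add: left_comodule_End_def compose_def restrict_def fun_eq_iff del: X_simps)
    show "(\<phi> \<otimes>\<^bsub>S'\<^esub> \<psi>) \<odot>\<^bsub>HK K\<^esub> h = \<phi> \<odot>\<^bsub>HK K\<^esub> (\<psi> \<odot>\<^bsub>HK K\<^esub> h)"
      using S'_closed[OF \<phi>] by (simp add: left_comodule_End_def compose_def restrict_def fun_eq_iff del: X_simps)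
  next
    fix h assume "h \<in> carrier (HK K)"
    then have e: "h \<in> extensional (carrier X)" by simp
    show "\<one>\<^bsub>S'\<^esub> \<odot>\<^bsub>HK K\<^esub> h = h"
      by (rule extensionalityI[of _ "carrier X"]) (simp_all add: left_comodule_End_def compose_def e del: X_simps)
  qed
qed

lemmas T_group = tensor_group[OF Xe_right HK_module]
lemmas CK_group = tensor_group[OF C_right K]
lemmas T_eqI = tensor_eqI[OF Xe_right HK_module]

lemma CK_map:
  assumes "left_linear A X K h"
  shows "left_linear A CX (CK K) (tensor_map A C K (\<lambda>c. c) h)"
    and "\<And>c g. c \<in> carrier C \<Longrightarrow> g \<in> carrier X \<Longrightarrow> tensor_map A C K (\<lambda>c. c) h (pure A C X c g) = pure A C K c (h g)"
  by (rule tensor_map_left_linear[OF C_bimodule X_left C_bimodule K right_linear_ident left_linear_ident assms],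
      rule tensor_map_pure[OF C_right X_left C_right K right_linear_ident assms])

lemma galois_balanced: "balanced S' Xe (HK K) (CK K) (\<lambda>q h. tensor_map A C K (\<lambda>c. c) h (\<rho>X q))"
proof (rule balancedI)
  note \<rho>c = left_linear_closed[OF \<rho>X_left_linear]
  note idC = right_linear_ident[of A C]
  show "additive_map (HK K) (CK K) (\<lambda>h. tensor_map A C K (\<lambda>c. c) h (\<rho>X q))" if "q \<in> carrier Xe" for q
  proof (rule additive_mapI)
    have q: "\<rho>X q \<in> carrier CX" using \<rho>c that by simp
    fix h assume h: "h \<in> carrier (HK K)"
    show "tensor_map A C K (\<lambda>c. c) h (\<rho>X q) \<in> carrier (CK K)"
      by (rule left_linear_closed[OF CK_map(1)[OF HK_linear[OF h]] q])
    fix h' assume h': "h' \<in> carrier (HK K)"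
    have "tensor_map A C K (\<lambda>c. c) (h \<oplus>\<^bsub>HK K\<^esub> h') (\<rho>X q) = tensor_map A C K (\<lambda>c. c) (\<lambda>x. h x \<oplus>\<^bsub>K\<^esub> h' x) (\<rho>X q)"
      by (rule tensor_map_cong[OF C_right X_left C_right K idC left_linear_plus[OF K HK_linear[OF h] HK_linear[OF h']] _ _ q])
        (simp_all del: X_simps)
    then show "tensor_map A C K (\<lambda>c. c) (h \<oplus>\<^bsub>HK K\<^esub> h') (\<rho>X q) =
        tensor_map A C K (\<lambda>c. c) h (\<rho>X q) \<oplus>\<^bsub>CK K\<^esub> tensor_map A C K (\<lambda>c. c) h' (\<rho>X q)"
      using tensor_map_add_right[OF C_right X_left C_right K idC HK_linear[OF h] HK_linear[OF h'] q] by simp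
  qed
  show "additive_map Xe (CK K) (\<lambda>q. tensor_map A C K (\<lambda>c. c) h (\<rho>X q))" if h: "h \<in> carrier (HK K)" for h
    using additive_map_comp[OF left_linear_additive[OF \<rho>X_left_linear] left_linear_additive[OF CK_map(1)[OF HK_linear[OF h]]]]
    by (simp add: additive_map_def del: X_simps)
  fix q \<phi> h assume "q \<in> carrier Xe" and \<phi>: "\<phi> \<in> carrier S'" and h: "h \<in> carrier (HK K)"
  then have q: "q \<in> carrier X" by simp
  have "tensor_map A C K (\<lambda>c. c) h (\<rho>X (\<phi> q)) = tensor_map A C K (\<lambda>c. c) (\<lambda>x. h (\<phi> x)) (\<rho>X q)"
    unfolding S'_coaction[OF \<phi> q]
    by (rule tensor_map_comp[OF C_right X_left C_right X_left C_right K idC S'_linear[OF \<phi>] idC HK_linear[OF h] \<rho>c[OF q]])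
  also have "\<dots> = tensor_map A C K (\<lambda>c. c) (\<phi> \<odot>\<^bsub>HK K\<^esub> h) (\<rho>X q)"
    by (rule tensor_map_cong[OF C_right X_left C_right K idC HK_linear[OF lmod_closed[OF HK_module \<phi> h]] _ _ \<rho>c[OF q]])
      (simp_all add: compose_def del: X_simps)
  finally show "tensor_map A C K (\<lambda>c. c) h (\<rho>X (q \<odot>\<^sub>r\<^bsub>Xe\<^esub> \<phi>)) = tensor_map A C K (\<lambda>c. c) (\<phi> \<odot>\<^bsub>HK K\<^esub> h) (\<rho>X q)"
    by simp
qed

lemmas galois_lift = tensor_lift[OF Xe_right HK_module CK_group galois_balanced, folded galois_map_def]

lemma galois_additive: "additive_map (T K) (CK K) (\<gamma> K)"
  by (rule galois_lift(1))

lemma galois_pure: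
  assumes q: "q \<in> carrier X" and h: "h \<in> carrier (HK K)"
  shows "(\<gamma> K) (pure S' Xe (HK K) q h) = (\<Oplus>\<^bsub>CK K\<^esub>i\<in>{..<n}. pure A C K (hat q (p i)) (h (\<pi> i)))"
proof -
  note m = CK_map[OF HK_linear[OF h]]
  have "(\<gamma> K) (pure S' Xe (HK K) q h) = tensor_map A C K (\<lambda>c. c) h (\<rho>X q)"
    using galois_lift(2)[OF _ h] q by simp
  also have "\<dots> = (\<Oplus>\<^bsub>CK K\<^esub>i\<in>{..<n}. tensor_map A C K (\<lambda>c. c) h (pure A C X (hat q (p i)) (\<pi> i)))"
    by (rule additive_\<rho>X[OF left_linear_additive[OF m(1)] CK_group q])
  also have "\<dots> = (\<Oplus>\<^bsub>CK K\<^esub>i\<in>{..<n}. pure A C K (hat q (p i)) (h (\<pi> i)))"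
    by (intro finsum_eqI[OF CK_group] m(2) pure_closed[OF C_right K] hat_C q p_closed \<pi>_closed HK_closed[OF h]) auto
  finally show ?thesis .
qed

lemma galois_left_linear: "left_linear A (T K) (CK K) (\<gamma> K)"
  unfolding left_linear_def
proof (intro conjI ballI galois_additive)
  fix a t assume a: "a \<in> carrier A" and t: "t \<in> carrier (T K)"
  note ad = smult_tensor_additive[OF Xe_bimodule HK_module a]
  show "(\<gamma> K) (a \<odot>\<^bsub>T K\<^esub> t) = a \<odot>\<^bsub>CK K\<^esub> (\<gamma> K) t"
  proof (rule T_eqI[OF additive_map_comp[OF ad galois_additive]
        additive_map_comp[OF galois_additive smult_tensor_additive[OF C_bimodule K a]] _ t])
    fix q h assume q: "q \<in> carrier Xe" and h: "h \<in> carrier (HK K)"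
    have q': "q \<in> carrier X" "a \<odot>\<^bsub>Xe\<^esub> q \<in> carrier Xe"
      using q lmod_closed[OF bimod_left[OF Xe_bimodule] a q] by simp_all
    have "(\<gamma> K) (a \<odot>\<^bsub>T K\<^esub> pure S' Xe (HK K) q h) = tensor_map A C K (\<lambda>c. c) h (\<rho>X (a \<odot>\<^bsub>Xe\<^esub> q))"
      unfolding smult_pure[OF Xe_bimodule HK_module a q h] by (rule galois_lift(2)[OF q'(2) h])
    also have "\<dots> = a \<odot>\<^bsub>CK K\<^esub> tensor_map A C K (\<lambda>c. c) h (\<rho>X q)"
      using left_linear_smult[OF \<rho>X_left_linear a q'(1)]
        left_linear_smult[OF CK_map(1)[OF HK_linear[OF h]] a left_linear_closed[OF \<rho>X_left_linear q'(1)]]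
      by simp
    also have "\<dots> = a \<odot>\<^bsub>CK K\<^esub> (\<gamma> K) (pure S' Xe (HK K) q h)" by (simp only: galois_lift(2)[OF q h])
    finally show "(\<gamma> K) (a \<odot>\<^bsub>T K\<^esub> pure S' Xe (HK K) q h) = a \<odot>\<^bsub>CK K\<^esub> (\<gamma> K) (pure S' Xe (HK K) q h)" .
  qed
qed

lemma evk_apply: "g \<in> carrier X \<Longrightarrow> evk K x k g = g x \<odot>\<^bsub>K\<^esub> k"
  by (simp add: evk_def)

lemma evk_closed:
  assumes x: "x \<in> carrier P" and k: "k \<in> carrier K"
  shows "evk K x k \<in> carrier (HK K)"
proof -
  have "left_linear A X K (\<lambda>g. g x \<odot>\<^bsub>K\<^esub> k)"
    unfolding left_linear_def
  proof (intro conjI ballI additive_mapI)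
    fix g assume g: "g \<in> carrier X"
    show "g x \<odot>\<^bsub>K\<^esub> k \<in> carrier K" by (rule lmod_closed[OF K X_closed[OF g x] k])
    show "(g \<oplus>\<^bsub>X\<^esub> g') x \<odot>\<^bsub>K\<^esub> k = g x \<odot>\<^bsub>K\<^esub> k \<oplus>\<^bsub>K\<^esub> g' x \<odot>\<^bsub>K\<^esub> k" if "g' \<in> carrier X" for g'
      using lmod_scalar_add[OF K X_closed[OF g x] X_closed[OF that x] k] x by simp
    show "(a \<odot>\<^bsub>X\<^esub> g) x \<odot>\<^bsub>K\<^esub> k = a \<odot>\<^bsub>K\<^esub> (g x \<odot>\<^bsub>K\<^esub> k)" if "a \<in> carrier A" for a
      using lmod_mult[OF K that X_closed[OF g x] k] x by simp
  qed
  from left_linear_restrict[OF X_left this] show ?thesis by (simp add: evk_def del: X_simps)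
qed

lemma evk_additive_left: "k \<in> carrier K \<Longrightarrow> additive_map P (HK K) (\<lambda>x. evk K x k)"
proof (rule additive_mapI, rule evk_closed)
  fix x y assume k: "k \<in> carrier K" and x: "x \<in> carrier P" and y: "y \<in> carrier P"
  show "evk K (x \<oplus>\<^bsub>P\<^esub> y) k = evk K x k \<oplus>\<^bsub>HK K\<^esub> evk K y k"
  proof (rule extensionalityI[of _ "carrier X"])
    fix g assume g: "g \<in> carrier X"
    show "evk K (x \<oplus>\<^bsub>P\<^esub> y) k g = (evk K x k \<oplus>\<^bsub>HK K\<^esub> evk K y k) g"
      using lmod_scalar_add[OF K X_closed[OF g x] X_closed[OF g y] k] g
        right_linear_add[OF X_linear[OF g] x y]
      by (simp add: evk_def del: X_simps)
  qed (simp_all add: evk_def)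
qed simp_all

lemma evk_additive_right: "x \<in> carrier P \<Longrightarrow> additive_map K (HK K) (evk K x)"
proof (rule additive_mapI, rule evk_closed)
  fix k k' assume x: "x \<in> carrier P" and k: "k \<in> carrier K" and k': "k' \<in> carrier K"
  show "evk K x (k \<oplus>\<^bsub>K\<^esub> k') = evk K x k \<oplus>\<^bsub>HK K\<^esub> evk K x k'"
    by (rule extensionalityI[of _ "carrier X"])
      (simp_all add: evk_def x k k' lmod_add[OF K] X_closed del: X_simps)
qed simp_all

lemma evk_balanced:
  assumes x: "x \<in> carrier P" and a: "a \<in> carrier A" and k: "k \<in> carrier K"
  shows "evk K (x \<odot>\<^sub>r\<^bsub>P\<^esub> a) k = evk K x (a \<odot>\<^bsub>K\<^esub> k)"
  by (rule extensionalityI[of _ "carrier X"])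
    (simp_all add: evk_def right_linear_rsmult[OF X_linear a x] lmod_mult[OF K _ a k] X_closed x del: X_simps)

lemma evk_S:
  assumes s: "s \<in> carrier S" and x: "x \<in> carrier P" and q: "q \<in> carrier X" and k: "k \<in> carrier K"
  shows "pure S' Xe (HK K) (q \<odot>\<^sub>r\<^bsub>X\<^esub> s) (evk K x k) = pure S' Xe (HK K) q (evk K (s x) k)"
proof -
  have "pure S' Xe (HK K) (q \<odot>\<^sub>r\<^bsub>Xe\<^esub> transpose s) (evk K x k) = pure S' Xe (HK K) q (transpose s \<odot>\<^bsub>HK K\<^esub> evk K x k)"
    using q by (intro pure_balanced[OF Xe_right HK_module] transpose_closed s evk_closed x k) simp
  moreover have "q \<odot>\<^sub>r\<^bsub>Xe\<^esub> transpose s = q \<odot>\<^sub>r\<^bsub>X\<^esub> s" using q by (simp add: transpose_def del: X_simps)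
  moreover have "transpose s \<odot>\<^bsub>HK K\<^esub> evk K x k = evk K (s x) k"
  proof (rule extensionalityI[of _ "carrier X"])
    fix g assume g: "g \<in> carrier X"
    then show "(transpose s \<odot>\<^bsub>HK K\<^esub> evk K x k) g = evk K (s x) k g"
      using rmod_closed[OF X_right s g] x by (simp add: compose_def transpose_def evk_def del: X_simps(1))
  qed (simp_all add: evk_def compose_def)
  ultimately show ?thesis by simp
qed

text \<open>On these elements the Galois map is the canonical map tensored with \<open>K\<close>.\<close>

lemma galois_evk:
  assumes q: "q \<in> carrier X" and x: "x \<in> carrier P" and k: "k \<in> carrier K"
  shows "(\<gamma> K) (pure S' Xe (HK K) q (evk K x k)) = pure A C K (hat q x) k"
proof -
  have c: "hat q (p i) \<odot>\<^sub>r\<^bsub>C\<^esub> \<pi> i x \<in> carrier C" if "i \<in> {..<n}" for i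
    using that by (intro rmod_closed[OF C_right] X_closed \<pi>_closed x hat_C q p_closed) auto
  have "(\<gamma> K) (pure S' Xe (HK K) q (evk K x k)) = (\<Oplus>\<^bsub>CK K\<^esub>i\<in>{..<n}. pure A C K (hat q (p i)) (evk K x k (\<pi> i)))"
    by (rule galois_pure[OF q evk_closed[OF x k]])
  also have "\<dots> = (\<Oplus>\<^bsub>CK K\<^esub>i\<in>{..<n}. pure A C K (hat q (p i) \<odot>\<^sub>r\<^bsub>C\<^esub> \<pi> i x) k)"
  proof (rule finsum_eqI[OF CK_group])
    fix i assume i: "i \<in> {..<n}"
    then have i': "i < n" by simp
    show "pure A C K (hat q (p i) \<odot>\<^sub>r\<^bsub>C\<^esub> \<pi> i x) k \<in> carrier (CK K)" by (rule pure_closed[OF C_right K c[OF i] k])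
    show "pure A C K (hat q (p i)) (evk K x k (\<pi> i)) = pure A C K (hat q (p i) \<odot>\<^sub>r\<^bsub>C\<^esub> \<pi> i x) k"
      unfolding evk_apply[OF \<pi>_closed[OF i']]
      by (rule pure_balanced[OF C_right K hat_C[OF q p_closed[OF i']] X_closed[OF \<pi>_closed[OF i'] x] k, symmetric])
  qed
  also have "\<dots> = pure A C K (\<Oplus>\<^bsub>C\<^esub>i\<in>{..<n}. hat q (p i) \<odot>\<^sub>r\<^bsub>C\<^esub> \<pi> i x) k"
    by (rule additive_map_sum[OF pure_additive_left[OF C_right K k] C_group CK_group c, symmetric])
  also have "\<dots> = pure A C K (hat q x) k"
    by (simp only: linear_expand[OF C_right hat_linear[OF q] x])
  finally show ?thesis .
qed

lemma evk_expand:
  assumes h: "h \<in> carrier (HK K)"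
  shows "(\<Oplus>\<^bsub>HK K\<^esub>i\<in>{..<n}. evk K (p i) (h (\<pi> i))) = h"
proof (rule extensionalityI[of _ "carrier X"])
  have c: "evk K (p i) (h (\<pi> i)) \<in> carrier (HK K)" if "i \<in> {..<n}" for i
    using that by (intro evk_closed p_closed HK_closed[OF h] \<pi>_closed) auto
  have ex: "f \<in> carrier (HK K) \<Longrightarrow> f \<in> extensional (carrier X)" for f by simp
  show "(\<Oplus>\<^bsub>HK K\<^esub>i\<in>{..<n}. evk K (p i) (h (\<pi> i))) \<in> extensional (carrier X)"
    by (rule ex[OF finsum_in[OF lmod_group[OF HK_module] c]])
  show "h \<in> extensional (carrier X)" by (rule ex[OF h])
  fix g assume g: "g \<in> carrier X"
  have "additive_map (HK K) K (\<lambda>f. f g)"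
  proof (rule additive_mapI)
    show "f g \<in> carrier K" if "f \<in> carrier (HK K)" for f by (rule HK_closed[OF that g])
  qed (use g in \<open>simp del: X_simps\<close>)
  then have "(\<Oplus>\<^bsub>HK K\<^esub>i\<in>{..<n}. evk K (p i) (h (\<pi> i))) g = (\<Oplus>\<^bsub>K\<^esub>i\<in>{..<n}. evk K (p i) (h (\<pi> i)) g)"
    by (rule additive_map_sum[OF _ lmod_group[OF HK_module] lmod_group[OF K] c])
  also have "\<dots> = h g"
    unfolding evk_apply[OF g] by (rule linear_form_expand[OF K HK_linear[OF h] g])
  finally show "(\<Oplus>\<^bsub>HK K\<^esub>i\<in>{..<n}. evk K (p i) (h (\<pi> i))) g = h g" .
qed

end

end

section \<open>From a splitting to the Galois property\<close>

context galois_setup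
begin

abbreviation "XP \<equiv> tensor Bs X P"
abbreviation "HP \<equiv> tensor Bs H P"
abbreviation "XS \<equiv> tensor Bs X SB"
abbreviation "\<mu> \<equiv> canonical_map C"
abbreviation "coactHP \<equiv> tensor_coaction Bs A C H P \<rho>"

lemmas XB = right_module_subring[OF B X_right] and HB = right_module_subring[OF B H_module]
lemmas XP_group = tensor_group[OF XB P_left] and HP_group = tensor_group[OF HB P_left]
lemmas XS_group = tensor_group[OF XB SB_left]
lemmas XP_module = tensor_right_module[OF XB P_bimodule] and HP_module = tensor_right_module[OF HB P_bimodule]
lemmas hatB = right_linear_subring[OF B hat_right_linear] and unhatB = right_linear_subring[OF B unhat_right_linear]

lemma SB_bimodule: "bimodule Bs S SB"
  by (rule bimodule_left_subring[OF B regular_bimodule[OF S_ring]])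

lemmas XS_module = tensor_right_module[OF XB SB_bimodule]

lemma canonical_balanced: "balanced Bs H P C (\<lambda>f x. f x)"
proof (rule balancedI)
  show "additive_map P C (\<lambda>x. f x)" if "f \<in> carrier H" for f
    by (rule right_linear_additive[OF H_linear[OF that]])
  show "additive_map H C (\<lambda>f. f x)" if x: "x \<in> carrier P" for x
  proof (rule additive_mapI)
    show "f x \<in> carrier C" if "f \<in> carrier H" for f by (rule H_closed[OF that x])
  qed (use x in simp)
qed (simp add: compose_def)

lemmas canonical_lift = tensor_lift[OF HB P_left C_group canonical_balanced, folded canonical_map_def]

text \<open>The canonical map, with \<open>Hom\<^sup>C(P, C)\<close> replaced by \<open>P\<^sup>*\<close>.\<close>

definition muX where "muX = tensor_lift C (\<lambda>g x. hat g x)"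

lemma hat_additive: "x \<in> carrier P \<Longrightarrow> additive_map X C (\<lambda>g. hat g x)"
  by (rule additive_mapI) (rule hat_C hat_add; assumption)+

lemma muX_balanced: "balanced Bs X P C (\<lambda>g x. hat g x)"
proof (rule balancedI)
  show "additive_map P C (\<lambda>x. hat g x)" if "g \<in> carrier X" for g
    by (rule right_linear_additive[OF hat_linear[OF that]])
  show "hat (g \<odot>\<^sub>r\<^bsub>X\<^esub> b) x = hat g (b \<odot>\<^bsub>P\<^esub> x)" if "g \<in> carrier X" "b \<in> carrier Bs" "x \<in> carrier P" for g b x
    using hat_rsmult[OF that(1) B_subset that(3), of b] that(2) by simp
qed (rule hat_additive)

lemmas muX_lift = tensor_lift[OF XB P_left C_group muX_balanced, folded muX_def]

abbreviation "J \<equiv> tensor_map Bs H P hat (\<lambda>x. x)"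
abbreviation "J' \<equiv> tensor_map Bs X P unhat (\<lambda>x. x)"

lemmas J = tensor_map_additive[OF XB P_left HB P_left hatB left_linear_ident]
  tensor_map_pure[OF XB P_left HB P_left hatB left_linear_ident]
  tensor_map_right_linear[OF XB P_bimodule HB P_bimodule hatB left_linear_ident right_linear_ident]
lemmas J' = tensor_map_additive[OF HB P_left XB P_left unhatB left_linear_ident]
  tensor_map_pure[OF HB P_left XB P_left unhatB left_linear_ident]
  tensor_map_right_linear[OF HB P_bimodule XB P_bimodule unhatB left_linear_ident right_linear_ident]

lemma muX_J': "z \<in> carrier HP \<Longrightarrow> muX (J' z) = \<mu> z"
  by (rule tensor_eqI[OF HB P_left additive_map_comp[OF J'(1) muX_lift(1)] canonical_lift(1)])
    (simp_all only: J'(2) muX_lift(2) canonical_lift(2) unhat_X hat_unhat)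

lemma canonical_J: "t \<in> carrier XP \<Longrightarrow> \<mu> (J t) = muX t"
  by (rule tensor_eqI[OF XB P_left additive_map_comp[OF J(1) canonical_lift(1)] muX_lift(1)])
    (simp_all only: J(2) muX_lift(2) canonical_lift(2) hat_H)

definition mulX where "mulX = tensor_lift X (\<lambda>y s. y \<odot>\<^sub>r\<^bsub>X\<^esub> s)"

lemma mulX_balanced: "balanced Bs X SB X (\<lambda>y s. y \<odot>\<^sub>r\<^bsub>X\<^esub> s)"
proof (rule balancedI)
  show "additive_map SB X (\<lambda>s. y \<odot>\<^sub>r\<^bsub>X\<^esub> s)" if "y \<in> carrier X" for y
    using rmod_scalar_additive[OF X_right that] by (simp add: additive_map_def del: X_simps S_simps)
  show "additive_map X X (\<lambda>y. y \<odot>\<^sub>r\<^bsub>X\<^esub> s)" if "s \<in> carrier SB" for s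
    using rmod_additive[OF X_right, of s] that by (simp del: X_simps S_simps)
  show "(y \<odot>\<^sub>r\<^bsub>X\<^esub> b) \<odot>\<^sub>r\<^bsub>X\<^esub> s = y \<odot>\<^sub>r\<^bsub>X\<^esub> (b \<odot>\<^bsub>SB\<^esub> s)" if "y \<in> carrier X" "b \<in> carrier Bs" "s \<in> carrier SB" for y b s
    using rmod_mult[OF X_right B_subset, of b s y] that by (simp del: X_simps S_simps)
qed

lemmas mulX_lift = tensor_lift[OF XB SB_left X_group mulX_balanced, folded mulX_def]

abbreviation "evX x \<equiv> tensor_map Bs X P (\<lambda>y. y) (\<lambda>e. e x)"

lemmas evX_additive = ev_additive[OF XB SB_map_module P_left] and evX_pure = ev_pure[OF XB SB_map_module P_left]
lemmas evX_linear = ev_right_linear[OF XB SB_map_module P_bimodule]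

lemma evX_closed: "t \<in> carrier XS \<Longrightarrow> x \<in> carrier P \<Longrightarrow> evX x t \<in> carrier XP"
  by (rule additive_map_closed[OF evX_additive])

text \<open>For \<open>t\<close> in \<open>P\<^sup>* \<otimes> S\<close>, regarded as a map \<open>P \<rightarrow> P\<^sup>* \<otimes> P\<close>, composition with the canonical map amounts to
  multiplication \<open>P\<^sup>* \<otimes> S \<rightarrow> P\<^sup>*\<close>.\<close>

lemma muX_ev:
  assumes t: "t \<in> carrier XS" and x: "x \<in> carrier P"
  shows "muX (evX x t) = hat (mulX t) x"
proof (rule tensor_eqI[OF XB SB_left additive_map_comp[OF evX_additive[OF x] muX_lift(1)]
      additive_map_comp[OF mulX_lift(1) hat_additive[OF x]] _ t])
  fix y s assume y: "y \<in> carrier X" and s: "s \<in> carrier SB"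
  then have s': "s \<in> carrier S" by simp
  show "muX (evX x (pure Bs X SB y s)) = hat (mulX (pure Bs X SB y s)) x"
    unfolding evX_pure[OF x y s] muX_lift(2)[OF y S_closed[OF s' x]] mulX_lift(2)[OF y s] hat_rsmult[OF y s' x] ..
qed

lemma evX_rsmult:
  assumes t: "t \<in> carrier XS" and x: "x \<in> carrier P" and s: "s \<in> carrier S"
  shows "evX x (t \<odot>\<^sub>r\<^bsub>XS\<^esub> s) = evX (s x) t"
  unfolding rsmult_tensor
  using tensor_map_comp[OF XB SB_left XB SB_left XB P_left right_linear_ident bimod_right_smult_left_linear[OF SB_bimodule s]
      right_linear_ident eval_left_linear[OF SB_map_module x] t] x
  by (simp add: compose_def)

lemma canonical_linear: "right_linear A HP C \<mu>"
  unfolding right_linear_def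
proof (intro conjI ballI canonical_lift(1))
  fix a t assume a: "a \<in> carrier A" and t: "t \<in> carrier HP"
  show "\<mu> (t \<odot>\<^sub>r\<^bsub>HP\<^esub> a) = \<mu> t \<odot>\<^sub>r\<^bsub>C\<^esub> a"
    by (rule tensor_eqI[OF HB P_left additive_map_comp[OF rmod_additive[OF HP_module a] canonical_lift(1)]
          additive_map_comp[OF canonical_lift(1) rmod_additive[OF C_right a]] _ t])
      (simp only: rsmult_pure[OF HB P_bimodule a] canonical_lift(2) rmod_closed[OF P_module a] right_linear_rsmult[OF H_linear a])
qed

lemma tensor_H_extend:
  assumes w: "w \<in> carrier PC" and f: "f \<in> carrier H"
  shows "tensor_map A C C \<mu> (\<lambda>c. c) (tensor_assoc_inv Bs A H P C (pure Bs H PC f w)) = tensor_map A C C f (\<lambda>c. c) w"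
proof -
  note as = tensor_assoc_inv_additive[OF HB P_bimodule C_left] tensor_assoc_inv_pure[OF HB P_bimodule C_left]
  show ?thesis
    by (rule tensor_eqI[OF P_module C_left additive_map_comp[OF additive_map_comp[OF pure_additive_right[OF HB PC_left f] as(1)]
          tensor_C_additive[OF HP_module C_right canonical_linear]] PC_additive[OF C_right H_linear[OF f]] _ w])
      (simp only: as(2) f tensor_C_pure[OF HP_module C_right canonical_linear] pure_closed[OF HB P_left] canonical_lift(2) PC_pure[OF C_right H_linear[OF f]])
qed

lemma canonical_colinear: "right_colinear A C HP coactHP C (comult C) \<mu>"
proof -
  note li = right_linear_ident[of Bs H] coact_left_linear
  note r = tensor_map_additive[OF HB P_left HB PC_left li] tensor_map_pure[OF HB P_left HB PC_left li]
  note as = tensor_assoc_inv_additive[OF HB P_bimodule C_left]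
  have "comult C (\<mu> t) = tensor_map A C C \<mu> (\<lambda>c. c) (tensor_assoc_inv Bs A H P C (tensor_map Bs H PC (\<lambda>x. x) \<rho> t))"
    if t: "t \<in> carrier HP" for t
  proof (rule tensor_eqI[OF HB P_left additive_map_comp[OF canonical_lift(1) right_linear_additive[OF comult_linear]]
        additive_map_comp[OF additive_map_comp[OF r(1) as] tensor_C_additive[OF HP_module C_right canonical_linear]] _ t])
    fix f x assume f: "f \<in> carrier H" and x: "x \<in> carrier P"
    show "comult C (\<mu> (pure Bs H P f x)) =
      tensor_map A C C \<mu> (\<lambda>c. c) (tensor_assoc_inv Bs A H P C (tensor_map Bs H PC (\<lambda>x. x) \<rho> (pure Bs H P f x)))"
      unfolding canonical_lift(2)[OF f x] r(2)[OF f x] tensor_H_extend[OF coact_closed[OF x] f]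
      using f x by (simp add: right_colinear_def)
  qed
  then show ?thesis using canonical_linear by (simp add: right_colinear_def tensor_coaction_def)
qed

context
  fixes \<sigma>
  assumes bij: "hom_tensor_bij X" and \<sigma>: "right_colinear A C C (comult C) HP coactHP \<sigma>"
    and split: "\<And>c. c \<in> carrier C \<Longrightarrow> \<mu> (\<sigma> c) = c"
begin

definition \<sigma>X where "\<sigma>X c = J' (\<sigma> c)"

lemma \<sigma>_linear: "right_linear A C HP \<sigma>"
  by (rule rcolin_linear[OF \<sigma>])

lemma \<sigma>_closed: "c \<in> carrier C \<Longrightarrow> \<sigma> c \<in> carrier HP"
  by (rule right_linear_closed[OF \<sigma>_linear])

lemma \<sigma>X_linear: "right_linear A C XP \<sigma>X"
  unfolding \<sigma>X_def by (rule right_linear_comp[OF \<sigma>_linear J'(3)])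

lemmas \<sigma>X_additive = right_linear_additive[OF \<sigma>X_linear]

lemma muX_\<sigma>X: "c \<in> carrier C \<Longrightarrow> muX (\<sigma>X c) = c"
  by (simp add: \<sigma>X_def muX_J'[OF \<sigma>_closed] split)

text \<open>A composite of colinear maps \<open>P \<rightarrow> C \<rightarrow> Hom\<^sup>C(P, C) \<otimes> P\<close>; naturality of associativity carries it over to
  \<open>P\<^sup>* \<otimes> P\<close>.\<close>

lemma \<sigma>X_hat_colin:
  assumes q: "q \<in> carrier X"
  shows "colin X (\<lambda>x. \<sigma>X (hat q x))"
  unfolding colin_def
proof (intro conjI ballI)
  note ql = hat_linear[OF q]
  have Fl: "right_linear A P HP (\<lambda>x. \<sigma> (hat q x))" by (rule right_linear_comp[OF ql \<sigma>_linear])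
  show "right_linear A P XP (\<lambda>x. \<sigma>X (hat q x))" by (rule right_linear_comp[OF ql \<sigma>X_linear])
  fix x assume x: "x \<in> carrier P"
  note idH = right_linear_ident[of Bs H] and idX = right_linear_ident[of Bs X]
  note c = hat_C[OF q x]
  let ?w = "tensor_map A HP C (\<lambda>x. \<sigma> (hat q x)) (\<lambda>c. c) (\<rho> x)"
  have w: "?w \<in> carrier (tensor A HP C)"
    by (rule additive_map_closed[OF PC_additive[OF HP_module Fl] coact_closed[OF x]])
  have "coactHP (\<sigma> (hat q x)) = tensor_map A HP C \<sigma> (\<lambda>c. c) (tensor_map A C C (hat q) (\<lambda>c. c) (\<rho> x))"
    using rcolin_coaction[OF \<sigma> c] comult_hat[OF q x] by simp
  also have "\<dots> = ?w"
    by (rule tensor_C_comp[OF P_module C_right HP_module ql \<sigma>_linear coact_closed[OF x]])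
  finally have "tensor_assoc Bs A H P C (coactHP (\<sigma> (hat q x))) = tensor_assoc Bs A H P C ?w" by simp
  moreover have "tensor_map Bs H PC (\<lambda>x. x) \<rho> (\<sigma> (hat q x)) \<in> carrier (tensor Bs H PC)"
    by (rule additive_map_closed[OF tensor_map_additive[OF HB P_left HB PC_left idH coact_left_linear] \<sigma>_closed[OF c]])
  ultimately have e: "tensor_map Bs H PC (\<lambda>x. x) \<rho> (\<sigma> (hat q x)) = tensor_assoc Bs A H P C ?w"
    by (simp add: tensor_coaction_def tensor_assoc_assoc_inv[OF HB P_bimodule C_left])
  have "tensor_map Bs X PC (\<lambda>y. y) \<rho> (\<sigma>X (hat q x)) = tensor_map Bs X PC unhat \<rho> (\<sigma> (hat q x))"
    unfolding \<sigma>X_def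
    by (rule tensor_map_comp[OF HB P_left XB P_left XB PC_left unhatB left_linear_ident idX coact_left_linear \<sigma>_closed[OF c]])
  also have "\<dots> = tensor_map Bs X PC unhat (\<lambda>y. y) (tensor_map Bs H PC (\<lambda>x. x) \<rho> (\<sigma> (hat q x)))"
    by (rule tensor_map_comp[OF HB P_left HB PC_left XB PC_left idH coact_left_linear unhatB left_linear_ident \<sigma>_closed[OF c], symmetric])
  also have "\<dots> = tensor_assoc Bs A X P C (tensor_map A XP C J' (\<lambda>c. c) ?w)"
    unfolding e by (rule tensor_assoc_natural[OF HB XB P_bimodule C_left unhatB w, symmetric])
  also have "tensor_map A XP C J' (\<lambda>c. c) ?w = tensor_map A XP C (\<lambda>x. \<sigma>X (hat q x)) (\<lambda>c. c) (\<rho> x)"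
    unfolding \<sigma>X_def by (rule tensor_C_comp[OF P_module HP_module XP_module Fl J'(3) coact_closed[OF x]])
  finally show "tensor_map Bs X PC (\<lambda>y. y) \<rho> (\<sigma>X (hat q x)) =
      tensor_assoc Bs A X P C (tensor_map A XP C (\<lambda>x. \<sigma>X (hat q x)) (\<lambda>c. c) (\<rho> x))" .
qed

text \<open>The splitting of \<open>P\<^sup>* \<otimes> S \<rightarrow> P\<^sup>*\<close> is \<open>Hom\<^sup>C(P, \<sigma>)\<close>.\<close>

definition sec where "sec q = (THE t. t \<in> carrier XS \<and> (\<forall>x\<in>carrier P. evX x t = \<sigma>X (hat q x)))"

lemma XS_eqI:
  assumes "t \<in> carrier XS" "t' \<in> carrier XS" "\<And>x. x \<in> carrier P \<Longrightarrow> evX x t = evX x t'"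
  shows "t = t'"
  by (rule bij[unfolded hom_tensor_bij_def, THEN conjunct1, THEN bspec, OF assms(1), THEN bspec, OF assms(2), THEN mp])
    (intro ballI assms(3))

lemma sec:
  assumes q: "q \<in> carrier X"
  shows "sec q \<in> carrier XS" and "\<And>x. x \<in> carrier P \<Longrightarrow> evX x (sec q) = \<sigma>X (hat q x)"
proof -
  obtain t where t: "t \<in> carrier XS" "\<forall>x\<in>carrier P. evX x t = \<sigma>X (hat q x)"
    using bij[unfolded hom_tensor_bij_def, THEN conjunct2, THEN spec, THEN mp, OF \<sigma>X_hat_colin[OF q]] by (rule bexE)
  have "sec q \<in> carrier XS \<and> (\<forall>x\<in>carrier P. evX x (sec q) = \<sigma>X (hat q x))"
    unfolding sec_def
  proof (rule theI[of _ t])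
    show "t \<in> carrier XS \<and> (\<forall>x\<in>carrier P. evX x t = \<sigma>X (hat q x))" using t by (rule conjI)
    fix u assume u: "u \<in> carrier XS \<and> (\<forall>x\<in>carrier P. evX x u = \<sigma>X (hat q x))"
    show "u = t"
      by (rule XS_eqI[OF conjunct1[OF u] t(1)]) (simp only: t(2)[THEN bspec] u[THEN conjunct2, THEN bspec])
  qed
  then show "sec q \<in> carrier XS" "\<And>x. x \<in> carrier P \<Longrightarrow> evX x (sec q) = \<sigma>X (hat q x)"
    by (rule conjunct1, rule conjunct2[THEN bspec])
qed

lemma mulX_sec:
  assumes q: "q \<in> carrier X"
  shows "mulX (sec q) = q"
proof -
  have m: "mulX (sec q) \<in> carrier X" by (rule additive_map_closed[OF mulX_lift(1) sec(1)[OF q]])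
  have "hat (mulX (sec q)) x = hat q x" if x: "x \<in> carrier P" for x
    using muX_ev[OF sec(1)[OF q] x] sec(2)[OF q x] muX_\<sigma>X[OF hat_C[OF q x]] by simp
  then have "hat (mulX (sec q)) = hat q" by (intro extensionalityI[of _ "carrier P"]) (auto simp: hat_def)
  then show ?thesis using unhat_hat[OF m] unhat_hat[OF q] by simp
qed

lemma sec_linear: "right_linear S X XS sec"
  unfolding right_linear_def
proof (intro conjI ballI additive_mapI)
  interpret X: abelian_group X by (rule X_group)
  interpret XS: abelian_group XS by (rule XS_group)
  fix q assume q: "q \<in> carrier X"
  show "sec q \<in> carrier XS" by (rule sec(1)[OF q])
  show "sec (q \<oplus>\<^bsub>X\<^esub> q') = sec q \<oplus>\<^bsub>XS\<^esub> sec q'" if q': "q' \<in> carrier X" for q'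
  proof (rule XS_eqI)
    show "sec (q \<oplus>\<^bsub>X\<^esub> q') \<in> carrier XS" "sec q \<oplus>\<^bsub>XS\<^esub> sec q' \<in> carrier XS"
      by (intro sec(1) X.a_closed XS.a_closed q q')+
    fix x assume x: "x \<in> carrier P"
    show "evX x (sec (q \<oplus>\<^bsub>X\<^esub> q')) = evX x (sec q \<oplus>\<^bsub>XS\<^esub> sec q')"
      by (simp only: sec X.a_closed q q' x hat_add additive_map_add[OF \<sigma>X_additive hat_C hat_C] additive_map_add[OF evX_additive])
  qed
  show "sec (q \<odot>\<^sub>r\<^bsub>X\<^esub> s) = sec q \<odot>\<^sub>r\<^bsub>XS\<^esub> s" if s: "s \<in> carrier S" for s
  proof (rule XS_eqI)
    show "sec (q \<odot>\<^sub>r\<^bsub>X\<^esub> s) \<in> carrier XS" "sec q \<odot>\<^sub>r\<^bsub>XS\<^esub> s \<in> carrier XS"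
      by (intro sec(1) rmod_closed[OF X_right] rmod_closed[OF XS_module] q s)+
    fix x assume x: "x \<in> carrier P"
    show "evX x (sec (q \<odot>\<^sub>r\<^bsub>X\<^esub> s)) = evX x (sec q \<odot>\<^sub>r\<^bsub>XS\<^esub> s)"
      by (simp only: sec rmod_closed[OF X_right s] q x hat_rsmult s evX_rsmult S_closed)
  qed
qed

lemma relative_projective_dual: "relative_projective S B X"
  unfolding relative_projective_def
  using X_right sec_linear mulX_sec unfolding mulX_def by blast

text \<open>The inverse of the Galois map sends \<open>c \<otimes> k\<close> to \<open>\<Sum> g\<^sub>j \<otimes> (g \<mapsto> g(x\<^sub>j) k)\<close>, where \<open>\<sigma>(c) = \<Sum> g\<^sub>j \<otimes> x\<^sub>j\<close>.\<close>

definition spread where "spread K k = tensor_lift (T K) (\<lambda>g x. pure S' Xe (HK K) g (evk K x k))"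

definition galois_inv where "galois_inv K = tensor_lift (T K) (\<lambda>c k. spread K k (\<sigma>X c))"

context
  fixes K :: "('a, 'k, 'k1, 'k2) bimod_scheme"
  assumes K: "left_module A K"
begin

lemma spread_lift:
  assumes k: "k \<in> carrier K"
  shows "additive_map XP (T K) (spread K k)"
    and "\<And>g x. g \<in> carrier X \<Longrightarrow> x \<in> carrier P \<Longrightarrow> spread K k (pure Bs X P g x) = pure S' Xe (HK K) g (evk K x k)"
proof -
  note T = T_group[OF K] and HKm = HK_module[OF K]
  have "balanced Bs X P (T K) (\<lambda>g x. pure S' Xe (HK K) g (evk K x k))"
  proof (rule balancedI)
    show "additive_map P (T K) (\<lambda>x. pure S' Xe (HK K) g (evk K x k))" if "g \<in> carrier X" for g
      using that by (intro additive_map_comp[OF evk_additive_left[OF K k] pure_additive_right[OF Xe_right HKm]]) simp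
    show "additive_map X (T K) (\<lambda>g. pure S' Xe (HK K) g (evk K x k))" if "x \<in> carrier P" for x
      using pure_additive_left[OF Xe_right HKm evk_closed[OF K that k]] by (simp add: additive_map_def del: X_simps)
    show "pure S' Xe (HK K) (g \<odot>\<^sub>r\<^bsub>X\<^esub> b) (evk K x k) = pure S' Xe (HK K) g (evk K (b \<odot>\<^bsub>P\<^esub> x) k)"
      if "g \<in> carrier X" "b \<in> carrier Bs" "x \<in> carrier P" for g b x
      using evk_S[OF K B_subset that(3,1) k, of b] that(2) by simp
  qed
  note l = tensor_lift[OF XB P_left T this, folded spread_def]
  show "additive_map XP (T K) (spread K k)" by (rule l(1))
  show "spread K k (pure Bs X P g x) = pure S' Xe (HK K) g (evk K x k)" if "g \<in> carrier X" "x \<in> carrier P" for g x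
    by (rule l(2)[OF that])
qed

lemma spread_closed: "k \<in> carrier K \<Longrightarrow> t \<in> carrier XP \<Longrightarrow> spread K k t \<in> carrier (T K)"
  by (rule additive_map_closed[OF spread_lift(1)])

lemma galois_inv_lift:
  "additive_map (CK K) (T K) (galois_inv K)"
  "\<And>c k. c \<in> carrier C \<Longrightarrow> k \<in> carrier K \<Longrightarrow> (galois_inv K) (pure A C K c k) = spread K k (\<sigma>X c)"
proof -
  note T = T_group[OF K] and HKm = HK_module[OF K]
  interpret K: abelian_group K by (rule lmod_group[OF K])
  have "balanced A C K (T K) (\<lambda>c k. spread K k (\<sigma>X c))"
  proof (rule balancedI)
    show "additive_map C (T K) (\<lambda>c. spread K k (\<sigma>X c))" if "k \<in> carrier K" for k
      by (rule additive_map_comp[OF \<sigma>X_additive spread_lift(1)[OF that]])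
    fix c assume c: "c \<in> carrier C"
    then have sc: "\<sigma>X c \<in> carrier XP" by (rule additive_map_closed[OF \<sigma>X_additive])
    show "additive_map K (T K) (\<lambda>k. spread K k (\<sigma>X c))"
    proof (rule additive_mapI)
      fix k k' assume k: "k \<in> carrier K" and k': "k' \<in> carrier K"
      show "spread K k (\<sigma>X c) \<in> carrier (T K)" by (rule spread_closed[OF k sc])
      show "spread K (k \<oplus>\<^bsub>K\<^esub> k') (\<sigma>X c) = spread K k (\<sigma>X c) \<oplus>\<^bsub>T K\<^esub> spread K k' (\<sigma>X c)"
      proof (rule tensor_eqI[OF XB P_left spread_lift(1)[OF K.a_closed[OF k k']]
            additive_map_plus[OF spread_lift(1)[OF k] spread_lift(1)[OF k'] T] _ sc])
        fix g x assume g: "g \<in> carrier X" and x: "x \<in> carrier P"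
        have g': "g \<in> carrier Xe" using g by simp
        show "spread K (k \<oplus>\<^bsub>K\<^esub> k') (pure Bs X P g x) = spread K k (pure Bs X P g x) \<oplus>\<^bsub>T K\<^esub> spread K k' (pure Bs X P g x)"
          by (simp only: spread_lift(2) K.a_closed k k' g x additive_map_add[OF evk_additive_right[OF K x]]
            pure_add_right[OF Xe_right HKm g' evk_closed[OF K x k] evk_closed[OF K x k']])
      qed
    qed
    fix a k assume a: "a \<in> carrier A" and k: "k \<in> carrier K"
    have ak: "a \<odot>\<^bsub>K\<^esub> k \<in> carrier K" by (rule lmod_closed[OF K a k])
    have "spread K k (\<sigma>X c \<odot>\<^sub>r\<^bsub>XP\<^esub> a) = spread K (a \<odot>\<^bsub>K\<^esub> k) (\<sigma>X c)"
      by (rule tensor_eqI[OF XB P_left additive_map_comp[OF rmod_additive[OF XP_module a] spread_lift(1)[OF k]]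
            spread_lift(1)[OF ak] _ sc])
        (simp only: rsmult_pure[OF XB P_bimodule a] spread_lift(2) k ak rmod_closed[OF P_module a] evk_balanced[OF K _ a k])
    then show "spread K k (\<sigma>X (c \<odot>\<^sub>r\<^bsub>C\<^esub> a)) = spread K (a \<odot>\<^bsub>K\<^esub> k) (\<sigma>X c)"
      by (simp only: right_linear_rsmult[OF \<sigma>X_linear a c])
  qed
  note l = tensor_lift[OF C_right K T this, folded galois_inv_def]
  show "additive_map (CK K) (T K) (galois_inv K)" by (rule l(1))
  show "(galois_inv K) (pure A C K c k) = spread K k (\<sigma>X c)" if "c \<in> carrier C" "k \<in> carrier K" for c k
    by (rule l(2)[OF that])
qed

lemma galois_spread:
  assumes k: "k \<in> carrier K" and t: "t \<in> carrier XP"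
  shows "galois_map A C \<rho>X K (spread K k t) = pure A C K (muX t) k"
  by (rule tensor_eqI[OF XB P_left additive_map_comp[OF spread_lift(1)[OF k] galois_additive[OF K]]
        additive_map_comp[OF muX_lift(1) pure_additive_left[OF C_right K k]] _ t])
    (simp only: spread_lift(2)[OF k] muX_lift(2) galois_evk[OF K] k)

text \<open>Members of \<open>S\<close> can be moved across the tensor sign of \<open>P\<^sup>* \<otimes> Hom(P\<^sup>*, K)\<close>, which is taken over the endomorphism
  ring; hence only the product of \<open>t\<close> matters.\<close>

lemma spread_ev:
  assumes k: "k \<in> carrier K" and t: "t \<in> carrier XS" and x: "x \<in> carrier P"
  shows "spread K k (evX x t) = pure S' Xe (HK K) (mulX t) (evk K x k)"
proof -
  have ad: "additive_map X (T K) (\<lambda>g. pure S' Xe (HK K) g (evk K x k))"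
    using pure_additive_left[OF Xe_right HK_module[OF K] evk_closed[OF K x k]] by (simp add: additive_map_def del: X_simps)
  show ?thesis
  proof (rule tensor_eqI[OF XB SB_left additive_map_comp[OF evX_additive[OF x] spread_lift(1)[OF k]]
        additive_map_comp[OF mulX_lift(1) ad] _ t])
    fix y s assume y: "y \<in> carrier X" and s: "s \<in> carrier SB"
    then have s': "s \<in> carrier S" by simp
    show "spread K k (evX x (pure Bs X SB y s)) = pure S' Xe (HK K) (mulX (pure Bs X SB y s)) (evk K x k)"
      unfolding evX_pure[OF x y s] mulX_lift(2)[OF y s] spread_lift(2)[OF k y S_closed[OF s' x]] evk_S[OF K s' x y k] ..
  qed
qed

lemma galois_bij: "bij_betw (galois_map A C \<rho>X K) (carrier (T K)) (carrier (CK K))"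
proof (rule bij_betw_byWitness[where f' = "galois_inv K"])
  note T = T_group[OF K] and HKm = HK_module[OF K] and CKg = CK_group[OF K]
  let ?\<gamma> = "galois_map A C \<rho>X K"
  have "?\<gamma> ((galois_inv K) u) = u" if u: "u \<in> carrier (CK K)" for u
    by (rule tensor_eqI[OF C_right K additive_map_comp[OF galois_inv_lift(1) galois_additive[OF K]] additive_map_ident _ u])
      (simp only: galois_inv_lift(2) galois_spread additive_map_closed[OF \<sigma>X_additive] muX_\<sigma>X)
  then show "\<forall>u\<in>carrier (CK K). ?\<gamma> ((galois_inv K) u) = u" by blast
  have "(galois_inv K) (?\<gamma> t) = t" if t: "t \<in> carrier (T K)" for t
  proof (rule T_eqI[OF K additive_map_comp[OF galois_additive[OF K] galois_inv_lift(1)] additive_map_ident _ t])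
    fix q h assume "q \<in> carrier Xe" and h: "h \<in> carrier (HK K)"
    then have q: "q \<in> carrier X" and q': "q \<in> carrier Xe" by simp_all
    have hk: "h (\<pi> i) \<in> carrier K" if "i \<in> {..<n}" for i
      using that by (intro HK_closed[OF K h] \<pi>_closed) simp
    have c1: "pure A C K (hat q (p i)) (h (\<pi> i)) \<in> carrier (CK K)" if "i \<in> {..<n}" for i
      using that hk by (intro pure_closed[OF C_right K] hat_C q p_closed) auto
    have c2: "evk K (p i) (h (\<pi> i)) \<in> carrier (HK K)" if "i \<in> {..<n}" for i
      using that hk by (intro evk_closed[OF K] p_closed) auto
    have "(galois_inv K) (?\<gamma> (pure S' Xe (HK K) q h)) = (\<Oplus>\<^bsub>T K\<^esub>i\<in>{..<n}. (galois_inv K) (pure A C K (hat q (p i)) (h (\<pi> i))))"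
      unfolding galois_pure[OF K q h] by (rule additive_map_sum[OF galois_inv_lift(1) CKg T c1])
    also have "\<dots> = (\<Oplus>\<^bsub>T K\<^esub>i\<in>{..<n}. pure S' Xe (HK K) q (evk K (p i) (h (\<pi> i))))"
    proof (rule finsum_eqI[OF T])
      fix i assume i: "i \<in> {..<n}"
      then have pi: "p i \<in> carrier P" by (intro p_closed) simp
      show "pure S' Xe (HK K) q (evk K (p i) (h (\<pi> i))) \<in> carrier (T K)"
        by (rule pure_closed[OF Xe_right HKm q' c2[OF i]])
      show "(galois_inv K) (pure A C K (hat q (p i)) (h (\<pi> i))) = pure S' Xe (HK K) q (evk K (p i) (h (\<pi> i)))"
        unfolding galois_inv_lift(2)[OF hat_C[OF q pi] hk[OF i]] sec(2)[OF q pi, symmetric]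
          spread_ev[OF hk[OF i] sec(1)[OF q] pi] mulX_sec[OF q] ..
    qed
    also have "\<dots> = pure S' Xe (HK K) q (\<Oplus>\<^bsub>HK K\<^esub>i\<in>{..<n}. evk K (p i) (h (\<pi> i)))"
      by (rule additive_map_sum[OF pure_additive_right[OF Xe_right HKm q'] lmod_group[OF HKm] T c2, symmetric])
    also have "\<dots> = pure S' Xe (HK K) q h" unfolding evk_expand[OF K h] ..
    finally show "(galois_inv K) (?\<gamma> (pure S' Xe (HK K) q h)) = pure S' Xe (HK K) q h" .
  qed
  then show "\<forall>t\<in>carrier (T K). (galois_inv K) (?\<gamma> t) = t" by blast
  show "?\<gamma> ` carrier (T K) \<subseteq> carrier (CK K)" using additive_map_closed[OF galois_additive[OF K]] by blast
  show "(galois_inv K) ` carrier (CK K) \<subseteq> carrier (T K)" using additive_map_closed[OF galois_inv_lift(1)] by blast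
qed

end

lemma galois_dual: "galois_left_comodule TYPE('u) A C X \<rho>X"
  unfolding galois_left_comodule_def Let_def
  using dual_left_comodule galois_left_linear galois_bij by blast

end

end

section \<open>From the Galois property to a splitting\<close>

lemma additive_map_inv_into:
  assumes f: "additive_map M N f" and bij: "bij_betw f (carrier M) (carrier N)" and M: "abelian_group M"
  shows "additive_map N M (inv_into (carrier M) f)"
proof (rule additive_mapI)
  interpret M: abelian_group M by fact
  let ?g = "inv_into (carrier M) f"
  have c: "?g y \<in> carrier M" "f (?g y) = y" if "y \<in> carrier N" for y
    using bij that by (auto simp: bij_betw_def inv_into_into f_inv_into_f)
  show "?g y \<in> carrier M" if "y \<in> carrier N" for y using c that by blast
  fix x y assume xy: "x \<in> carrier N" "y \<in> carrier N"
  have "f (?g x \<oplus>\<^bsub>M\<^esub> ?g y) = x \<oplus>\<^bsub>N\<^esub> y" using additive_map_add[OF f] c xy by simp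
  then show "?g (x \<oplus>\<^bsub>N\<^esub> y) = ?g x \<oplus>\<^bsub>M\<^esub> ?g y"
    using bij c xy M.a_closed by (metis bij_betw_inv_into_left)
qed

context galois_setup
begin

lemma P_eqI:
  assumes "x \<in> carrier P" "y \<in> carrier P" "\<And>g. g \<in> carrier X \<Longrightarrow> g x = g y"
  shows "x = y"
proof -
  have "(\<Oplus>\<^bsub>P\<^esub>i\<in>{..<n}. p i \<odot>\<^sub>r\<^bsub>P\<^esub> \<pi> i x) = (\<Oplus>\<^bsub>P\<^esub>i\<in>{..<n}. p i \<odot>\<^sub>r\<^bsub>P\<^esub> \<pi> i y)"
  proof (rule finsum_eqI[OF P_group])
    fix i assume "i \<in> {..<n}"
    then have i: "i < n" by simp
    show "p i \<odot>\<^sub>r\<^bsub>P\<^esub> \<pi> i x = p i \<odot>\<^sub>r\<^bsub>P\<^esub> \<pi> i y" by (simp only: assms(3)[OF \<pi>_closed[OF i]])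
    show "p i \<odot>\<^sub>r\<^bsub>P\<^esub> \<pi> i y \<in> carrier P" by (rule rmod_closed[OF P_module X_closed[OF \<pi>_closed[OF i] assms(2)] p_closed[OF i]])
  qed
  then show ?thesis unfolding expand[OF assms(1)] expand[OF assms(2)] .
qed

text \<open>\<open>K\<close> is a copy of the left module \<open>A\<close> for which the Galois map is bijective, and \<open>s'\<close> is a section of the
  multiplication \<open>P\<^sup>* \<otimes> S \<rightarrow> P\<^sup>*\<close>.\<close>

context
  fixes K :: "('a, 'k, 'k1, 'k2) bimod_scheme" and \<iota> r s'
  assumes K: "left_module A K"
    and \<iota>: "left_linear A (regular A) K \<iota>" and r: "left_linear A K (regular A) r"
    and r\<iota>: "\<And>a. a \<in> carrier A \<Longrightarrow> r (\<iota> a) = a"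
    and bij: "bij_betw (galois_map A C \<rho>X K) (carrier (T K)) (carrier (CK K))"
    and sl: "right_linear S X XS s'" and ms: "\<And>q. q \<in> carrier X \<Longrightarrow> mulX (s' q) = q"
begin

private lemmas HKm = HK_module[OF K] and Tg = T_group[OF K] and CKg = CK_group[OF K]

private lemma r_closed: "k \<in> carrier K \<Longrightarrow> r k \<in> carrier A"
  using left_linear_closed[OF r] by simp

private lemma one_closed: "\<one>\<^bsub>A\<^esub> \<in> carrier A"
  using A_ring by (rule ring.ring_simprules(6))

private lemma \<iota>1: "\<iota> \<one>\<^bsub>A\<^esub> \<in> carrier K"
  using left_linear_closed[OF \<iota>] one_closed by simp

text \<open>The isomorphism \<open>Hom(P\<^sup>*, A) = P\<close>.\<close>

definition point where "point h = (\<Oplus>\<^bsub>P\<^esub>i\<in>{..<n}. p i \<odot>\<^sub>r\<^bsub>P\<^esub> r (h (\<pi> i)))"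

private lemma point_summand:
  assumes "h \<in> carrier (HK K)" "i \<in> {..<n}"
  shows "p i \<in> carrier P" "r (h (\<pi> i)) \<in> carrier A" "p i \<odot>\<^sub>r\<^bsub>P\<^esub> r (h (\<pi> i)) \<in> carrier P"
proof -
  have i: "i < n" using assms(2) by simp
  show p: "p i \<in> carrier P" by (rule p_closed[OF i])
  show a: "r (h (\<pi> i)) \<in> carrier A" by (rule r_closed[OF HK_closed[OF K assms(1) \<pi>_closed[OF i]]])
  show "p i \<odot>\<^sub>r\<^bsub>P\<^esub> r (h (\<pi> i)) \<in> carrier P" by (rule rmod_closed[OF P_module a p])
qed

private lemma point_closed: "h \<in> carrier (HK K) \<Longrightarrow> point h \<in> carrier P"
  unfolding point_def by (rule finsum_in[OF P_group point_summand(3)])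

private lemma linear_point:
  assumes M: "right_module A M" and f: "right_linear A P M f" and h: "h \<in> carrier (HK K)"
  shows "f (point h) = (\<Oplus>\<^bsub>M\<^esub>i\<in>{..<n}. f (p i) \<odot>\<^sub>r\<^bsub>M\<^esub> r (h (\<pi> i)))"
proof -
  note fc = right_linear_closed[OF f]
  have "f (point h) = (\<Oplus>\<^bsub>M\<^esub>i\<in>{..<n}. f (p i \<odot>\<^sub>r\<^bsub>P\<^esub> r (h (\<pi> i))))"
    unfolding point_def by (rule additive_map_sum[OF right_linear_additive[OF f] P_group rmod_group[OF M] point_summand(3)[OF h]])
  also have "\<dots> = (\<Oplus>\<^bsub>M\<^esub>i\<in>{..<n}. f (p i) \<odot>\<^sub>r\<^bsub>M\<^esub> r (h (\<pi> i)))"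
    by (rule finsum_eqI[OF rmod_group[OF M]])
      (simp_all only: right_linear_rsmult[OF f point_summand(2,1)[OF h]] rmod_closed[OF M point_summand(2)[OF h] fc[OF point_summand(1)[OF h]]])
  finally show ?thesis .
qed

private lemma form_point:
  assumes g: "g \<in> carrier X" and h: "h \<in> carrier (HK K)"
  shows "g (point h) = r (h g)"
proof -
  note rg = regular_bimodule[OF A_ring]
  have "g (point h) = (\<Oplus>\<^bsub>regular A\<^esub>i\<in>{..<n}. g (p i) \<odot>\<^bsub>regular A\<^esub> r (h (\<pi> i)))"
    unfolding linear_point[OF bimod_right[OF rg] X_linear[OF g] h] by simp
  also have "\<dots> = r (h g)"
    by (rule linear_form_expand[OF bimod_left[OF rg] left_linear_comp[OF HK_linear[OF K h] r] g])
  finally show ?thesis .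
qed

private lemma point_additive: "additive_map (HK K) P point"
proof (rule additive_mapI)
  interpret P: abelian_group P by (rule P_group)
  interpret HK: abelian_group "HK K" by (rule lmod_group[OF HKm])
  fix h h' assume h: "h \<in> carrier (HK K)" and h': "h' \<in> carrier (HK K)"
  show "point h \<in> carrier P" by (rule point_closed[OF h])
  show "point (h \<oplus>\<^bsub>HK K\<^esub> h') = point h \<oplus>\<^bsub>P\<^esub> point h'"
  proof (rule P_eqI)
    show "point (h \<oplus>\<^bsub>HK K\<^esub> h') \<in> carrier P" by (rule point_closed[OF HK.a_closed[OF h h']])
    show "point h \<oplus>\<^bsub>P\<^esub> point h' \<in> carrier P" by (intro P.a_closed point_closed h h')
    fix g assume g: "g \<in> carrier X"
    have "g (point (h \<oplus>\<^bsub>HK K\<^esub> h')) = r (h g \<oplus>\<^bsub>K\<^esub> h' g)"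
      unfolding form_point[OF g HK.a_closed[OF h h']] using g by (simp del: X_simps)
    also have "\<dots> = g (point h) \<oplus>\<^bsub>A\<^esub> g (point h')"
      unfolding form_point[OF g h] form_point[OF g h']
      using left_linear_add[OF r HK_closed[OF K h g] HK_closed[OF K h' g]] by simp
    also have "\<dots> = g (point h \<oplus>\<^bsub>P\<^esub> point h')"
      using right_linear_add[OF X_linear[OF g] point_closed[OF h] point_closed[OF h']] by simp
    finally show "g (point (h \<oplus>\<^bsub>HK K\<^esub> h')) = g (point h \<oplus>\<^bsub>P\<^esub> point h')" .
  qed
qed

private lemma point_evk:
  assumes x: "x \<in> carrier P"
  shows "point (evk K x (\<iota> \<one>\<^bsub>A\<^esub>)) = x"
proof (rule P_eqI[OF point_closed[OF evk_closed[OF K x \<iota>1]] x])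
  interpret A: ring A by (rule A_ring)
  fix g assume g: "g \<in> carrier X"
  have gx: "g x \<in> carrier A" by (rule X_closed[OF g x])
  show "g (point (evk K x (\<iota> \<one>\<^bsub>A\<^esub>))) = g x"
    unfolding form_point[OF g evk_closed[OF K x \<iota>1]] evk_apply[OF K g]
    using left_linear_smult[OF r gx \<iota>1] r\<iota>[OF one_closed] gx by simp
qed

private lemma point_smult:
  assumes \<phi>: "\<phi> \<in> carrier S'" and s: "s \<in> carrier S" "\<And>g. g \<in> carrier X \<Longrightarrow> \<phi> g = g \<odot>\<^sub>r\<^bsub>X\<^esub> s" and h: "h \<in> carrier (HK K)"
  shows "point (\<phi> \<odot>\<^bsub>HK K\<^esub> h) = s (point h)"
proof (rule P_eqI)
  note \<phi>h = lmod_closed[OF HKm \<phi> h]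
  show "point (\<phi> \<odot>\<^bsub>HK K\<^esub> h) \<in> carrier P" by (rule point_closed[OF \<phi>h])
  show "s (point h) \<in> carrier P" by (rule S_closed[OF s(1) point_closed[OF h]])
  fix g assume g: "g \<in> carrier X"
  have "g (point (\<phi> \<odot>\<^bsub>HK K\<^esub> h)) = r (h (\<phi> g))"
    unfolding form_point[OF g \<phi>h] using g by (simp add: compose_def del: X_simps)
  also have "\<dots> = (\<phi> g) (point h)" by (rule form_point[OF S'_closed[OF \<phi> g] h, symmetric])
  also have "\<dots> = g (s (point h))" unfolding s(2)[OF g] using point_closed[OF h] by (simp add: compose_def)
  finally show "g (point (\<phi> \<odot>\<^bsub>HK K\<^esub> h)) = g (s (point h))" .
qed

text \<open>The section \<open>s'\<close> tensored with \<open>P = Hom(P\<^sup>*, A)\<close>.\<close>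

definition descend where "descend = tensor_lift XP (\<lambda>q h. evX (point h) (s' q))"

private lemma s'_closed: "q \<in> carrier X \<Longrightarrow> s' q \<in> carrier XS"
  by (rule right_linear_closed[OF sl])

private lemma descend_balanced: "balanced S' Xe (HK K) XP (\<lambda>q h. evX (point h) (s' q))"
proof (rule balancedI)
  show "additive_map (HK K) XP (\<lambda>h. evX (point h) (s' q))" if "q \<in> carrier Xe" for q
    using that by (intro additive_map_comp[OF point_additive right_linear_additive[OF evX_linear[OF s'_closed]]]) simp
  show "additive_map Xe XP (\<lambda>q. evX (point h) (s' q))" if h: "h \<in> carrier (HK K)" for h
    using additive_map_comp[OF right_linear_additive[OF sl] evX_additive[OF point_closed[OF h]]]
    by (simp add: additive_map_def del: X_simps)
  fix q \<phi> h assume "q \<in> carrier Xe" and \<phi>: "\<phi> \<in> carrier S'" and h: "h \<in> carrier (HK K)"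
  then have q: "q \<in> carrier X" by simp
  obtain s where s: "s \<in> carrier S" "\<And>g. g \<in> carrier X \<Longrightarrow> \<phi> g = g \<odot>\<^sub>r\<^bsub>X\<^esub> s"
    using \<phi> by (rule transpose_surj) blast
  have "s' (q \<odot>\<^sub>r\<^bsub>Xe\<^esub> \<phi>) = s' q \<odot>\<^sub>r\<^bsub>XS\<^esub> s"
    using s(2)[OF q] right_linear_rsmult[OF sl s(1) q] by simp
  moreover have "point (\<phi> \<odot>\<^bsub>HK K\<^esub> h) = s (point h)" by (rule point_smult[OF \<phi> s h])
  ultimately show "evX (point h) (s' (q \<odot>\<^sub>r\<^bsub>Xe\<^esub> \<phi>)) = evX (point (\<phi> \<odot>\<^bsub>HK K\<^esub> h)) (s' q)"
    by (simp only: evX_rsmult[OF s'_closed[OF q] point_closed[OF h] s(1)])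
qed

private lemmas descend_lift = tensor_lift[OF Xe_right HKm XP_group descend_balanced, folded descend_def]

definition \<gamma>inv where "\<gamma>inv = inv_into (carrier (T K)) (\<gamma> K)"

private lemma \<gamma>inv_additive: "additive_map (CK K) (T K) \<gamma>inv"
  unfolding \<gamma>inv_def by (rule additive_map_inv_into[OF galois_additive[OF K] bij Tg])

text \<open>The inverse Galois map on \<open>C = C \<otimes> A\<close>, followed by the section.\<close>

definition splitX where "splitX c = descend (\<gamma>inv (pure A C K c (\<iota> \<one>\<^bsub>A\<^esub>)))"

private lemma splitX_additive: "additive_map C XP splitX"
  unfolding splitX_def
  by (rule additive_map_comp[OF additive_map_comp[OF pure_additive_left[OF C_right K \<iota>1] \<gamma>inv_additive] descend_lift(1)])

private lemma splitX_hat: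
  assumes q: "q \<in> carrier X" and x: "x \<in> carrier P"
  shows "splitX (hat q x) = evX x (s' q)"
proof -
  have q': "q \<in> carrier Xe" using q by simp
  note e = evk_closed[OF K x \<iota>1]
  have "\<gamma>inv (pure A C K (hat q x) (\<iota> \<one>\<^bsub>A\<^esub>)) = pure S' Xe (HK K) q (evk K x (\<iota> \<one>\<^bsub>A\<^esub>))"
    unfolding \<gamma>inv_def galois_evk[OF K q x \<iota>1, symmetric]
    by (rule bij_betw_inv_into_left[OF bij pure_closed[OF Xe_right HKm q' e]])
  then show ?thesis unfolding splitX_def by (simp only: descend_lift(2)[OF q' e] point_evk[OF x])
qed

text \<open>The Galois property shows that \<open>C\<close> is generated by the values of the colinear maps \<open>P \<rightarrow> C\<close>.\<close>

private lemma C_eqI: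
  assumes f: "additive_map C G f" and g: "additive_map C G g"
    and eq: "\<And>q x. q \<in> carrier X \<Longrightarrow> x \<in> carrier P \<Longrightarrow> f (hat q x) = g (hat q x)" and c: "c \<in> carrier C"
  shows "f c = g c"
proof -
  interpret A: ring A by (rule A_ring)
  have "balanced A C K C (\<lambda>c k. c \<odot>\<^sub>r\<^bsub>C\<^esub> r k)"
  proof (rule balancedI)
    show "additive_map K C (\<lambda>k. c \<odot>\<^sub>r\<^bsub>C\<^esub> r k)" if "c \<in> carrier C" for c
      using additive_map_comp[OF left_linear_additive[OF r], of C "\<lambda>a. c \<odot>\<^sub>r\<^bsub>C\<^esub> a"] rmod_scalar_additive[OF C_right that]
      by (simp add: additive_map_def)
    show "additive_map C C (\<lambda>c. c \<odot>\<^sub>r\<^bsub>C\<^esub> r k)" if "k \<in> carrier K" for k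
      by (rule rmod_additive[OF C_right r_closed[OF that]])
    show "(c \<odot>\<^sub>r\<^bsub>C\<^esub> a) \<odot>\<^sub>r\<^bsub>C\<^esub> r k = c \<odot>\<^sub>r\<^bsub>C\<^esub> r (a \<odot>\<^bsub>K\<^esub> k)" if "c \<in> carrier C" "a \<in> carrier A" "k \<in> carrier K" for c a k
      using left_linear_smult[OF r that(2,3)] rmod_mult[OF C_right that(2) r_closed[OF that(3)] that(1)] by simp
  qed
  note k = tensor_lift[OF C_right K C_group this]
  let ?k = "tensor_lift C (\<lambda>c k. c \<odot>\<^sub>r\<^bsub>C\<^esub> r k)"
  have \<gamma>k: "?k ((\<gamma> K) (pure S' Xe (HK K) q h)) = hat q (point h)" if q: "q \<in> carrier X" and h: "h \<in> carrier (HK K)" for q h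
  proof -
    have c1: "pure A C K (hat q (p i)) (h (\<pi> i)) \<in> carrier (CK K)" if "i \<in> {..<n}" for i
      using that by (intro pure_closed[OF C_right K] hat_C q p_closed HK_closed[OF K h] \<pi>_closed) auto
    have "?k ((\<gamma> K) (pure S' Xe (HK K) q h)) = (\<Oplus>\<^bsub>C\<^esub>i\<in>{..<n}. ?k (pure A C K (hat q (p i)) (h (\<pi> i))))"
      unfolding galois_pure[OF K q h] by (rule additive_map_sum[OF k(1) CKg C_group c1])
    also have "\<dots> = (\<Oplus>\<^bsub>C\<^esub>i\<in>{..<n}. hat q (p i) \<odot>\<^sub>r\<^bsub>C\<^esub> r (h (\<pi> i)))"
      by (intro finsum_eqI[OF C_group] k(2) rmod_closed[OF C_right] hat_C q p_closed r_closed HK_closed[OF K h] \<pi>_closed) auto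
    also have "\<dots> = hat q (point h)" by (rule linear_point[OF C_right hat_linear[OF q] h, symmetric])
    finally show ?thesis .
  qed
  note k\<gamma> = additive_map_comp[OF galois_additive[OF K] k(1)]
  have all: "f (?k ((\<gamma> K) t)) = g (?k ((\<gamma> K) t))" if "t \<in> carrier (T K)" for t
    by (rule T_eqI[OF K additive_map_comp[OF k\<gamma> f] additive_map_comp[OF k\<gamma> g] _ that])
      (simp only: Xe_simps \<gamma>k eq point_closed)
  have pc: "pure A C K c (\<iota> \<one>\<^bsub>A\<^esub>) \<in> carrier (CK K)" by (rule pure_closed[OF C_right K c \<iota>1])
  have "?k ((\<gamma> K) (\<gamma>inv (pure A C K c (\<iota> \<one>\<^bsub>A\<^esub>)))) = ?k (pure A C K c (\<iota> \<one>\<^bsub>A\<^esub>))"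
    unfolding \<gamma>inv_def by (simp only: bij_betw_inv_into_right[OF bij pc])
  also have "\<dots> = c" unfolding k(2)[OF c \<iota>1] r\<iota>[OF one_closed] by (rule rmod_one[OF C_right c])
  finally show ?thesis using all[OF additive_map_closed[OF \<gamma>inv_additive pc]] by simp
qed

definition splitH where "splitH c = J (splitX c)"

private lemma splitH_additive: "additive_map C HP splitH"
  unfolding splitH_def by (rule additive_map_comp[OF splitX_additive J(1)])

private lemma splitH_hat: "q \<in> carrier X \<Longrightarrow> x \<in> carrier P \<Longrightarrow> splitH (hat q x) = J (evX x (s' q))"
  by (simp add: splitH_def splitX_hat)

private lemma splitH_linear: "right_linear A C HP splitH"
  unfolding right_linear_def
proof (intro conjI ballI splitH_additive)
  fix a c assume a: "a \<in> carrier A" and c: "c \<in> carrier C"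
  show "splitH (c \<odot>\<^sub>r\<^bsub>C\<^esub> a) = splitH c \<odot>\<^sub>r\<^bsub>HP\<^esub> a"
  proof (rule C_eqI[OF additive_map_comp[OF rmod_additive[OF C_right a] splitH_additive]
        additive_map_comp[OF splitH_additive rmod_additive[OF HP_module a]] _ c])
    fix q x assume q: "q \<in> carrier X" and x: "x \<in> carrier P"
    note sq = s'_closed[OF q]
    have "splitH (hat q x \<odot>\<^sub>r\<^bsub>C\<^esub> a) = J (evX (x \<odot>\<^sub>r\<^bsub>P\<^esub> a) (s' q))"
      using splitH_hat[OF q rmod_closed[OF P_module a x]] right_linear_rsmult[OF hat_linear[OF q] a x] by simp
    also have "\<dots> = J (evX x (s' q)) \<odot>\<^sub>r\<^bsub>HP\<^esub> a"
      unfolding right_linear_rsmult[OF evX_linear[OF sq] a x] by (rule right_linear_rsmult[OF J(3) a evX_closed[OF sq x]])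
    finally show "splitH (hat q x \<odot>\<^sub>r\<^bsub>C\<^esub> a) = splitH (hat q x) \<odot>\<^sub>r\<^bsub>HP\<^esub> a" unfolding splitH_hat[OF q x] .
  qed
qed

private lemma canonical_splitH:
  assumes c: "c \<in> carrier C"
  shows "\<mu> (splitH c) = c"
proof (rule C_eqI[OF additive_map_comp[OF splitH_additive canonical_lift(1)] additive_map_ident _ c])
  fix q x assume q: "q \<in> carrier X" and x: "x \<in> carrier P"
  show "\<mu> (splitH (hat q x)) = hat q x"
    unfolding splitH_hat[OF q x] canonical_J[OF evX_closed[OF s'_closed[OF q] x]] muX_ev[OF s'_closed[OF q] x] ms[OF q] ..
qed

text \<open>On a generator \<open>q^(x)\<close> the splitting is \<open>x \<mapsto> \<Sum> f\<^sub>j \<otimes> s\<^sub>j(x)\<close> for a tensor \<open>\<Sum> f\<^sub>j \<otimes> s\<^sub>j\<close> in \<open>Hom\<^sup>C(P, C) \<otimes> S\<close>, and such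
  maps are colinear.\<close>

private lemma splitH_coaction:
  assumes c: "c \<in> carrier C"
  shows "coactHP (splitH c) = tensor_map A HP C splitH (\<lambda>c. c) (comult C c)"
proof -
  note idH = right_linear_ident[of Bs H]
  note HS = tensor_map_additive[OF XB SB_left HB SB_left hatB left_linear_ident]
  have ca: "additive_map HP (tensor A HP C) coactHP"
    unfolding tensor_coaction_def
    by (rule additive_map_comp[OF tensor_map_additive[OF HB P_left HB PC_left idH coact_left_linear]
        tensor_assoc_inv_additive[OF HB P_bimodule C_left]])
  show ?thesis
  proof (rule C_eqI[OF additive_map_comp[OF splitH_additive ca]
        additive_map_comp[OF right_linear_additive[OF comult_linear] tensor_C_additive[OF C_right HP_module splitH_linear]] _ c])
    fix q x assume q: "q \<in> carrier X" and x: "x \<in> carrier P"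
    let ?t = "tensor_map Bs H SB hat (\<lambda>s. s) (s' q)"
    let ?F = "\<lambda>x. tensor_map Bs H P (\<lambda>y. y) (\<lambda>e. e x) ?t"
    have t: "?t \<in> carrier (tensor Bs H SB)" by (rule additive_map_closed[OF HS s'_closed[OF q]])
    have F: "?F y = splitH (hat q y)" if y: "y \<in> carrier P" for y
    proof -
      note el = eval_left_linear[OF SB_map_module y]
      have "?F y = tensor_map Bs H P hat (\<lambda>e. e y) (s' q)"
        by (rule tensor_map_comp[OF XB SB_left HB SB_left HB P_left hatB left_linear_ident idH el s'_closed[OF q]])
      also have "\<dots> = J (evX y (s' q))"
        by (rule tensor_map_comp[OF XB SB_left XB P_left HB P_left right_linear_ident el hatB left_linear_ident s'_closed[OF q], symmetric])
      finally show ?thesis by (simp only: splitH_hat[OF q y])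
    qed
    have Fl: "right_linear A P HP ?F" by (rule ev_right_linear[OF HB SB_map_module P_bimodule t])
    have w: "tensor_map A HP C ?F (\<lambda>c. c) (\<rho> x) \<in> carrier (tensor A HP C)"
      by (rule additive_map_closed[OF PC_additive[OF HP_module Fl] coact_closed[OF x]])
    have "tensor_map Bs H PC (\<lambda>y. y) \<rho> (?F x) = tensor_assoc Bs A H P C (tensor_map A HP C ?F (\<lambda>c. c) (\<rho> x))"
      using ev_colin[OF HB t] x unfolding colin_def by blast
    then have "coactHP (?F x) = tensor_map A HP C ?F (\<lambda>c. c) (\<rho> x)"
      unfolding tensor_coaction_def by (simp only: tensor_assoc_inv_assoc[OF HB P_bimodule C_left w])
    also have "\<dots> = tensor_map A HP C (\<lambda>x. splitH (hat q x)) (\<lambda>c. c) (\<rho> x)"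
      by (rule tensor_C_cong[OF P_module HP_module Fl F[symmetric] coact_closed[OF x], symmetric])
    also have "\<dots> = tensor_map A HP C splitH (\<lambda>c. c) (tensor_map A C C (hat q) (\<lambda>c. c) (\<rho> x))"
      by (rule tensor_C_comp[OF P_module C_right HP_module hat_linear[OF q] splitH_linear coact_closed[OF x], symmetric])
    also have "\<dots> = tensor_map A HP C splitH (\<lambda>c. c) (comult C (hat q x))"
      by (simp only: comult_hat[OF q x])
    finally show "coactHP (splitH (hat q x)) = tensor_map A HP C splitH (\<lambda>c. c) (comult C (hat q x))"
      unfolding F[OF x] .
  qed
qed

lemma splitting_from_galois: "splitting_epi A C HP coactHP C (comult C) \<mu>"
  unfolding splitting_epi_def
proof (intro conjI canonical_colinear exI[of _ splitH] ballI canonical_splitH)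
  show "right_colinear A C C (comult C) HP coactHP splitH"
    unfolding right_colinear_def using splitH_linear splitH_coaction by blast
qed

end

text \<open>Forward, either alternative of the last assumption yields \<open>hom_tensor_bij\<close>; the converse uses the Galois map at a
  copy of \<open>A\<close>.\<close>

theorem splitting_iff_galois:
  fixes emb1 :: "'a \<Rightarrow> 'u" and emb2 :: "('p \<Rightarrow> ('p, 'c) tens) \<Rightarrow> 'u"
  assumes emb1: "inj emb1" and emb2: "inj emb2"
    and flat_or_inj: "flat_right_module TYPE('u) Bs X \<or> strongly_injective A C P \<rho> B"
  shows "splitting_epi A C HP coactHP C (comult C) \<mu> \<longleftrightarrow>
    galois_left_comodule TYPE('u) A C X \<rho>X \<and> relative_projective S B X"
proof
  assume "splitting_epi A C HP coactHP C (comult C) \<mu>"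
  then obtain \<sigma> where \<sigma>: "right_colinear A C C (comult C) HP coactHP \<sigma>" "\<And>c. c \<in> carrier C \<Longrightarrow> \<mu> (\<sigma> c) = c"
    unfolding splitting_epi_def by blast
  have "hom_tensor_bij X"
    using flat_or_inj flat_hom_tensor_bij[OF XB _ emb2] strongly_injective_hom_tensor_bij[OF XB] by blast
  then show "galois_left_comodule TYPE('u) A C X \<rho>X \<and> relative_projective S B X"
    using galois_dual[OF _ \<sigma>] relative_projective_dual[OF _ \<sigma>] by blast
next
  assume b: "galois_left_comodule TYPE('u) A C X \<rho>X \<and> relative_projective S B X"
  let ?K = "left_copy emb1 (regular A)"
  note K = left_copy[OF bimod_left[OF regular_bimodule[OF A_ring]] emb1]
  from b obtain s' where s': "right_linear S X XS s'" "\<And>q. q \<in> carrier X \<Longrightarrow> mulX (s' q) = q"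
    unfolding relative_projective_def mulX_def by blast
  have "bij_betw (galois_map A C \<rho>X ?K) (carrier (T ?K)) (carrier (CK ?K))"
    using b K(1) unfolding galois_left_comodule_def Let_def by blast
  moreover have "inv_into UNIV emb1 (emb1 a) = a" for a using emb1 by simp
  ultimately show "splitting_epi A C HP coactHP C (comult C) \<mu>"
    using splitting_from_galois[OF K _ _ s'] by blast
qed

end

section \<open>Independence of the left action\<close>

text \<open>Comodules, Hom modules and tensor products with \<open>P\<close> on the left see only the right action of \<open>P\<close>, which
  \<open>eval_bimod\<close> does not change.  Hence the left action of \<open>P\<close> may be taken to be evaluation.\<close>

definition same_right :: "('l, 'm, 'r, 'y) bimod_scheme \<Rightarrow> ('k, 'm, 'r, 'z) bimod_scheme \<Rightarrow> bool" where
  "same_right M M' \<longleftrightarrow> carrier M = carrier M' \<and> zero M = zero M' \<and> add M = add M' \<and> rsmult M = rsmult M'"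

lemma same_right_tensor:
  assumes "same_right M M'"
  shows "pure R M N = pure R M' N" and "tensor_group R M N = tensor_group R M' N"
    and "tensor_map R M N = tensor_map R M' N" and "same_right (tensor R M N) (tensor R M' N)"
    and "tensor_lift (tensor R M N) = (tensor_lift (tensor R M' N) :: ('b \<Rightarrow> 'd \<Rightarrow> _) \<Rightarrow> _)"
proof -
  have r: "tensor_relators R M N = tensor_relators R M' N" and c: "carrier M = carrier M'"
    using assms by (simp_all add: same_right_def tensor_relators_def)
  have k: "tensor_kernel R M N = tensor_kernel R M' N" by (simp add: tensor_kernel_def r c)
  show p: "pure R M N = pure R M' N" by (intro ext) (simp add: pure_def k c)
  show g: "tensor_group R M N = tensor_group R M' N" by (simp add: tensor_group_def tensor_quot_def k c)
  show m: "tensor_map R M N = tensor_map R M' N" by (intro ext) (simp add: tensor_map_def p g)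
  show "same_right (tensor R M N) (tensor R M' N)" by (simp add: same_right_def tensor_def g m)
  show "tensor_lift (tensor R M N) = (tensor_lift (tensor R M' N) :: ('b \<Rightarrow> 'd \<Rightarrow> _) \<Rightarrow> _)"
    by (intro ext) (simp add: tensor_lift_tensor_group[symmetric] g)
qed

lemma same_right_module: "same_right M M' \<Longrightarrow> right_module R M = right_module R M'"
proof -
  assume s: "same_right M M'"
  have "abelian_group M = abelian_group M'"
    using s by (auto simp: same_right_def elim!: abelian_group_cong)
  with s show ?thesis by (simp add: right_module_def same_right_def)
qed

lemma same_right_linear:
  "same_right M M' \<Longrightarrow> same_right N N' \<Longrightarrow> right_linear R M N f = right_linear R M' N' f"
  by (simp add: right_linear_def additive_map_def same_right_def)

lemma same_right_refl: "same_right M M" by (simp add: same_right_def)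

lemma same_right_finsum: "same_right M M' \<Longrightarrow> finsum M = finsum M'"
  by (intro ext) (simp add: same_right_def finsum_def finprod_def)

context
  fixes P :: "('l, 'p, 'a) bimod"
begin

private abbreviation "E0 \<equiv> eval_bimod P"

lemma eval_same_right: "same_right E0 P"
  by (simp add: same_right_def eval_bimod_def)

private lemmas t = same_right_tensor[OF eval_same_right]
private lemmas t2 = same_right_tensor[OF t(4)]

lemma eval_eval: "eval_bimod E0 = E0"
  by (simp add: eval_bimod_def)

lemma eval_assoc: "tensor_assoc A A E0 C D = tensor_assoc A A P C D"
  unfolding tensor_assoc_def t(1) t(5) ..

lemma eval_carrier: "carrier E0 = carrier P"
  by (simp add: eval_bimod_def)

lemma eval_lift: "tensor_lift E0 \<beta> = tensor_lift P \<beta>"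
  by (rule tensor_lift_cong) (simp_all add: eval_bimod_def)

lemma eval_right_comodule: "right_comodule A C E0 \<rho> = right_comodule A C P \<rho>"
  unfolding right_comodule_def same_right_module[OF eval_same_right] same_right_linear[OF eval_same_right t(4)]
    eval_assoc t(3) t2(3) eval_carrier eval_lift
  by (simp add: eval_bimod_def)

lemma eval_right_colinear: "right_colinear A C E0 \<rho> N \<rho>' f = right_colinear A C P \<rho> N \<rho>' f"
  unfolding right_colinear_def same_right_linear[OF eval_same_right same_right_refl] eval_carrier by (rule refl)

lemma right_colinear_eval: "right_colinear A C M \<rho>' E0 \<rho> f = right_colinear A C M \<rho>' P \<rho> f"
  unfolding right_colinear_def same_right_linear[OF same_right_refl eval_same_right] t(3) by (rule refl)

lemma eval_End: "right_comodule_End A C E0 \<rho> = right_comodule_End A C P \<rho>"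
  unfolding right_comodule_End_def eval_right_colinear right_colinear_eval eval_carrier by (simp add: eval_bimod_def)

lemma eval_dual: "right_dual A E0 = right_dual A P"
  unfolding right_dual_def hom_bimod_def same_right_linear[OF eval_same_right same_right_refl] eval_carrier by (rule refl)

lemma eval_colinear_hom: "colinear_hom A C E0 \<rho> N \<rho>' = colinear_hom A C P \<rho> N \<rho>'"
  unfolding colinear_hom_def hom_bimod_def eval_right_colinear eval_carrier by (rule refl)

lemma eval_dual_basis: "dual_basis A E0 n p \<pi> = dual_basis A P n p \<pi>"
  unfolding dual_basis_def eval_carrier eval_dual same_right_finsum[OF eval_same_right] by (simp add: eval_bimod_def)

lemma eval_dual_coaction_wrt: "dual_coaction_wrt A C E0 \<rho> n p \<pi> = dual_coaction_wrt A C P \<rho> n p \<pi>"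
  by (intro ext) (simp only: dual_coaction_wrt_def eval_dual)

lemma eval_strongly_injective: "strongly_injective A C E0 \<rho> B = strongly_injective A C P \<rho> B"
  unfolding strongly_injective_def eval_End eval_eval right_colinear_eval eval_carrier by (rule refl)

end

lemma dual_coaction_some_basis:
  assumes "dual_basis A P n p \<pi>"
  obtains m q \<theta> where "dual_basis A P m q \<theta>" "dual_coaction A C P \<rho> = dual_coaction_wrt A C P \<rho> m q \<theta>"
proof -
  obtain m q \<theta> where b: "(SOME (n, p, \<pi>). dual_basis A P n p \<pi>) = (m, q, \<theta>)" by (metis prod_cases3)
  have "case (SOME (n, p, \<pi>). dual_basis A P n p \<pi>) of (n, p, \<pi>) \<Rightarrow> dual_basis A P n p \<pi>"
    by (rule someI[of _ "(n, p, \<pi>)"]) (simp add: assms)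
  then have "dual_basis A P m q \<theta>" unfolding b by simp
  moreover have "dual_coaction A C P \<rho> = dual_coaction_wrt A C P \<rho> m q \<theta>"
    by (intro ext) (simp add: dual_coaction_def b)
  ultimately show ?thesis by (rule that)
qed

theorem mainTheorem4:
  fixes A :: "'a ring"
    and C :: "('a, 'c) coring"
    and P :: "(unit, 'p, 'a) bimod"
    and \<rho> :: "'p \<Rightarrow> ('p, 'c) tens"
    and B :: "('p \<Rightarrow> 'p) set"
    and emb :: "(nat \<Rightarrow> 'a) + ('p \<Rightarrow> ('p, 'c) tens) \<Rightarrow> 'u"
  assumes large_universe: "inj emb"
    and "ring A"
    and "is_coring A C"
    and "right_comodule A C P \<rho>"
    and "fin_gen_right_module A P"
    and "projective_right_module TYPE('u) A P"
    and "subring B (right_comodule_End A C P \<rho>)"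
    and "flat_right_module TYPE('u) ((right_comodule_End A C P \<rho>)\<lparr>carrier := B\<rparr>) (right_dual A P) \<or>
         strongly_injective A C P \<rho> B"
  shows "splitting_epi A C
           (canonical_domain A C P \<rho> B) (canonical_domain_coaction A C P \<rho> B) C (comult C)
           (canonical_map C)
         \<longleftrightarrow>
         galois_left_comodule TYPE('u) A C (right_dual A P) (dual_coaction A C P \<rho>) \<and>
         relative_projective (right_comodule_End A C P \<rho>) B (right_dual A P)"
proof -
  have e1: "inj (\<lambda>f. emb (Inl f))" and e2: "inj (\<lambda>f. emb (Inr f))"
    using large_universe by (auto simp: inj_def)
  \<comment> \<open>The universe also contains copies of \<open>'p\<close> and \<open>'a\<close>, as constant functions.\<close>
  have "inj (\<lambda>(x::'p) (y::'p). {frag_of (x, undefined :: 'c)})" and "inj (\<lambda>(a::'a) (i::nat). a)"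
    by (auto simp: inj_def fun_eq_iff frag_of_eq)
  then have e3: "inj (\<lambda>x. emb (Inr (\<lambda>y::'p. {frag_of (x::'p, undefined :: 'c)})))" and e4: "inj (\<lambda>a. emb (Inl (\<lambda>i::nat. a)))"
    using e1 e2 by (auto simp: inj_def)
  obtain n0 p0 \<pi>0 where "dual_basis A P n0 p0 \<pi>0"
    using dual_basis_exists[OF assms(5,6) e1 e3] by blast
  then obtain n p \<pi> where basis: "dual_basis A P n p \<pi>" and coact: "dual_coaction A C P \<rho> = dual_coaction_wrt A C P \<rho> n p \<pi>"
    by (rule dual_coaction_some_basis)
  interpret galois_setup A C "eval_bimod P" \<rho> n p \<pi> B
    using assms(3,4,7) basis
    by (intro galois_setup.intro fg_comodule.intro comodule.intro coring.intro galois_setup_axioms.intro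
        fg_comodule_axioms.intro comodule_axioms.intro)
      (simp_all only: eval_right_comodule eval_dual_basis eval_eval eval_End)
  have "canonical_domain A C P \<rho> B = HP" "canonical_domain_coaction A C P \<rho> B = coactHP"
    unfolding canonical_domain_def canonical_domain_coaction_def eval_End eval_colinear_hom by (rule refl)+
  with splitting_iff_galois[OF e4 e2] assms(8) show ?thesis
    unfolding coact eval_End eval_dual eval_dual_coaction_wrt eval_strongly_injective eval_colinear_hom by simp
qed

end
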